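(* Let $G$, $H$ and $K$ be abelian groups of finite burden, definable in (a monster model of) some $\omega$-categorical theory, and let $\lambda : G\times H\to K$ be a definable bilinear quasi-form. Then $\lambda$ is virtually almost trivial. Moreover, if $G$ and $H$ are connected, then $\lambda$ is trivial, i.e. $\lambda(g,h)=0$ for all $g\in G$ and $h\in H$.
   Context: We work in a monster model of a complete first-order theory ($\bar\kappa$-saturated and $\bar\kappa$-homogeneous for a sufficiently large cardinal $\bar\kappa$). "Definable" means definable with parameters, and includes imaginary sets (definable sets modulo definable equivalence relations). A complete theory in a countable language is $\omega$-categorical if it has exactly one countable model up to isomorphism. Burden. An inp-pattern of depth $\kappa$ in a partial type $\pi(\bar x)$ is a sequence of formulas $\langle\varphi_i(\bar x,\bar y_i):i<\kappa\rangle$ together with an array of parameters $\langle \bar a_{i,j}:i<\kappa,j<\omega\rangle$ such that (a) for each $i<\kappa$ there is $k_i<\omega$ such that $\{\varphi_i(\bar x,\bar a_{i,j}):j<\omega\}$ is $k_i$-inconsistent; (b) for each $\eta:\kappa\to\omega$ the partial type $\pi(\bar x)\cup\{\varphi_i(\bar x,\bar a_{i,\eta(i)}):i<\kappa\}$ is consistent. A definable set has finite burden if there is $n<\omega$ such that the partial type defining it has no inp-pattern of depth $n+1$; its burden is then the maximal depth of an inp-pattern in it. Bilinear quasi-forms. For abelian groups $G,H,K$, a bilinear quasi-form is a partial function $\lambda:G\times H\to K$ such that for every $g\in G$ and every $h\in H$ the partial functions $\lambda_g:H\to K$, $x\mapsto\lambda(g,x)$, and $\lambda'_h:G\to K$,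 $y\mapsto\lambda(y,h)$, are partial homomorphisms each defined on a subgroup of finite index (of $H$, respectively of $G$). It is definable if $G,H,K,\lambda$ are definable. It is almost trivial if there is a finite subgroup of $K$ containing $\mathrm{im}\,\lambda$ (the set of all values of $\lambda$). It is virtually almost trivial if there are subgroups $G_0$ of finite index in $G$ and $H_0$ of finite index in $H$ such that the restriction of $\lambda$ to $G_0\times H_0$ is almost trivial. A definable group is connected if it has no proper definable subgroup of finite index. *)

theory Defs
  imports "HOL-Library.Countable_Set" "HOL-Algebra.Coset"
begin

unbundle cardinal_syntax

section \<open>First-order logic\<close>

record ('f, 'r) language =
  funs :: "'f set"
  farity :: "'f \<Rightarrow> nat"
  rels :: "'r set"
  rarity :: "'r \<Rightarrow> nat"

datatype 'f trm = Var nat | App 'f "'f trm list"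

datatype ('f, 'r) fm =
    Equal "'f trm" "'f trm"
  | Rel 'r "'f trm list"
  | Neg "('f, 'r) fm"
  | Conj "('f, 'r) fm" "('f, 'r) fm"
  | Exists nat "('f, 'r) fm"

fun trm_vars :: "'f trm \<Rightarrow> nat set" where
  "trm_vars (Var i) = {i}"
| "trm_vars (App f ts) = (\<Union>t\<in>set ts. trm_vars t)"

fun free_vars :: "('f, 'r) fm \<Rightarrow> nat set" where
  "free_vars (Equal s t) = trm_vars s \<union> trm_vars t"
| "free_vars (Rel r ts) = (\<Union>t\<in>set ts. trm_vars t)"
| "free_vars (Neg \<phi>) = free_vars \<phi>"
| "free_vars (Conj \<phi> \<psi>) = free_vars \<phi> \<union> free_vars \<psi>"
| "free_vars (Exists i \<phi>) = free_vars \<phi> - {i}"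

fun wf_trm :: "('f, 'r) language \<Rightarrow> 'f trm \<Rightarrow> bool" where
  "wf_trm L (Var i) \<longleftrightarrow> True"
| "wf_trm L (App f ts) \<longleftrightarrow>
     f \<in> funs L \<and> length ts = farity L f \<and> (\<forall>t\<in>set ts. wf_trm L t)"

fun wf_fm :: "('f, 'r) language \<Rightarrow> ('f, 'r) fm \<Rightarrow> bool" where
  "wf_fm L (Equal s t) \<longleftrightarrow> wf_trm L s \<and> wf_trm L t"
| "wf_fm L (Rel r ts) \<longleftrightarrow>
     r \<in> rels L \<and> length ts = rarity L r \<and> (\<forall>t\<in>set ts. wf_trm L t)"
| "wf_fm L (Neg \<phi>) \<longleftrightarrow> wf_fm L \<phi>"
| "wf_fm L (Conj \<phi> \<psi>) \<longleftrightarrow> wf_fm L \<phi> \<and> wf_fm L \<psi>"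
| "wf_fm L (Exists i \<phi>) \<longleftrightarrow> wf_fm L \<phi>"

text \<open>A formula in the variables \<open>0, \<dots>, n - 1\<close>; \<open>formulas L 0\<close> are the sentences.\<close>

definition formulas :: "('f, 'r) language \<Rightarrow> nat \<Rightarrow> ('f, 'r) fm set" where
  "formulas L n = {\<phi>. wf_fm L \<phi> \<and> free_vars \<phi> \<subseteq> {..<n}}"

record ('f, 'r, 'm) fo_struct =
  universe :: "'m set"
  fun_int :: "'f \<Rightarrow> 'm list \<Rightarrow> 'm"
  rel_int :: "'r \<Rightarrow> 'm list \<Rightarrow> bool"

definition tuples :: "('f, 'r, 'm) fo_struct \<Rightarrow> nat \<Rightarrow> 'm list set" where
  "tuples M n = {x. set x \<subseteq> universe M \<and> length x = n}"

definition is_struct :: "('f, 'r) language \<Rightarrow> ('f, 'r, 'm) fo_struct \<Rightarrow> bool" where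
  "is_struct L M \<longleftrightarrow> universe M \<noteq> {} \<and>
     (\<forall>f\<in>funs L. \<forall>x\<in>tuples M (farity L f). fun_int M f x \<in> universe M)"

fun eval_trm :: "('f, 'r, 'm) fo_struct \<Rightarrow> (nat \<Rightarrow> 'm) \<Rightarrow> 'f trm \<Rightarrow> 'm" where
  "eval_trm M e (Var i) = e i"
| "eval_trm M e (App f ts) = fun_int M f (map (eval_trm M e) ts)"

fun sat :: "('f, 'r, 'm) fo_struct \<Rightarrow> (nat \<Rightarrow> 'm) \<Rightarrow> ('f, 'r) fm \<Rightarrow> bool" where
  "sat M e (Equal s t) \<longleftrightarrow> eval_trm M e s = eval_trm M e t"
| "sat M e (Rel r ts) \<longleftrightarrow> rel_int M r (map (eval_trm M e) ts)"
| "sat M e (Neg \<phi>) \<longleftrightarrow> \<not> sat M e \<phi>"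
| "sat M e (Conj \<phi> \<psi>) \<longleftrightarrow> sat M e \<phi> \<and> sat M e \<psi>"
| "sat M e (Exists i \<phi>) \<longleftrightarrow> (\<exists>c\<in>universe M. sat M (e(i := c)) \<phi>)"

text \<open>
  Truth of a formula at a tuple. Values of \<open>(!)\<close> beyond the length of \<open>x\<close> are unspecified, so this
  is used only for \<open>\<phi> \<in> formulas L (length x)\<close>. For \<open>\<phi>(x, y)\<close> the tuple is \<open>x @ y\<close>.
\<close>

definition holds :: "('f, 'r, 'm) fo_struct \<Rightarrow> ('f, 'r) fm \<Rightarrow> 'm list \<Rightarrow> bool" where
  "holds M \<phi> x \<longleftrightarrow> sat M (\<lambda>i. x ! i) \<phi>"

definition models :: "('f, 'r) language \<Rightarrow> ('f, 'r, 'm) fo_struct \<Rightarrow> ('f, 'r) fm set \<Rightarrow> bool" where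
  "models L M T \<longleftrightarrow> is_struct L M \<and> (\<forall>\<phi>\<in>T. holds M \<phi> [])"

text \<open>
  Theories are taken to be closed under consequence. Consistency is not part of the definition:
  it is ensured wherever a model is present, as in \<open>omega_categorical\<close> and \<open>monster_model\<close>.
\<close>

definition complete_theory :: "('f, 'r) language \<Rightarrow> ('f, 'r) fm set \<Rightarrow> bool" where
  "complete_theory L T \<longleftrightarrow> T \<subseteq> formulas L 0 \<and> (\<forall>\<phi>\<in>formulas L 0. \<phi> \<in> T \<longleftrightarrow> Neg \<phi> \<notin> T)"

definition is_iso ::
  "('f, 'r) language \<Rightarrow> ('f, 'r, 'm) fo_struct \<Rightarrow> ('f, 'r, 'n) fo_struct \<Rightarrow> ('m \<Rightarrow> 'n) \<Rightarrow> bool" where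
  "is_iso L M N h \<longleftrightarrow> bij_betw h (universe M) (universe N) \<and>
     (\<forall>f\<in>funs L. \<forall>x\<in>tuples M (farity L f). h (fun_int M f x) = fun_int N f (map h x)) \<and>
     (\<forall>r\<in>rels L. \<forall>x\<in>tuples M (rarity L r). rel_int M r x \<longleftrightarrow> rel_int N r (map h x))"

text \<open>
  Every countable structure is isomorphic to one whose universe is a set of natural numbers, so
  it is enough to let the countable models range over structures of element type \<open>nat\<close>.
\<close>

definition omega_categorical :: "('f, 'r) language \<Rightarrow> ('f, 'r) fm set \<Rightarrow> bool" where
  "omega_categorical L T \<longleftrightarrow>
     countable (funs L) \<and> countable (rels L) \<and> complete_theory L T \<and>
     (\<exists>N :: ('f, 'r, nat) fo_struct. models L N T) \<and>
     (\<forall>(N :: ('f, 'r, nat) fo_struct) (N' :: ('f, 'r, nat) fo_struct).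
        models L N T \<and> models L N' T \<longrightarrow> (\<exists>h. is_iso L N N' h))"


section \<open>Monster models\<close>

text \<open>
  A partial type over \<open>A\<close> in \<open>n\<close> variables is a set of pairs \<open>(\<phi>, a)\<close>, standing for \<open>\<phi>(x, a)\<close>.
  It is consistent (with the elementary diagram of \<open>M\<close>) iff it is finitely satisfiable in \<open>M\<close>.
\<close>

definition partial_types ::
  "('f, 'r) language \<Rightarrow> nat \<Rightarrow> 'm set \<Rightarrow> (('f, 'r) fm \<times> 'm list) set set" where
  "partial_types L n A = Pow {(\<phi>, a). a \<in> lists A \<and> \<phi> \<in> formulas L (n + length a)}"

definition realized_in ::
  "('f, 'r, 'm) fo_struct \<Rightarrow> nat \<Rightarrow> (('f, 'r) fm \<times> 'm list) set \<Rightarrow> bool" where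
  "realized_in M n p \<longleftrightarrow> (\<exists>x\<in>tuples M n. \<forall>(\<phi>, a)\<in>p. holds M \<phi> (x @ a))"

definition saturated ::
  "('f, 'r) language \<Rightarrow> ('f, 'r, 'm) fo_struct \<Rightarrow> 'k rel \<Rightarrow> bool" where
  "saturated L M \<kappa> \<longleftrightarrow> (\<forall>A \<subseteq> universe M. card_of A <o \<kappa> \<longrightarrow>
     (\<forall>n. \<forall>p\<in>partial_types L n A.
        (\<forall>q \<subseteq> p. finite q \<longrightarrow> realized_in M n q) \<longrightarrow> realized_in M n p))"

definition partial_elementary ::
  "('f, 'r) language \<Rightarrow> ('f, 'r, 'm) fo_struct \<Rightarrow> 'm set \<Rightarrow> ('m \<Rightarrow> 'm) \<Rightarrow> bool" where
  "partial_elementary L M A f \<longleftrightarrow> A \<subseteq> universe M \<and> f ` A \<subseteq> universe M \<and>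
     (\<forall>a\<in>lists A. \<forall>\<phi>\<in>formulas L (length a). holds M \<phi> a \<longleftrightarrow> holds M \<phi> (map f a))"

text \<open>
  This is what is often called strong homogeneity; the version extending partial elementary maps
  by one element only already follows from saturation.
\<close>

definition homogeneous ::
  "('f, 'r) language \<Rightarrow> ('f, 'r, 'm) fo_struct \<Rightarrow> 'k rel \<Rightarrow> bool" where
  "homogeneous L M \<kappa> \<longleftrightarrow> (\<forall>A f. card_of A <o \<kappa> \<and> partial_elementary L M A f \<longrightarrow>
     (\<exists>\<sigma>. is_iso L M M \<sigma> \<and> (\<forall>a\<in>A. \<sigma> a = f a)))"

text \<open>``Sufficiently large'' is read as: any uncountable cardinal.\<close>

definition monster_model ::
  "('f, 'r) language \<Rightarrow> ('f, 'r) fm set \<Rightarrow> 'k rel \<Rightarrow> ('f, 'r, 'm) fo_struct \<Rightarrow> bool" where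
  "monster_model L T \<kappa> M \<longleftrightarrow> Card_order \<kappa> \<and> natLeq <o \<kappa> \<and>
     models L M T \<and> saturated L M \<kappa> \<and> homogeneous L M \<kappa>"


section \<open>Definable sets, including imaginaries\<close>

definition definable :: "('f, 'r) language \<Rightarrow> ('f, 'r, 'm) fo_struct \<Rightarrow> nat \<Rightarrow> 'm list set \<Rightarrow> bool" where
  "definable L M n X \<longleftrightarrow> (\<exists>a\<in>lists (universe M). \<exists>\<phi>\<in>formulas L (n + length a).
     X = {x \<in> tuples M n. holds M \<phi> (x @ a)})"

text \<open>
  A definable set of imaginaries is a quotient \<open>X // E\<close>; its elements are the classes. A definable
  set of real tuples is recovered, as a set of singletons, by taking \<open>E\<close> to be equality.
\<close>

definition imag_set ::
  "('f, 'r) language \<Rightarrow> ('f, 'r, 'm) fo_struct \<Rightarrow> nat \<Rightarrow> 'm list set set \<Rightarrow> bool" where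
  "imag_set L M n S \<longleftrightarrow> (\<exists>X E. definable L M n X \<and> equiv X E \<and>
     definable L M (n + n) {x @ y | x y. (x, y) \<in> E} \<and> S = X // E)"

text \<open>
  A relation between imaginaries (a set of lists of classes) is definable iff the set of all
  concatenated representatives is.
\<close>

definition imag_rel_definable ::
  "('f, 'r) language \<Rightarrow> ('f, 'r, 'm) fo_struct \<Rightarrow> 'm list set list set \<Rightarrow> bool" where
  "imag_rel_definable L M R \<longleftrightarrow>
     (\<exists>N. definable L M N {concat xs | xs cs. cs \<in> R \<and> list_all2 (\<in>) xs cs})"


section \<open>Burden\<close>

text \<open>
  The variable of an inp-pattern in \<open>S = X // E\<close> ranges over \<open>S\<close>. An \<open>L\<close>-formula \<open>\<phi>(x, y)\<close> is read
  as the formula ``some representative \<open>x\<close> of \<open>c\<close> satisfies \<open>\<phi>(x, y)\<close>'' about the imaginary \<open>c\<close>;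
  every formula about elements of \<open>S\<close>, with real or imaginary parameters, can be written in this
  form with real parameters.
\<close>

definition imag_holds :: "('f, 'r, 'm) fo_struct \<Rightarrow> ('f, 'r) fm \<Rightarrow> 'm list set \<Rightarrow> 'm list \<Rightarrow> bool" where
  "imag_holds M \<phi> c a \<longleftrightarrow> (\<exists>x\<in>c. holds M \<phi> (x @ a))"

text \<open>
  Finite depth \<open>d\<close> suffices to define finite burden; a finite set of formulas is consistent iff
  it is realized in \<open>M\<close>. Inconsistency refers to sets of indices, not of (possibly
  repeated) formulas.
\<close>

definition inp_pattern ::
  "('f, 'r) language \<Rightarrow> ('f, 'r, 'm) fo_struct \<Rightarrow> nat \<Rightarrow> 'm list set set \<Rightarrow> nat \<Rightarrow>
   (nat \<Rightarrow> ('f, 'r) fm) \<Rightarrow> (nat \<Rightarrow> nat \<Rightarrow> 'm list) \<Rightarrow> bool" where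
  "inp_pattern L M n S d \<phi> a \<longleftrightarrow>
     (\<forall>i<d. \<exists>m. \<phi> i \<in> formulas L (n + m) \<and> (\<forall>j. a i j \<in> tuples M m)) \<and>
     (\<forall>i<d. \<exists>k. \<forall>J. finite J \<and> card J = k \<longrightarrow>
        \<not> (\<exists>c\<in>S. \<forall>j\<in>J. imag_holds M (\<phi> i) c (a i j))) \<and>
     (\<forall>\<eta> :: nat \<Rightarrow> nat. \<exists>c\<in>S. \<forall>i<d. imag_holds M (\<phi> i) c (a i (\<eta> i)))"

definition finite_burden ::
  "('f, 'r) language \<Rightarrow> ('f, 'r, 'm) fo_struct \<Rightarrow> nat \<Rightarrow> 'm list set set \<Rightarrow> bool" where
  "finite_burden L M n S \<longleftrightarrow> (\<exists>d. \<not> (\<exists>\<phi> a. inp_pattern L M n S (Suc d) \<phi> a))"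


section \<open>Definable groups and bilinear quasi-forms\<close>

text \<open>Groups are in the multiplicative notation of the library: \<open>\<one>\<close> plays the role of zero.\<close>

definition definable_group ::
  "('f, 'r) language \<Rightarrow> ('f, 'r, 'm) fo_struct \<Rightarrow> nat \<Rightarrow> 'm list set monoid \<Rightarrow> bool" where
  "definable_group L M n G \<longleftrightarrow> group G \<and> imag_set L M n (carrier G) \<and>
     imag_rel_definable L M {[a, b, a \<otimes>\<^bsub>G\<^esub> b] | a b. a \<in> carrier G \<and> b \<in> carrier G}"

definition finite_index_subgroup :: "'g set \<Rightarrow> 'g monoid \<Rightarrow> bool" where
  "finite_index_subgroup D G \<longleftrightarrow> subgroup D G \<and> finite (rcosets\<^bsub>G\<^esub> D)"

definition connected_group ::
  "('f, 'r) language \<Rightarrow> ('f, 'r, 'm) fo_struct \<Rightarrow> 'm list set monoid \<Rightarrow> bool" where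
  "connected_group L M G \<longleftrightarrow>
     (\<forall>D. finite_index_subgroup D G \<and> imag_rel_definable L M {[c] | c. c \<in> D} \<longrightarrow> D = carrier G)"

definition partial_hom :: "'g monoid \<Rightarrow> 'k monoid \<Rightarrow> ('g \<Rightarrow> 'k option) \<Rightarrow> bool" where
  "partial_hom G K f \<longleftrightarrow> (let D = {x \<in> carrier G. f x \<noteq> None} in
     finite_index_subgroup D G \<and> (\<lambda>x. the (f x)) \<in> hom (G\<lparr>carrier := D\<rparr>) K)"

text \<open>
  The partial function is undefined where its value is \<open>None\<close>; its values outside
  \<open>carrier G \<times> carrier H\<close> are irrelevant.
\<close>

definition bilinear_quasi_form ::
  "'g monoid \<Rightarrow> 'h monoid \<Rightarrow> 'k monoid \<Rightarrow> ('g \<Rightarrow> 'h \<Rightarrow> 'k option) \<Rightarrow> bool" where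
  "bilinear_quasi_form G H K lam \<longleftrightarrow> comm_group G \<and> comm_group H \<and> comm_group K \<and>
     (\<forall>g\<in>carrier G. partial_hom H K (\<lambda>h. lam g h)) \<and>
     (\<forall>h\<in>carrier H. partial_hom G K (\<lambda>g. lam g h))"

definition definable_partial_map ::
  "('f, 'r) language \<Rightarrow> ('f, 'r, 'm) fo_struct \<Rightarrow> 'm list set monoid \<Rightarrow> 'm list set monoid \<Rightarrow>
   ('m list set \<Rightarrow> 'm list set \<Rightarrow> 'm list set option) \<Rightarrow> bool" where
  "definable_partial_map L M G H lam \<longleftrightarrow>
     imag_rel_definable L M
       {[g, h, k] | g h k. g \<in> carrier G \<and> h \<in> carrier H \<and> lam g h = Some k}"

definition almost_trivial_on ::
  "'k monoid \<Rightarrow> ('g \<Rightarrow> 'h \<Rightarrow> 'k option) \<Rightarrow> 'g set \<Rightarrow> 'h set \<Rightarrow> bool" where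
  "almost_trivial_on K lam A B \<longleftrightarrow>
     (\<exists>F. subgroup F K \<and> finite F \<and> {k. \<exists>g\<in>A. \<exists>h\<in>B. lam g h = Some k} \<subseteq> F)"

definition virtually_almost_trivial ::
  "'g monoid \<Rightarrow> 'h monoid \<Rightarrow> 'k monoid \<Rightarrow> ('g \<Rightarrow> 'h \<Rightarrow> 'k option) \<Rightarrow> bool" where
  "virtually_almost_trivial G H K lam \<longleftrightarrow>
     (\<exists>G0 H0. finite_index_subgroup G0 G \<and> finite_index_subgroup H0 H \<and>
        almost_trivial_on K lam G0 H0)"

end

theory Submission
  imports Defs "HOL-Algebra.FiniteProduct"
begin

text \<open>Why the theorem holds. By Ryll-Nardzewski, the automorphisms of \<open>M\<close> fixing finitely many parameters
have finitely many orbits on tuples of each length, and the sets they preserve are definable. So the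
model theory can be forgotten: what remains is the abelian group \<open>A = G \<times> H \<times> K\<close> with an oligomorphic
group of automorphisms, where ``definable subgroup'' means a subgroup invariant under the stabiliser
of a finite list (\<open>dfn\<close>). Write \<open>B \<lesssim> C\<close> (in the code \<open>alm B C\<close>) if finitely many cosets of \<open>C\<close> cover
\<open>B\<close>. An inp-pattern made of cosets turns finite burden into the property \<open>tame\<close>: among any \<open>d + 1\<close>
definable subgroups, the intersection of all but a suitable one is almost contained in that one.
Oligomorphy is used through two counting facts, \<open>index_bound\<close> and \<open>invr_repeat\<close>: finite indices are
bounded, and sequences of invariant relations repeat, uniformly in parameters of bounded number.

Write \<open>\<lambda>\<^sub>g\<close> for the partial map \<open>lam g\<close> and \<open>res Z X\<close> for the group of all \<open>g\<close> with \<open>\<lambda>\<^sub>g[X] \<lesssim> Z\<close>. The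
heart of the matter is \<open>almost_all_trivial\<close>: \<open>G \<lesssim> res {0} H\<close>, that is, for almost all \<open>g\<close> the map
\<open>\<lambda>\<^sub>g\<close> has finite image. Once this is known, an argument of B. H. Neumann about groups with
bounded conjugacy classes (\<open>finite_values\<close>) puts all values on subgroups of finite index into one
finite group, and connectedness makes kernels of finite index equal to the whole group
(\<open>connected_trivial\<close>).

Suppose that \<open>\<lambda>\<^sub>g\<close> has infinite image for many \<open>g\<close>. Choose definable \<open>Y \<le> G\<close>, \<open>X \<le> H\<close> and \<open>Z\<^sub>1, Z\<^sub>0 \<le> K\<close>
such that almost all of \<open>\<lambda>\<close> on \<open>Y \<times> X\<close> goes into \<open>Z\<^sub>1\<close> but not into \<open>Z\<^sub>0\<close>, minimising the sum of three
widths (lengths of independent families of definable subgroups, a subadditive substitute for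
burden). In the minimal configuration \<open>(G\<^sub>1, H\<^sub>1, K\<^sub>1, K\<^sub>0)\<close> annihilators modulo \<open>K\<^sub>0\<close> are comparable
with all large definable subgroups (\<open>P1\<close>), and the form is prime: if it goes into a sum of two
subgroups above \<open>K\<^sub>0\<close>, then into one of them (\<open>P2\<close>).

For \<open>a, y \<in> G\<^sub>1\<close> consider the additive relation \<open>T = \<lambda>\<^sub>a\<^sup>-\<^sup>1 \<circ> \<lambda>\<^sub>y\<close> modulo \<open>K\<^sub>0\<close> on \<open>H\<^sub>1\<close> (\<open>TT a y\<close>). Three
results play against each other.
\<^item> \<open>generic_kernel\<close>: for almost all \<open>y\<close> in a definable \<open>Y\<close>, the kernel of \<open>\<lambda>\<^sub>y\<close> is much larger than
  the annihilator \<open>X\<close> of \<open>Y\<close>. Otherwise many relations \<open>T\<close> induce invertible endomorphisms of a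
  common section \<open>S/M\<close>, depending additively on \<open>y\<close> and all of the same finite order \<open>n\<close>. But the
  \<open>n\<close>-th power is a polynomial of degree \<open>n\<close>, so it cannot be \<open>1\<close> on all nonempty subsums of \<open>n + 1\<close>
  elements and \<open>0\<close> on the empty one (\<open>additive_family_trivial\<close>).
\<^item> \<open>nilpotent\<close>: if the kernel of \<open>\<lambda>\<^sub>y\<close> is much larger than \<open>X\<close> and that of \<open>\<lambda>\<^sub>a\<close> is not, then
  \<open>T\<^sup>N[H\<^sub>1] \<lesssim> X\<close> for a constant \<open>N\<close>: on the part of \<open>H\<^sub>1\<close> where \<open>T\<close> is surjective, the kernels of its
  powers would increase forever.
\<^item> \<open>good_small\<close>: for almost all \<open>y\<close>, many \<open>a\<close> satisfy \<open>\<lambda>\<^sub>a[X] \<lesssim> \<lambda>\<^sub>y[X] + K\<^sub>0\<close>, so that \<open>T\<close> has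
  large image. This is primeness together with the dual form of finite burden.

In \<open>impossible\<close> they are applied along a chain \<open>X\<^sub>0 = H\<^sub>1, X\<^sub>1, \<dots>, X\<^sub>N\<close> built from the same results with
the roles of \<open>G\<close> and \<open>H\<close> exchanged (\<open>good_element\<close>): one finds \<open>a\<close> and \<open>y\<close> with \<open>X\<^sub>N \<lesssim> T\<^sup>N[H\<^sub>1] \<lesssim> X\<close>,
against the choice of \<open>X\<close> in \<open>closed_pair\<close>.\<close>

section \<open>Almost inclusion of subgroups\<close>

context comm_group
begin

definition alm :: "'a set => 'a set => bool" where
  "alm B C \<longleftrightarrow> (\<exists>F. finite F \<and> F \<subseteq> carrier G \<and> B \<subseteq> F <#> C)"

definition sep :: "'a set => 'a set => bool" where
  "sep F C \<longleftrightarrow> (\<forall>x\<in>F. \<forall>y\<in>F. x \<noteq> y --> x \<otimes> inv y \<notin> C)"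

lemma sub_car: "subgroup B G ==> x \<in> B ==> x \<in> carrier G" by (rule subgroup.mem_carrier)

lemma sub_m: "subgroup B G ==> x \<in> B ==> y \<in> B ==> x \<otimes> y \<in> B"
  by (rule subgroup.m_closed)

lemma sub_inv: "subgroup B G ==> x \<in> B ==> inv x \<in> B" by (rule subgroup.m_inv_closed)

lemma sub_div: "subgroup B G ==> x \<in> B ==> y \<in> B ==> x \<otimes> inv y \<in> B"
  by (simp add: sub_m sub_inv)

lemma sub_one: "subgroup B G ==> \<one> \<in> B" by (rule subgroup.one_closed)

lemma set_multI: "h \<in> H ==> k \<in> K ==> x = h \<otimes> k ==> x \<in> H <#> K"
  unfolding set_mult_def by blast

lemma set_multE:
  assumes "x \<in> H <#> K"
  obtains h k where "h \<in> H" "k \<in> K" "x = h \<otimes> k"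
  using assms unfolding set_mult_def by blast

lemma sub_left: "subgroup B G ==> subgroup C G ==> B \<subseteq> B <#> C"
  by (auto intro!: set_multI[of _ _ \<one>] simp: sub_one sub_car)

lemma sub_right: "subgroup B G ==> subgroup C G ==> C \<subseteq> B <#> C"
  by (auto intro!: set_multI[of \<one>] simp: sub_one sub_car)

lemma cancel_div:
  assumes "f \<in> carrier G" "c \<in> carrier G" "d \<in> carrier G"
  shows "(f \<otimes> c) \<otimes> inv (f \<otimes> d) = c \<otimes> inv d"
proof -
  have "(f \<otimes> c) \<otimes> inv (f \<otimes> d) = (f \<otimes> inv f) \<otimes> (c \<otimes> inv d)"
    using assms by (simp add: inv_mult m_ac del: r_inv)
  then show ?thesis using assms by simp
qed

lemma sep_mono: "sep F C ==> F' \<subseteq> F ==> D \<subseteq> C ==> sep F' D"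
  unfolding sep_def by blast

lemma alm_card:
  assumes "finite F" "F \<subseteq> carrier G" "B \<subseteq> F <#> C" "subgroup C G" "E \<subseteq> B" "sep E C"
  shows "finite E \<and> card E \<le> card F"
proof -
  have "\<forall>x\<in>E. \<exists>f. f \<in> F \<and> (\<exists>c\<in>C. f \<otimes> c = x)"
    using assms(3,5) by (blast elim: set_multE)
  from bchoice[OF this] obtain p where p: "\<And>x. x \<in> E ==> p x \<in> F \<and> (\<exists>c\<in>C. p x \<otimes> c = x)" by blast
  have "inj_on p E"
  proof (rule inj_onI, rule ccontr)
    fix x y assume h: "x \<in> E" "y \<in> E" "p x = p y" "x \<noteq> y"
    obtain c d where c: "c \<in> C" "p x \<otimes> c = x" and d: "d \<in> C" "p x \<otimes> d = y"
      using p[OF h(1)] p[OF h(2)] h(3) by metis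
    have cc: "p x \<in> carrier G" "c \<in> carrier G" "d \<in> carrier G"
      using p[OF h(1)] assms(2) c d sub_car[OF assms(4)] by auto
    have "x \<otimes> inv y = (p x \<otimes> c) \<otimes> inv (p x \<otimes> d)" using c d by simp
    also have "\<dots> = c \<otimes> inv d" using cc by (simp add: cancel_div)
    finally have "x \<otimes> inv y \<in> C" using c d sub_div[OF assms(4)] by simp
    then show False using h assms(6) unfolding sep_def by blast
  qed
  moreover have "p ` E \<subseteq> F" using p by blast
  ultimately show ?thesis using assms(1) by (metis card_inj_on_le inj_on_finite)
qed

text \<open>A maximal family of elements in different cosets of \<open>C\<close> represents all cosets that meet \<open>B\<close>. This
translates almost inclusion into a bound on separated families, which is preserved by
automorphisms and can be counted.\<close>

lemma sep_max_cover:
  assumes "subgroup C G" "B \<subseteq> carrier G" and bd: "\<And>F. finite F ==> F \<subseteq> B ==> sep F C ==> card F \<le> n"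
  shows "\<exists>F. finite F \<and> F \<subseteq> B \<and> sep F C \<and> B \<subseteq> F <#> C \<and> card F \<le> n"
proof -
  let ?P = "\<lambda>k. \<exists>F. finite F \<and> F \<subseteq> B \<and> sep F C \<and> card F = k"
  have "?P 0" by (rule exI[of _ "{}"]) (simp add: sep_def)
  moreover have bd': "j \<le> n" if "?P j" for j using that bd by blast
  ultimately have "?P (GREATEST j. ?P j)" "\<And>j. ?P j ==> j \<le> (GREATEST j. ?P j)"
    using GreatestI_nat[of ?P 0 n] Greatest_le_nat[of ?P _ n] by blast+
  then obtain k where k: "?P k" "\<And>j. ?P j ==> j \<le> k" by blast
  then obtain F where F: "finite F" "F \<subseteq> B" "sep F C" "card F = k" by blast
  have "B \<subseteq> F <#> C"
  proof
    fix x assume x: "x \<in> B"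
    show "x \<in> F <#> C"
    proof (rule ccontr)
      assume no: "x \<notin> F <#> C"
      have xc: "x \<in> carrier G" using x assms by blast
      have "x \<notin> F" using no sub_one[OF assms(1)] xc by (auto intro: set_multI[of x _ \<one>])
      have a: "x \<otimes> inv y \<notin> C" "y \<otimes> inv x \<notin> C" if y: "y \<in> F" for y
      proof -
        have yc: "y \<in> carrier G" using y F assms by blast
        show 1: "x \<otimes> inv y \<notin> C"
        proof
          assume "x \<otimes> inv y \<in> C"
          then have "x \<in> F <#> C" using y xc yc
            by (intro set_multI[of y _ "x \<otimes> inv y"]) (auto simp: m_lcomm)
          then show False using no by simp
        qed
        show "y \<otimes> inv x \<notin> C"
        proof
          assume "y \<otimes> inv x \<in> C"
          then have "inv (y \<otimes> inv x) \<in> C" using sub_inv[OF assms(1)] by blast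
          then show False using 1 xc yc by (simp add: inv_mult m_comm)
        qed
      qed
      have "sep (insert x F) C" using F(3) a unfolding sep_def by auto
      then have "?P (Suc k)" using F x \<open>x \<notin> F\<close> by (intro exI[of _ "insert x F"]) auto
      then show False using k(2) by fastforce
    qed
  qed
  then show ?thesis using F bd by blast
qed

lemma alm_iff_sep:
  assumes "subgroup C G" "B \<subseteq> carrier G"
  shows "alm B C \<longleftrightarrow> (\<exists>n. \<forall>F. finite F --> F \<subseteq> B --> sep F C --> card F \<le> n)"
proof
  assume "alm B C"
  then obtain F where "finite F" "F \<subseteq> carrier G" "B \<subseteq> F <#> C" unfolding alm_def by blast
  then show "\<exists>n. \<forall>F. finite F --> F \<subseteq> B --> sep F C --> card F \<le> n"
    using alm_card[OF _ _ _ assms(1)] by blast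
next
  assume "\<exists>n. \<forall>F. finite F --> F \<subseteq> B --> sep F C --> card F \<le> n"
  then obtain n where "\<And>F. finite F ==> F \<subseteq> B ==> sep F C ==> card F \<le> n" by blast
  from sep_max_cover[OF assms this] show "alm B C" unfolding alm_def using assms(2) by blast
qed

lemma alm_in:
  assumes "alm B C" "subgroup C G" "B \<subseteq> carrier G"
  obtains F where "finite F" "F \<subseteq> B" "B \<subseteq> F <#> C"
proof -
  obtain n where "\<And>F. finite F ==> F \<subseteq> B ==> sep F C ==> card F \<le> n"
    using alm_iff_sep[OF assms(2,3)] assms(1) by blast
  from sep_max_cover[OF assms(2,3) this] show thesis using that by blast
qed

lemma not_alm_sep:
  assumes "\<not> alm B C" "subgroup C G" "B \<subseteq> carrier G"
  obtains F where "finite F" "F \<subseteq> B" "sep F C" "card F = n"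
proof -
  obtain F where F: "finite F" "F \<subseteq> B" "sep F C" "\<not> card F \<le> n"
    using alm_iff_sep[OF assms(2,3)] assms(1) by blast
  then obtain E where "E \<subseteq> F" "card E = n" by (metis nat_le_linear obtain_subset_with_card_n)
  then show thesis using that[of E] F sep_mono by (metis finite_subset order_refl subset_trans)
qed

lemma alm_subset: "B \<subseteq> C ==> C \<subseteq> carrier G ==> alm B C"
  unfolding alm_def by (rule exI[of _ "{\<one>}"]) (auto intro!: set_multI[of \<one>])

lemma alm_refl: "subgroup C G ==> alm C C" by (rule alm_subset) (auto simp: sub_car)

lemma alm_subset_left: "alm B C ==> B' \<subseteq> B ==> alm B' C" unfolding alm_def by blast

lemma alm_trans:
  assumes "alm B C" "alm C D" "D \<subseteq> carrier G"
  shows "alm B D"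
proof -
  obtain F F' where F: "finite F" "F \<subseteq> carrier G" "B \<subseteq> F <#> C"
    and F': "finite F'" "F' \<subseteq> carrier G" "C \<subseteq> F' <#> D" using assms unfolding alm_def by blast
  have "B \<subseteq> F <#> (F' <#> D)" using F F' by (meson mono_set_mult order_trans order_refl)
  also have "\<dots> = (F <#> F') <#> D" using F F' assms by (simp add: set_mult_assoc)
  finally show ?thesis unfolding alm_def
    by (intro exI[of _ "F <#> F'"]) (use F F' in \<open>auto simp: set_mult_def\<close>)
qed

lemma alm_subset_right: "alm B C ==> C \<subseteq> C' ==> C' \<subseteq> carrier G ==> alm B C'"
  by (rule alm_trans[OF _ alm_subset])

lemma sub_int: "subgroup B G ==> subgroup C G ==> subgroup (B \<inter> C) G"
  by (rule subgroups_Inter_pair)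

lemma alm_inter:
  assumes "alm B C" "alm B D" "subgroup C G" "subgroup D G" "B \<subseteq> carrier G"
  shows "alm B (C \<inter> D)"
proof -
  obtain F F' where F: "finite F" "F \<subseteq> carrier G" "B \<subseteq> F <#> C"
    and F': "finite F'" "F' \<subseteq> carrier G" "B \<subseteq> F' <#> D" using assms unfolding alm_def by blast
  have "card E \<le> card F * card F'" if E: "finite E" "E \<subseteq> B" "sep E (C \<inter> D)" for E
  proof -
    have "\<forall>x\<in>E. \<exists>f. f \<in> F \<and> (\<exists>c\<in>C. f \<otimes> c = x)"
      using F(3) E(2) by (blast elim: set_multE)
    from bchoice[OF this] obtain p where p: "\<And>x. x \<in> E ==> p x \<in> F \<and> (\<exists>c\<in>C. p x \<otimes> c = x)" by blast
    have "\<forall>x\<in>E. \<exists>f. f \<in> F' \<and> (\<exists>c\<in>D. f \<otimes> c = x)"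
      using F'(3) E(2) by (blast elim: set_multE)
    from bchoice[OF this] obtain q where q: "\<And>x. x \<in> E ==> q x \<in> F' \<and> (\<exists>c\<in>D. q x \<otimes> c = x)" by blast
    have key: "x \<otimes> inv y \<in> S" if k: "subgroup S G" "f \<in> carrier G" "\<exists>c\<in>S. f \<otimes> c = x" "\<exists>c\<in>S. f \<otimes> c = y" for S f x y
    proof -
      obtain c d where c: "c \<in> S" "x = f \<otimes> c" "d \<in> S" "y = f \<otimes> d" using k(3,4) by auto
      then have "x \<otimes> inv y = c \<otimes> inv d" using k(1,2) sub_car[OF k(1)]
        by (simp add: cancel_div)
      then show ?thesis using c sub_div[OF k(1)] by simp
    qed
    have "inj_on (\<lambda>x. (p x, q x)) E"
    proof (rule inj_onI, rule ccontr)
      fix x y assume h: "x \<in> E" "y \<in> E" "(p x, q x) = (p y, q y)" "x \<noteq> y"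
      have "x \<otimes> inv y \<in> C \<inter> D"
        using key[OF assms(3), of "p x" x y] key[OF assms(4), of "q x" x y] p[OF h(1)] p[OF h(2)] q[OF h(1)] q[OF h(2)] h(3) F F' by auto
      then show False using E(3) h unfolding sep_def by blast
    qed
    then have "card E \<le> card (F \<times> F')" using p q F F' by (intro card_inj_on_le) auto
    then show ?thesis by (simp add: card_cartesian_product)
  qed
  then show ?thesis using alm_iff_sep[OF sub_int[OF assms(3,4)] assms(5)] by blast
qed

lemma alm_inter_mono:
  assumes "alm B C" "subgroup C G" "subgroup D G" "subgroup B G"
  shows "alm (B \<inter> D) (C \<inter> D)"
proof -
  have c: "B \<subseteq> carrier G" using assms sub_car by blast
  obtain n where n: "\<And>F. finite F ==> F \<subseteq> B ==> sep F C ==> card F \<le> n"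
    using assms(1) alm_iff_sep[OF assms(2) c] by blast
  have "sep F C" if "F \<subseteq> B \<inter> D" "sep F (C \<inter> D)" for F
    using that sub_div[OF assms(3)] unfolding sep_def by blast
  then have "\<forall>F. finite F --> F \<subseteq> B \<inter> D --> sep F (C \<inter> D) --> card F \<le> n" using n by blast
  moreover have "B \<inter> D \<subseteq> carrier G" using c by blast
  ultimately show ?thesis using alm_iff_sep[OF sub_int[OF assms(2,3)]] by blast
qed

lemma alm_mult:
  assumes "alm B D" "alm C D" "subgroup D G"
  shows "alm (B <#> C) D"
proof -
  obtain F F' where F: "finite F" "F \<subseteq> carrier G" "B \<subseteq> F <#> D"
    and F': "finite F'" "F' \<subseteq> carrier G" "C \<subseteq> F' <#> D" using assms unfolding alm_def by blast
  have "B <#> C \<subseteq> (F <#> F') <#> D"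
  proof
    fix x assume "x \<in> B <#> C"
    then obtain b c where "b \<in> B" "c \<in> C" and x: "x = b \<otimes> c" by (elim set_multE)
    then obtain f d f' d' where h: "f \<in> F" "d \<in> D" "b = f \<otimes> d" "f' \<in> F'" "d' \<in> D" "c = f' \<otimes> d'"
      using F(3) F'(3) by (blast elim: set_multE)
    have cc: "f \<in> carrier G" "f' \<in> carrier G" "d \<in> carrier G" "d' \<in> carrier G"
      using h F F' sub_car[OF assms(3)] by auto
    have "x = (f \<otimes> f') \<otimes> (d \<otimes> d')" using cc by (simp add: x h m_ac)
    then show "x \<in> (F <#> F') <#> D" using h sub_m[OF assms(3)] by (blast intro: set_multI)
  qed
  then show ?thesis unfolding alm_def
    by (intro exI[of _ "F <#> F'"]) (use F F' in \<open>auto simp: set_mult_def\<close>)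
qed

lemma sub_mult: "subgroup B G ==> subgroup C G ==> subgroup (B <#> C) G" by (rule mult_subgroups)

lemma sub_sub: "subgroup B G ==> B \<subseteq> carrier G" by (rule subgroup.subset)

lemma alm_mult_mono:
  assumes "alm B B'" "alm C C'" "subgroup B' G" "subgroup C' G"
  shows "alm (B <#> C) (B' <#> C')"
  by (intro alm_mult sub_mult assms alm_subset_right[OF assms(1)] alm_subset_right[OF assms(2)]
      sub_left sub_right sub_sub)

text \<open>The modular law for subgroups; it is what makes the width below behave like a dimension.\<close>

lemma modular:
  assumes "subgroup B G" "subgroup C G" "subgroup D G" "B \<subseteq> C"
  shows "C \<inter> (B <#> D) = B <#> (C \<inter> D)"
proof (intro equalityI subsetI)
  fix x assume x: "x \<in> C \<inter> (B <#> D)"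
  then obtain b d where h: "b \<in> B" "d \<in> D" "x = b \<otimes> d" by (blast elim: set_multE)
  have "d = inv b \<otimes> x" using h sub_car assms by (simp add: inv_solve_left)
  then have "d \<in> C" using x h assms sub_m[OF assms(2)] sub_inv[OF assms(2)] by blast
  then show "x \<in> B <#> (C \<inter> D)" using h by (blast intro: set_multI)
next
  fix x assume "x \<in> B <#> (C \<inter> D)"
  then obtain b d where h: "b \<in> B" "d \<in> C \<inter> D" "x = b \<otimes> d" by (blast elim: set_multE)
  then show "x \<in> C \<inter> (B <#> D)" using assms sub_m[OF assms(2)] by (blast intro: set_multI)
qed

lemma mult_idem: "subgroup B G ==> B <#> B = B" by (rule subgroup_mult_id)

lemma mult_comm_sets: "B \<subseteq> carrier G ==> C \<subseteq> carrier G ==> B <#> C = C <#> B"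
  unfolding set_mult_def by (auto; metis m_comm subsetD)

text \<open>B. H. Neumann's lemma, by induction on the number of different subgroups. The finitely many cosets
of one of them, \<open>B\<close>, leave out some coset of \<open>B\<close>; it has to be covered by cosets of the other
subgroups, and translating this cover to the listed cosets of \<open>B\<close> eliminates \<open>B\<close>.\<close>

lemma coset_union_step:
  assumes "subgroup A G" "finite I"
    and "\<And>p. p \<in> I ==> fst p \<in> carrier G \<and> subgroup (snd p) G \<and> \<not> alm A (snd p)"
  shows "\<not> A \<subseteq> (\<Union>p\<in>I. fst p <# snd p)" using assms(2,3)
proof (induction "card (snd ` I)" arbitrary: I rule: less_induct)
  case less
  show ?case
  proof
    assume cov: "A \<subseteq> (\<Union>p\<in>I. fst p <# snd p)"
    have "I \<noteq> {}" using cov sub_one[OF assms(1)] by auto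
    then obtain p0 where p0: "p0 \<in> I" by blast
    define B where "B = snd p0"
    have B: "subgroup B G" "\<not> alm A B" using less(3)[OF p0] by (auto simp: B_def)
    define I1 where "I1 = {p \<in> I. snd p = B}"
    define I2 where "I2 = {p \<in> I. snd p \<noteq> B}"
    have I12: "I = I1 \<union> I2" "finite I1" "finite I2" using less(2) by (auto simp: I1_def I2_def)
    have "\<exists>a\<in>A. \<forall>p\<in>I1. a \<notin> fst p <# B"
    proof (rule ccontr)
      assume "\<not> ?thesis"
      then have "A \<subseteq> fst ` I1 <#> B" unfolding l_coset_def set_mult_def by fastforce
      then have "alm A B" unfolding alm_def using I12 less(3) by (intro exI[of _ "fst ` I1"]) auto
      then show False using B by simp
    qed
    then obtain a where a: "a \<in> A" "\<And>p. p \<in> I1 ==> a \<notin> fst p <# B" by blast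
    have ac: "a \<in> carrier G" using a sub_car assms by blast
    \<comment> \<open>the coset of \<open>a\<close> is covered by \<open>I2\<close>\<close>
    define r where "r p = (SOME r. r \<in> A \<inter> (fst p <# B))" for p :: "'a \<times> 'a set"
    have r: "r p \<in> A \<inter> (fst p <# B)" if "A \<inter> (fst p <# B) \<noteq> {}" for p :: "'a \<times> 'a set"
      unfolding r_def using that by (meson all_not_in_conv someI_ex)
    define J where "J = I2 \<union> (\<lambda>(p, q). (r p \<otimes> inv a \<otimes> fst q, snd q)) ` ({p\<in>I1. A \<inter> (fst p <# B) \<noteq> {}} \<times> I2)"
    have fJ: "finite J" unfolding J_def using I12 by auto
    have sJ: "snd ` J \<subseteq> snd ` I2" unfolding J_def by force
    have pJ: "fst p \<in> carrier G \<and> subgroup (snd p) G \<and> \<not> alm A (snd p)" if pJ: "p \<in> J" for p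
    proof (cases "p \<in> I2")
      case True then show ?thesis using less(3) I12 by blast
    next
      case False
      then obtain s q where sq: "A \<inter> (fst s <# B) \<noteq> {}" "q \<in> I2" "p = (r s \<otimes> inv a \<otimes> fst q, snd q)"
      proof -
        from pJ False obtain z where z: "z \<in> {p\<in>I1. A \<inter> (fst p <# B) \<noteq> {}} \<times> I2"
          "p = (\<lambda>(p, q). (r p \<otimes> inv a \<otimes> fst q, snd q)) z" unfolding J_def by blast
        show thesis by (rule that[of "fst z" "snd z"]) (use z in \<open>auto simp: case_prod_beta\<close>)
      qed
      have "r s \<in> carrier G" using r[OF sq(1)] sub_car[OF assms(1)] by blast
      then show ?thesis using sq less(3)[of q] I12 ac by auto
    qed
    have "card (snd ` J) < card (snd ` I)"
    proof (rule psubset_card_mono)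
      show "finite (snd ` I)" using less by simp
      have "B \<in> snd ` I" using p0 unfolding B_def by blast
      moreover have "B \<notin> snd ` J" using sJ unfolding I2_def by auto
      moreover have "snd ` J \<subseteq> snd ` I" using sJ unfolding I2_def by auto
      ultimately show "snd ` J \<subset> snd ` I" by blast
    qed
    moreover have "A \<subseteq> (\<Union>p\<in>J. fst p <# snd p)"
    proof
      fix x assume x: "x \<in> A"
      have xc: "x \<in> carrier G" using x sub_car assms by blast
      obtain p where p: "p \<in> I" "x \<in> fst p <# snd p" using cov x by blast
      show "x \<in> (\<Union>p\<in>J. fst p <# snd p)"
      proof (cases "p \<in> I2")
        case True then show ?thesis using p unfolding J_def by blast
      next
        case False
        then have p1: "p \<in> I1" "snd p = B" using p(1) unfolding I1_def I2_def by blast+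
        have ne: "A \<inter> (fst p <# B) \<noteq> {}" using x p p1 by auto
        have pc: "fst p \<in> carrier G" using less(3) p by auto
        obtain c where c: "c \<in> B" "r p = fst p \<otimes> c" using r[OF ne] unfolding l_coset_def by auto
        obtain d where d: "d \<in> B" "x = fst p \<otimes> d" using p p1 unfolding l_coset_def by auto
        have cc: "c \<in> carrier G" "d \<in> carrier G" "r p \<in> carrier G" "r p \<in> A"
          using c d r[OF ne] sub_car[OF B(1)] sub_car[OF assms(1)] by auto
        define b where "b = inv (r p) \<otimes> x"
        have b: "b \<in> A" "b \<in> carrier G" "x = r p \<otimes> b" using cc x xc sub_m[OF assms(1)] sub_inv[OF assms(1)]
          by (auto simp: b_def m_assoc[symmetric])
        have "b = (fst p \<otimes> d) \<otimes> inv (fst p \<otimes> c)" using c d cc pc by (simp add: b_def m_comm)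
        also have "\<dots> = d \<otimes> inv c" using cc pc by (simp add: cancel_div)
        finally have "b = d \<otimes> inv c" .
        then have bB: "b \<in> B" using c d sub_div[OF B(1)] by blast
        have ab: "a \<otimes> b \<notin> fst s <# B" if s: "s \<in> I1" for s
        proof
          assume "a \<otimes> b \<in> fst s <# B"
          then obtain d where d: "d \<in> B" "a \<otimes> b = fst s \<otimes> d" unfolding l_coset_def by auto
          have rc: "fst s \<in> carrier G" "d \<in> carrier G" using less(3) s I12 d sub_car[OF B(1)] by auto
          have "a = a \<otimes> b \<otimes> inv b" using ac b by (simp add: m_assoc)
          also have "\<dots> = fst s \<otimes> (d \<otimes> inv b)" using d rc b by (simp add: m_assoc)
          finally have "a \<in> fst s <# B" using d bB sub_div[OF B(1)] unfolding l_coset_def by auto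
          then show False using a s by blast
        qed
        have "a \<otimes> b \<in> A" using a b sub_m[OF assms(1)] by blast
        then obtain q where q: "q \<in> I" "a \<otimes> b \<in> fst q <# snd q" using cov by blast
        then have "q \<in> I2" using ab unfolding I1_def I2_def by blast
        obtain e where e: "e \<in> snd q" "a \<otimes> b = fst q \<otimes> e" using q unfolding l_coset_def by auto
        have qc: "fst q \<in> carrier G" "e \<in> carrier G" using less(3)[OF q(1)] e sub_car by auto
        have "x = r p \<otimes> inv a \<otimes> (a \<otimes> b)" using b cc ac by (simp add: m_assoc inv_solve_left)
        also have "\<dots> = (r p \<otimes> inv a \<otimes> fst q) \<otimes> e" using e qc cc ac by (simp add: m_assoc)
        finally have "x \<in> (r p \<otimes> inv a \<otimes> fst q) <# snd q" using e unfolding l_coset_def by auto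
        moreover have "(r p \<otimes> inv a \<otimes> fst q, snd q) \<in> J" using p1 ne \<open>q \<in> I2\<close> unfolding J_def by force
        ultimately show ?thesis by force
      qed
    qed
    ultimately show False using less(1)[OF _ fJ] pJ by blast
  qed
qed

text \<open>The ideal of sets negligible in \<open>A\<close>: those covered by finitely many cosets of subgroups of infinite
relative index. Neumann's lemma says that \<open>A\<close> itself is not in it, so ``almost all elements of \<open>A\<close>''
has a meaning and finitely many generic conditions can be met at once.\<close>

definition small :: "'a set => 'a set => bool" where
  "small A S \<longleftrightarrow> (\<exists>I. finite I \<and> (\<forall>p\<in>I. fst p \<in> carrier G \<and> subgroup (snd p) G \<and> \<not> alm A (snd p))
     \<and> S \<subseteq> (\<Union>p\<in>I. fst p <# snd p))"

lemma not_small: "subgroup A G ==> \<not> small A A"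
  unfolding small_def using coset_union_step by blast

lemma small_subset: "small A S ==> S' \<subseteq> S ==> small A S'"
  unfolding small_def by (meson order_trans)

lemma small_empty: "small A {}" unfolding small_def by blast

lemma small_Un: assumes "small A S" "small A S'" shows "small A (S \<union> S')"
proof -
  obtain I where I: "finite I" "\<forall>p\<in>I. fst p \<in> carrier G \<and> subgroup (snd p) G \<and> \<not> alm A (snd p)" "S \<subseteq> (\<Union>p\<in>I. fst p <# snd p)"
    using assms unfolding small_def by blast
  obtain J where J: "finite J" "\<forall>p\<in>J. fst p \<in> carrier G \<and> subgroup (snd p) G \<and> \<not> alm A (snd p)" "S' \<subseteq> (\<Union>p\<in>J. fst p <# snd p)"
    using assms unfolding small_def by blast
  show ?thesis unfolding small_def using I J by (intro exI[of _ "I \<union> J"]) auto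
qed

lemma small_UN: "finite I ==> (\<And>i. i \<in> I ==> small A (S i)) ==> small A (\<Union>i\<in>I. S i)"
  by (induction I rule: finite_induct) (auto simp: small_empty intro: small_Un)

lemma small_cover:
  assumes "finite F" "F \<subseteq> carrier G" "S \<subseteq> F <#> B" "subgroup B G" "\<not> alm A B"
  shows "small A S" unfolding small_def
proof (intro exI conjI)
  show "finite ((\<lambda>x. (x, B)) ` F)" using assms by simp
  show "\<forall>p\<in>(\<lambda>x. (x, B)) ` F. fst p \<in> carrier G \<and> subgroup (snd p) G \<and> \<not> alm A (snd p)" using assms by auto
  show "S \<subseteq> (\<Union>p\<in>(\<lambda>x. (x, B)) ` F. fst p <# snd p)"
    using assms(3) unfolding set_mult_def l_coset_def by fastforce
qed

lemma small_sep:
  assumes "subgroup R G" "\<not> alm A R" "S \<subseteq> carrier G"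
    "\<And>F. finite F ==> F \<subseteq> S ==> sep F R ==> card F \<le> n"
  shows "small A S"
proof -
  obtain F where "finite F" "F \<subseteq> S" "S \<subseteq> F <#> R" using sep_max_cover[OF assms(1,3,4)] by blast
  then show ?thesis using small_cover[of F S R A] assms by blast
qed

lemma small_subgroup: "subgroup B G ==> \<not> alm A B ==> small A B"
  by (rule small_cover[of "{\<one>}"]) (auto intro!: set_multI[of \<one>] simp: sub_car)

text \<open>Additive relations (subgroups of the square) replace the partially defined, multivalued maps such
as \<open>\<lambda>\<^sub>a\<^sup>-\<^sup>1 \<circ> \<lambda>\<^sub>y\<close>, whose domains shrink under composition.\<close>

definition arel :: "('a \<times> 'a) set => bool" where
  "arel R \<longleftrightarrow> R \<subseteq> carrier G \<times> carrier G \<and> (\<one>, \<one>) \<in> R \<and>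
     (\<forall>x y x' y'. (x, y) \<in> R --> (x', y') \<in> R --> (x \<otimes> x', y \<otimes> y') \<in> R) \<and>
     (\<forall>x y. (x, y) \<in> R --> (inv x, inv y) \<in> R)"

lemma arelD:
  assumes "arel R"
  shows "(x, y) \<in> R ==> x \<in> carrier G" "(x, y) \<in> R ==> y \<in> carrier G" "(\<one>, \<one>) \<in> R"
    "(x, y) \<in> R ==> (x', y') \<in> R ==> (x \<otimes> x', y \<otimes> y') \<in> R"
    "(x, y) \<in> R ==> (inv x, inv y) \<in> R"
    "(x, y) \<in> R ==> (x', y') \<in> R ==> (x \<otimes> inv x', y \<otimes> inv y') \<in> R"
  using assms unfolding arel_def by auto

lemma arel_converse: "arel R ==> arel (R\<inverse>)" unfolding arel_def by auto

lemma arel_comp: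
  assumes "arel R" "arel S" shows "arel (R O S)" unfolding arel_def
proof (intro conjI allI impI)
  show "R O S \<subseteq> carrier G \<times> carrier G" using arelD(1)[OF assms(1)] arelD(2)[OF assms(2)] by blast
  show "(\<one>, \<one>) \<in> R O S" using arelD(3)[OF assms(1)] arelD(3)[OF assms(2)] by blast
  fix x y assume "(x, y) \<in> R O S"
  then obtain z where z: "(x, z) \<in> R" "(z, y) \<in> S" by blast
  then show "(inv x, inv y) \<in> R O S" using arelD(5)[OF assms(1)] arelD(5)[OF assms(2)] by blast
  fix x' y' assume "(x', y') \<in> R O S"
  then obtain z' where z': "(x', z') \<in> R" "(z', y') \<in> S" by blast
  then show "(x \<otimes> x', y \<otimes> y') \<in> R O S"
    using z arelD(4)[OF assms(1)] arelD(4)[OF assms(2)] by blast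
qed

lemma subgroupI':
  assumes "B \<subseteq> carrier G" "\<one> \<in> B" "\<And>x y. x \<in> B ==> y \<in> B ==> x \<otimes> y \<in> B" "\<And>x. x \<in> B ==> inv x \<in> B"
  shows "subgroup B G" using assms by (simp add: subgroup.intro)

lemma sub_image: assumes "arel R" "subgroup B G" shows "subgroup (R `` B) G"
proof (rule subgroupI')
  show "R `` B \<subseteq> carrier G" using arelD(2)[OF assms(1)] by blast
  show "\<one> \<in> R `` B" using arelD(3)[OF assms(1)] sub_one[OF assms(2)] by blast
next
  fix x y assume "x \<in> R `` B" "y \<in> R `` B"
  then obtain b c where "b \<in> B" "c \<in> B" "(b, x) \<in> R" "(c, y) \<in> R" by blast
  then show "x \<otimes> y \<in> R `` B" using arelD(4)[OF assms(1)] sub_m[OF assms(2)] by blast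
next
  fix x assume "x \<in> R `` B"
  then obtain b where "b \<in> B" "(b, x) \<in> R" by blast
  then show "inv x \<in> R `` B" using arelD(5)[OF assms(1)] sub_inv[OF assms(2)] by blast
qed

lemma sub_Domain: assumes "arel R" shows "subgroup (Domain R) G"
proof -
  have "Domain R = R\<inverse> `` carrier G" using arelD(2)[OF assms] by blast
  then show ?thesis using sub_image[OF arel_converse[OF assms] subgroup_self] by simp
qed

lemma alm_image:
  assumes "arel R" "alm B C" "subgroup C G" "subgroup B G"
  shows "alm (R `` B) (R `` C)"
proof -
  have c: "B \<subseteq> carrier G" using sub_sub assms by blast
  obtain n where n: "\<And>F. finite F ==> F \<subseteq> B ==> sep F C ==> card F \<le> n"
    using assms(2) alm_iff_sep[OF assms(3) c] by blast
  have "card F \<le> n" if F: "finite F" "F \<subseteq> R `` B" "sep F (R `` C)" for F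
  proof -
    have "\<forall>y\<in>F. \<exists>x. x \<in> B \<and> (x, y) \<in> R" using F by blast
    from bchoice[OF this] obtain p where p: "\<And>y. y \<in> F ==> p y \<in> B \<and> (p y, y) \<in> R" by blast
    have key: "p x \<otimes> inv (p y) \<notin> C" if "x \<in> F" "y \<in> F" "x \<noteq> y" for x y
    proof
      assume "p x \<otimes> inv (p y) \<in> C"
      moreover have "(p x \<otimes> inv (p y), x \<otimes> inv y) \<in> R" using p that arelD(6)[OF assms(1)] by blast
      ultimately show False using that F(3) unfolding sep_def by blast
    qed
    have inj: "inj_on p F"
    proof (rule inj_onI, rule ccontr)
      fix x y assume h: "x \<in> F" "y \<in> F" "p x = p y" "x \<noteq> y"
      then have "p x \<otimes> inv (p y) = \<one>" using p sub_car[OF assms(4)] by (metis r_inv)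
      then show False using key[OF h(1,2,4)] sub_one[OF assms(3)] by simp
    qed
    have "sep (p ` F) C" unfolding sep_def using key by blast
    then have "card (p ` F) \<le> n" using n[of "p ` F"] p F(1) by blast
    then show ?thesis by (simp add: card_image[OF inj])
  qed
  moreover have "R `` B \<subseteq> carrier G" using sub_image assms sub_sub by blast
  ultimately show ?thesis using alm_iff_sep[OF sub_image[OF assms(1,3)]] by blast
qed

lemma alm_preimage:
  assumes "arel R" "alm (R `` B) Z" "alm B (Domain R)" "subgroup B G" "subgroup Z G"
  shows "alm B (R\<inverse> `` Z)"
proof -
  have "alm (R\<inverse> `` (R `` B)) (R\<inverse> `` Z)"
    by (intro alm_image arel_converse assms sub_image)
  moreover have "B \<inter> Domain R \<subseteq> R\<inverse> `` (R `` B)" by blast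
  ultimately have "alm (B \<inter> Domain R) (R\<inverse> `` Z)" using alm_subset_left by blast
  moreover have "alm B (B \<inter> Domain R)" by (intro alm_inter alm_refl sub_Domain assms sub_sub)
  ultimately show ?thesis using alm_trans sub_sub[OF sub_image[OF arel_converse[OF assms(1)] assms(5)]] by blast
qed

end

section \<open>Oligomorphic automorphism groups\<close>

text \<open>The elements of \<open>\<Gamma>\<close> are functions on the whole type of which only the values on \<open>carrier A\<close> matter;
hence inverses and composites are required only up to equality there.\<close>

locale oligo = comm_group A for A (structure) +
  fixes \<Gamma> :: "('a => 'a) set"
  assumes \<Gamma>_hom: "\<sigma> \<in> \<Gamma> ==> \<sigma> \<in> hom A A"
    and \<Gamma>_inv: "\<sigma> \<in> \<Gamma> ==> \<exists>\<tau>\<in>\<Gamma>. \<forall>x\<in>carrier A. \<tau> (\<sigma> x) = x \<and> \<sigma> (\<tau> x) = x"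
    and \<Gamma>_comp: "\<sigma> \<in> \<Gamma> ==> \<tau> \<in> \<Gamma> ==> \<exists>\<rho>\<in>\<Gamma>. \<forall>x\<in>carrier A. \<rho> x = \<sigma> (\<tau> x)"
    and orbits: "\<exists>R. finite R \<and> (\<forall>r\<in>R. set r \<subseteq> carrier A) \<and>
      (\<forall>us. set us \<subseteq> carrier A --> length us = l --> (\<exists>r\<in>R. \<exists>\<sigma>\<in>\<Gamma>. map \<sigma> r = us))"
begin

definition stab :: "'a list => ('a => 'a) set" where
  "stab c = {\<sigma> \<in> \<Gamma>. \<forall>x\<in>set c. \<sigma> x = x}"

definition invs :: "'a list => 'a set => bool" where
  "invs c X \<longleftrightarrow> X \<subseteq> carrier A \<and> (\<forall>\<sigma>\<in>stab c. \<forall>x\<in>X. \<sigma> x \<in> X)"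

definition invr :: "'a list => ('a \<times> 'a) set => bool" where
  "invr c R \<longleftrightarrow> R \<subseteq> carrier A \<times> carrier A \<and> (\<forall>\<sigma>\<in>stab c. \<forall>x y. (x, y) \<in> R --> (\<sigma> x, \<sigma> y) \<in> R)"

lemma \<Gamma>_closed: "\<sigma> \<in> \<Gamma> ==> x \<in> carrier A ==> \<sigma> x \<in> carrier A"
  using \<Gamma>_hom by (auto simp: hom_def)

lemma \<Gamma>_mult: "\<sigma> \<in> \<Gamma> ==> x \<in> carrier A ==> y \<in> carrier A ==> \<sigma> (x \<otimes> y) = \<sigma> x \<otimes> \<sigma> y"
  using \<Gamma>_hom by (auto simp: hom_def)

lemma \<Gamma>_group_hom: "\<sigma> \<in> \<Gamma> ==> group_hom A A \<sigma>"
  using \<Gamma>_hom by (simp add: group_hom_def group_hom_axioms_def is_group)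

lemma \<Gamma>_one: "\<sigma> \<in> \<Gamma> ==> \<sigma> \<one> = \<one>"
  by (rule group_hom.hom_one[OF \<Gamma>_group_hom])

lemma \<Gamma>_m_inv: "\<sigma> \<in> \<Gamma> ==> x \<in> carrier A ==> \<sigma> (inv x) = inv (\<sigma> x)"
  by (rule group_hom.hom_inv[OF \<Gamma>_group_hom])

lemma stab_sub: "\<sigma> \<in> stab c ==> \<sigma> \<in> \<Gamma>" by (simp add: stab_def)

lemma stab_inv:
  assumes "\<sigma> \<in> stab c" "set c \<subseteq> carrier A"
  obtains \<tau> where "\<tau> \<in> stab c" "\<And>x. x \<in> carrier A ==> \<tau> (\<sigma> x) = x" "\<And>x. x \<in> carrier A ==> \<sigma> (\<tau> x) = x"
proof -
  obtain \<tau> where t: "\<tau> \<in> \<Gamma>" "\<forall>x\<in>carrier A. \<tau> (\<sigma> x) = x \<and> \<sigma> (\<tau> x) = x" using assms \<Gamma>_inv stab_sub by blast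
  have "\<tau> x = x" if x: "x \<in> set c" for x
  proof -
    have "\<sigma> x = x" "x \<in> carrier A" using x assms by (auto simp: stab_def)
    then show ?thesis using t(2) by metis
  qed
  then have "\<tau> \<in> stab c" using t by (simp add: stab_def)
  then show thesis using that t by blast
qed

lemma stab_mono: "set c \<subseteq> set d ==> stab d \<subseteq> stab c" by (auto simp: stab_def)

lemma invs_mono: "invs c X ==> set c \<subseteq> set d ==> invs d X"
  using stab_mono unfolding invs_def by blast

lemma invr_mono: "invr c X ==> set c \<subseteq> set d ==> invr d X"
  using stab_mono unfolding invr_def by blast

lemma invs_image:
  assumes "invs c X" "\<sigma> \<in> stab c" "set c \<subseteq> carrier A" shows "\<sigma> ` X = X"
proof
  show "\<sigma> ` X \<subseteq> X" using assms unfolding invs_def by blast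
  obtain \<tau> where t: "\<tau> \<in> stab c" "\<And>x. x \<in> carrier A ==> \<tau> (\<sigma> x) = x" "\<And>x. x \<in> carrier A ==> \<sigma> (\<tau> x) = x"
    using stab_inv[OF assms(2,3)] by metis
  show "X \<subseteq> \<sigma> ` X"
  proof
    fix x assume x: "x \<in> X"
    then have "\<tau> x \<in> X" "x \<in> carrier A" using assms(1) t(1) unfolding invs_def by blast+
    then show "x \<in> \<sigma> ` X" using t(3)[of x] by (metis image_eqI)
  qed
qed

text \<open>A relation invariant under the stabiliser of \<open>c\<close> is determined by the orbits of the lists
\<open>c @ [x, y]\<close> with \<open>(x, y)\<close> in it, and the number of orbits depends on the length of \<open>c\<close> alone.\<close>

lemma invr_bound: "\<exists>N. \<forall>c. set c \<subseteq> carrier A --> length c \<le> l --> finite {R. invr c R} \<and> card {R. invr c R} \<le> N"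
proof -
  have "\<exists>N. \<forall>c. set c \<subseteq> carrier A --> length c = l --> finite {R. invr c R} \<and> card {R. invr c R} \<le> N" for l
  proof -
    from orbits[of "l + 2"] obtain Rp where Rp0: "finite Rp \<and> (\<forall>r\<in>Rp. set r \<subseteq> carrier A) \<and>
      (\<forall>us. set us \<subseteq> carrier A --> length us = l + 2 --> (\<exists>r\<in>Rp. \<exists>\<sigma>\<in>\<Gamma>. map \<sigma> r = us))" by (rule exE)
    have Rp: "finite Rp" "\<And>r. r \<in> Rp ==> set r \<subseteq> carrier A" using Rp0 by simp_all
    have Rp3: "\<exists>r\<in>Rp. \<exists>\<sigma>\<in>\<Gamma>. map \<sigma> r = us" if "set us \<subseteq> carrier A" "length us = l + 2" for us
      using Rp0 that by simp_all
    have "finite {R. invr c R} \<and> card {R. invr c R} \<le> card (Pow Rp)" if c: "set c \<subseteq> carrier A" "length c = l" for c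
    proof -
      define code where "code R = {r \<in> Rp. \<exists>\<sigma>\<in>\<Gamma>. \<exists>x y. map \<sigma> r = c @ [x, y] \<and> (x, y) \<in> R}" for R
      have sub: "R \<subseteq> R'" if R: "invr c R" "invr c R'" "code R = code R'" for R R'
      proof
        fix p assume p: "p \<in> R"
        obtain x y where xy: "p = (x, y)" by (cases p)
        have "x \<in> carrier A" "y \<in> carrier A" using p xy R(1) unfolding invr_def by auto
        then have "set (c @ [x, y]) \<subseteq> carrier A" "length (c @ [x, y]) = l + 2" using c by auto
        from Rp3[OF this] obtain r \<sigma> where r: "r \<in> Rp" "\<sigma> \<in> \<Gamma>" "map \<sigma> r = c @ [x, y]" by blast
        then have "r \<in> code R'" using p xy R(3) unfolding code_def by blast
        then obtain \<sigma>' x' y' where s: "\<sigma>' \<in> \<Gamma>" "map \<sigma>' r = c @ [x', y']" "(x', y') \<in> R'" unfolding code_def by blast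
        obtain \<tau> where t: "\<tau> \<in> \<Gamma>" "\<forall>x\<in>carrier A. \<tau> (\<sigma>' x) = x \<and> \<sigma>' (\<tau> x) = x" using \<Gamma>_inv[OF s(1)] by (rule bexE)
        obtain \<rho> where rho: "\<rho> \<in> \<Gamma>" "\<forall>x\<in>carrier A. \<rho> x = \<sigma> (\<tau> x)" using \<Gamma>_comp[OF r(2) t(1)] by (rule bexE)
        have rc: "set r \<subseteq> carrier A" by (rule Rp(2)[OF r(1)])
        have "\<rho> (\<sigma>' u) = \<sigma> u" if u: "u \<in> set r" for u
        proof -
          have "u \<in> carrier A" using u rc by blast
          then show ?thesis using rho(2)[rule_format, OF \<Gamma>_closed[OF s(1)]] t(2)[rule_format, of u] by simp
        qed
        then have "map \<rho> (map \<sigma>' r) = map \<sigma> r" by simp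
        then have "map \<rho> (c @ [x', y']) = c @ [x, y]" using r(3) s(2) by simp
        then have m: "map \<rho> c = c" "\<rho> x' = x" "\<rho> y' = y" by auto
        have "\<forall>x\<in>set c. \<rho> x = x" using m(1) by (induction c) auto
        then have "\<rho> \<in> stab c" using rho(1) unfolding stab_def by blast
        then show "p \<in> R'" using R(2) s(3) m xy unfolding invr_def by blast
      qed
      have "inj_on code {R. invr c R}" using sub by (intro inj_onI) blast
      moreover have "code ` {R. invr c R} \<subseteq> Pow Rp" unfolding code_def by blast
      moreover have "finite (Pow Rp)" using Rp(1) by simp
      ultimately show ?thesis using card_inj_on_le[of code "{R. invr c R}" "Pow Rp"] inj_on_finite[of code "{R. invr c R}" "Pow Rp"] by blast
    qed
    then show ?thesis by blast
  qed
  then have "\<forall>l. \<exists>N. \<forall>c. set c \<subseteq> carrier A --> length c = l --> finite {R. invr c R} \<and> card {R. invr c R} \<le> N" by blast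
  from choice[OF this] obtain N where N: "\<And>l c. set c \<subseteq> carrier A ==> length c = l ==> finite {R. invr c R} \<and> card {R. invr c R} \<le> N l" by blast
  have "N (length c) \<le> (\<Sum>i\<le>l. N i)" if "length c \<le> l" for c :: "'a list"
    using that by (intro member_le_sum) auto
  then have "finite {R. invr c R} \<and> card {R. invr c R} \<le> (\<Sum>i\<le>l. N i)" if "set c \<subseteq> carrier A" "length c \<le> l" for c
    using N[OF that(1) refl] that(2) order_trans by blast
  then show ?thesis by blast
qed

lemma invr_repeat: "\<exists>N. \<forall>c f. set c \<subseteq> carrier A --> length c \<le> l --> (\<forall>i. invr c (f i)) --> (\<exists>i j. i < j \<and> j \<le> (N::nat) \<and> f i = f j)"
proof -
  obtain N where N: "\<And>c. set c \<subseteq> carrier A ==> length c \<le> l ==> finite {R. invr c R} \<and> card {R. invr c R} \<le> N"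
    using invr_bound[of l] by blast
  have "\<exists>i j. i < j \<and> j \<le> N \<and> f i = f j" if c: "set c \<subseteq> carrier A" "length c \<le> l" "\<forall>i. invr c (f i)" for c f
  proof -
    have "f ` {..N} \<subseteq> {R. invr c R}" using c by blast
    then have "card (f ` {..N}) \<le> N" using N[OF c(1,2)] by (meson card_mono order_trans)
    then have "\<not> inj_on f {..N}" using card_image by fastforce
    then obtain i j where "i \<le> N" "j \<le> N" "i \<noteq> j" "f i = f j" unfolding inj_on_def by auto
    then show ?thesis by (metis nat_neq_iff)
  qed
  then show ?thesis by blast
qed

lemma invs_Id_on: "invs c X ==> invr c (Id_on X)" unfolding invs_def invr_def by auto

lemma invs_repeat: "\<exists>N. \<forall>c f. set c \<subseteq> carrier A --> length c \<le> l --> (\<forall>i. invs c (f i)) --> (\<exists>i j. i < j \<and> j \<le> (N::nat) \<and> f i = f j)"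
proof -
  obtain N where N0: "\<forall>c f. set c \<subseteq> carrier A --> length c \<le> l --> (\<forall>i. invr c (f i)) --> (\<exists>i j. i < j \<and> j \<le> (N::nat) \<and> f i = f j)"
    using invr_repeat[of l] by (rule exE)
  have N: "\<exists>i j. i < j \<and> j \<le> N \<and> f i = f j" if "set c \<subseteq> carrier A" "length c \<le> l" "\<forall>i. invr c (f i)" for c f
    using N0 that by simp
  have "\<exists>i j. i < j \<and> j \<le> N \<and> f i = f j" if c: "set c \<subseteq> carrier A" "length c \<le> l" "\<forall>i. invs c (f i)" for c f
  proof -
    obtain i j where ij: "i < j" "j \<le> N" "Id_on (f i) = Id_on (f j)"
      using N[OF c(1,2), of "\<lambda>i. Id_on (f i)"] c(3) invs_Id_on by blast
    then have "f i = f j" by (metis Domain_Id_on)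
    then show ?thesis using ij by blast
  qed
  then show ?thesis by blast
qed

lemma invs_finite:
  assumes "set c \<subseteq> carrier A" shows "finite {X. invs c X}"
proof -
  have "finite {R. invr c R}" using invr_bound[of "length c"] assms by blast
  moreover have "Id_on ` {X. invs c X} \<subseteq> {R. invr c R}" using invs_Id_on by blast
  moreover have "inj_on Id_on {X. invs c X}" by (metis (no_types, lifting) Domain_Id_on inj_onI)
  ultimately show ?thesis using inj_on_finite by blast
qed

lemma alm_transport:
  assumes "\<sigma> \<in> \<Gamma>" "alm B C" "C \<subseteq> carrier A"
  shows "alm (\<sigma> ` B) (\<sigma> ` C)"
proof -
  obtain F where F: "finite F" "F \<subseteq> carrier A" "B \<subseteq> F <#> C" using assms unfolding alm_def by blast
  have "\<sigma> ` B \<subseteq> \<sigma> ` F <#> \<sigma> ` C"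
  proof
    fix y assume "y \<in> \<sigma> ` B"
    then obtain x where x: "x \<in> B" "y = \<sigma> x" by blast
    then obtain f c where "f \<in> F" "c \<in> C" "x = f \<otimes> c" using F(3) by (blast elim: set_multE)
    then show "y \<in> \<sigma> ` F <#> \<sigma> ` C" using x \<Gamma>_mult[OF assms(1)] F(2) assms(3) by (blast intro: set_multI)
  qed
  then show ?thesis unfolding alm_def using F \<Gamma>_closed[OF assms(1)] by (intro exI[of _ "\<sigma> ` F"]) auto
qed

lemma sub_transport: "\<sigma> \<in> \<Gamma> ==> subgroup B A ==> subgroup (\<sigma> ` B) A"
  by (rule group_hom.subgroup_img_is_subgroup[OF \<Gamma>_group_hom])

text \<open>Up to an automorphism \<open>c\<close> is one of finitely many lists, each of which leaves finitely many pairs of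
invariant subgroups. So there are finitely many finite indices to be bounded.\<close>

lemma index_bound:
  "\<exists>N. \<forall>c X Y F. set c \<subseteq> carrier A --> length c \<le> l --> invs c X --> invs c Y --> subgroup X A --> subgroup Y A -->
     alm X Y --> F \<subseteq> X --> finite F --> sep F Y --> card F \<le> N"
proof -
  have "\<exists>N. \<forall>c X Y F. set c \<subseteq> carrier A --> length c = l --> invs c X --> invs c Y --> subgroup X A --> subgroup Y A -->
     alm X Y --> F \<subseteq> X --> finite F --> sep F Y --> card F \<le> N" for l
  proof -
    from orbits[of "l"] obtain Rp where Rp0: "finite Rp \<and> (\<forall>r\<in>Rp. set r \<subseteq> carrier A) \<and>
      (\<forall>us. set us \<subseteq> carrier A --> length us = l --> (\<exists>r\<in>Rp. \<exists>\<sigma>\<in>\<Gamma>. map \<sigma> r = us))" by (rule exE)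
    have Rp: "finite Rp" "\<And>r. r \<in> Rp ==> set r \<subseteq> carrier A" using Rp0 by simp_all
    have Rp3: "\<exists>r\<in>Rp. \<exists>\<sigma>\<in>\<Gamma>. map \<sigma> r = us" if "set us \<subseteq> carrier A" "length us = l" for us
      using Rp0 that by simp_all
    have "\<exists>n. alm X Y --> subgroup X A --> subgroup Y A --> (\<forall>F. finite F --> F \<subseteq> X --> sep F Y --> card F \<le> n)" for X Y
      using alm_iff_sep[of Y X] sub_sub by blast
    then have "\<forall>p. \<exists>n. alm (fst p) (snd p) --> subgroup (fst p) A --> subgroup (snd p) A --> (\<forall>F. finite F --> F \<subseteq> fst p --> sep F (snd p) --> card F \<le> n)" by blast
    from choice[OF this] obtain n0 where n0: "\<And>p. alm (fst p) (snd p) --> subgroup (fst p) A --> subgroup (snd p) A --> (\<forall>F. finite F --> F \<subseteq> fst p --> sep F (snd p) --> card F \<le> n0 p)" by blast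
    define n where "n X Y = n0 (X, Y)" for X Y
    have n: "card F \<le> n X Y" if "alm X Y" "subgroup X A" "subgroup Y A" "finite F" "F \<subseteq> X" "sep F Y" for X Y F
      using n0[of "(X, Y)"] that unfolding n_def by simp
    define T where "T = (SIGMA r:Rp. {X. invs r X} \<times> {Y. invs r Y})"
    have fT: "finite T" unfolding T_def using Rp(1,2) invs_finite by auto
    define N where "N = (\<Sum>(r, X, Y)\<in>T. n X Y)"
    have "card F \<le> N" if h: "set c \<subseteq> carrier A" "length c = l" "invs c X" "invs c Y" "subgroup X A" "subgroup Y A"
       "alm X Y" "F \<subseteq> X" "finite F" "sep F Y" for c X Y F
    proof -
      obtain r \<sigma> where r: "r \<in> Rp" "\<sigma> \<in> \<Gamma>" "map \<sigma> r = c" using Rp3[OF h(1,2)] by blast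
      obtain \<tau> where t: "\<tau> \<in> \<Gamma>" "\<forall>x\<in>carrier A. \<tau> (\<sigma> x) = x \<and> \<sigma> (\<tau> x) = x" using \<Gamma>_inv[OF r(2)] by (rule bexE)
      have rc: "set r \<subseteq> carrier A" by (rule Rp(2)[OF r(1)])
      have tr: "invs r (\<tau> ` Z)" if Z: "invs c Z" for Z unfolding invs_def
      proof (intro conjI ballI)
        show "\<tau> ` Z \<subseteq> carrier A" using Z \<Gamma>_closed[OF t(1)] unfolding invs_def by blast
        fix \<rho> y assume rho: "\<rho> \<in> stab r" and "y \<in> \<tau> ` Z"
        then obtain z where z: "z \<in> Z" "y = \<tau> z" by blast
        have zc: "z \<in> carrier A" using z Z unfolding invs_def by blast
        obtain \<mu>0 where m0: "\<mu>0 \<in> \<Gamma>" "\<forall>x\<in>carrier A. \<mu>0 x = \<sigma> (\<rho> x)" using \<Gamma>_comp[OF r(2)] stab_sub[OF rho] by blast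
        obtain \<mu> where m: "\<mu> \<in> \<Gamma>" "\<forall>x\<in>carrier A. \<mu> x = \<mu>0 (\<tau> x)" using \<Gamma>_comp[OF m0(1) t(1)] by blast
        have "\<mu> x = x" if x: "x \<in> set c" for x
        proof -
          obtain u where u: "u \<in> set r" "x = \<sigma> u" using x r(3) by auto
          have "\<rho> u = u" using rho u unfolding stab_def by blast
          have uc: "u \<in> carrier A" "x \<in> carrier A" using u rc \<Gamma>_closed[OF r(2)] by auto
          have "\<tau> x = u" using t(2) u(2) uc(1) by simp
          then have "\<mu> x = \<mu>0 u" using m(2) uc(2) by simp
          also have "\<dots> = \<sigma> u" using m0(2) uc(1) \<open>\<rho> u = u\<close> by simp
          finally show ?thesis using u(2) by simp
        qed
        then have "\<mu> \<in> stab c" using m(1) unfolding stab_def by blast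
        then have "\<mu> z \<in> Z" using Z z unfolding invs_def by blast
        moreover have "\<tau> (\<mu> z) = \<rho> (\<tau> z)"
        proof -
          have c1: "\<tau> z \<in> carrier A" by (rule \<Gamma>_closed[OF t(1) zc])
          have "\<mu> z = \<sigma> (\<rho> (\<tau> z))" using m(2)[rule_format, OF zc] m0(2)[rule_format, OF c1] by simp
          then show ?thesis using t(2)[rule_format, OF \<Gamma>_closed[OF stab_sub[OF rho] c1]] by simp
        qed
        ultimately show "\<rho> y \<in> \<tau> ` Z" using z by (metis image_eqI)
      qed
      have inj: "inj_on \<tau> (carrier A)"
      proof (rule inj_onI)
        fix x y assume xy: "x \<in> carrier A" "y \<in> carrier A" "\<tau> x = \<tau> y"
        have "x = \<sigma> (\<tau> x)" using t(2)[rule_format, OF xy(1)] by (simp only:)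
        also have "\<dots> = \<sigma> (\<tau> y)" by (simp only: xy(3))
        also have "\<dots> = y" using t(2)[rule_format, OF xy(2)] by (simp only:)
        finally show "x = y" .
      qed
      have Xc: "X \<subseteq> carrier A" "Y \<subseteq> carrier A" using h sub_sub by auto
      have "sep (\<tau> ` F) (\<tau> ` Y)" unfolding sep_def
      proof (intro ballI impI notI)
        fix a b assume ab: "a \<in> \<tau> ` F" "b \<in> \<tau> ` F" "a \<noteq> b" "a \<otimes> inv b \<in> \<tau> ` Y"
        then obtain x y w where x: "x \<in> F" "a = \<tau> x" "y \<in> F" "b = \<tau> y" "w \<in> Y" "a \<otimes> inv b = \<tau> w" by blast
        have xyc: "x \<in> carrier A" "y \<in> carrier A" using x h(8) Xc by auto
        have "\<tau> (x \<otimes> inv y) = \<tau> w" using x xyc \<Gamma>_mult[OF t(1), of x "inv y"] \<Gamma>_m_inv[OF t(1), of y] by simp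
        moreover have "x \<otimes> inv y \<in> carrier A" "w \<in> carrier A" using xyc x(5) Xc by auto
        ultimately have "x \<otimes> inv y = w" by (rule inj_onD[OF inj])
        then have "x \<otimes> inv y \<in> Y" using x(5) by simp
        moreover have "x \<noteq> y" using x(2,4) ab(3) by blast
        ultimately show False using h(10) x(1,3) unfolding sep_def by blast
      qed
      then have "card (\<tau> ` F) \<le> n (\<tau> ` X) (\<tau> ` Y)"
        by (intro n[of "\<tau> ` X" "\<tau> ` Y" "\<tau> ` F"] alm_transport[OF t(1) h(7)] sub_transport[OF t(1)] h(5,6) Xc(2) finite_imageI h(9) image_mono h(8))
      also have "card (\<tau> ` F) = card F" by (rule card_image[OF inj_on_subset[OF inj order_trans[OF h(8) Xc(1)]]])
      also have "n (\<tau> ` X) (\<tau> ` Y) \<le> N"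
      proof -
        have "(r, \<tau> ` X, \<tau> ` Y) \<in> T" unfolding T_def using r(1) tr[OF h(3)] tr[OF h(4)] by simp
        then show ?thesis unfolding N_def using fT
          member_le_sum[of "(r, \<tau> ` X, \<tau> ` Y)" T "\<lambda>(r, X, Y). n X Y"] by simp
      qed
      finally show ?thesis .
    qed
    then show ?thesis by blast
  qed
  then have "\<forall>l. \<exists>N. \<forall>c X Y F. set c \<subseteq> carrier A --> length c = l --> invs c X --> invs c Y --> subgroup X A --> subgroup Y A -->
     alm X Y --> F \<subseteq> X --> finite F --> sep F Y --> card F \<le> N" by blast
  from choice[OF this] obtain N where N: "\<forall>l. \<forall>c X Y F. set c \<subseteq> carrier A --> length c = l --> invs c X --> invs c Y --> subgroup X A --> subgroup Y A -->
     alm X Y --> F \<subseteq> X --> finite F --> sep F Y --> card F \<le> N l" by blast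
  have "N (length c) \<le> (\<Sum>i\<le>l. N i)" if "length c \<le> l" for c :: "'a list"
    using that by (intro member_le_sum) auto
  then have "card F \<le> (\<Sum>i\<le>l. N i)" if hh: "set c \<subseteq> carrier A" "length c \<le> l" "invs c X" "invs c Y" "subgroup X A" "subgroup Y A"
       "alm X Y" "F \<subseteq> X" "finite F" "sep F Y" for c X Y F
  proof -
    have "card F \<le> N (length c)" using N[rule_format, OF hh(1) refl hh(3-10)] .
    then show ?thesis using \<open>\<And>c. length c \<le> l ==> N (length c) \<le> (\<Sum>i\<le>l. N i)\<close>[OF hh(2)] by (rule order_trans)
  qed
  then show ?thesis by blast
qed

lemma invs_Int: "invs c X ==> invs c Y ==> invs c (X \<inter> Y)" unfolding invs_def by blast

lemma invs_mult:
  assumes "invs c X" "invs c Y" shows "invs c (X <#> Y)" unfolding invs_def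
proof (intro conjI ballI)
  show "X <#> Y \<subseteq> carrier A" using assms setmult_subset_G unfolding invs_def by blast
  fix \<sigma> z assume s: "\<sigma> \<in> stab c" and "z \<in> X <#> Y"
  then obtain x y where z: "x \<in> X" "y \<in> Y" "z = x \<otimes> y" by (blast elim: set_multE)
  then have "\<sigma> z = \<sigma> x \<otimes> \<sigma> y" using assms \<Gamma>_mult[OF stab_sub[OF s]] unfolding invs_def by blast
  then show "\<sigma> z \<in> X <#> Y" using z s assms unfolding invs_def by (blast intro: set_multI)
qed

lemma invs_rel_image: "invr c R ==> invs c X ==> invs c (R `` X)"
  unfolding invr_def invs_def by blast

lemma invr_converse: "invr c R ==> invr c (R\<inverse>)" unfolding invr_def by blast

lemma invr_comp: "invr c R ==> invr c S ==> invr c (R O S)" unfolding invr_def by blast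

lemma invr_Int: "invr c R ==> invr c S ==> invr c (R \<inter> S)" unfolding invr_def by blast

lemma invr_Times: "invs c X ==> invs c Y ==> invr c (X \<times> Y)"
  unfolding invr_def invs_def by blast

text \<open>By the theorem of Ryll-Nardzewski these are the subgroups definable with parameters.\<close>

definition dfn :: "'a set => bool" where
  "dfn X \<longleftrightarrow> subgroup X A \<and> (\<exists>c. set c \<subseteq> carrier A \<and> invs c X)"

lemma dfn_sub: "dfn X ==> subgroup X A" by (simp add: dfn_def)

lemma dfn_car: "dfn X ==> X \<subseteq> carrier A" by (simp add: dfn_def sub_sub)

lemma dfnE:
  assumes "dfn X" obtains c where "set c \<subseteq> carrier A" "invs c X"
  using assms unfolding dfn_def by blast

lemma dfn_pair:
  assumes "dfn X" "dfn Y" obtains c where "set c \<subseteq> carrier A" "invs c X" "invs c Y"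
proof -
  obtain c d where "set c \<subseteq> carrier A" "invs c X" "set d \<subseteq> carrier A" "invs d Y" using assms unfolding dfn_def by blast
  then show thesis using that[of "c @ d"] invs_mono[of c X "c @ d"] invs_mono[of d Y "c @ d"] by auto
qed

lemma dfn_Int: assumes "dfn X" "dfn Y" shows "dfn (X \<inter> Y)"
  using dfn_pair[OF assms] invs_Int sub_int assms unfolding dfn_def by metis

lemma dfn_mult: assumes "dfn X" "dfn Y" shows "dfn (X <#> Y)"
  using dfn_pair[OF assms] invs_mult sub_mult assms unfolding dfn_def by metis

lemma dfn_one: "dfn {\<one>}"
proof -
  have "invs [] {\<one>}" unfolding invs_def using \<Gamma>_one stab_sub by auto
  then show ?thesis unfolding dfn_def using triv_subgroup by (metis empty_set empty_subsetI)
qed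

end

section \<open>Width and invariant quasi-forms\<close>

context oligo
begin

text \<open>What is left of finite burden: an independent family of \<open>d + 1\<close> definable subgroups, none of which
almost contains the intersection of the others, would give an inp-pattern made of their cosets.\<close>

definition tame :: "'a set => bool" where
  "tame T \<longleftrightarrow> dfn T \<and> (\<exists>d::nat. \<forall>D. (\<forall>i\<le>d. dfn (D i)) -->
     (\<exists>i\<le>d. alm (T \<inter> (\<Inter>j\<in>{..d}-{i}. D j)) (D i)))"

definition indep :: "nat => 'a set => 'a set => (nat => 'a set) => bool" where
  "indep n X Y D \<longleftrightarrow> (\<forall>i<n. dfn (D i) \<and> alm Y (D i)) \<and>
     (\<forall>i<n. \<not> alm (X \<inter> (\<Inter>j\<in>{..<n}-{i}. D j)) (D i))"

definition bdd :: "'a set => bool" where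
  "bdd X \<longleftrightarrow> (\<exists>d. \<forall>n Y D. indep n X Y D --> n \<le> d)"

text \<open>The width of \<open>X\<close> over \<open>Y\<close>: the largest number of definable subgroups above \<open>Y\<close> that are independent
on \<open>X\<close>. Unlike burden itself it is defined for pairs, and it strictly increases from \<open>X\<close> to \<open>X <#> Y\<close>
over \<open>X \<inter> Y\<close> unless \<open>Y\<close> is almost contained in \<open>X\<close>.\<close>

definition wd :: "'a set => 'a set => nat" where
  "wd X Y = Max {n. \<exists>D. indep n X Y D}"

lemma tame_bdd:
  assumes "tame T" "X \<subseteq> T" shows "bdd X"
proof -
  obtain d :: nat where d: "\<And>D. (\<forall>i\<le>d. dfn (D i)) ==> (\<exists>i\<le>d. alm (T \<inter> (\<Inter>j\<in>{..d}-{i}. D j)) (D i))"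
    using assms(1) unfolding tame_def by blast
  have "n \<le> d" if i: "indep n X Y D" for n Y D
  proof (rule ccontr)
    assume nd: "\<not> n \<le> d"
    then have "\<forall>i\<le>d. dfn (D i)" using i unfolding indep_def by simp
    from d[OF this] obtain i0 where i0: "i0 \<le> d" "alm (T \<inter> (\<Inter>j\<in>{..d}-{i0}. D j)) (D i0)" by blast
    have "X \<inter> (\<Inter>j\<in>{..<n}-{i0}. D j) \<subseteq> T \<inter> (\<Inter>j\<in>{..d}-{i0}. D j)" using nd assms(2) by auto
    then have "alm (X \<inter> (\<Inter>j\<in>{..<n}-{i0}. D j)) (D i0)" using alm_subset_left[OF i0(2)] by blast
    then show False using i i0(1) nd unfolding indep_def by simp
  qed
  then show ?thesis unfolding bdd_def by blast
qed

lemma indep_fin: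
  assumes "bdd X" shows "finite {n. \<exists>D. indep n X Y D}" "{n. \<exists>D. indep n X Y D} \<noteq> {}"
proof -
  obtain d where "\<And>n Y D. indep n X Y D ==> n \<le> d" using assms unfolding bdd_def by blast
  then have "{n. \<exists>D. indep n X Y D} \<subseteq> {..d}" by blast
  then show "finite {n. \<exists>D. indep n X Y D}" using finite_subset by blast
  have "indep 0 X Y D" for D by (simp add: indep_def)
  then show "{n. \<exists>D. indep n X Y D} \<noteq> {}" by blast
qed

lemma wd_ge: "bdd X ==> indep n X Y D ==> n \<le> wd X Y"
  unfolding wd_def by (rule Max_ge) (use indep_fin in auto)

lemma wd_ex: assumes "bdd X" shows "\<exists>D. indep (wd X Y) X Y D"
  using Max_in[OF indep_fin[OF assms, of Y]] unfolding wd_def by blast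

lemma sub_Int_INT:
  assumes "subgroup X A" "\<And>j. j \<in> J ==> subgroup (D j) A"
  shows "subgroup (X \<inter> (\<Inter>j\<in>J. D j)) A"
  by (rule subgroupI') (use assms in \<open>auto simp: sub_car sub_one sub_m sub_inv\<close>)

text \<open>An independent family on \<open>X'\<close> over \<open>Y'\<close> is made into one on \<open>X\<close> over \<open>Y\<close> by replacing each member
\<open>D\<close> with \<open>(D \<inter> X') <#> Y\<close>; by the modular law this changes the trace on \<open>X'\<close> only within the
commensurability class.\<close>

lemma wd_mono:
  assumes d: "dfn X" "dfn X'" "dfn Y" "dfn Y'" and b: "bdd X" "bdd X'"
    and a: "alm X' X" "alm (X' \<inter> Y) Y'"
  shows "wd X' Y' \<le> wd X Y"
proof -
  define n where "n = wd X' Y'"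
  obtain D where D: "indep n X' Y' D" using wd_ex[OF b(2)] unfolding n_def by blast
  have Dd: "dfn (D i)" "alm Y' (D i)" if "i < n" for i using D that unfolding indep_def by auto
  define D' where "D' i = (D i \<inter> X') <#> Y" for i
  note s = d[THEN dfn_sub]
  have D'd: "dfn (D' i)" if "i < n" for i using Dd(1)[OF that] d unfolding D'_def by (intro dfn_mult dfn_Int)
  have "indep n X Y D'" unfolding indep_def
  proof (intro conjI allI impI)
    fix i assume i: "i < n"
    show "dfn (D' i)" by (rule D'd[OF i])
    show "alm Y (D' i)" unfolding D'_def
      by (intro alm_subset sub_right sub_sub sub_mult sub_int s dfn_sub[OF Dd(1)[OF i]])
    show "\<not> alm (X \<inter> (\<Inter>j\<in>{..<n}-{i}. D' j)) (D' i)"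
    proof
      assume bad: "alm (X \<inter> (\<Inter>j\<in>{..<n}-{i}. D' j)) (D' i)"
      define E where "E = X' \<inter> (\<Inter>j\<in>{..<n}-{i}. D j)"
      have sE: "subgroup E A" unfolding E_def by (intro sub_Int_INT s) (use Dd dfn_sub in auto)
      have EX: "alm E X'" by (rule alm_subset) (auto simp: E_def sub_car[OF s(2)])
      have "alm E (E \<inter> X)" by (intro alm_inter alm_refl sE s sub_sub alm_trans[OF EX a(1)])
      moreover have "E \<inter> X \<subseteq> X \<inter> (\<Inter>j\<in>{..<n}-{i}. D' j)"
      proof -
        have "E \<subseteq> D' j" if j: "j \<in> {..<n}-{i}" for j
        proof -
          have "E \<subseteq> D j \<inter> X'" using j unfolding E_def by blast
          also have "\<dots> \<subseteq> D' j" unfolding D'_def using j by (intro sub_left sub_int s dfn_sub[OF Dd(1)]) auto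
          finally show ?thesis .
        qed
        then show ?thesis by blast
      qed
      ultimately have "alm E (D' i)"
        using alm_trans[OF _ alm_subset_left[OF bad] dfn_car[OF D'd[OF i]]] by blast
      then have "alm E (X' \<inter> D' i)" by (intro alm_inter EX s sE sub_sub dfn_sub D'd i)
      moreover have "X' \<inter> D' i = (D i \<inter> X') <#> (X' \<inter> Y)" unfolding D'_def
        by (intro modular sub_int s dfn_sub[OF Dd(1)] i) blast
      moreover have "alm ((D i \<inter> X') <#> (X' \<inter> Y)) (D i)"
        by (intro alm_mult alm_trans[OF a(2) Dd(2)] alm_subset dfn_car[OF Dd(1)[OF i]] dfn_sub[OF Dd(1)] i) blast
      ultimately have "alm E (D i)" using alm_trans dfn_car[OF Dd(1)[OF i]] by metis
      then show False using D i unfolding indep_def E_def by blast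
    qed
  qed
  from wd_ge[OF b(1) this] show ?thesis unfolding n_def .
qed

text \<open>Extend an independent family for \<open>X\<close> by \<open>X\<close> itself and add \<open>Y\<close> to the other members: the summand
\<open>Y\<close> witnesses that the new member \<open>X\<close> is independent of them.\<close>

lemma wd_super:
  assumes d: "dfn X" "dfn Y" and b: "bdd X" "bdd (X <#> Y)" and a: "\<not> alm Y X"
  shows "wd X (X \<inter> Y) + 1 \<le> wd (X <#> Y) (X \<inter> Y)"
proof -
  define n where "n = wd X (X \<inter> Y)"
  obtain D where D: "indep n X (X \<inter> Y) D" using wd_ex[OF b(1)] unfolding n_def by blast
  have Dd: "dfn (D i)" "alm (X \<inter> Y) (D i)" if "i < n" for i using D that unfolding indep_def by auto
  define D' where "D' i = (if i < n then (D i \<inter> X) <#> Y else X)" for i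
  note s = d[THEN dfn_sub]
  have D'd: "dfn (D' i)" for i using Dd(1) d unfolding D'_def by (auto intro!: dfn_mult dfn_Int)
  have YD: "Y \<subseteq> D' i" if "i < n" for i using that unfolding D'_def
    by (auto intro!: sub_right[THEN subsetD] sub_int s dfn_sub[OF Dd(1)])
  have "indep (n + 1) (X <#> Y) (X \<inter> Y) D'" unfolding indep_def
  proof (intro conjI allI impI)
    fix i assume i: "i < n + 1"
    show "dfn (D' i)" by (rule D'd)
    show "alm (X \<inter> Y) (D' i)"
    proof (cases "i < n")
      case True then show ?thesis using YD by (intro alm_subset dfn_car D'd) blast
    next
      case False then show ?thesis by (intro alm_subset dfn_car D'd) (auto simp: D'_def)
    qed
    show "\<not> alm ((X <#> Y) \<inter> (\<Inter>j\<in>{..<n+1}-{i}. D' j)) (D' i)"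
    proof (cases "i < n")
      case True
      define E where "E = X \<inter> (\<Inter>j\<in>{..<n}-{i}. D j)"
      have sE: "subgroup E A" unfolding E_def by (intro sub_Int_INT s) (use Dd dfn_sub in auto)
      have EX: "E \<subseteq> X" unfolding E_def by blast
      have "E \<subseteq> D' j" if j: "j \<in> {..<n+1}-{i}" for j
      proof (cases "j < n")
        case jn: True
        have "E \<subseteq> D j \<inter> X" using j jn unfolding E_def by blast
        also have "\<dots> \<subseteq> D' j" unfolding D'_def using jn by (auto intro!: sub_left[THEN subsetD] sub_int s dfn_sub[OF Dd(1)])
        finally show ?thesis .
      next
        case False then show ?thesis using EX by (auto simp: D'_def)
      qed
      moreover have "X \<subseteq> X <#> Y" by (intro sub_left s)
      ultimately have sub: "E \<subseteq> (X <#> Y) \<inter> (\<Inter>j\<in>{..<n+1}-{i}. D' j)" using EX by blast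
      show ?thesis
      proof
        assume "alm ((X <#> Y) \<inter> (\<Inter>j\<in>{..<n+1}-{i}. D' j)) (D' i)"
        then have "alm E (D' i)" using sub alm_subset_left by blast
        then have "alm E (X \<inter> D' i)" by (intro alm_inter[OF alm_subset[OF EX sub_sub[OF s(1)]]] s sub_sub sE dfn_sub D'd)
        moreover have "X \<inter> D' i = (D i \<inter> X) <#> (X \<inter> Y)"
        proof -
          have "X \<inter> ((D i \<inter> X) <#> Y) = (D i \<inter> X) <#> (X \<inter> Y)"
            by (intro modular sub_int s dfn_sub[OF Dd(1)] True) blast
          then show ?thesis unfolding D'_def using True by simp
        qed
        moreover have "alm ((D i \<inter> X) <#> (X \<inter> Y)) (D i)"
          by (intro alm_mult Dd(2) alm_subset dfn_car[OF Dd(1)[OF True]] dfn_sub[OF Dd(1)] True) blast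
        ultimately have "alm E (D i)" using alm_trans dfn_car[OF Dd(1)[OF True]] by metis
        then show False using D True unfolding indep_def E_def by blast
      qed
    next
      case False
      then have i: "i = n" using i by simp
      have "Y \<subseteq> X <#> Y" by (intro sub_right s)
      have "Y \<subseteq> D' j" if j: "j \<in> {..<n+1}-{i}" for j using YD[of j] j i by simp
      then have "Y \<subseteq> (\<Inter>j\<in>{..<n+1}-{i}. D' j)" by (rule INT_greatest)
      with \<open>Y \<subseteq> X <#> Y\<close> have "Y \<subseteq> (X <#> Y) \<inter> (\<Inter>j\<in>{..<n+1}-{i}. D' j)" by (rule Int_greatest)
      then show ?thesis using a i alm_subset_left unfolding D'_def by fastforce
    qed
  qed
  from wd_ge[OF b(2) this] show ?thesis unfolding n_def .
qed

text \<open>The analogue of the isomorphism between \<open>(Z <#> Z') / Z\<close> and \<open>Z' / (Z \<inter> Z')\<close>.\<close>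

lemma wd_second_iso:
  assumes d: "dfn Z" "dfn Z'" and b: "bdd (Z <#> Z')" "bdd Z'"
  shows "wd (Z <#> Z') Z \<le> wd Z' (Z \<inter> Z')"
proof -
  define n where "n = wd (Z <#> Z') Z"
  obtain D where D: "indep n (Z <#> Z') Z D" using wd_ex[OF b(1)] unfolding n_def by blast
  have Dd: "dfn (D i)" "alm Z (D i)" if "i < n" for i using D that unfolding indep_def by auto
  note s = d[THEN dfn_sub]
  define D' where "D' i = Z <#> D i" for i
  have D'd: "dfn (D' i)" if "i < n" for i using Dd(1)[OF that] d unfolding D'_def by (intro dfn_mult)
  have ZD: "Z \<subseteq> D' i" if "i < n" for i unfolding D'_def by (intro sub_left s dfn_sub[OF Dd(1)] that)
  have "indep n Z' (Z \<inter> Z') D'" unfolding indep_def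
  proof (intro conjI allI impI)
    fix i assume i: "i < n"
    show "dfn (D' i)" by (rule D'd[OF i])
    show "alm (Z \<inter> Z') (D' i)" using ZD[OF i] by (intro alm_subset dfn_car D'd i) blast
    show "\<not> alm (Z' \<inter> (\<Inter>j\<in>{..<n}-{i}. D' j)) (D' i)"
    proof
      assume bad: "alm (Z' \<inter> (\<Inter>j\<in>{..<n}-{i}. D' j)) (D' i)"
      have DD': "alm (D' i) (D i)" unfolding D'_def by (intro alm_mult alm_refl Dd(2) dfn_sub[OF Dd(1)] i)
      define W where "W = carrier A \<inter> (\<Inter>j\<in>{..<n}-{i}. D' j)"
      have sW: "subgroup W A" unfolding W_def by (intro sub_Int_INT subgroup_self) (use D'd dfn_sub in auto)
      have ZW: "Z \<subseteq> W" using ZD sub_sub[OF s(1)] unfolding W_def by auto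
      have "(Z <#> Z') \<inter> (\<Inter>j\<in>{..<n}-{i}. D j) \<subseteq> W \<inter> (Z <#> Z')"
      proof -
        have "D j \<subseteq> D' j" if "j < n" for j unfolding D'_def by (intro sub_right s dfn_sub[OF Dd(1)] that)
        then show ?thesis unfolding W_def using sub_sub[OF sub_mult[OF s]] by auto
      qed
      also have "\<dots> = Z <#> (W \<inter> Z')" by (intro modular s sW ZW)
      finally have e: "(Z <#> Z') \<inter> (\<Inter>j\<in>{..<n}-{i}. D j) \<subseteq> Z <#> (W \<inter> Z')" .
      have "W \<inter> Z' \<subseteq> Z' \<inter> (\<Inter>j\<in>{..<n}-{i}. D' j)" unfolding W_def by blast
      then have "alm (W \<inter> Z') (D i)" using alm_trans[OF alm_subset_left[OF bad] DD' dfn_car[OF Dd(1)[OF i]]] by blast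
      then have "alm (Z <#> (W \<inter> Z')) (D i)" by (intro alm_mult Dd(2) dfn_sub[OF Dd(1)] i)
      then show False using D i e alm_subset_left unfolding indep_def by blast
    qed
  qed
  from wd_ge[OF b(2) this] show ?thesis unfolding n_def .
qed

end

text \<open>All three groups live inside one ambient group, so that a single notion of invariance serves for
subgroups, kernels and images. The assumptions are symmetric in \<open>G\<close> and \<open>H\<close>; every result about
elements of \<open>G\<close> is used a second time through \<open>qform_swap\<close>.\<close>

locale qform = oligo A \<Gamma> for A (structure) and \<Gamma> +
  fixes G H K :: "'a set" and lam :: "'a => 'a => 'a option"
  assumes invG: "invs [] G" and invH: "invs [] H" and invK: "invs [] K"
    and tameG: "tame G" and tameH: "tame H" and tameK: "tame K"
    and lamK: "g \<in> G ==> h \<in> H ==> lam g h = Some k ==> k \<in> K"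
    and lam_inv: "\<sigma> \<in> \<Gamma> ==> g \<in> G ==> h \<in> H ==> lam (\<sigma> g) (\<sigma> h) = map_option \<sigma> (lam g h)"
    and lin1: "g \<in> G ==> h \<in> H ==> h' \<in> H ==> lam g h = Some k ==> lam g h' = Some k' ==> lam g (h \<otimes> h') = Some (k \<otimes> k')"
    and one1: "g \<in> G ==> lam g \<one> = Some \<one>"
    and minv1: "g \<in> G ==> h \<in> H ==> lam g h = Some k ==> lam g (inv h) = Some (inv k)"
    and dom1: "g \<in> G ==> alm H {h \<in> H. lam g h \<noteq> None}"
    and lin2: "g \<in> G ==> g' \<in> G ==> h \<in> H ==> lam g h = Some k ==> lam g' h = Some k' ==> lam (g \<otimes> g') h = Some (k \<otimes> k')"
    and one2: "h \<in> H ==> lam \<one> h = Some \<one>"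
    and minv2: "g \<in> G ==> h \<in> H ==> lam g h = Some k ==> lam (inv g) h = Some (inv k)"
    and dom2: "h \<in> H ==> alm G {g \<in> G. lam g h \<noteq> None}"
begin

lemma qform_swap: "qform A \<Gamma> H G K (\<lambda>h g. lam g h)"
  by unfold_locales (use invG invH invK tameG tameH tameK lamK lam_inv lin1 one1 minv1 dom1 lin2 one2 minv2 dom2 in auto)

lemma dG: "dfn G" and dH: "dfn H" and dK: "dfn K" using tameG tameH tameK unfolding tame_def by auto

lemmas sG = dG[THEN dfn_sub] and sH = dH[THEN dfn_sub] and sK = dK[THEN dfn_sub]
lemmas cG = dG[THEN dfn_car] and cH = dH[THEN dfn_car] and cK = dK[THEN dfn_car]

lemma bddG: "X \<subseteq> G ==> bdd X" and bddH: "X \<subseteq> H ==> bdd X" and bddK: "X \<subseteq> K ==> bdd X"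
  using tame_bdd tameG tameH tameK by auto

definition gr :: "'a => ('a \<times> 'a) set" where "gr g = {(h, k). h \<in> H \<and> lam g h = Some k}"
definition gl :: "'a => ('a \<times> 'a) set" where "gl h = {(g, k). g \<in> G \<and> lam g h = Some k}"

text \<open>The residual of \<open>X\<close> modulo \<open>Z\<close>, that is, the almost annihilator: the elements of \<open>G\<close> mapping \<open>X\<close> almost
into \<open>Z\<close>. Its mirror image is \<open>resl\<close>.\<close>

definition res :: "'a set => 'a set => 'a set" where "res Z X = {g \<in> G. alm (gr g `` X) Z}"
definition resl :: "'a set => 'a set => 'a set" where "resl Z Y = {h \<in> H. alm (gl h `` Y) Z}"

lemma sw_gr: "qform.gr G (\<lambda>h g. lam g h) = gl"
  by (rule ext) (simp add: qform.gr_def[OF qform_swap] gl_def)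
lemma sw_gl: "qform.gl H (\<lambda>h g. lam g h) = gr"
  by (rule ext) (simp add: qform.gl_def[OF qform_swap] gr_def)
lemma sw_res: "qform.res A H G (\<lambda>h g. lam g h) = resl"
  by (intro ext) (simp add: qform.res_def[OF qform_swap] resl_def sw_gr)
lemma sw_resl: "qform.resl A H G (\<lambda>h g. lam g h) = res"
  by (intro ext) (simp add: qform.resl_def[OF qform_swap] res_def sw_gl)

lemmas sw = sw_gr sw_gl sw_res sw_resl

lemma arel_gr: assumes "g \<in> G" shows "arel (gr g)" unfolding arel_def
proof (intro conjI allI impI)
  show "gr g \<subseteq> carrier A \<times> carrier A" unfolding gr_def using lamK[OF assms] cH cK by blast
  show "(\<one>, \<one>) \<in> gr g" unfolding gr_def using one1[OF assms] sub_one[OF sH] by simp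
  show "(x \<otimes> x', y \<otimes> y') \<in> gr g" if "(x, y) \<in> gr g" "(x', y') \<in> gr g" for x y x' y'
    using that lin1[OF assms, of x x' y y'] sub_m[OF sH, of x x'] unfolding gr_def by simp
  show "(inv x, inv y) \<in> gr g" if "(x, y) \<in> gr g" for x y
    using that minv1[OF assms, of x y] sub_inv[OF sH, of x] unfolding gr_def by simp
qed

lemma gr_K: "g \<in> G ==> gr g `` X \<subseteq> K" unfolding gr_def using lamK by blast

lemma gr_dom: "g \<in> G ==> alm H (Domain (gr g))"
proof -
  assume "g \<in> G"
  moreover have "Domain (gr g) = {h \<in> H. lam g h \<noteq> None}" unfolding gr_def by auto
  ultimately show ?thesis using dom1 by simp
qed

lemma sub_gr: "g \<in> G ==> subgroup X A ==> subgroup (gr g `` X) A"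
  by (rule sub_image[OF arel_gr])

lemma gr_inv_image: assumes "g \<in> G" "subgroup X A" shows "gr (inv g) `` X = gr g `` X"
proof -
  have "k \<in> gr g `` X" if g: "g \<in> G" "k \<in> gr (inv g) `` X" for g k
  proof -
    obtain x where x: "x \<in> X" "x \<in> H" "lam (inv g) x = Some k" using g(2) unfolding gr_def by blast
    have ig: "inv g \<in> G" using sub_inv[OF sG g(1)] .
    have "lam (inv (inv g)) x = Some (inv k)" by (rule minv2[OF ig x(2,3)])
    then have "lam g x = Some (inv k)" using g cG by auto
    then have "inv k \<in> gr g `` X" using x unfolding gr_def by blast
    then have "inv (inv k) \<in> gr g `` X" by (rule sub_inv[OF sub_gr[OF g(1) assms(2)]])
    moreover have "k \<in> carrier A" using lamK[OF ig x(2,3)] cK by blast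
    ultimately show ?thesis by simp
  qed
  note key = this
  have ii: "inv (inv g) = g" using assms(1) cG by auto
  show ?thesis
  proof (intro equalityI subsetI)
    show "k \<in> gr g `` X" if "k \<in> gr (inv g) `` X" for k using key[OF assms(1) that] .
    show "k \<in> gr (inv g) `` X" if "k \<in> gr g `` X" for k
      using key[OF sub_inv[OF sG assms(1)], of k] that unfolding ii .
  qed
qed

lemma gr_mult_image:
  assumes "g \<in> G" "g' \<in> G" "subgroup X A" "X \<subseteq> H"
  shows "alm (gr (g \<otimes> g') `` X) (gr g `` X <#> gr g' `` X)"
proof -
  have gg: "g \<otimes> g' \<in> G" using assms sub_m[OF sG] by blast
  define X' where "X' = X \<inter> (Domain (gr g) \<inter> Domain (gr g'))"
  have sD: "subgroup (Domain (gr g) \<inter> Domain (gr g')) A"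
    by (intro sub_int sub_Domain arel_gr assms)
  have sX': "subgroup X' A" unfolding X'_def by (intro sub_int assms sD)
  have XH: "alm X H" by (rule alm_subset[OF assms(4) cH])
  have D: "alm X (Domain (gr g))" if "g \<in> G" for g
    by (rule alm_trans[OF XH gr_dom[OF that] sub_sub[OF sub_Domain[OF arel_gr[OF that]]]])
  have "alm X X'" unfolding X'_def
    by (intro alm_inter alm_refl D assms sD sub_sub sub_Domain arel_gr)
  then have 1: "alm (gr (g \<otimes> g') `` X) (gr (g \<otimes> g') `` X')"
    by (intro alm_image arel_gr gg sX' assms)
  have 2: "gr (g \<otimes> g') `` X' \<subseteq> gr g `` X <#> gr g' `` X"
  proof
    fix k assume "k \<in> gr (g \<otimes> g') `` X'"
    then obtain x where x: "x \<in> X'" "x \<in> H" "lam (g \<otimes> g') x = Some k" unfolding gr_def by blast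
    then obtain a b where ab: "lam g x = Some a" "lam g' x = Some b" unfolding X'_def gr_def by blast
    have "k = a \<otimes> b" using lin2[OF assms(1,2) x(2) ab] x(3) by simp
    moreover have "a \<in> gr g `` X" "b \<in> gr g' `` X" using ab x unfolding X'_def gr_def by blast+
    ultimately show "k \<in> gr g `` X <#> gr g' `` X" by (blast intro: set_multI)
  qed
  show ?thesis by (rule alm_subset_right[OF 1 2]) (intro sub_sub sub_mult sub_gr assms)
qed

lemma res_G: "res Z X \<subseteq> G" unfolding res_def by blast

lemma sub_res:
  assumes "subgroup Z A" "subgroup X A" "X \<subseteq> H"
  shows "subgroup (res Z X) A"
proof (rule subgroupI')
  show "res Z X \<subseteq> carrier A" using res_G cG by blast
  have "gr \<one> `` X \<subseteq> {\<one>}" using one2 assms(3) unfolding gr_def by auto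
  moreover have "{\<one>} \<subseteq> Z" using sub_one[OF assms(1)] by simp
  ultimately have "alm (gr \<one> `` X) Z" by (intro alm_subset sub_sub assms) blast
  then show "\<one> \<in> res Z X" unfolding res_def using sub_one[OF sG] by blast
  fix g assume g: "g \<in> res Z X"
  then have "inv g \<in> G" using sub_inv[OF sG] unfolding res_def by blast
  then show "inv g \<in> res Z X" using g gr_inv_image[OF _ assms(2), of g] unfolding res_def by auto
  fix g' assume g': "g' \<in> res Z X"
  have gg: "g \<in> G" "g' \<in> G" using g g' unfolding res_def by auto
  have "alm (gr g `` X <#> gr g' `` X) Z" using g g' unfolding res_def by (intro alm_mult assms) auto
  with gr_mult_image[OF gg assms(2,3)] have "alm (gr (g \<otimes> g') `` X) Z" by (rule alm_trans[OF _ _ sub_sub[OF assms(1)]])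
  then show "g \<otimes> g' \<in> res Z X" unfolding res_def using sub_m[OF sG gg] by blast
qed

lemma gr_transport:
  assumes "\<sigma> \<in> \<Gamma>" "g \<in> G" "X \<subseteq> H" shows "\<sigma> ` (gr g `` X) = gr (\<sigma> g) `` (\<sigma> ` X)"
proof (intro equalityI subsetI)
  have Hc: "\<sigma> h \<in> H" if "h \<in> H" for h using invH that assms(1) unfolding invs_def stab_def by auto
  fix y assume "y \<in> \<sigma> ` (gr g `` X)"
  then obtain x k where x: "x \<in> X" "x \<in> H" "lam g x = Some k" "y = \<sigma> k" unfolding gr_def by blast
  then have "lam (\<sigma> g) (\<sigma> x) = Some y" using lam_inv[OF assms(1,2) x(2)] by simp
  then show "y \<in> gr (\<sigma> g) `` (\<sigma> ` X)" using x Hc unfolding gr_def by blast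
next
  fix y assume "y \<in> gr (\<sigma> g) `` (\<sigma> ` X)"
  then obtain x where x: "x \<in> X" "lam (\<sigma> g) (\<sigma> x) = Some y" unfolding gr_def by blast
  have "x \<in> H" using x(1) assms(3) by blast
  then have "map_option \<sigma> (lam g x) = Some y" using lam_inv[OF assms(1,2), of x] x(2) by simp
  then obtain k where "lam g x = Some k" "y = \<sigma> k" by (cases "lam g x") auto
  then show "y \<in> \<sigma> ` (gr g `` X)" using x assms(3) unfolding gr_def by blast
qed

lemma G_closed: "\<sigma> \<in> \<Gamma> ==> g \<in> G ==> \<sigma> g \<in> G"
  using invG unfolding invs_def stab_def by auto

lemma H_closed: "\<sigma> \<in> \<Gamma> ==> g \<in> H ==> \<sigma> g \<in> H"
  using invH unfolding invs_def stab_def by auto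

lemma invr_gr:
  assumes "g \<in> G" "g \<in> set c" shows "invr c (gr g)" unfolding invr_def
proof (intro conjI ballI allI impI)
  show "gr g \<subseteq> carrier A \<times> carrier A" using arel_gr[OF assms(1)] unfolding arel_def by blast
  fix \<sigma> x y assume s: "\<sigma> \<in> stab c" and xy: "(x, y) \<in> gr g"
  have "\<sigma> g = g" using s assms(2) unfolding stab_def by blast
  then show "(\<sigma> x, \<sigma> y) \<in> gr g" using xy lam_inv[OF stab_sub[OF s] assms(1), of x] H_closed[OF stab_sub[OF s]] unfolding gr_def by auto
qed

lemma invs_res:
  assumes "set c \<subseteq> carrier A" "invs c Z" "invs c X" "X \<subseteq> H"
  shows "invs c (res Z X)" unfolding invs_def
proof (intro conjI ballI)
  show "res Z X \<subseteq> carrier A" using res_G cG by blast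
  fix \<sigma> g assume s: "\<sigma> \<in> stab c" and g: "g \<in> res Z X"
  have gG: "g \<in> G" "alm (gr g `` X) Z" using g unfolding res_def by auto
  have "alm (\<sigma> ` (gr g `` X)) (\<sigma> ` Z)"
    using alm_transport[OF stab_sub[OF s] gG(2)] assms(2) unfolding invs_def by blast
  then have "alm (gr (\<sigma> g) `` X) Z"
    using gr_transport[OF stab_sub[OF s] gG(1) assms(4)] invs_image[OF assms(2) s assms(1)] invs_image[OF assms(3) s assms(1)] by simp
  then show "\<sigma> g \<in> res Z X" unfolding res_def using G_closed[OF stab_sub[OF s] gG(1)] by blast
qed

lemma dfn_res: assumes "dfn Z" "dfn X" "X \<subseteq> H" shows "dfn (res Z X)"
proof -
  obtain c where "set c \<subseteq> carrier A" "invs c Z" "invs c X" using dfn_pair[OF assms(1,2)] by metis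
  then show ?thesis unfolding dfn_def using invs_res[OF _ _ _ assms(3)] sub_res assms dfn_sub by metis
qed

lemma res_mono_X:
  assumes "alm X' X" "subgroup X A" "subgroup X' A" "subgroup Z A"
  shows "res Z X \<subseteq> res Z X'"
  unfolding res_def using alm_trans[OF alm_image[OF arel_gr assms(1-3)]] sub_sub[OF assms(4)] by blast

lemma res_mono_Z:
  assumes "alm Z Z'" "subgroup Z' A"
  shows "res Z X \<subseteq> res Z' X"
  unfolding res_def using alm_trans[OF _ assms(1)] sub_sub[OF assms(2)] by blast

lemma res_Int:
  assumes "subgroup Z A" "subgroup Z' A" "subgroup X A" shows "res Z X \<inter> res Z' X \<subseteq> res (Z \<inter> Z') X"
  unfolding res_def using alm_inter[OF _ _ assms(1,2) sub_sub[OF sub_gr[OF _ assms(3)]]] by blast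

text \<open>Almost every element of \<open>Y\<close> maps \<open>X\<close> almost into \<open>Z\<close>. By \<open>pr_flip_iff\<close> the relation is symmetric in
\<open>X\<close> and \<open>Y\<close>, which makes \<open>res\<close> and \<open>resl\<close> a Galois connection up to commensurability.\<close>

definition pr :: "'a set => 'a set => 'a set => bool" where
  "pr Y X Z \<longleftrightarrow> alm Y (res Z X)"

text \<open>If \<open>X\<close> were not almost contained in the residual of \<open>Y\<close>, there would be many elements of \<open>X\<close> that
are pairwise different modulo it. For each two of them, the set of \<open>g \<in> Y\<close> at which they take the same
value modulo \<open>Z\<close> is negligible, so some \<open>g\<close> separates all of them. For this \<open>g\<close> the image of \<open>X\<close> meets
more cosets of \<open>Z\<close> than the uniform bound on finite indices allows.\<close>

lemma pr_flip:
  assumes d: "dfn Y" "dfn X" "dfn Z" and sub: "Y \<subseteq> G" "X \<subseteq> H" and p: "pr Y X Z"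
  shows "alm X (resl Z Y)"
proof (rule ccontr)
  assume na: "\<not> alm X (resl Z Y)"
  interpret sw: qform A \<Gamma> H G K "\<lambda>h g. lam g h" by (rule qform_swap)
  note s = d[THEN dfn_sub]
  obtain c1 where c1: "set c1 \<subseteq> carrier A" "invs c1 X" "invs c1 Z" using dfn_pair[OF d(2,3)] by metis
  from index_bound[of "length c1 + 1"] obtain N where N: "\<And>c X Y F. set c \<subseteq> carrier A ==> length c \<le> length c1 + 1 ==> invs c X ==> invs c Y ==>
     subgroup X A ==> subgroup Y A ==> alm X Y ==> F \<subseteq> X ==> finite F ==> sep F Y ==> card F \<le> N" by blast
  have sr: "subgroup (resl Z Y) A" using sw.sub_res[OF s(3,1) sub(1)] by (simp add: sw)
  obtain F where F: "finite F" "F \<subseteq> X" "sep F (resl Z Y)" "card F = N + 1"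
    using not_alm_sep[OF na sr sub_sub[OF s(2)]] by metis
  define Y' where "Y' = Y \<inter> res Z X"
  have sY': "subgroup Y' A" unfolding Y'_def by (intro sub_int s sub_res sub)
  have YY': "alm Y Y'" unfolding Y'_def using p unfolding pr_def by (intro alm_inter alm_refl s sub_res sub sub_sub)
  define W where "W = Y' \<inter> (\<Inter>x\<in>F. Domain (gl x))"
  have FH: "F \<subseteq> H" using F sub by blast
  have agl: "arel (gl x)" if "x \<in> H" for x using sw.arel_gr[OF that] by (simp add: sw)
  have sW: "subgroup W A" unfolding W_def using FH by (intro sub_Int_INT sY' sub_Domain agl) auto
  have dom: "alm Y (Domain (gl x))" if "x \<in> H" for x
  proof -
    have "alm G (Domain (gl x))" using sw.gr_dom[OF that] by (simp add: sw)
    then show ?thesis using alm_subset_left sub(1) by blast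
  qed
  have "alm Y (Y' \<inter> (\<Inter>x\<in>E. Domain (gl x)))" if "E \<subseteq> F" for E
    using finite_subset[OF that F(1)] that
  proof (induction E rule: finite_induct)
    case empty then show ?case using YY' by simp
  next
    case (insert x E)
    then have xH: "x \<in> H" using FH by blast
    have "subgroup (Y' \<inter> (\<Inter>x\<in>E. Domain (gl x))) A" using insert FH by (intro sub_Int_INT sY' sub_Domain agl) auto
    moreover have "alm Y (Y' \<inter> (\<Inter>x\<in>E. Domain (gl x)))" using insert by blast
    ultimately have "alm Y (Domain (gl x) \<inter> (Y' \<inter> (\<Inter>x\<in>E. Domain (gl x))))"
      using alm_inter[OF dom[OF xH] _ sub_Domain[OF agl[OF xH]] _ sub_sub[OF s(1)]] by blast
    then show ?case by (simp add: Int_left_commute)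
  qed
  then have YW: "alm Y W" unfolding W_def by blast
  define B where "B x y = (gl (x \<otimes> inv y))\<inverse> `` Z" for x y
  have xyH: "x \<otimes> inv y \<in> H" if "x \<in> F" "y \<in> F" for x y using that FH sub_div[OF sH] by blast
  have nB: "\<not> alm W (B x y)" and sB: "subgroup (B x y) A" if h: "x \<in> F" "y \<in> F" "x \<noteq> y" for x y
  proof -
    note xy = xyH[OF h(1,2)]
    show sB: "subgroup (B x y) A" unfolding B_def by (intro sub_image arel_converse agl xy s)
    show "\<not> alm W (B x y)"
    proof
      assume "alm W (B x y)"
      then have "alm Y (B x y)" using alm_trans[OF YW _ sub_sub[OF sB]] by blast
      then have "alm (gl (x \<otimes> inv y) `` Y) (gl (x \<otimes> inv y) `` B x y)" by (intro alm_image agl xy sB s)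
      moreover have "gl (x \<otimes> inv y) `` B x y \<subseteq> Z" unfolding B_def gl_def by auto
      ultimately have "alm (gl (x \<otimes> inv y) `` Y) Z" using alm_subset_right sub_sub[OF s(3)] by blast
      then have "x \<otimes> inv y \<in> resl Z Y" unfolding resl_def using xy by blast
      then show False using F(3) h unfolding sep_def by blast
    qed
  qed
  have "small W (\<Union>p\<in>{p\<in>F\<times>F. fst p \<noteq> snd p}. B (fst p) (snd p))"
    using F(1) by (intro small_UN small_subgroup nB sB) auto
  then have "\<not> W \<subseteq> (\<Union>p\<in>{p\<in>F\<times>F. fst p \<noteq> snd p}. B (fst p) (snd p))"
    using not_small[OF sW] small_subset by blast
  then obtain g where g0: "g \<in> W" "g \<notin> (\<Union>p\<in>{p\<in>F\<times>F. fst p \<noteq> snd p}. B (fst p) (snd p))" by blast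
  then have g: "g \<in> W" "\<And>x y. x \<in> F ==> y \<in> F ==> x \<noteq> y ==> g \<notin> B x y" by auto
  have gG: "g \<in> G" "alm (gr g `` X) Z" using g(1) unfolding W_def Y'_def res_def by auto
  have "\<forall>x\<in>F. \<exists>k. lam g x = Some k" using g(1) unfolding W_def gl_def by auto
  from bchoice[OF this] obtain v where v: "\<And>x. x \<in> F ==> lam g x = Some (v x)" by blast
  have vd: "v x \<otimes> inv (v y) \<notin> Z" if h: "x \<in> F" "y \<in> F" "x \<noteq> y" for x y
  proof
    assume z: "v x \<otimes> inv (v y) \<in> Z"
    have xy: "x \<in> H" "y \<in> H" "inv y \<in> H" using h FH sub_inv[OF sH] by auto
    have "lam g (x \<otimes> inv y) = Some (v x \<otimes> inv (v y))"
      by (rule lin1[OF gG(1) xy(1,3) v[OF h(1)] minv1[OF gG(1) xy(2) v[OF h(2)]]])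
    then have "g \<in> B x y" unfolding B_def gl_def using z gG by blast
    then show False using g(2)[OF h] by blast
  qed
  have vK: "v x \<in> carrier A" if "x \<in> F" for x using lamK[OF gG(1) _ v[OF that]] that FH cK by blast
  have inj: "inj_on v F"
  proof (rule inj_onI, rule ccontr)
    fix x y assume h: "x \<in> F" "y \<in> F" "v x = v y" "x \<noteq> y"
    then have "v x \<otimes> inv (v y) = \<one>" using vK by simp
    then show False using vd[OF h(1,2,4)] sub_one[OF s(3)] by simp
  qed
  have sp: "sep (v ` F) Z" unfolding sep_def using vd by blast
  have vi: "v ` F \<subseteq> gr g `` X" using v F(2) FH unfolding gr_def by blast
  have gc: "set (g # c1) \<subseteq> carrier A" using c1 gG cG by auto
  have "invs (g # c1) (gr g `` X)" by (intro invs_rel_image invr_gr gG invs_mono[OF c1(2)]) auto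
  moreover have "invs (g # c1) Z" by (rule invs_mono[OF c1(3)]) auto
  ultimately have "card (v ` F) \<le> N"
    by (intro N[OF gc, of "gr g `` X" Z]) (use sub_gr[OF gG(1) s(2)] s gG vi F sp in auto)
  then show False using F(4) card_image[OF inj] by simp
qed

lemma pr_flip_iff:
  assumes d: "dfn Y" "dfn X" "dfn Z" and sub: "Y \<subseteq> G" "X \<subseteq> H"
  shows "alm X (resl Z Y) \<longleftrightarrow> pr Y X Z"
proof
  interpret sw: qform A \<Gamma> H G K "\<lambda>h g. lam g h" by (rule qform_swap)
  assume "alm X (resl Z Y)"
  then have "sw.pr X Y Z" unfolding sw.pr_def by (simp add: sw)
  from sw.pr_flip[OF d(2,1,3) sub(2,1) this] show "pr Y X Z" unfolding pr_def by (simp add: sw)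
qed (rule pr_flip[OF assms])

end

section \<open>Minimal configurations\<close>

context qform
begin

lemma pr_mono_Z:
  assumes "pr Y X Z" "alm Z Z'" "subgroup Z' A" "subgroup X A" "X \<subseteq> H" shows "pr Y X Z'"
  using assms alm_subset_right[OF assms(1)[unfolded pr_def] res_mono_Z[OF assms(2,3)] sub_sub[OF sub_res[OF assms(3-5)]]]
  unfolding pr_def by blast

lemma pr_mono_X:
  assumes "pr Y X Z" "alm X' X" "subgroup X A" "subgroup X' A" "subgroup Z A" "X' \<subseteq> H" shows "pr Y X' Z"
  using alm_subset_right[OF assms(1)[unfolded pr_def] res_mono_X[OF assms(2-5)] sub_sub[OF sub_res[OF assms(5,4,6)]]]
  unfolding pr_def .

definition conf :: "'a set => 'a set => 'a set => 'a set => bool" where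
  "conf Y X Z1 Z0 \<longleftrightarrow> dfn Y \<and> dfn X \<and> dfn Z1 \<and> dfn Z0 \<and> Y \<subseteq> G \<and> X \<subseteq> H \<and> Z1 \<subseteq> K \<and> pr Y X Z1 \<and> \<not> pr Y X Z0"

text \<open>The quantity to be minimised; the first two summands are the widths of \<open>Y\<close> and \<open>X\<close> over the parts on
which the form already goes into \<open>Z0\<close>.\<close>

definition mu :: "'a set => 'a set => 'a set => 'a set => nat" where
  "mu Y X Z1 Z0 = wd Y (Y \<inter> res Z0 X) + wd X (X \<inter> resl Z0 Y) + wd Z1 Z0"

lemma dfn_resl: "dfn Z ==> dfn Y ==> Y \<subseteq> G ==> dfn (resl Z Y)"
  using qform.dfn_res[OF qform_swap] by (simp add: sw)

lemma sub_resl: "subgroup Z A ==> subgroup Y A ==> Y \<subseteq> G ==> subgroup (resl Z Y) A"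
  using qform.sub_res[OF qform_swap] by (simp add: sw)

lemma resl_mono_Y: "alm Y' Y ==> subgroup Y A ==> subgroup Y' A ==> subgroup Z A ==> resl Z Y \<subseteq> resl Z Y'"
  using qform.res_mono_X[OF qform_swap] by (simp add: sw)

lemma resl_H: "resl Z X \<subseteq> H" unfolding resl_def by blast

lemma resl_Int: "subgroup Z A ==> subgroup Z' A ==> subgroup X A ==> resl Z X \<inter> resl Z' X \<subseteq> resl (Z \<inter> Z') X"
  using qform.res_Int[OF qform_swap] by (simp add: sw)

lemma sw_conf: "qform.conf A \<Gamma> H G K (\<lambda>h g. lam g h) X Y Z1 Z0 \<longleftrightarrow> conf Y X Z1 Z0"
proof -
  have "qform.pr A H G (\<lambda>h g. lam g h) X Y Z \<longleftrightarrow> pr Y X Z" if "dfn Y" "dfn X" "Y \<subseteq> G" "X \<subseteq> H" "dfn Z" for Z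
    using pr_flip_iff[OF that(1,2,5,3,4)] by (simp add: qform.pr_def[OF qform_swap] sw)
  then show ?thesis unfolding conf_def qform.conf_def[OF qform_swap] by blast
qed

lemma sw_mu: "qform.mu A \<Gamma> H G (\<lambda>h g. lam g h) X Y Z1 Z0 = mu Y X Z1 Z0"
  unfolding mu_def qform.mu_def[OF qform_swap] by (simp add: sw)

lemma mu_mono:
  assumes d: "dfn Y" "dfn X" "dfn Z1" "dfn Z0" "dfn Y'" "dfn X'" "dfn Z1'" "dfn Z0'"
    and sub: "Y \<subseteq> G" "X \<subseteq> H" "Z1 \<subseteq> K" "Y' \<subseteq> G" "X' \<subseteq> H" "Z1' \<subseteq> K"
    and a: "alm Y' Y" "alm (Y' \<inter> (Y \<inter> res Z0 X)) (res Z0' X')"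
       "alm X' X" "alm (X' \<inter> (X \<inter> resl Z0 Y)) (resl Z0' Y')" "alm Z1' Z1" "alm (Z1' \<inter> Z0) Z0'"
  shows "mu Y' X' Z1' Z0' \<le> mu Y X Z1 Z0" unfolding mu_def
proof (intro add_mono)
  note s = d[THEN dfn_sub]
  have 1: "alm (Y' \<inter> (Y \<inter> res Z0 X)) (Y' \<inter> res Z0' X')"
    by (intro alm_inter a alm_subset sub_sub sub_int sub_res s sub) blast
  show "wd Y' (Y' \<inter> res Z0' X') \<le> wd Y (Y \<inter> res Z0 X)"
    by (rule wd_mono[OF d(1,5) dfn_Int[OF d(1) dfn_res] dfn_Int[OF d(5) dfn_res] bddG bddG a(1) 1])
       (use d sub in auto)
  have 2: "alm (X' \<inter> (X \<inter> resl Z0 Y)) (X' \<inter> resl Z0' Y')"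
    by (intro alm_inter a alm_subset sub_sub sub_int sub_resl s sub) blast
  show "wd X' (X' \<inter> resl Z0' Y') \<le> wd X (X \<inter> resl Z0 Y)"
    by (rule wd_mono[OF d(2,6) dfn_Int[OF d(2) dfn_resl] dfn_Int[OF d(6) dfn_resl] bddH bddH a(3) 2])
       (use d sub in auto)
  show "wd Z1' Z0' \<le> wd Z1 Z0"
    by (rule wd_mono[OF d(3,7,4,8) bddK bddK a(5,6)]) (use sub in auto)
qed

end

text \<open>A configuration of least measure, shrunk by finite index so that the almost inclusions hold for
every element: \<open>G1\<close> maps \<open>H1\<close> into \<open>K1\<close>, and the annihilator of \<open>G1\<close> in \<open>H1\<close> into \<open>K0\<close>.\<close>

locale qmin = qform A \<Gamma> G H K lam for A (structure) and \<Gamma> G H K lam +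
  fixes G1 H1 K1 K0
  assumes cf: "conf G1 H1 K1 K0"
    and mn: "conf Y X Z1 Z0 ==> mu G1 H1 K1 K0 \<le> mu Y X Z1 Z0"
    and K01: "K0 \<subseteq> K1"
    and GK1: "G1 \<subseteq> res K1 H1" and HK1: "H1 \<subseteq> resl K1 G1"
    and GK0: "G1 \<subseteq> res K0 (H1 \<inter> resl K0 G1)" and HK0: "H1 \<subseteq> resl K0 (G1 \<inter> res K0 H1)"
begin

lemma qmin_swap: "qmin A \<Gamma> H G K (\<lambda>h g. lam g h) H1 G1 K1 K0"
proof -
  interpret sw: qform A \<Gamma> H G K "\<lambda>h g. lam g h" by (rule qform_swap)
  show ?thesis
    by unfold_locales (use cf mn K01 GK1 HK1 GK0 HK0 in \<open>simp_all add: sw_conf sw_mu sw\<close>)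
qed

definition OG where "OG = G1 \<inter> res K0 H1"
definition OH where "OH = H1 \<inter> resl K0 G1"

lemma sw_OG: "qmin.OG A H G (\<lambda>h g. lam g h) H1 G1 K0 = OH"
  by (simp add: qmin.OG_def[OF qmin_swap] OH_def sw)

lemma d1: "dfn G1" "dfn H1" "dfn K1" "dfn K0" "G1 \<subseteq> G" "H1 \<subseteq> H" "K1 \<subseteq> K" "pr G1 H1 K1" "\<not> pr G1 H1 K0"
  using cf unfolding conf_def by auto

lemmas s1 = d1(1-4)[THEN dfn_sub]

lemma dOG: "dfn OG" and dOH: "dfn OH"
  unfolding OG_def OH_def by (auto intro!: dfn_Int dfn_res dfn_resl d1)

lemma OH_sub: "OH \<subseteq> H1" unfolding OH_def by auto

lemma wd_le_G:
  assumes "dfn Y" "dfn X" "dfn Z" "Y \<subseteq> G1" "X \<subseteq> H1" "alm K0 Z"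
  shows "wd Y (Y \<inter> res Z X) \<le> wd G1 (G1 \<inter> res K0 H1)"
proof -
  have "res K0 H1 \<subseteq> res K0 X" by (intro res_mono_X alm_subset assms dfn_sub d1 dfn_car)
  also have "\<dots> \<subseteq> res Z X" by (intro res_mono_Z assms dfn_sub)
  finally have "Y \<inter> (G1 \<inter> res K0 H1) \<subseteq> Y \<inter> res Z X" by blast
  then have 1: "alm (Y \<inter> (G1 \<inter> res K0 H1)) (Y \<inter> res Z X)"
    by (rule alm_subset) (use assms(1) dfn_car in auto)
  have YX: "Y \<subseteq> G" "X \<subseteq> H" using assms d1 by auto
  show ?thesis
    by (rule wd_mono[OF d1(1) assms(1) dfn_Int[OF d1(1) dfn_res[OF d1(4,2,6)]] dfn_Int[OF assms(1) dfn_res[OF assms(3,2) YX(2)]]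
        bddG[OF d1(5)] bddG[OF YX(1)] alm_subset[OF assms(4) dfn_car[OF d1(1)]] 1])
qed

lemma wd_le_H:
  assumes "dfn Y" "dfn X" "dfn Z" "Y \<subseteq> G1" "X \<subseteq> H1" "alm K0 Z"
  shows "wd X (X \<inter> resl Z Y) \<le> wd H1 (H1 \<inter> resl K0 G1)"
  using qmin.wd_le_G[OF qmin_swap assms(2,1,3,5,4,6)] by (simp add: sw)

lemma wd_le_K:
  assumes "dfn Z" "alm K0 Z" shows "wd K1 Z \<le> wd K1 K0"
  by (intro wd_mono d1 assms bddK alm_refl s1 alm_subset_left[OF assms(2)]) auto

lemma prK1: assumes "dfn Y" "dfn X" "Y \<subseteq> G1" "X \<subseteq> H1" shows "pr Y X K1"
proof -
  have "Y \<subseteq> res K1 X"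
    using assms(3) GK1 res_mono_X[OF alm_subset[OF assms(4) dfn_car[OF d1(2)]] s1(2) dfn_sub[OF assms(2)] s1(3)] by blast
  moreover have "X \<subseteq> H" using assms d1 by blast
  ultimately show ?thesis unfolding pr_def using assms d1 by (intro alm_subset dfn_car dfn_res) auto
qed

text \<open>If \<open>T\<close> were not almost contained in \<open>S\<close>, then by \<open>wd_super\<close> the group \<open>S\<close> would have smaller width over
\<open>S \<inter> T\<close>, hence over its residual part, than \<open>H1\<close> has over \<open>OH\<close>, and \<open>(Y, S, K1, Z)\<close> would be a
configuration of smaller measure.\<close>

lemma P1:
  assumes d: "dfn S" "dfn T" "dfn Y" "dfn Z" and sub: "S \<subseteq> H1" "T \<subseteq> H1" "Y \<subseteq> G1"
    and Z: "alm K0 Z" and np: "\<not> pr Y S Z" and a: "alm (S \<inter> T) (resl Z Y)" "alm OH (S \<inter> T)"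
  shows "alm T S"
proof (rule ccontr)
  assume na: "\<not> alm T S"
  note s = d[THEN dfn_sub]
  have HH: "S \<subseteq> H" "Y \<subseteq> G" using sub d1 by auto
  have STH: "S <#> T \<subseteq> H1" using sub mult_idem[OF s1(2)] mono_set_mult by metis
  have "conf Y S K1 Z" unfolding conf_def using d d1 HH np prK1[OF d(3,1) sub(3,1)] by blast
  from mn[OF this] have "wd H1 (H1 \<inter> resl K0 G1) \<le> wd S (S \<inter> resl Z Y)"
    using wd_le_G[OF d(3,1,4) sub(3,1) Z] wd_le_K[OF d(4) Z] unfolding mu_def by linarith
  also have "\<dots> \<le> wd S (S \<inter> T)"
  proof (intro wd_mono d bddH HH alm_refl s dfn_Int dfn_resl)
    show "alm (S \<inter> (S \<inter> T)) (S \<inter> resl Z Y)"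
      by (intro alm_inter alm_subset_left[OF a(1)] alm_subset sub_sub sub_int sub_resl s HH) auto
  qed
  also have "\<dots> < wd (S <#> T) (S \<inter> T)"
    using wd_super[OF d(1,2) _ _ na] bddH HH STH d1 by fastforce
  also have "\<dots> \<le> wd H1 (H1 \<inter> resl K0 G1)"
  proof (intro wd_mono d d1 bddH dfn_Int dfn_resl dfn_mult)
    show "S <#> T \<subseteq> H" using STH d1 by blast
    show "alm (S <#> T) H1" by (intro alm_subset STH dfn_car d1)
    show "alm ((S <#> T) \<inter> (H1 \<inter> resl K0 G1)) (S \<inter> T)" by (rule alm_subset_left[OF a(2)]) (auto simp: OH_def)
  qed
  finally show False by simp
qed

text \<open>Primeness. If both \<open>Z\<close> and \<open>Z'\<close> failed, then \<open>(Y, X, Z <#> Z', Z)\<close> would be a configuration. By the second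
isomorphism inequality its third width is at most that of \<open>Z'\<close> over \<open>Z \<inter> Z'\<close>, which is less than the
width of \<open>K1\<close> over \<open>K0\<close>.\<close>

lemma P2:
  assumes d: "dfn Y" "dfn X" "dfn Z" "dfn Z'" and sub: "Y \<subseteq> G1" "X \<subseteq> H1" "Z \<subseteq> K" "Z' \<subseteq> K"
    and a: "alm K0 Z" "alm K0 Z'" "alm (Z <#> Z') K1" and p: "pr Y X (Z <#> Z')"
  shows "pr Y X Z \<or> pr Y X Z'"
proof (rule ccontr)
  assume "\<not> ?thesis"
  then have np: "\<not> pr Y X Z" "\<not> pr Y X Z'" by auto
  note s = d[THEN dfn_sub]
  have HH: "X \<subseteq> H" "Y \<subseteq> G" using sub d1 by auto
  have ZZK: "Z <#> Z' \<subseteq> K" using sub mult_idem[OF sK] mono_set_mult by metis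
  have na: "\<not> alm Z Z'"
  proof
    assume "alm Z Z'"
    then have "alm (Z <#> Z') Z'" by (intro alm_mult alm_refl s)
    from pr_mono_Z[OF p this s(4,2) HH(1)] np show False by blast
  qed
  have cm: "Z' <#> Z = Z <#> Z'" by (intro mult_comm_sets sub_sub s)
  have "conf Y X (Z <#> Z') Z" unfolding conf_def using d HH ZZK dfn_mult p np by blast
  from mn[OF this] have "wd K1 K0 \<le> wd (Z <#> Z') Z"
    using wd_le_G[OF d(1-3) sub(1,2) a(1)] wd_le_H[OF d(1-3) sub(1,2) a(1)] unfolding mu_def by linarith
  also have "\<dots> \<le> wd Z' (Z' \<inter> Z)"
    using wd_second_iso[OF d(3,4) bddK[OF ZZK] bddK[OF sub(4)]] by (simp add: Int_commute)
  also have "\<dots> < wd (Z' <#> Z) (Z' \<inter> Z)"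
    using wd_super[OF d(4,3) bddK[OF sub(4)] bddK na] ZZK cm by simp
  also have "\<dots> \<le> wd K1 K0" unfolding cm
  proof (intro wd_mono d d1 bddK dfn_Int dfn_mult ZZK a)
    show "alm ((Z <#> Z') \<inter> K0) (Z' \<inter> Z)" by (rule alm_subset_left[OF alm_inter[OF a(2,1) s(4,3) sub_sub[OF s1(4)]]]) blast
  qed
  finally show False by simp
qed

text \<open>Two targets between \<open>K0\<close> and \<open>K1\<close> that are told apart by \<open>(Y', X')\<close> cannot be told apart the other way
round: otherwise \<open>(Y, X, Z1, Z2)\<close> would be a configuration of smaller measure.\<close>

lemma pr_trans_K:
  assumes d: "dfn Y" "dfn X" "dfn Y'" "dfn X'" "dfn Z1" "dfn Z2"
    and sub: "Y \<subseteq> G1" "X \<subseteq> H1" "Y' \<subseteq> G1" "X' \<subseteq> H1" "Z1 \<subseteq> K" "Z2 \<subseteq> K"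
    and a: "alm K0 Z1" "alm K0 Z2" "alm Z1 K1" "alm Z2 K1"
    and p: "pr Y X Z1" "\<not> pr Y' X' Z1" "pr Y' X' Z2"
  shows "pr Y X Z2"
proof (rule ccontr)
  assume np: "\<not> pr Y X Z2"
  note s = d[THEN dfn_sub]
  have HH: "X \<subseteq> H" "Y \<subseteq> G" "X' \<subseteq> H" using sub d1 by auto
  have ZZK: "Z1 <#> Z2 \<subseteq> K" using sub mult_idem[OF sK] mono_set_mult by metis
  have na: "\<not> alm Z2 Z1" using pr_mono_Z[OF p(3) _ s(5,4) HH(3)] p(2) by blast
  have "conf Y X Z1 Z2" unfolding conf_def using d HH sub p np by blast
  from mn[OF this] have "wd K1 K0 \<le> wd Z1 Z2"
    using wd_le_G[OF d(1,2,6) sub(1,2) a(2)] wd_le_H[OF d(1,2,6) sub(1,2) a(2)] unfolding mu_def by linarith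
  also have "\<dots> \<le> wd Z1 (Z1 \<inter> Z2)"
    by (intro wd_mono d bddK sub alm_refl s dfn_Int alm_subset dfn_car) auto
  also have "\<dots> < wd (Z1 <#> Z2) (Z1 \<inter> Z2)"
    using wd_super[OF d(5,6) bddK[OF sub(5)] bddK na] ZZK by simp
  also have "\<dots> \<le> wd K1 K0"
  proof (intro wd_mono d d1 bddK dfn_Int dfn_mult ZZK alm_mult a s s1)
    show "alm ((Z1 <#> Z2) \<inter> K0) (Z1 \<inter> Z2)" by (rule alm_subset_left[OF alm_inter[OF a(1,2) s(5,6) sub_sub[OF s1(4)]]]) blast
  qed
  finally show False by simp
qed

end

context qform
begin

text \<open>Take a configuration of least measure, replace \<open>Ka\<close> by its intersection with \<open>K1\<close>, and pass to the
subgroups of finite index on which the almost inclusions become inclusions. By \<open>mu_mono\<close> none of this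
increases the measure.\<close>

lemma qmin_exists:
  assumes np: "\<not> pr G H {\<one>}"
  shows "\<exists>G1 H1 K1 K0. qmin A \<Gamma> G H K lam G1 H1 K1 K0"
proof -
  define P where "P q \<longleftrightarrow> (case q of (Y, X, Z1, Z0) => conf Y X Z1 Z0)" for q
  define m where "m q = (case q of (Y, X, Z1, Z0) => mu Y X Z1 Z0)" for q
  have GK: "G \<subseteq> res K H" unfolding res_def using alm_subset[OF gr_K cK] by auto
  then have "pr G H K" unfolding pr_def by (intro alm_subset dfn_car dfn_res dK dH) auto
  then have "P (G, H, K, {\<one>})" unfolding P_def conf_def using dG dH dK dfn_one np by simp
  from arg_min_nat_lemma[of P, OF this, of m] have
    ex1: "P (arg_min m P)" and ex2: "\<And>q. P q ==> m (arg_min m P) \<le> m q" by fast+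
  obtain Ga Ha K1 Ka where q: "arg_min m P = (Ga, Ha, K1, Ka)" by (cases "arg_min m P") auto
  have ca: "conf Ga Ha K1 Ka" using ex1 unfolding q P_def by simp
  have ma: "mu Ga Ha K1 Ka \<le> mu Y X Z1 Z0" if "conf Y X Z1 Z0" for Y X Z1 Z0
    using ex2[of "(Y, X, Z1, Z0)"] that unfolding q P_def m_def by simp
  have da: "dfn Ga" "dfn Ha" "dfn K1" "dfn Ka" "Ga \<subseteq> G" "Ha \<subseteq> H" "K1 \<subseteq> K" "pr Ga Ha K1" "\<not> pr Ga Ha Ka"
    using ca unfolding conf_def by auto
  note sa = da(1-4)[THEN dfn_sub]
  define K0 where "K0 = Ka \<inter> K1"
  have d0: "dfn K0" unfolding K0_def by (intro dfn_Int da)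
  note s0 = dfn_sub[OF d0]
  define Ga0 Ha0 where "Ga0 = Ga \<inter> res K0 Ha" and "Ha0 = Ha \<inter> resl K0 Ga"
  have dO: "dfn Ga0" "dfn Ha0" unfolding Ga0_def Ha0_def by (auto intro!: dfn_Int dfn_res dfn_resl da d0)
  have OG: "Ga0 \<subseteq> G" "Ha0 \<subseteq> H" unfolding Ga0_def Ha0_def using da by auto
  define G1 where "G1 = Ga \<inter> (res K1 Ha \<inter> res K0 Ha0)"
  define H1 where "H1 = Ha \<inter> (resl K1 Ga \<inter> resl K0 Ga0)"
  have dGH: "dfn G1" "dfn H1" unfolding G1_def H1_def by (auto intro!: dfn_Int dfn_res dfn_resl da d0 dO OG)
  note sGH = dGH[THEN dfn_sub]
  have sub: "G1 \<subseteq> G" "H1 \<subseteq> H" "G1 \<subseteq> Ga" "H1 \<subseteq> Ha" unfolding G1_def H1_def using da by auto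
  have aG: "alm Ga G1" unfolding G1_def
  proof (intro alm_inter alm_refl sa sub_int sub_res s0 dfn_sub[OF dO(2)] da OG sub_sub)
    show "alm Ga (res K1 Ha)" using da unfolding pr_def by blast
    have "alm Ha0 (resl K0 Ga)" unfolding Ha0_def
      by (intro alm_subset sub_sub sub_resl s0 sa da) blast
    then show "alm Ga (res K0 Ha0)" using pr_flip_iff[OF da(1) dO(2) d0 da(5) OG(2)] unfolding pr_def by blast
  qed
  have aH: "alm Ha H1" unfolding H1_def
  proof (intro alm_inter alm_refl sa sub_int sub_resl s0 dfn_sub[OF dO(1)] da OG sub_sub)
    show "alm Ha (resl K1 Ga)" using pr_flip_iff[OF da(1-3,5,6)] da(8) by blast
    have "pr Ga0 Ha K0" unfolding Ga0_def pr_def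
      by (intro alm_subset sub_sub sub_res s0 sa da) blast
    then show "alm Ha (resl K0 Ga0)" using pr_flip_iff[OF dO(1) da(2) d0 OG(1) da(6)] by blast
  qed
  have aG': "alm G1 Ga" and aH': "alm H1 Ha" using alm_subset[OF sub(3) dfn_car[OF da(1)]] alm_subset[OF sub(4) dfn_car[OF da(2)]] by auto
  have eqs: "res Z Ha = res Z H1" "resl Z Ga = resl Z G1" if "subgroup Z A" for Z
    using res_mono_X[OF aH sGH(2) sa(2) that] res_mono_X[OF aH' sa(2) sGH(2) that]
      resl_mono_Y[OF aG sGH(1) sa(1) that] resl_mono_Y[OF aG' sa(1) sGH(1) that] by auto
  have p1: "pr G1 H1 K1" using alm_trans[OF aG' da(8)[unfolded pr_def eqs(1)[OF sa(3)]] sub_sub[OF sub_res[OF sa(3) sGH(2) sub(2)]]] unfolding pr_def .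
  have p0: "\<not> pr G1 H1 K0"
  proof
    assume "pr G1 H1 K0"
    then have "alm G1 (res K0 Ha)" unfolding pr_def eqs(1)[OF s0] .
    from alm_trans[OF aG this sub_sub[OF sub_res[OF s0 sa(2) da(6)]]] have "pr Ga Ha K0" unfolding pr_def .
    then have "pr Ga Ha Ka" by (rule pr_mono_Z[OF _ alm_subset sa(4,2) da(6)]) (auto simp: K0_def sub_car[OF sa(4)])
    then show False using da by blast
  qed
  have cf: "conf G1 H1 K1 K0" unfolding conf_def using dGH da d0 sub p1 p0 by blast
  have "mu G1 H1 K1 K0 \<le> mu Ga Ha K1 Ka"
  proof (intro mu_mono da dGH d0 sub aG' aH' alm_refl sa)
    show "alm (K1 \<inter> Ka) K0" unfolding K0_def by (rule alm_subset) (auto simp: sub_car[OF sa(4)])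
    have "G1 \<inter> (Ga \<inter> res Ka Ha) \<subseteq> res K1 Ha \<inter> res Ka Ha" unfolding G1_def by blast
    also have "\<dots> \<subseteq> res K0 H1" unfolding K0_def
      using res_Int[OF sa(3,4,2)] eqs(1)[OF s0] unfolding K0_def by (simp add: Int_commute)
    finally show "alm (G1 \<inter> (Ga \<inter> res Ka Ha)) (res K0 H1)" by (intro alm_subset sub_sub sub_res s0 sGH sub)
    have "H1 \<inter> (Ha \<inter> resl Ka Ga) \<subseteq> resl K1 Ga \<inter> resl Ka Ga" unfolding H1_def by blast
    also have "\<dots> \<subseteq> resl K0 G1" unfolding K0_def
      using resl_Int[OF sa(3,4,1)] eqs(2)[OF s0] unfolding K0_def by (simp add: Int_commute)
    finally show "alm (H1 \<inter> (Ha \<inter> resl Ka Ga)) (resl K0 G1)" by (intro alm_subset sub_sub sub_resl s0 sGH sub)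
  qed
  then have mn: "mu G1 H1 K1 K0 \<le> mu Y X Z1 Z0" if "conf Y X Z1 Z0" for Y X Z1 Z0
    using ma[OF that] by linarith
  have "qmin A \<Gamma> G H K lam G1 H1 K1 K0"
  proof unfold_locales
    show "conf G1 H1 K1 K0" by (rule cf)
    show "conf Y X Z1 Z0 ==> mu G1 H1 K1 K0 \<le> mu Y X Z1 Z0" for Y X Z1 Z0 by (rule mn)
    show "K0 \<subseteq> K1" unfolding K0_def by blast
    show "G1 \<subseteq> res K1 H1" using eqs(1)[OF sa(3)] unfolding G1_def by blast
    show "H1 \<subseteq> resl K1 G1" using eqs(2)[OF sa(3)] unfolding H1_def by blast
    have "H1 \<inter> resl K0 G1 \<subseteq> Ha0" unfolding Ha0_def using sub(4) eqs(2)[OF s0] by blast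
    then have "res K0 Ha0 \<subseteq> res K0 (H1 \<inter> resl K0 G1)"
      by (intro res_mono_X alm_subset dfn_car dO dfn_sub dfn_Int dfn_resl d0 dGH sub)
    then show "G1 \<subseteq> res K0 (H1 \<inter> resl K0 G1)" unfolding G1_def by blast
    have "G1 \<inter> res K0 H1 \<subseteq> Ga0" unfolding Ga0_def using sub(3) eqs(1)[OF s0] by blast
    then have "resl K0 Ga0 \<subseteq> resl K0 (G1 \<inter> res K0 H1)"
      by (intro resl_mono_Y alm_subset dfn_car dO dfn_sub dfn_Int dfn_res d0 dGH sub)
    then show "H1 \<subseteq> resl K0 (G1 \<inter> res K0 H1)" unfolding H1_def by blast
  qed
  then show ?thesis by blast
qed

end

section \<open>Additive families of endomorphisms\<close>

context comm_group
begin

text \<open>Congruence modulo \<open>M\<close>. Working with elements up to congruence avoids passing to the quotient group,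
whose endomorphisms would be functions on cosets.\<close>

definition cg :: "'a set => 'a => 'a => bool" where
  "cg M x y \<longleftrightarrow> x \<in> carrier G \<and> y \<in> carrier G \<and> x \<otimes> inv y \<in> M"

lemma cg_car: "cg M x y ==> x \<in> carrier G" "cg M x y ==> y \<in> carrier G"
  by (simp_all add: cg_def)

lemma cg_refl: "subgroup M G ==> x \<in> carrier G ==> cg M x x" by (simp add: cg_def sub_one)

lemma cg_sym: assumes "subgroup M G" "cg M x y" shows "cg M y x"
proof -
  have c: "x \<in> carrier G" "y \<in> carrier G" using assms by (auto simp: cg_def)
  have "inv (x \<otimes> inv y) \<in> M" using assms by (auto simp: cg_def intro: sub_inv)
  then show ?thesis using c by (simp add: cg_def inv_mult m_comm)
qed

lemma cg_trans: assumes "subgroup M G" "cg M x y" "cg M y z" shows "cg M x z"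
proof -
  have c: "x \<in> carrier G" "y \<in> carrier G" "z \<in> carrier G" using assms by (auto simp: cg_def)
  have "(x \<otimes> inv y) \<otimes> (y \<otimes> inv z) \<in> M" using assms by (auto simp: cg_def intro: sub_m)
  also have "inv y \<otimes> (y \<otimes> inv z) = inv z" using c by (simp add: m_assoc[symmetric])
  then have "(x \<otimes> inv y) \<otimes> (y \<otimes> inv z) = x \<otimes> inv z" using c by (simp add: m_assoc)
  finally show ?thesis using c by (simp add: cg_def)
qed

lemma cg_mult: assumes "subgroup M G" "cg M x y" "cg M x' y'" shows "cg M (x \<otimes> x') (y \<otimes> y')"
proof -
  have c: "x \<in> carrier G" "y \<in> carrier G" "x' \<in> carrier G" "y' \<in> carrier G" using assms by (auto simp: cg_def)
  have "(x \<otimes> inv y) \<otimes> (x' \<otimes> inv y') \<in> M" using assms by (auto simp: cg_def intro: sub_m)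
  also have "(x \<otimes> inv y) \<otimes> (x' \<otimes> inv y') = (x \<otimes> x') \<otimes> inv (y \<otimes> y')" using c by (simp add: inv_mult m_ac)
  finally show ?thesis using c by (simp add: cg_def)
qed

lemma cg_inv: assumes "subgroup M G" "cg M x y" shows "cg M (inv x) (inv y)"
proof -
  have c: "x \<in> carrier G" "y \<in> carrier G" using assms by (auto simp: cg_def)
  have "inv (x \<otimes> inv y) \<in> M" using assms by (auto simp: cg_def intro: sub_inv)
  then show ?thesis using c by (simp add: cg_def inv_mult)
qed

lemma cg_div: "subgroup M G ==> cg M x y ==> cg M x' y' ==> cg M (x \<otimes> inv x') (y \<otimes> inv y')"
  by (intro cg_mult cg_inv)

lemma cg_one: "x \<in> carrier G ==> cg M x \<one> \<longleftrightarrow> x \<in> M"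
  by (simp add: cg_def)

text \<open>A function on the subsets of \<open>J\<close> has degree at most \<open>m\<close> modulo \<open>M\<close> if all its differences of order
\<open>m + 1\<close>, taken by adding elements of \<open>J\<close> to the argument, vanish.\<close>

primrec deg :: "'a set => nat => 'i set => ('i set => 'a) => bool" where
  "deg M 0 J g \<longleftrightarrow> (\<forall>I\<subseteq>J. cg M (g I) (g {}))"
| "deg M (Suc m) J g \<longleftrightarrow> (\<forall>y\<in>J. deg M m (J - {y}) (\<lambda>I. g (insert y I) \<otimes> inv (g I)))"

lemma deg_cong:
  assumes "subgroup M G"
  shows "deg M m J g ==> (\<And>I. I \<subseteq> J ==> cg M (g I) (g' I)) ==> deg M m J g'"
proof (induction m arbitrary: J g g')
  case 0
  show ?case unfolding deg.simps
  proof (intro allI impI)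
    fix I assume I: "I \<subseteq> J"
    have "cg M (g I) (g {})" using 0(1) I by simp
    with cg_sym[OF assms 0(2)[OF I]] have "cg M (g' I) (g {})" by (rule cg_trans[OF assms])
    then show "cg M (g' I) (g' {})" by (rule cg_trans[OF assms _ 0(2)]) simp
  qed
next
  case (Suc m)
  show ?case unfolding deg.simps
  proof
    fix y assume y: "y \<in> J"
    show "deg M m (J - {y}) (\<lambda>I. g' (insert y I) \<otimes> inv (g' I))"
    proof (rule Suc.IH)
      show "deg M m (J - {y}) (\<lambda>I. g (insert y I) \<otimes> inv (g I))" using Suc.prems(1) y by simp
      show "cg M (g (insert y I) \<otimes> inv (g I)) (g' (insert y I) \<otimes> inv (g' I))" if "I \<subseteq> J - {y}" for I
        using that y by (intro cg_div assms Suc.prems(2)) auto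
    qed
  qed
qed

lemma deg_mult:
  assumes "subgroup M G"
  shows "deg M m J g ==> deg M m J g' ==> (\<And>I. g I \<in> carrier G) ==> (\<And>I. g' I \<in> carrier G) ==> deg M m J (\<lambda>I. g I \<otimes> g' I)"
proof (induction m arbitrary: J g g')
  case 0 then show ?case by (simp add: cg_mult[OF assms])
next
  case (Suc m)
  have e: "(g (insert y I) \<otimes> g' (insert y I)) \<otimes> inv (g I \<otimes> g' I) = (g (insert y I) \<otimes> inv (g I)) \<otimes> (g' (insert y I) \<otimes> inv (g' I))" for y I
    using Suc.prems(3,4) by (simp add: inv_mult m_ac)
  show ?case unfolding deg.simps e
  proof
    fix y assume "y \<in> J"
    then show "deg M m (J - {y}) (\<lambda>I. g (insert y I) \<otimes> inv (g I) \<otimes> (g' (insert y I) \<otimes> inv (g' I)))"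
      using Suc.prems by (intro Suc.IH[of "J - {y}" "\<lambda>I. g (insert y I) \<otimes> inv (g I)" "\<lambda>I. g' (insert y I) \<otimes> inv (g' I)"]) simp_all
  qed
qed

lemma deg_hom:
  assumes M: "subgroup M G" and S: "subgroup S G"
    and f: "\<And>x. x \<in> S ==> f x \<in> S"
      "\<And>x y. x \<in> S ==> y \<in> S ==> cg M x y ==> cg M (f x) (f y)"
      "\<And>x y. x \<in> S ==> y \<in> S ==> cg M (f (x \<otimes> inv y)) (f x \<otimes> inv (f y))"
  shows "deg M m J g ==> (\<And>I. g I \<in> S) ==> deg M m J (\<lambda>I. f (g I))"
proof (induction m arbitrary: J g)
  case 0 then show ?case by (auto intro: f)
next
  case (Suc m)
  show ?case unfolding deg.simps
  proof
    fix y assume y: "y \<in> J"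
    have "deg M m (J - {y}) (\<lambda>I. f (g (insert y I) \<otimes> inv (g I)))"
      using Suc.prems y by (intro Suc.IH sub_div[OF S]) auto
    then show "deg M m (J - {y}) (\<lambda>I. f (g (insert y I)) \<otimes> inv (f (g I)))"
      by (rule deg_cong[OF M]) (rule f(3)[OF Suc.prems(2) Suc.prems(2)])
  qed
qed

lemma deg_insert:
  assumes "subgroup M G"
  shows "deg M m J g ==> y \<in> J ==> deg M m (J - {y}) (\<lambda>I. g (insert y I))"
proof (induction m arbitrary: J g)
  case 0
  show ?case unfolding deg.simps
  proof (intro allI impI)
    fix I assume "I \<subseteq> J - {y}"
    then have "insert y I \<subseteq> J" "{y} \<subseteq> J" using 0(2) by auto
    then have "cg M (g (insert y I)) (g {})" "cg M (g {y}) (g {})" using 0(1) unfolding deg.simps by blast+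
    then show "cg M (g (insert y I)) (g {y})" using cg_trans[OF assms] cg_sym[OF assms] by blast
  qed
next
  case (Suc m)
  show ?case unfolding deg.simps
  proof
    fix z assume z: "z \<in> J - {y}"
    have "deg M m (J - {z}) (\<lambda>I. g (insert z I) \<otimes> inv (g I))" using Suc.prems(1) z by simp
    then have "deg M m (J - {z} - {y}) (\<lambda>I. g (insert z (insert y I)) \<otimes> inv (g (insert y I)))"
      by (rule Suc.IH) (use Suc.prems z in auto)
    moreover have "J - {z} - {y} = J - {y} - {z}" by blast
    ultimately show "deg M m (J - {y} - {z}) (\<lambda>I. g (insert y (insert z I)) \<otimes> inv (g (insert y I)))"
      by (simp add: insert_commute)
  qed
qed

text \<open>A function of degree less than \<open>card J\<close> that is constant on nonempty sets is constant: its first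
difference has smaller degree and vanishes on nonempty sets.\<close>

lemma deg_final:
  assumes "subgroup M G"
  shows "deg M m J g ==> finite J ==> m < card J ==> (\<And>I. g I \<in> carrier G) ==>
    (\<And>I. I \<subseteq> J ==> I \<noteq> {} ==> cg M (g I) x) ==> cg M (g {}) x"
proof (induction m arbitrary: J g x)
  case 0
  then have "J \<noteq> {}" by auto
  then have "cg M (g J) x" "cg M (g J) (g {})" using 0 by auto
  then show ?case using cg_trans[OF assms] cg_sym[OF assms] by blast
next
  case (Suc m)
  then obtain y where y: "y \<in> J" by (metis card.empty equals0I not_less_zero)
  define h where "h I = g (insert y I) \<otimes> inv (g I)" for I
  have x: "cg M (g {y}) x" using Suc.prems(5)[of "{y}"] y by simp
  have xc: "x \<in> carrier G" using x by (rule cg_car)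
  have "cg M (h {}) \<one>"
  proof (rule Suc.IH)
    show "deg M m (J - {y}) h" using Suc.prems(1) y unfolding h_def by simp
    show "finite (J - {y})" "m < card (J - {y})" using Suc.prems y by auto
    show "h I \<in> carrier G" for I unfolding h_def using Suc.prems(4) by simp
    show "cg M (h I) \<one>" if "I \<subseteq> J - {y}" "I \<noteq> {}" for I
    proof -
      have "cg M (h I) (x \<otimes> inv x)" unfolding h_def using that y by (intro cg_div assms Suc.prems(5)) auto
      then show ?thesis using xc by simp
    qed
  qed
  then have "h {} \<in> M" using cg_one[of "h {}"] Suc.prems(4) unfolding h_def by simp
  then have "g {y} \<otimes> inv (g {}) \<in> M" unfolding h_def .
  then have "cg M (g {y}) (g {})" using Suc.prems(4) by (simp add: cg_def)
  then show ?case using x cg_trans[OF assms] cg_sym[OF assms] by blast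
qed

text \<open>Applying to a function of degree \<open>m\<close> an endomorphism that depends additively on the set raises the
degree by at most one. The difference in direction \<open>y\<close> is \<open>F I\<close> applied to the difference of \<open>g\<close>,
handled by induction, plus the fixed endomorphism \<open>F {y}\<close> applied to a shift of \<open>g\<close>.\<close>

lemma deg_apply:
  assumes M: "subgroup M G" and S: "subgroup S G"
    and F: "\<And>I x. x \<in> S ==> F I x \<in> S"
  shows "deg M m J g ==> (\<And>I. g I \<in> S) ==>
      (\<And>I x y. I \<subseteq> J ==> x \<in> S ==> y \<in> S ==> cg M x y ==> cg M (F I x) (F I y)) ==>
      (\<And>I x y. I \<subseteq> J ==> x \<in> S ==> y \<in> S ==> cg M (F I (x \<otimes> inv y)) (F I x \<otimes> inv (F I y))) ==>
      (\<And>I x y. I \<subseteq> J ==> x \<in> S ==> y \<in> J - I ==> cg M (F (insert y I) x) (F I x \<otimes> F {y} x)) ==>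
      deg M (Suc m) J (\<lambda>I. F I (g I))"
proof (induction m arbitrary: J g)
  case 0
  have Sc: "x \<in> carrier G" if "x \<in> S" for x using sub_car[OF S that] .
  have gS: "\<And>I. g I \<in> S" using 0 by blast
  have "cg M (F (insert y I) (g (insert y I)) \<otimes> inv (F I (g I))) (F {y} (g {}))" if y: "y \<in> J" "I \<subseteq> J - {y}" for y I
  proof -
    have J: "insert y I \<subseteq> J" "I \<subseteq> J" "y \<in> J - I" using y by auto
    have c: "cg M (g I) (g {})" "cg M (g (insert y I)) (g {})" using 0(1) J by auto
    have "cg M (F (insert y I) (g (insert y I))) (F (insert y I) (g {}))" using 0(3)[OF J(1) gS gS c(2)] .
    then have 1: "cg M (F (insert y I) (g (insert y I))) (F I (g {}) \<otimes> F {y} (g {}))"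
      using 0(5)[OF J(2) gS J(3)] cg_trans[OF M] by blast
    have "cg M (F (insert y I) (g (insert y I)) \<otimes> inv (F I (g I))) ((F I (g {}) \<otimes> F {y} (g {})) \<otimes> inv (F I (g {})))"
      by (rule cg_div[OF M 1 0(3)[OF J(2) gS gS c(1)]])
    moreover have "(F I (g {}) \<otimes> F {y} (g {})) \<otimes> inv (F I (g {})) = F {y} (g {})"
    proof -
      have fc: "F I (g {}) \<in> carrier G" "F {y} (g {}) \<in> carrier G" using Sc[OF F[OF gS]] by auto
      have "F I (g {}) \<otimes> F {y} (g {}) = F {y} (g {}) \<otimes> F I (g {})" by (rule m_comm[OF fc])
      then show ?thesis using fc by (simp add: m_assoc)
    qed
    ultimately show ?thesis by simp
  qed
  note key = this
  show ?case unfolding deg.simps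
  proof (intro ballI allI impI)
    fix y I assume y: "y \<in> J" "I \<subseteq> J - {y}"
    show "cg M (F (insert y I) (g (insert y I)) \<otimes> inv (F I (g I))) (F (insert y {}) (g (insert y {})) \<otimes> inv (F {} (g {})))"
      by (rule cg_trans[OF M key[OF y] cg_sym[OF M key[OF y(1)]]]) simp
  qed
next
  case (Suc m)
  have Sc: "x \<in> carrier G" if "x \<in> S" for x using sub_car[OF S that] .
  have gS: "\<And>I. g I \<in> S" using Suc.prems by blast
  show ?case unfolding deg.simps(2)[of M "Suc m"]
  proof
    fix y assume y: "y \<in> J"
    define h where "h I = g (insert y I) \<otimes> inv (g I)" for I
    have hS: "h I \<in> S" for I unfolding h_def by (intro sub_div S gS)
    have "deg M (Suc m) (J - {y}) (\<lambda>I. F I (h I))"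
    proof (rule Suc.IH[OF _ hS])
      show "deg M m (J - {y}) h" using Suc.prems(1) y unfolding h_def by simp
      fix I x z assume I: "I \<subseteq> J - {y}" and x: "x \<in> S"
      have I': "I \<subseteq> J" using I by blast
      show "cg M (F I x) (F I z)" if "z \<in> S" "cg M x z" by (rule Suc.prems(3)[OF I' x that])
      show "cg M (F I (x \<otimes> inv z)) (F I x \<otimes> inv (F I z))" if "z \<in> S" by (rule Suc.prems(4)[OF I' x that])
      show "cg M (F (insert z I) x) (F I x \<otimes> F {z} x)" if "z \<in> J - {y} - I" for z
        by (rule Suc.prems(5)[OF I' x]) (use that in blast)
    qed
    moreover have "deg M (Suc m) (J - {y}) (\<lambda>I. F {y} (g (insert y I)))"
    proof (rule deg_hom[OF M S F])
      show "deg M (Suc m) (J - {y}) (\<lambda>I. g (insert y I))" by (rule deg_insert[OF M Suc.prems(1) y])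
      have y': "{y} \<subseteq> J" using y by blast
      show "cg M (F {y} x) (F {y} z)" if "x \<in> S" "z \<in> S" "cg M x z" for x z by (rule Suc.prems(3)[OF y' that])
      show "cg M (F {y} (x \<otimes> inv z)) (F {y} x \<otimes> inv (F {y} z))" if "x \<in> S" "z \<in> S" for x z by (rule Suc.prems(4)[OF y' that])
      show "g (insert y I) \<in> S" for I by (rule gS)
    qed
    ultimately have "deg M (Suc m) (J - {y}) (\<lambda>I. F I (h I) \<otimes> F {y} (g (insert y I)))"
      by (rule deg_mult[OF M]) (intro Sc F hS gS)+
    then show "deg M (Suc m) (J - {y}) (\<lambda>I. F (insert y I) (g (insert y I)) \<otimes> inv (F I (g I)))"
    proof (rule deg_cong[OF M])
      fix I assume "I \<subseteq> J - {y}"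
      then have J: "insert y I \<subseteq> J" "I \<subseteq> J" "y \<in> J - I" using y by auto
      let ?a = "F I (g (insert y I))" and ?b = "F I (g I)" and ?d = "F {y} (g (insert y I))"
      have abc: "?a \<in> carrier G" "?b \<in> carrier G" "?d \<in> carrier G" by (intro Sc F gS)+
      have 1: "cg M (F I (h I) \<otimes> ?d) ((?a \<otimes> inv ?b) \<otimes> ?d)"
        unfolding h_def by (rule cg_mult[OF M Suc.prems(4)[OF J(2) gS gS] cg_refl[OF M abc(3)]])
      have 2: "cg M (F (insert y I) (g (insert y I)) \<otimes> inv ?b) ((?a \<otimes> ?d) \<otimes> inv ?b)"
        by (rule cg_div[OF M Suc.prems(5)[OF J(2) gS J(3)] cg_refl[OF M abc(2)]])
      have "(?a \<otimes> inv ?b) \<otimes> ?d = (?a \<otimes> ?d) \<otimes> inv ?b" using abc by (simp add: m_ac)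
      with 1 have "cg M (F I (h I) \<otimes> ?d) ((?a \<otimes> ?d) \<otimes> inv ?b)" by simp
      then show "cg M (F I (h I) \<otimes> ?d) (F (insert y I) (g (insert y I)) \<otimes> inv ?b)"
        by (rule cg_trans[OF M _ cg_sym[OF M 2]])
    qed
  qed
qed

text \<open>For each \<open>x\<close> the function taking \<open>I\<close> to \<open>(F I ^^ n) x\<close> has degree at most \<open>n < card J\<close>. It equals \<open>x\<close> on
nonempty sets and \<open>\<one>\<close> on the empty set, hence \<open>x\<close> is trivial modulo \<open>M\<close>.\<close>

lemma additive_family_trivial:
  assumes M: "subgroup M G" and S: "subgroup S G" and J: "finite J" "n < card J" "0 < n"
    and F: "\<And>I x. x \<in> S ==> F I x \<in> S" "\<And>x. x \<in> S ==> F {} x = \<one>"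
      "\<And>I x y. I \<subseteq> J ==> x \<in> S ==> y \<in> S ==> cg M x y ==> cg M (F I x) (F I y)"
      "\<And>I x y. I \<subseteq> J ==> x \<in> S ==> y \<in> S ==> cg M (F I (x \<otimes> inv y)) (F I x \<otimes> inv (F I y))"
      "\<And>I x y. I \<subseteq> J ==> x \<in> S ==> y \<in> J - I ==> cg M (F (insert y I) x) (F I x \<otimes> F {y} x)"
      "\<And>I x. I \<subseteq> J ==> I \<noteq> {} ==> x \<in> S ==> cg M ((F I ^^ n) x) x"
  shows "S \<subseteq> M"
proof
  fix x assume x: "x \<in> S"
  have pS: "(F I ^^ k) x \<in> S" for I k by (induction k) (auto simp: x F(1))
  have d: "deg M k J (\<lambda>I. (F I ^^ k) x)" for k
  proof (induction k)
    case 0 show ?case using x by (simp add: cg_refl[OF M] sub_car[OF S])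
  next
    case (Suc k)
    have "deg M (Suc k) J (\<lambda>I. F I ((F I ^^ k) x))"
      by (rule deg_apply[OF M S F(1) Suc pS F(3,4,5)])
    then show ?case by simp
  qed
  have "cg M ((F {} ^^ n) x) x"
    by (rule deg_final[OF M d J(1,2)]) (use pS sub_car[OF S] F(6) x in auto)
  moreover have "(F {} ^^ n) x = \<one>" using F(2)[OF pS] J(3) by (cases n) auto
  ultimately have "cg M \<one> x" by simp
  then have "cg M x \<one>" by (rule cg_sym[OF M])
  then show "x \<in> M" using cg_one sub_car[OF S x] by blast
qed

lemma arel_relpow: assumes "arel R" shows "arel (R ^^ Suc k)"
proof (induction k)
  case 0 then show ?case using assms by simp
next
  case (Suc k) then show ?case using arel_comp[OF Suc assms] by simp
qed

lemma arel_Int: "arel R ==> arel S ==> arel (R \<inter> S)" unfolding arel_def by blast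

lemma arel_Times: "subgroup B G ==> subgroup C G ==> arel (B \<times> C)"
  unfolding arel_def by (auto simp: sub_car sub_one sub_m sub_inv)

end

lemma (in oligo) invr_relpow: "invr c R ==> invr c (R ^^ Suc k)"
  by (induction k) (auto intro: invr_comp)

text \<open>Additive relations on \<open>H\<close> that preserve smallness over \<open>Q\<close> in both directions, and whose inverses
preserve finite index, become honest injective endomorphisms of one section of \<open>H\<close>. There are finitely
many invariant subgroups, so one can take \<open>M\<close> to be the largest invariant subgroup above \<open>Q\<close> that is
small over \<open>Q\<close>, and \<open>S\<close> the least invariant one above \<open>M\<close> of finite index in \<open>H\<close>. By maximality the
relations and their inverses map \<open>M\<close> to itself, so they are single valued and injective modulo \<open>M\<close>;
by minimality their domains cover \<open>S\<close> modulo \<open>M\<close>.\<close>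

lemma (in oligo) endo_family:
  assumes c: "set c \<subseteq> carrier A" and Q: "subgroup Q A" "invs c Q" and H: "subgroup H A" "invs c H"
    and OH: "Q \<subseteq> H" "\<not> alm H Q"
    and R: "\<And>w. w \<in> \<Omega> ==> arel (R w)" "\<And>w. w \<in> \<Omega> ==> invr c (R w)" "\<And>w. w \<in> \<Omega> ==> R w \<subseteq> H \<times> H"
    and sm: "\<And>w B. w \<in> \<Omega> ==> subgroup B A ==> B \<subseteq> H ==> alm B Q ==> alm (R w `` B) Q"
      "\<And>w B. w \<in> \<Omega> ==> subgroup B A ==> B \<subseteq> H ==> alm B Q ==> alm ((R w)\<inverse> `` B) Q"
    and lg: "\<And>w B. w \<in> \<Omega> ==> subgroup B A ==> B \<subseteq> H ==> alm H B ==> alm H ((R w)\<inverse> `` B)"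
  obtains M S p where "subgroup M A" "subgroup S A" "\<not> S \<subseteq> M"
    "\<And>w x. w \<in> \<Omega> ==> x \<in> S ==> p w x \<in> S"
    "\<And>w x y. w \<in> \<Omega> ==> x \<in> S ==> y \<in> S ==> cg M x y ==> cg M (p w x) (p w y)"
    "\<And>w x y. w \<in> \<Omega> ==> x \<in> S ==> y \<in> S ==> cg M (p w (x \<otimes> inv y)) (p w x \<otimes> inv (p w y))"
    "\<And>w w' w'' x. w \<in> \<Omega> ==> w' \<in> \<Omega> ==> w'' \<in> \<Omega> ==> x \<in> S ==>
       (\<And>x y y'. (x, y) \<in> R w ==> (x, y') \<in> R w' ==> (x, y \<otimes> y') \<in> R w'') ==> cg M (p w'' x) (p w x \<otimes> p w' x)"
    "\<And>w x i j. w \<in> \<Omega> ==> x \<in> S ==> i < j ==> R w ^^ Suc i = R w ^^ Suc j ==> cg M ((p w ^^ (j - i)) x) x"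
proof -
  have Hc: "H \<subseteq> carrier A" and Oc: "Q \<subseteq> carrier A" using H Q sub_sub by auto
  define Ms where "Ms = {B. invs c B \<and> subgroup B A \<and> Q \<subseteq> B \<and> B \<subseteq> H \<and> alm B Q}"
  have "finite Ms" by (rule finite_subset[OF _ invs_finite[OF c]]) (auto simp: Ms_def)
  moreover have OMs: "Q \<in> Ms" unfolding Ms_def using Q OH alm_refl by auto
  ultimately obtain M where M: "M \<in> Ms" "\<And>B. B \<in> Ms ==> M \<subseteq> B ==> M = B"
    using finite_has_maximal[of Ms] by blast
  have Mp: "invs c M" "subgroup M A" "Q \<subseteq> M" "M \<subseteq> H" "alm M Q" using M(1) unfolding Ms_def by auto
  have HH: "B <#> B' \<subseteq> H" if "B \<subseteq> H" "B' \<subseteq> H" for B B' using that mult_idem[OF H(1)] mono_set_mult by metis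
  have maxM: "B \<subseteq> M" if B: "invs c B" "subgroup B A" "B \<subseteq> H" "alm B Q" for B
  proof -
    have s: "M \<subseteq> M <#> B" "B \<subseteq> M <#> B" by (intro sub_left sub_right Mp B)+
    have "M <#> B \<in> Ms" unfolding Ms_def
      by (intro CollectI conjI invs_mult sub_mult alm_mult HH Mp B Q order_trans[OF Mp(3) s(1)])
    from M(2)[OF this s(1)] s(2) show ?thesis by simp
  qed
  define Ss where "Ss = {B. invs c B \<and> subgroup B A \<and> M \<subseteq> B \<and> B \<subseteq> H \<and> alm H B}"
  have "finite Ss" by (rule finite_subset[OF _ invs_finite[OF c]]) (auto simp: Ss_def)
  moreover have "H \<in> Ss" unfolding Ss_def using H Mp alm_refl by auto
  ultimately obtain S where S: "S \<in> Ss" "\<And>B. B \<in> Ss ==> B \<subseteq> S ==> S = B"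
    using finite_has_minimal[of Ss] by blast
  have Sp: "invs c S" "subgroup S A" "M \<subseteq> S" "S \<subseteq> H" "alm H S" using S(1) unfolding Ss_def by auto
  have rep: "\<exists>q\<in>S \<inter> B. cg M x q" if B: "invs c B" "subgroup B A" "B \<subseteq> H" "alm H B" and x: "x \<in> S" for B x
  proof -
    have BM: "M \<subseteq> B <#> M" "B \<subseteq> B <#> M" by (intro sub_left sub_right Mp B)+
    have BMH: "B <#> M \<subseteq> H" by (intro HH B Mp)
    have "alm H (B <#> M)" by (rule alm_subset_right[OF B(4) BM(2)]) (use BMH Hc in blast)
    then have "alm H (S \<inter> (B <#> M))" by (intro alm_inter Sp sub_mult B Mp Hc)
    then have "S \<inter> (B <#> M) \<in> Ss" unfolding Ss_def
      by (intro CollectI conjI invs_Int invs_mult sub_int sub_mult Int_greatest Sp Mp B BM(1) order_trans[OF Int_lower1 Sp(4)])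
    then have "S = S \<inter> (B <#> M)" by (rule S(2)) blast
    then have "x \<in> B <#> M" using x by blast
    then obtain q m where q: "q \<in> B" "m \<in> M" "x = q \<otimes> m" by (blast elim: set_multE)
    have cc: "q \<in> carrier A" "m \<in> carrier A" "x \<in> carrier A" using q x sub_car[OF B(2)] sub_car[OF Mp(2)] sub_car[OF Sp(2)] by auto
    have "q = x \<otimes> inv m" using q(3) cc by (simp add: m_assoc)
    moreover have "m \<in> S" using q(2) Sp(3) by blast
    ultimately have "q \<in> S" using sub_div[OF Sp(2) x] by simp
    moreover have "x \<otimes> inv q = m" using q(3) cc by (simp add: m_comm[of q m] m_assoc)
    then have "cg M x q" using cc q(2) by (simp add: cg_def)
    ultimately show ?thesis using q(1) by blast
  qed
  have TM: "R w `` M \<subseteq> M" "(R w)\<inverse> `` M \<subseteq> M" if w: "w \<in> \<Omega>" for w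
  proof -
    have h: "R w `` M \<subseteq> H" "(R w)\<inverse> `` M \<subseteq> H" using R(3)[OF w] by auto
    show "R w `` M \<subseteq> M"
      by (rule maxM[OF invs_rel_image[OF R(2)[OF w] Mp(1)] sub_image[OF R(1)[OF w] Mp(2)] h(1) sm(1)[OF w Mp(2,4,5)]])
    show "(R w)\<inverse> `` M \<subseteq> M"
      by (rule maxM[OF invs_rel_image[OF invr_converse[OF R(2)[OF w]] Mp(1)] sub_image[OF arel_converse[OF R(1)[OF w]] Mp(2)] h(2) sm(2)[OF w Mp(2,4,5)]])
  qed
  define T where "T w = R w \<inter> S \<times> S" for w
  have aT: "arel (T w)" if "w \<in> \<Omega>" for w unfolding T_def by (intro arel_Int R that arel_Times Sp)
  have iT: "invr c (T w)" if "w \<in> \<Omega>" for w unfolding T_def by (intro invr_Int R that invr_Times Sp)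
  have pre: "alm H ((T w)\<inverse> `` B)" if w: "w \<in> \<Omega>" and B: "subgroup B A" "B \<subseteq> S" "alm H B" for w B
  proof -
    have "alm H ((R w)\<inverse> `` B)" using B Sp by (intro lg w) auto
    then have "alm H (S \<inter> (R w)\<inverse> `` B)" by (intro alm_inter Sp Hc sub_image arel_converse R w B)
    moreover have "S \<inter> (R w)\<inverse> `` B = (T w)\<inverse> `` B" unfolding T_def using B(2) by blast
    ultimately show ?thesis by simp
  qed
  have dom: "alm H (Domain (T w ^^ Suc k)) \<and> subgroup (Domain (T w ^^ Suc k)) A \<and> invs c (Domain (T w ^^ Suc k)) \<and> Domain (T w ^^ Suc k) \<subseteq> S"
    if w: "w \<in> \<Omega>" for w k
  proof (induction k)
    case 0
    have e: "Domain (T w) = (T w)\<inverse> `` S" unfolding T_def by blast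
    have "alm H (Domain (T w))" unfolding e by (rule pre[OF w Sp(2) order_refl Sp(5)])
    moreover have "invs c (Domain (T w))" unfolding e by (intro invs_rel_image invr_converse iT w Sp)
    moreover have "Domain (T w) \<subseteq> S" unfolding T_def by blast
    ultimately show ?case using sub_Domain[OF aT[OF w]] by simp
  next
    case (Suc k)
    have e: "Domain (T w ^^ Suc (Suc k)) = (T w)\<inverse> `` Domain (T w ^^ Suc k)"
      unfolding relpow.simps(2)[of "Suc k"] relpow_commute[symmetric] by blast
    show ?case unfolding e
    proof (intro conjI)
      show "alm H ((T w)\<inverse> `` Domain (T w ^^ Suc k))" using Suc by (intro pre[OF w]) blast+
      show "subgroup ((T w)\<inverse> `` Domain (T w ^^ Suc k)) A" using Suc by (intro sub_image arel_converse aT w) blast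
      show "invs c ((T w)\<inverse> `` Domain (T w ^^ Suc k))" using Suc by (intro invs_rel_image invr_converse iT w) blast
      show "(T w)\<inverse> `` Domain (T w ^^ Suc k) \<subseteq> S" unfolding T_def by blast
    qed
  qed
  have uniq: "cg M y y'" if w: "w \<in> \<Omega>" and h: "(q, y) \<in> R w" "(q', y') \<in> R w" "cg M q q'" for w q q' y y'
  proof -
    note a = arelD[OF R(1)[OF w]]
    have "(q \<otimes> inv q', y \<otimes> inv y') \<in> R w" by (rule a(6)[OF h(1,2)])
    moreover have "q \<otimes> inv q' \<in> M" using h(3) by (simp add: cg_def)
    ultimately have "y \<otimes> inv y' \<in> M" using TM(1)[OF w] by blast
    then show ?thesis using a(2)[OF h(1)] a(2)[OF h(2)] by (simp add: cg_def)
  qed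
  have inj: "cg M q q'" if w: "w \<in> \<Omega>" and h: "(q, y) \<in> R w" "(q', y') \<in> R w" "cg M y y'" for w q q' y y'
  proof -
    note a = arelD[OF R(1)[OF w]]
    have "(q \<otimes> inv q', y \<otimes> inv y') \<in> R w" by (rule a(6)[OF h(1,2)])
    moreover have "y \<otimes> inv y' \<in> M" using h(3) by (simp add: cg_def)
    ultimately have "q \<otimes> inv q' \<in> M" using TM(2)[OF w] by blast
    then show ?thesis using a(1)[OF h(1)] a(1)[OF h(2)] by (simp add: cg_def)
  qed
  define p where "p w x = (SOME y. \<exists>q. cg M x q \<and> (q, y) \<in> T w)" for w x
  have pp: "\<exists>q. cg M x q \<and> (q, p w x) \<in> T w" if w: "w \<in> \<Omega>" and x: "x \<in> S" for w x
  proof -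
    have d: "alm H (Domain (T w))" "subgroup (Domain (T w)) A" "invs c (Domain (T w))" "Domain (T w) \<subseteq> S"
      using dom[OF w, of 0] by simp_all
    have "Domain (T w) \<subseteq> H" using d(4) Sp(4) by blast
    from rep[OF d(3,2) this d(1) x] obtain q where "q \<in> Domain (T w)" "cg M x q" by blast
    then have "\<exists>y q. cg M x q \<and> (q, y) \<in> T w" by blast
    then show ?thesis unfolding p_def by (rule someI_ex)
  qed
  have pS: "p w x \<in> S" if "w \<in> \<Omega>" "x \<in> S" for w x using pp[OF that] unfolding T_def by blast
  have pu: "cg M (p w x) y" if w: "w \<in> \<Omega>" and x: "x \<in> S" "cg M x q" "(q, y) \<in> R w" for w x q y
  proof -
    obtain q' where q': "cg M x q'" "(q', p w x) \<in> R w" using pp[OF w x(1)] unfolding T_def by blast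
    have "cg M q' q" using cg_trans[OF Mp(2) cg_sym[OF Mp(2) q'(1)] x(2)] .
    then show ?thesis by (rule uniq[OF w q'(2) x(3)])
  qed
  have pcong: "cg M (p w x) (p w y)" if w: "w \<in> \<Omega>" and x: "x \<in> S" "y \<in> S" "cg M x y" for w x y
  proof -
    obtain q where q: "cg M y q" "(q, p w y) \<in> R w" using pp[OF w x(2)] unfolding T_def by blast
    show ?thesis by (rule pu[OF w x(1) cg_trans[OF Mp(2) x(3) q(1)] q(2)])
  qed
  have phom: "cg M (p w (x \<otimes> inv y)) (p w x \<otimes> inv (p w y))" if w: "w \<in> \<Omega>" and x: "x \<in> S" "y \<in> S" for w x y
  proof -
    obtain q where q: "cg M x q" "(q, p w x) \<in> R w" using pp[OF w x(1)] unfolding T_def by blast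
    obtain q' where q': "cg M y q'" "(q', p w y) \<in> R w" using pp[OF w x(2)] unfolding T_def by blast
    show ?thesis
      by (rule pu[OF w sub_div[OF Sp(2) x] cg_div[OF Mp(2) q(1) q'(1)] arelD(6)[OF R(1)[OF w] q(2) q'(2)]])
  qed
  have padd: "cg M (p w'' x) (p w x \<otimes> p w' x)" if w: "w \<in> \<Omega>" "w' \<in> \<Omega>" "w'' \<in> \<Omega>" and x: "x \<in> S"
     and ad: "\<And>x y y'. (x, y) \<in> R w ==> (x, y') \<in> R w' ==> (x, y \<otimes> y') \<in> R w''" for w w' w'' x
  proof -
    have d: "alm H (Domain (T w))" "subgroup (Domain (T w)) A" "invs c (Domain (T w))" "Domain (T w) \<subseteq> S" if "w \<in> \<Omega>" for w
      using dom[OF that, of 0] by simp_all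
    have "alm H (Domain (T w) \<inter> Domain (T w'))" by (intro alm_inter d w Hc)
    moreover have "invs c (Domain (T w) \<inter> Domain (T w'))" by (intro invs_Int d w)
    moreover have "subgroup (Domain (T w) \<inter> Domain (T w')) A" by (intro sub_int d w)
    moreover have "Domain (T w) \<inter> Domain (T w') \<subseteq> H" using d(4)[OF w(1)] Sp(4) by blast
    ultimately obtain q where q: "q \<in> Domain (T w)" "q \<in> Domain (T w')" "cg M x q" using rep[OF _ _ _ _ x] by blast
    then obtain y y' where y: "(q, y) \<in> R w" "(q, y') \<in> R w'" unfolding T_def by blast
    have "cg M (p w'' x) (y \<otimes> y')" by (rule pu[OF w(3) x q(3) ad[OF y]])
    moreover have "cg M (p w x \<otimes> p w' x) (y \<otimes> y')"
      by (rule cg_mult[OF Mp(2) pu[OF w(1) x q(3) y(1)] pu[OF w(2) x q(3) y(2)]])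
    ultimately show ?thesis using cg_trans[OF Mp(2)] cg_sym[OF Mp(2)] by blast
  qed
  have ppow: "cg M ((p w ^^ k) x) z" if w: "w \<in> \<Omega>" and x: "x \<in> S" "cg M x q" and z: "(q, z) \<in> T w ^^ k" for w x q z k
    using z
  proof (induction k arbitrary: z)
    case 0 then show ?case using x by simp
  next
    case (Suc k)
    then obtain u where u: "(q, u) \<in> T w ^^ k" "(u, z) \<in> T w" by auto
    have "(p w ^^ k) x \<in> S" by (induction k) (auto simp: x pS w)
    then show ?case using pu[OF w _ Suc.IH[OF u(1)], of z] u(2) unfolding T_def by simp
  qed
  have fin: "cg M ((p w ^^ (j - i)) x) x" if w: "w \<in> \<Omega>" and x: "x \<in> S" and ij: "i < j" "R w ^^ Suc i = R w ^^ Suc j" for w x i j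
  proof -
    have fS: "(p w ^^ k) y \<in> S" if "y \<in> S" for k y using that by (induction k) (auto simp: pS w)
    have d: "alm H (Domain (T w ^^ Suc j))" "subgroup (Domain (T w ^^ Suc j)) A" "invs c (Domain (T w ^^ Suc j))" "Domain (T w ^^ Suc j) \<subseteq> S"
      using dom[OF w, of j] by auto
    have "Domain (T w ^^ Suc j) \<subseteq> H" using d(4) Sp(4) by blast
    from rep[OF d(3,2) this d(1) x] obtain q where q: "q \<in> Domain (T w ^^ Suc j)" "cg M x q" by blast
    then obtain z where z: "(q, z) \<in> T w ^^ Suc j" by blast
    have "Suc j = Suc i + (j - i)" using ij(1) by simp
    then have "(q, z) \<in> T w ^^ Suc i O T w ^^ (j - i)" using z relpow_add[of "Suc i" "j - i" "T w"] by (simp del: relpow.simps)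
    then obtain u where u: "(q, u) \<in> T w ^^ Suc i" by blast
    have TR: "T w ^^ k \<subseteq> R w ^^ k" for k
    proof (induction k)
      case (Suc k)
      have "T w \<subseteq> R w" unfolding T_def by blast
      then show ?case using relcomp_mono[OF Suc] by simp
    qed simp
    have "(q, u) \<in> R w ^^ Suc j" "(q, z) \<in> R w ^^ Suc j" using u z TR ij(2) by blast+
    then have "(q \<otimes> inv q, u \<otimes> inv z) \<in> R w ^^ Suc j" by (rule arelD(6)[OF arel_relpow[OF R(1)[OF w]]])
    moreover have qc: "q \<in> carrier A" using q(2) by (rule cg_car)
    ultimately have "u \<otimes> inv z \<in> (R w ^^ Suc j) `` M" using sub_one[OF Mp(2)] by (auto simp del: relpow.simps)
    moreover have "(R w ^^ k) `` M \<subseteq> M" for k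
    proof (induction k)
      case (Suc k)
      have "(R w ^^ Suc k) `` M = R w `` ((R w ^^ k) `` M)" by (simp add: relcomp_Image)
      also have "\<dots> \<subseteq> R w `` M" by (rule Image_mono[OF order_refl Suc])
      finally show ?case using TM(1)[OF w] by (rule order_trans)
    qed simp
    ultimately have uz: "u \<otimes> inv z \<in> M" by blast
    have "cg M ((p w ^^ Suc i) x) u" "cg M ((p w ^^ Suc j) x) z" using ppow[OF w x q(2)] u z by blast+
    moreover have "cg M u z" using uz cg_car(2)[OF calculation(1)] cg_car(2)[OF calculation(2)] by (simp add: cg_def)
    ultimately have "cg M ((p w ^^ Suc i) x) ((p w ^^ Suc j) x)" using cg_trans[OF Mp(2)] cg_sym[OF Mp(2)] by blast
    then have main: "cg M ((p w ^^ Suc i) x) ((p w ^^ Suc i) ((p w ^^ (j - i)) x))"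
      using \<open>Suc j = Suc i + (j - i)\<close> by (metis comp_apply funpow_add)
    have inj1: "cg M y y'" if y: "y \<in> S" "y' \<in> S" "cg M (p w y) (p w y')" for y y'
    proof -
      obtain q where q: "cg M y q" "(q, p w y) \<in> R w" using pp[OF w y(1)] unfolding T_def by blast
      obtain q' where q': "cg M y' q'" "(q', p w y') \<in> R w" using pp[OF w y(2)] unfolding T_def by blast
      have "cg M q q'" by (rule inj[OF w q(2) q'(2) y(3)])
      then show ?thesis using cg_trans[OF Mp(2)] cg_sym[OF Mp(2)] q(1) q'(1) by blast
    qed
    have "cg M y y'" if "y \<in> S" "y' \<in> S" "cg M ((p w ^^ k) y) ((p w ^^ k) y')" for k y y'
      using that(3)
    proof (induction k)
      case (Suc k)
      then show ?case using inj1[OF fS[OF that(1)] fS[OF that(2)], of k k] by simp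
    qed simp
    from this[OF x fS[OF x] main] show ?thesis by (rule cg_sym[OF Mp(2)])
  qed
  have "\<not> S \<subseteq> M"
  proof
    assume "S \<subseteq> M"
    then have "alm H M" using alm_subset_right[OF Sp(5)] sub_sub[OF Mp(2)] by blast
    then have "alm H Q" using Mp(5) by (rule alm_trans[OF _ _ Oc])
    then show False using OH(2) by blast
  qed
  from that[OF Mp(2) Sp(2) this pS pcong phom padd fin] show thesis .
qed

section \<open>Kernels and images in a minimal configuration\<close>

text \<open>The exchange-free half of dimension theory: if every \<open>d + 1\<close> elements are dependent, then any finite
set depends on at most \<open>d\<close> of its elements. It is applied to kernels ordered by intersection and to
images ordered by sum.\<close>

lemma dep_reduce:
  fixes dep :: "'b => 'b set => bool"
  assumes rf: "\<And>v V. finite V ==> V \<subseteq> U ==> v \<in> V ==> dep v V"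
    and tr: "\<And>u V W. finite V ==> finite W ==> V \<subseteq> U ==> W \<subseteq> U ==> (\<And>v. v \<in> V ==> dep v W) ==> dep u V ==> dep u W"
    and d: "\<And>V. V \<subseteq> U ==> finite V ==> card V = Suc d ==> \<exists>v\<in>V. dep v (V - {v})"
  shows "finite V ==> V \<subseteq> U ==> \<exists>W\<subseteq>V. card W \<le> d \<and> (\<forall>v\<in>V. dep v W)"
proof (induction "card V" arbitrary: V rule: less_induct)
  case less
  show ?case
  proof (cases "card V \<le> d")
    case True then show ?thesis using rf less.prems by blast
  next
    case False
    then have "Suc d \<le> card V" by simp
    then obtain V1 where V1: "V1 \<subseteq> V" "card V1 = Suc d" "finite V1" using obtain_subset_with_card_n by metis
    then obtain v where v: "v \<in> V1" "dep v (V1 - {v})" using d[of V1] less.prems by blast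
    have f: "finite (V1 - {v})" "finite (V - {v})" "V1 - {v} \<subseteq> U" "V - {v} \<subseteq> U" using V1 less.prems by auto
    have dv: "dep v (V - {v})"
    proof (rule tr[OF f _ v(2)])
      fix u assume "u \<in> V1 - {v}" then show "dep u (V - {v})" using V1 by (intro rf f) auto
    qed
    have "card (V - {v}) < card V" using v V1 less.prems by (intro psubset_card_mono) auto
    from less.hyps[OF this f(2,4)] obtain W where W: "W \<subseteq> V - {v}" "card W \<le> d" "\<forall>u\<in>V - {v}. dep u W" by blast
    have "dep v W" by (rule tr[OF f(2) finite_subset[OF W(1) f(2)] f(4) order_trans[OF W(1) f(4)] _ dv]) (use W(3) in blast)
    then show ?thesis using W by (intro exI[of _ W]) auto
  qed
qed

context comm_group
begin

lemma alm_INT: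
  assumes "alm B C" "subgroup C G" "subgroup B G"
  shows "finite V ==> (\<And>v. v \<in> V ==> alm B (f v)) ==> (\<And>v. v \<in> V ==> subgroup (f v) G) ==>
     alm B (C \<inter> (\<Inter>v\<in>V. f v)) \<and> subgroup (C \<inter> (\<Inter>v\<in>V. f v)) G"
proof (induction V rule: finite_induct)
  case empty then show ?case using assms by simp
next
  case (insert v V)
  have e: "C \<inter> (\<Inter>v\<in>insert v V. f v) = f v \<inter> (C \<inter> (\<Inter>v\<in>V. f v))" by blast
  have IH: "alm B (C \<inter> (\<Inter>v\<in>V. f v))" "subgroup (C \<inter> (\<Inter>v\<in>V. f v)) G" using insert by auto
  show ?case unfolding e by (intro conjI alm_inter sub_int IH insert.prems sub_sub assms) auto
qed

lemma mult_least: "subgroup Z G ==> B \<subseteq> Z ==> C \<subseteq> Z ==> B <#> C \<subseteq> Z"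
  using mult_idem[of Z] mono_set_mult[of B Z C Z G] by simp

lemma greedy_sep:
  assumes "subgroup P G" "finite RR" "RR \<noteq> {}" "\<And>R. R \<in> RR ==> subgroup R G \<and> \<not> alm P R"
  shows "\<exists>V. finite V \<and> V \<subseteq> P \<and> card V = n \<and> (\<forall>R\<in>RR. sep V R)"
proof (induction n)
  case 0 show ?case by (intro exI[of _ "{}"]) (simp add: sep_def)
next
  case (Suc n)
  then obtain V where V: "finite V" "V \<subseteq> P" "card V = n" "\<forall>R\<in>RR. sep V R" by blast
  have Vc: "V \<subseteq> carrier G" using V(2) sub_sub[OF assms(1)] by blast
  have "small P (\<Union>R\<in>RR. V <#> R)"
  proof (rule small_UN[OF assms(2)])
    fix R assume "R \<in> RR"
    then show "small P (V <#> R)" using assms(4) by (intro small_cover[OF V(1) Vc order_refl]) auto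
  qed
  then have "\<not> P \<subseteq> (\<Union>R\<in>RR. V <#> R)" using not_small[OF assms(1)] small_subset by blast
  then obtain e where e: "e \<in> P" "\<And>R. R \<in> RR ==> e \<notin> V <#> R" by blast
  have ec: "e \<in> carrier G" using e(1) sub_car[OF assms(1)] by blast
  have n1: "e \<otimes> inv v \<notin> R" if "R \<in> RR" "v \<in> V" for R v
  proof
    assume a: "e \<otimes> inv v \<in> R"
    have vc: "v \<in> carrier G" using that Vc by blast
    have "e = v \<otimes> (e \<otimes> inv v)" using ec vc by (simp add: m_comm[of v] m_assoc)
    then have "e \<in> V <#> R" using that(2) a by (rule set_multI[rotated 2])
    then show False using e(2)[OF that(1)] by blast
  qed
  have n2: "v \<otimes> inv e \<notin> R" if "R \<in> RR" "v \<in> V" for R v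
  proof
    assume a: "v \<otimes> inv e \<in> R"
    have vc: "v \<in> carrier G" using that Vc by blast
    have "inv (v \<otimes> inv e) \<in> R" using a assms(4) that sub_inv by blast
    moreover have "inv (v \<otimes> inv e) = e \<otimes> inv v" using ec vc by (simp add: inv_mult m_comm)
    ultimately show False using n1[OF that] by simp
  qed
  have "e \<notin> V"
  proof
    assume "e \<in> V"
    moreover obtain R where R: "R \<in> RR" using assms(3) by blast
    ultimately have "e \<otimes> inv e \<notin> R" using n1 by blast
    then show False using ec sub_one assms(4)[OF R] by simp
  qed
  then show ?case using V e(1) n1 n2 unfolding sep_def by (intro exI[of _ "insert e V"]) auto
qed

lemma finprod_sub:
  assumes "subgroup E G" shows "finite I ==> (\<And>i. i \<in> I ==> v i \<in> E) ==> finprod G v I \<in> E"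
proof (induction I rule: finite_induct)
  case empty then show ?case using sub_one[OF assms] by simp
next
  case (insert i I)
  then show ?case using sub_car[OF assms] sub_m[OF assms] by (subst finprod_insert) auto
qed

text \<open>Choose the elements one after the other, each outside the finitely many cosets of \<open>P\<close> that would
make a new subsum fall into \<open>P\<close>.\<close>

lemma indep_sums:
  assumes E: "subgroup E G" and P: "subgroup P G" and na: "\<not> alm E P"
  shows "\<exists>v::nat => 'a. (\<forall>i<k. v i \<in> E) \<and> (\<forall>I. I \<subseteq> {..<k} --> I \<noteq> {} --> finprod G v I \<notin> P)"
proof (induction k)
  case 0 show ?case by auto
next
  case (Suc k)
  then obtain v where v: "\<And>i. i < k ==> v i \<in> E" "\<And>I. I \<subseteq> {..<k} ==> I \<noteq> {} ==> finprod G v I \<notin> P" by blast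
  have vc: "v i \<in> carrier G" if "i < k" for i using sub_car[OF E v(1)[OF that]] .
  have fc: "finprod G v I \<in> carrier G" if "I \<subseteq> {..<k}" for I
    using that by (intro sub_car[OF E] finprod_sub[OF E] v(1) finite_subset[OF that]) auto
  define F where "F = (\<lambda>I. inv (finprod G v I)) ` Pow {..<k}"
  have "finite F" "F \<subseteq> carrier G" unfolding F_def using fc by auto
  then have "\<not> E \<subseteq> F <#> P" using na unfolding alm_def by blast
  then obtain e where e: "e \<in> E" "e \<notin> F <#> P" by blast
  have ec: "e \<in> carrier G" using sub_car[OF E e(1)] .
  define v' where "v' = v(k := e)"
  have "finprod G v' I \<notin> P" if I: "I \<subseteq> {..<Suc k}" "I \<noteq> {}" for I
  proof (cases "k \<in> I")
    case False
    then have I': "I \<subseteq> {..<k}" using I by (auto simp: less_Suc_eq)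
    then have "finprod G v' I = finprod G v I"
      by (intro finprod_cong' refl) (use I' vc in \<open>auto simp: v'_def\<close>)
    then show ?thesis using v(2)[OF I' I(2)] by simp
  next
    case True
    define I' where "I' = I - {k}"
    have I': "I' \<subseteq> {..<k}" "I = insert k I'" "k \<notin> I'" "finite I'" using True I finite_subset[of I "{..<Suc k}"] unfolding I'_def by (auto simp: less_Suc_eq)
    define f where "f = finprod G v I'"
    have f: "f \<in> carrier G" unfolding f_def by (rule fc[OF I'(1)])
    have "finprod G v' I' = f" unfolding f_def
      by (intro finprod_cong' refl) (use I' vc in \<open>auto simp: v'_def\<close>)
    moreover have "finprod G v' (insert k I') = v' k \<otimes> finprod G v' I'"
      by (rule finprod_insert[OF I'(4,3)]) (use I'(1) vc ec in \<open>auto simp: v'_def\<close>)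
    ultimately have eq: "finprod G v' I = e \<otimes> f" using I'(2) by (simp add: v'_def)
    show ?thesis
    proof
      assume "finprod G v' I \<in> P"
      then have "e \<otimes> f \<in> P" using eq by simp
      moreover have "inv f \<in> F" unfolding F_def f_def using I'(1) by blast
      moreover have "e = inv f \<otimes> (e \<otimes> f)" using ec f by (simp add: m_comm[of e f] m_assoc[symmetric])
      ultimately have "e \<in> F <#> P" using set_multI[of "inv f" F "e \<otimes> f" P e] by blast
      then show False using e(2) by blast
    qed
  qed
  moreover have "\<forall>i<Suc k. v' i \<in> E" using v(1) e(1) unfolding v'_def by (auto simp: less_Suc_eq)
  ultimately show ?case by blast
qed

end

context oligo
begin

lemma dfn_common:
  assumes "finite XX" "\<And>X. X \<in> XX ==> dfn X"
  obtains c where "set c \<subseteq> carrier A" "\<And>X. X \<in> XX ==> invs c X"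
proof -
  have "\<exists>c. set c \<subseteq> carrier A \<and> (\<forall>X\<in>XX. invs c X)" using assms
  proof (induction XX rule: finite_induct)
    case empty then show ?case by (intro exI[of _ "[]"]) simp
  next
    case (insert X XX)
    then obtain c where c: "set c \<subseteq> carrier A" "\<forall>X\<in>XX. invs c X" by auto
    obtain d where d: "set d \<subseteq> carrier A" "invs d X" using insert.prems[of X] unfolding dfn_def by auto
    have "\<forall>Y\<in>insert X XX. invs (c @ d) Y" using c d invs_mono[of c _ "c @ d"] invs_mono[of d X "c @ d"] by auto
    then show ?case using c d by (intro exI[of _ "c @ d"]) auto
  qed
  then show thesis using that by blast
qed

lemma dfn_image:
  assumes "arel R" "set c \<subseteq> carrier A" "invr c R" "dfn B" shows "dfn (R `` B)"
proof -
  obtain d where d: "set d \<subseteq> carrier A" "invs d B" using assms(4) by (rule dfnE)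
  have "invs (c @ d) (R `` B)" by (intro invs_rel_image invr_mono[OF assms(3)] invs_mono[OF d(2)]) auto
  then show ?thesis unfolding dfn_def using sub_image[OF assms(1) dfn_sub[OF assms(4)]] d assms(2) by (metis le_sup_iff set_append)
qed

lemma tame_card:
  assumes "tame T"
  shows "\<exists>d. \<forall>V (D :: 'i => 'a set). card V = Suc d --> (\<forall>v\<in>V. dfn (D v)) -->
     (\<exists>v\<in>V. alm (T \<inter> (\<Inter>w\<in>V - {v}. D w)) (D v))"
proof -
  obtain d :: nat where d: "\<And>D. (\<forall>i\<le>d. dfn (D i)) ==> (\<exists>i\<le>d. alm (T \<inter> (\<Inter>j\<in>{..d}-{i}. D j)) (D i))"
    using assms unfolding tame_def by blast
  have "\<exists>v\<in>V. alm (T \<inter> (\<Inter>w\<in>V - {v}. D w)) (D v)"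
    if V: "card V = Suc d" "\<And>v. v \<in> V ==> dfn (D v)" for V and D :: "'i => 'a set"
  proof -
    have "finite V" using V(1) card.infinite by fastforce
    then obtain e where e: "bij_betw e {0..<card V} V" using ex_bij_betw_nat_finite by blast
    have "{0..<card V} = {..d}" using V(1) by auto
    then have e: "bij_betw e {..d} V" using e by simp
    have eV: "e i \<in> V" if "i \<le> d" for i using e that unfolding bij_betw_def by auto
    have "\<forall>i\<le>d. dfn (D (e i))" using V(2) eV by blast
    from d[OF this] obtain i where i: "i \<le> d" "alm (T \<inter> (\<Inter>j\<in>{..d}-{i}. D (e j))) (D (e i))" by blast
    have "V - {e i} = e ` ({..d} - {i})" using e i(1) unfolding bij_betw_def inj_on_def by auto
    then have "(\<Inter>w\<in>V - {e i}. D w) = (\<Inter>j\<in>{..d}-{i}. D (e j))" by simp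
    then have "alm (T \<inter> (\<Inter>w\<in>V - {e i}. D w)) (D (e i))" using i(2) by simp
    then show ?thesis using eV[OF i(1)] by (rule bexI)
  qed
  then show ?thesis by blast
qed

end

context qmin
begin

lemma K0K: "K0 \<subseteq> K" using K01 d1 by blast

lemma G1G: "g \<in> G1 ==> g \<in> G" using d1 by blast

lemma K0K1: "alm K0 K1" by (intro alm_subset K01 sub_sub s1)

lemma dfn_gr: assumes "y \<in> G" "dfn X" shows "dfn (gr y `` X)"
  by (rule dfn_image[OF arel_gr[OF assms(1)] _ invr_gr[OF assms(1), of "[y]"] assms(2)]) (use assms cG in auto)

lemma dfn_gr_pre: assumes "y \<in> G" "dfn X" shows "dfn ((gr y)\<inverse> `` X)"
  by (rule dfn_image[OF arel_converse[OF arel_gr[OF assms(1)]] _ invr_converse[OF invr_gr[OF assms(1), of "[y]"]] assms(2)]) (use assms cG in auto)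

text \<open>The kernel of \<open>lam y\<close> modulo \<open>K0\<close>.\<close>

definition kr :: "'a => 'a set" where "kr y = H1 \<inter> (gr y)\<inverse> `` K0"

lemma kr_iff: "h \<in> kr y \<longleftrightarrow> h \<in> H1 \<and> (\<exists>k\<in>K0. lam y h = Some k)"
  unfolding kr_def gr_def using d1(6) by auto

lemma kr_H1: "kr y \<subseteq> H1" unfolding kr_def by blast

lemma dfn_kr: "y \<in> G ==> dfn (kr y)" unfolding kr_def by (intro dfn_Int d1 dfn_gr_pre)

lemma sub_kr: "y \<in> G ==> subgroup (kr y) A" by (rule dfn_sub[OF dfn_kr])

lemma alm_H1_dom: assumes "y \<in> G" "B \<subseteq> H1" shows "alm B (Domain (gr y))"
proof -
  have "B \<subseteq> H" using assms d1 by blast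
  then show ?thesis using alm_subset_left[OF gr_dom[OF assms(1)]] by blast
qed

lemma kr_alm:
  assumes y: "y \<in> G" and B: "subgroup B A" "B \<subseteq> H1" shows "alm (gr y `` B) K0 \<longleftrightarrow> alm B (kr y)"
proof
  assume "alm (gr y `` B) K0"
  then have 1: "alm B ((gr y)\<inverse> `` K0)" by (rule alm_preimage[OF arel_gr[OF y] _ alm_H1_dom[OF y B(2)] B(1) s1(4)])
  show "alm B (kr y)" unfolding kr_def
    by (intro alm_inter[OF alm_subset[OF B(2) dfn_car[OF d1(2)]] 1] B s1 sub_image arel_converse arel_gr y sub_sub)
next
  assume "alm B (kr y)"
  then have "alm (gr y `` B) (gr y `` kr y)" by (rule alm_image[OF arel_gr[OF y] _ sub_kr[OF y] B(1)])
  moreover have "gr y `` kr y \<subseteq> K0" unfolding kr_def gr_def by auto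
  ultimately show "alm (gr y `` B) K0" using alm_subset_right sub_sub[OF s1(4)] by blast
qed

lemma res_kr: "y \<in> G ==> subgroup B A ==> B \<subseteq> H1 ==> y \<in> res K0 B \<longleftrightarrow> alm B (kr y)"
  unfolding res_def using kr_alm by blast

lemma OH_kr: assumes "y \<in> G1" shows "alm OH (kr y)"
  using res_kr[OF G1G[OF assms] dfn_sub[OF dOH] OH_sub] GK0 assms unfolding OH_def by blast

definition Kc :: "('a \<times> 'a) set" where
  "Kc = {(k, k'). k \<in> carrier A \<and> k' \<in> carrier A \<and> k \<otimes> inv k' \<in> K0}"

text \<open>The relation \<open>\<lambda>\<^sub>y x = \<lambda>\<^sub>a x'\<close> modulo \<open>K0\<close>, that is, \<open>\<lambda>\<^sub>a\<^sup>-\<^sup>1 \<circ> \<lambda>\<^sub>y\<close> on \<open>H1\<close>. Exchanging \<open>a\<close> and \<open>y\<close> inverts it.\<close>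

definition TT :: "'a => 'a => ('a \<times> 'a) set" where
  "TT a y = (gr y O Kc O (gr a)\<inverse>) \<inter> H1 \<times> H1"

lemma TT_iff: assumes "a \<in> G" "y \<in> G"
  shows "(x, x') \<in> TT a y \<longleftrightarrow> x \<in> H1 \<and> x' \<in> H1 \<and> (\<exists>k k'. lam y x = Some k \<and> lam a x' = Some k' \<and> k \<otimes> inv k' \<in> K0)"
proof -
  have kc: "k \<in> carrier A" if "g \<in> G" "h \<in> H1" "lam g h = Some k" for g h k
  proof -
    have "h \<in> H" using that(2) d1(6) by blast
    then show ?thesis using lamK[OF that(1) _ that(3)] cK by blast
  qed
  show ?thesis unfolding TT_def Kc_def gr_def relcomp_unfold using kc[OF assms(1)] kc[OF assms(2)] d1(6) by auto
qed

lemma TT_H1: "TT a y \<subseteq> H1 \<times> H1" unfolding TT_def by blast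

lemma arel_Kc: "arel Kc" unfolding arel_def
proof (intro conjI allI impI)
  show "Kc \<subseteq> carrier A \<times> carrier A" "(\<one>, \<one>) \<in> Kc" unfolding Kc_def using sub_one[OF s1(4)] by auto
  show "(k \<otimes> l, k' \<otimes> l') \<in> Kc" if "(k, k') \<in> Kc" "(l, l') \<in> Kc" for k k' l l'
  proof -
    have c: "k \<in> carrier A" "k' \<in> carrier A" "l \<in> carrier A" "l' \<in> carrier A" using that unfolding Kc_def by auto
    have "(k \<otimes> l) \<otimes> inv (k' \<otimes> l') = (k \<otimes> inv k') \<otimes> (l \<otimes> inv l')" using c by (simp add: inv_mult m_ac)
    then show ?thesis using that sub_m[OF s1(4)] c unfolding Kc_def by simp
  qed
  show "(inv k, inv k') \<in> Kc" if "(k, k') \<in> Kc" for k k'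
  proof -
    have c: "k \<in> carrier A" "k' \<in> carrier A" using that unfolding Kc_def by auto
    have "inv k \<otimes> inv (inv k') = inv (k \<otimes> inv k')" using c by (simp add: inv_mult)
    then show ?thesis using that sub_inv[OF s1(4)] c unfolding Kc_def by simp
  qed
qed

lemma arel_TT: "a \<in> G ==> y \<in> G ==> arel (TT a y)"
  unfolding TT_def by (intro arel_Int arel_comp arel_gr arel_Kc arel_converse arel_Times s1)

lemma invr_Kc: assumes "invs c K0" shows "invr c Kc" unfolding invr_def
proof (intro conjI ballI allI impI)
  show "Kc \<subseteq> carrier A \<times> carrier A" using arelD[OF arel_Kc] by auto
  fix \<sigma> k k' assume s: "\<sigma> \<in> stab c" and k: "(k, k') \<in> Kc"
  have c: "k \<in> carrier A" "k' \<in> carrier A" "k \<otimes> inv k' \<in> K0" using k unfolding Kc_def by auto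
  note sg = stab_sub[OF s]
  have "\<sigma> (k \<otimes> inv k') \<in> K0" using assms s c(3) unfolding invs_def by blast
  then show "(\<sigma> k, \<sigma> k') \<in> Kc" unfolding Kc_def using c \<Gamma>_mult[OF sg, of k "inv k'"] \<Gamma>_m_inv[OF sg, of k'] \<Gamma>_closed[OF sg] by simp
qed

lemma invr_TT: "a \<in> G ==> y \<in> G ==> a \<in> set c ==> y \<in> set c ==> invs c K0 ==> invs c H1 ==> invr c (TT a y)"
  unfolding TT_def by (intro invr_Int invr_comp invr_gr invr_Kc invr_converse invr_Times)

lemma TT_conv: assumes "a \<in> G" "y \<in> G" shows "(TT a y)\<inverse> = TT y a"
proof -
  have "(x', x) \<in> TT y a" if ay: "a \<in> G" "y \<in> G" and h: "(x, x') \<in> TT a y" for a y x x'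
  proof -
    obtain k k' where k: "x \<in> H1" "x' \<in> H1" "lam y x = Some k" "lam a x' = Some k'" "k \<otimes> inv k' \<in> K0"
      using h TT_iff[OF ay] by blast
    have c: "k \<in> carrier A" "k' \<in> carrier A" using k lamK[OF ay(1)] lamK[OF ay(2)] d1(6) cK by blast+
    have "k' \<otimes> inv k = inv (k \<otimes> inv k')" using c by (simp add: inv_mult m_comm)
    then have "k' \<otimes> inv k \<in> K0" using sub_inv[OF s1(4) k(5)] by simp
    then show ?thesis using TT_iff[OF ay(2,1)] k by blast
  qed
  then show ?thesis using assms by auto
qed

lemma TT_image:
  assumes ay: "a \<in> G" "y \<in> G" and B: "subgroup B A" "B \<subseteq> H1"
  shows "TT a y `` B = H1 \<inter> (gr a)\<inverse> `` (gr y `` B <#> K0)"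
proof (intro equalityI subsetI)
  have HH: "h \<in> H" if "h \<in> H1" for h using that d1 by blast
  fix x' assume "x' \<in> TT a y `` B"
  then obtain x k k' where k: "x \<in> B" "x \<in> H1" "x' \<in> H1" "lam y x = Some k" "lam a x' = Some k'" "k \<otimes> inv k' \<in> K0"
    using TT_iff[OF ay] by blast
  have c: "k \<in> carrier A" "k' \<in> carrier A" using k lamK[OF ay(1)] lamK[OF ay(2)] HH cK by blast+
  have z: "inv (k \<otimes> inv k') \<in> K0" by (rule sub_inv[OF s1(4) k(6)])
  have e: "k' = k \<otimes> inv (k \<otimes> inv k')" using c by (simp add: inv_mult m_assoc[symmetric])
  have "k \<in> gr y `` B" using k HH unfolding gr_def by blast
  from set_multI[OF this z e] have "k' \<in> gr y `` B <#> K0" .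
  moreover have "(x', k') \<in> gr a" using k HH unfolding gr_def by blast
  ultimately show "x' \<in> H1 \<inter> (gr a)\<inverse> `` (gr y `` B <#> K0)" using k by blast
next
  fix x' assume "x' \<in> H1 \<inter> (gr a)\<inverse> `` (gr y `` B <#> K0)"
  then obtain k' where k': "x' \<in> H1" "(x', k') \<in> gr a" "k' \<in> gr y `` B <#> K0" by blast
  obtain k z where k: "k \<in> gr y `` B" "z \<in> K0" "k' = k \<otimes> z" using set_multE[OF k'(3)] by blast
  obtain x where x: "x \<in> B" "x \<in> H" "lam y x = Some k" using k(1) unfolding gr_def by blast
  have c: "k \<in> carrier A" "z \<in> carrier A" using lamK[OF ay(2) x(2,3)] cK k(2) sub_car[OF s1(4)] by auto
  have "k \<otimes> inv k' = inv z" using c k(3) by (simp add: inv_mult m_assoc[symmetric])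
  then have "k \<otimes> inv k' \<in> K0" using sub_inv[OF s1(4) k(2)] by simp
  moreover have "lam a x' = Some k'" using k'(2) unfolding gr_def by blast
  moreover have "x \<in> H1" using x(1) B(2) by blast
  ultimately have "(x, x') \<in> TT a y" using TT_iff[OF ay] x k'(1) by blast
  then show "x' \<in> TT a y `` B" using x(1) by blast
qed

lemma TT_small:
  assumes ay: "a \<in> G" "y \<in> G" and B: "subgroup B A" "B \<subseteq> H1" and sm: "alm B (kr y)"
  shows "alm (TT a y `` B) (kr a)"
proof -
  have 1: "alm (gr y `` B <#> K0) K0" using sm kr_alm[OF ay(2) B] by (intro alm_mult alm_refl s1) blast
  have 2: "subgroup (gr y `` B <#> K0) A" by (intro sub_mult sub_gr ay B s1)
  have 3: "alm ((gr a)\<inverse> `` (gr y `` B <#> K0)) ((gr a)\<inverse> `` K0)"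
    by (rule alm_image[OF arel_converse[OF arel_gr[OF ay(1)]] 1 s1(4) 2])
  have sa: "subgroup ((gr a)\<inverse> `` Z) A" if "subgroup Z A" for Z by (intro sub_image arel_converse arel_gr ay that)
  show ?thesis unfolding TT_image[OF ay B] kr_def
    using alm_inter_mono[OF 3 sa[OF s1(4)] s1(2) sa[OF 2]] by (simp add: Int_commute)
qed

lemma TT_large:
  assumes ay: "a \<in> G" "y \<in> G" and B: "subgroup B A" "B \<subseteq> H1" and C: "subgroup C A" "C \<subseteq> H1"
    and lg: "alm (gr a `` C) (gr y `` B <#> K0)"
  shows "alm C (TT a y `` B)"
proof -
  have 2: "subgroup (gr y `` B <#> K0) A" by (intro sub_mult sub_gr ay B s1)
  have "alm C ((gr a)\<inverse> `` (gr y `` B <#> K0))"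
    by (rule alm_preimage[OF arel_gr[OF ay(1)] lg alm_H1_dom[OF ay(1) C(2)] C(1) 2])
  from alm_inter[OF alm_subset[OF C(2) dfn_car[OF d1(2)]] this s1(2) sub_image[OF arel_converse[OF arel_gr[OF ay(1)]] 2] sub_sub[OF C(1)]]
  show ?thesis unfolding TT_image[OF ay B] .
qed

lemma dfn_bot: "dfn Y ==> Y \<subseteq> G1 ==> dfn (H1 \<inter> resl K0 Y)"
  using d1 by (intro dfn_Int dfn_resl) auto

text \<open>The annihilator \<open>X\<close> behaves like a prime: two groups above \<open>X\<close> that are infinite over it meet in a
group infinite over it. Otherwise \<open>P1\<close> would put \<open>T\<close> almost into \<open>S\<close>, hence into their intersection.\<close>

lemma bottom:
  assumes dY: "dfn Y" "Y \<subseteq> G1" and X: "X = H1 \<inter> resl K0 Y"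
    and d: "dfn S" "dfn T" and sub: "S \<subseteq> H1" "T \<subseteq> H1"
    and a: "alm X S" "alm X T" "\<not> alm S X" "\<not> alm T X"
  shows "\<not> alm (S \<inter> T) X"
proof
  assume st: "alm (S \<inter> T) X"
  have YG: "Y \<subseteq> G" using dY d1 by blast
  have sr: "resl K0 Y \<subseteq> carrier A" using resl_H cH by blast
  have dX: "dfn X" unfolding X by (rule dfn_bot[OF dY])
  note s = d[THEN dfn_sub]
  have np: "\<not> pr Y S K0"
  proof
    assume "pr Y S K0"
    then have "alm S (resl K0 Y)" using pr_flip_iff[OF dY(1) d(1) d1(4) YG] sub d1 by blast
    from alm_inter[OF alm_subset[OF sub(1) dfn_car[OF d1(2)]] this s1(2) dfn_sub[OF dfn_resl[OF d1(4) dY(1) YG]] dfn_car[OF d(1)]]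
    have "alm S X" unfolding X .
    then show False using a by blast
  qed
  have "OH \<subseteq> X" unfolding OH_def X
    using resl_mono_Y[OF alm_subset[OF dY(2) dfn_car[OF d1(1)]] s1(1) dfn_sub[OF dY(1)] s1(4)] by blast
  then have OX: "alm OH X" by (rule alm_subset[OF _ dfn_car[OF dX]])
  have "alm T S"
  proof (rule P1[OF d dY(1) d1(4) sub dY(2) alm_refl[OF s1(4)] np])
    show "alm (S \<inter> T) (resl K0 Y)" by (rule alm_subset_right[OF st _ sr]) (auto simp: X)
    show "alm OH (S \<inter> T)"
      by (intro alm_inter alm_trans[OF OX a(1)] alm_trans[OF OX a(2)] s sub_sub dfn_sub[OF dOH])
  qed
  then have "alm T (S \<inter> T)" by (intro alm_inter alm_refl s sub_sub)
  then have "alm T X" using st by (rule alm_trans[OF _ _ dfn_car[OF dX]])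
  then show False using a by blast
qed

text \<open>By \<open>P1\<close> the kernel and the annihilator are comparable, and the kernel cannot be the larger one because
\<open>a\<close> does not annihilate \<open>X\<close>.\<close>

lemma ker_comparable:
  assumes dY: "dfn Y" "Y \<subseteq> G1" and X: "X = H1 \<inter> resl K0 Y" and a: "a \<in> G1" "a \<notin> res K0 X"
  shows "alm (kr a) X"
proof (rule ccontr)
  assume na: "\<not> alm (kr a) X"
  have YG: "Y \<subseteq> G" using dY d1 by blast
  have sr: "resl K0 Y \<subseteq> carrier A" using resl_H cH by blast
  have dX: "dfn X" unfolding X by (rule dfn_bot[OF dY])
  have XH: "X \<subseteq> H1" unfolding X by blast
  note da = dfn_kr[OF G1G[OF a(1)]]
  have np: "\<not> pr Y (kr a) K0"
  proof
    assume "pr Y (kr a) K0"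
    then have "alm (kr a) (resl K0 Y)" using pr_flip_iff[OF dY(1) da d1(4) YG] kr_H1 d1 by blast
    from alm_inter[OF alm_subset[OF kr_H1 dfn_car[OF d1(2)]] this s1(2) dfn_sub[OF dfn_resl[OF d1(4) dY(1) YG]] dfn_car[OF da]]
    have "alm (kr a) X" unfolding X .
    then show False using na by blast
  qed
  have "OH \<subseteq> X" unfolding OH_def X
    using resl_mono_Y[OF alm_subset[OF dY(2) dfn_car[OF d1(1)]] s1(1) dfn_sub[OF dY(1)] s1(4)] by blast
  then have OX: "alm OH X" by (rule alm_subset[OF _ dfn_car[OF dX]])
  have "alm X (kr a)"
  proof (rule P1[OF da dX dY(1) d1(4) kr_H1 XH dY(2) alm_refl[OF s1(4)] np])
    show "alm (kr a \<inter> X) (resl K0 Y)" by (rule alm_subset[OF _ sr]) (auto simp: X)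
    show "alm OH (kr a \<inter> X)" by (intro alm_inter OH_kr a OX dfn_sub da dX dfn_car dOH)
  qed
  then have "a \<in> res K0 X" using res_kr[OF G1G[OF a(1)] dfn_sub[OF dX] XH] by blast
  then show False using a by blast
qed

text \<open>The sum of the images \<open>\<lambda>\<^sub>v[X]\<close> for \<open>v \<in> W\<close>, taken together with \<open>K0\<close>. Defined as an
intersection, it makes sense for every set \<open>W\<close>.\<close>

definition Sm :: "'a set => 'a set => 'a set" where
  "Sm X W = \<Inter>{Z. subgroup Z A \<and> K0 \<subseteq> Z \<and> (\<forall>v\<in>W. gr v `` X \<subseteq> Z)}"

lemma Sm_least: "subgroup Z A ==> K0 \<subseteq> Z ==> (\<And>v. v \<in> W ==> gr v `` X \<subseteq> Z) ==> Sm X W \<subseteq> Z"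
  unfolding Sm_def by blast

lemma Sm_K0: "K0 \<subseteq> Sm X W" unfolding Sm_def by blast

lemma Sm_mem: "v \<in> W ==> gr v `` X \<subseteq> Sm X W" unfolding Sm_def by blast

lemma Sm_mono: "W \<subseteq> W' ==> Sm X W \<subseteq> Sm X W'" unfolding Sm_def by blast

lemma Sm_K: "W \<subseteq> G1 ==> Sm X W \<subseteq> K"
  by (rule Sm_least[OF sK K0K]) (use gr_K G1G in blast)

lemma sub_Sm: assumes "W \<subseteq> G1" shows "subgroup (Sm X W) A"
proof (rule subgroupI')
  show "Sm X W \<subseteq> carrier A" using Sm_K[OF assms] cK by blast
  show "\<one> \<in> Sm X W" unfolding Sm_def using sub_one by blast
  show "x \<otimes> y \<in> Sm X W" if "x \<in> Sm X W" "y \<in> Sm X W" for x y using that sub_m unfolding Sm_def by blast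
  show "inv x \<in> Sm X W" if "x \<in> Sm X W" for x using that sub_inv unfolding Sm_def by blast
qed

lemma Sm_empty: "Sm X {} = K0" by (rule equalityI[OF Sm_least[OF s1(4) order_refl] Sm_K0]) simp

lemma sub_Z: "v \<in> G1 ==> subgroup X A ==> subgroup (gr v `` X <#> K0) A"
  by (intro sub_mult sub_gr G1G s1)

lemma Sm_insert:
  assumes "W \<subseteq> G1" "v \<in> G1" "subgroup X A"
  shows "Sm X (insert v W) = (gr v `` X <#> K0) <#> Sm X W"
proof (rule equalityI)
  have sg: "subgroup (gr v `` X) A" by (rule sub_gr[OF G1G[OF assms(2)] assms(3)])
  have vW: "insert v W \<subseteq> G1" using assms by blast
  note sW = sub_Sm[OF assms(1), of X]
  note sv = sub_Z[OF assms(2,3)]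
  have 1: "Sm X W \<subseteq> (gr v `` X <#> K0) <#> Sm X W" by (rule sub_right[OF sv sW])
  have 2: "gr v `` X \<subseteq> (gr v `` X <#> K0) <#> Sm X W" using sub_left[OF sg s1(4)] sub_left[OF sv sW] by blast
  show "Sm X (insert v W) \<subseteq> (gr v `` X <#> K0) <#> Sm X W"
  proof (rule Sm_least)
    show "subgroup ((gr v `` X <#> K0) <#> Sm X W) A" by (rule sub_mult[OF sv sW])
    show "K0 \<subseteq> (gr v `` X <#> K0) <#> Sm X W" by (rule order_trans[OF Sm_K0 1])
    show "gr u `` X \<subseteq> (gr v `` X <#> K0) <#> Sm X W" if "u \<in> insert v W" for u
      using that 2 order_trans[OF Sm_mem 1, of u] by blast
  qed
  show "(gr v `` X <#> K0) <#> Sm X W \<subseteq> Sm X (insert v W)"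
    by (intro mult_least sub_Sm vW Sm_K0 Sm_mem Sm_mono) auto
qed

lemma invs_Sm:
  assumes "finite W" "W \<subseteq> G1" "W \<subseteq> set c" "invs c X" "invs c K0" "subgroup X A"
  shows "invs c (Sm X W)" using assms(1-3)
proof (induction W rule: finite_induct)
  case empty then show ?case using assms by (simp add: Sm_empty)
next
  case (insert v W)
  have "v \<in> G" "v \<in> set c" using insert G1G by auto
  then have "invs c ((gr v `` X <#> K0) <#> Sm X W)" using insert by (intro invs_mult invs_rel_image invr_gr assms) auto
  then show ?case using Sm_insert[of W v X] insert assms by simp
qed

lemma alm_Sm:
  assumes "finite W" "W \<subseteq> G1" "subgroup X A" "\<And>v. v \<in> W ==> alm (gr v `` X) Z" "alm K0 Z" "subgroup Z A"
  shows "alm (Sm X W) Z" using assms(1,2,4)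
proof (induction W rule: finite_induct)
  case empty then show ?case using assms by (simp add: Sm_empty)
next
  case (insert v W)
  have 1: "alm (gr v `` X) Z" "alm (Sm X W) Z" using insert by auto
  have "alm ((gr v `` X <#> K0) <#> Sm X W) Z" by (intro alm_mult 1 assms(5,6))
  then show ?case using Sm_insert[of W v X] insert assms by simp
qed

lemma gr_K1: assumes "v \<in> G1" "dfn X" "X \<subseteq> H1" shows "alm (gr v `` X) K1"
proof -
  have "alm (gr v `` H1) K1" using assms(1) GK1 unfolding res_def by blast
  moreover have "gr v `` X \<subseteq> gr v `` H1" using assms(3) by blast
  ultimately show ?thesis by (rule alm_subset_left)
qed

lemma dfn_Z: "v \<in> G1 ==> dfn X ==> dfn (gr v `` X <#> K0)" by (intro dfn_mult dfn_gr G1G d1)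

lemma dfn_Sm: assumes "finite W" "W \<subseteq> G1" "dfn X" shows "dfn (Sm X W)"
proof -
  obtain c where c: "set c \<subseteq> carrier A" "invs c X" "invs c K0" using dfn_pair[OF assms(3) d1(4)] by metis
  obtain ws where ws: "set ws = W" using finite_list[OF assms(1)] by blast
  have "invs (ws @ c) (Sm X W)"
    by (intro invs_Sm assms invs_mono[OF c(2)] invs_mono[OF c(3)] dfn_sub) (auto simp: ws)
  moreover have "W \<subseteq> carrier A" using assms(2) dfn_car[OF d1(1)] by blast
  ultimately show ?thesis unfolding dfn_def using sub_Sm[OF assms(2)] c(1) ws by (metis le_sup_iff set_append)
qed

lemma Z_K: "v \<in> G1 ==> gr v `` X <#> K0 \<subseteq> K" by (intro mult_least sK gr_K G1G K0K)

lemma Z_K0: "v \<in> G1 ==> dfn X ==> alm K0 (gr v `` X <#> K0)"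
  by (intro alm_subset sub_right sub_sub sub_Z dfn_sub sub_gr G1G s1)

lemma Z_K1: "v \<in> G1 ==> dfn X ==> X \<subseteq> H1 ==> alm (gr v `` X <#> K0) K1"
  by (intro alm_mult gr_K1 K0K1 s1)

lemma P2_sum:
  assumes "finite W" "W \<noteq> {}" "W \<subseteq> G1" and d: "dfn E" "dfn X" "E \<subseteq> G1" "X \<subseteq> H1"
    and p: "pr E X (Sm X W)"
  shows "\<exists>v\<in>W. pr E X (gr v `` X <#> K0)" using assms(1-3) p
proof (induction W rule: finite_ne_induct)
  case (singleton v)
  have "Sm X {v} = (gr v `` X <#> K0) <#> K0" using Sm_insert[of "{}" v X] singleton dfn_sub[OF d(2)] by (simp add: Sm_empty)
  also have "\<dots> = gr v `` X <#> K0"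
  proof (rule equalityI)
    have v: "v \<in> G1" using singleton by simp
    note sv = sub_Z[OF v dfn_sub[OF d(2)]] and sg = sub_gr[OF G1G[OF v] dfn_sub[OF d(2)]]
    show "(gr v `` X <#> K0) <#> K0 \<subseteq> gr v `` X <#> K0" by (intro mult_least sv order_refl sub_right sg s1)
    show "gr v `` X <#> K0 \<subseteq> (gr v `` X <#> K0) <#> K0" by (rule sub_left[OF sv s1(4)])
  qed
  finally show ?case using singleton by simp
next
  case (insert v W)
  have v: "v \<in> G1" "W \<subseteq> G1" using insert by auto
  have "pr E X ((gr v `` X <#> K0) <#> Sm X W)" using insert.prems Sm_insert[OF v(2,1) dfn_sub[OF d(2)]] by simp
  moreover have "alm ((gr v `` X <#> K0) <#> Sm X W) K1"
    by (intro alm_mult Z_K1 v d alm_Sm insert dfn_sub K0K1 s1 gr_K1) (use v in auto)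
  moreover have "alm K0 (Sm X W)" by (intro alm_subset Sm_K0 sub_sub sub_Sm v)
  ultimately have "pr E X (gr v `` X <#> K0) \<or> pr E X (Sm X W)"
    by (intro P2[OF d(1,2) dfn_Z[OF v(1) d(2)] dfn_Sm[OF insert(1) v(2) d(2)] d(3,4) Z_K[OF v(1)] Sm_K[OF v(2)] Z_K0[OF v(1) d(2)]])
  then show ?case using insert v by blast
qed

text \<open>The dual form of finite burden: applied to the sums with one summand left out, \<open>tame\<close> finds a summand
almost contained in the sum of the others.\<close>

lemma sum_reduce:
  assumes "dfn X"
  shows "\<exists>d. \<forall>V. finite V --> V \<subseteq> G1 --> (\<exists>W\<subseteq>V. card W \<le> d \<and> (\<forall>v\<in>V. alm (gr v `` X) (Sm X W)))"
proof -
  from tame_card[OF tameK] obtain d where d: "\<forall>V (D :: 'a => 'a set). card V = Suc d --> (\<forall>v\<in>V. dfn (D v)) -->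
     (\<exists>v\<in>V. alm (K \<inter> (\<Inter>w\<in>V - {v}. D w)) (D v))" by (rule exE)
  note sX = dfn_sub[OF assms]
  have "\<exists>W\<subseteq>V. card W \<le> d \<and> (\<forall>v\<in>V. alm (gr v `` X) (Sm X W))" if V: "finite V" "V \<subseteq> G1" for V
  proof (rule dep_reduce[OF _ _ _ V])
    show "alm (gr v `` X) (Sm X V)" if "finite V" "V \<subseteq> G1" "v \<in> V" for v V
      by (intro alm_subset Sm_mem sub_sub sub_Sm that)
    show "alm (gr u `` X) (Sm X W)" if h: "finite V" "finite W" "V \<subseteq> G1" "W \<subseteq> G1" "\<And>v. v \<in> V ==> alm (gr v `` X) (Sm X W)" "alm (gr u `` X) (Sm X V)" for u V W
      by (rule alm_trans[OF h(6) alm_Sm[OF h(1,3) sX h(5) alm_subset[OF Sm_K0 sub_sub[OF sub_Sm[OF h(4)]]] sub_Sm[OF h(4)]] sub_sub[OF sub_Sm[OF h(4)]]])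
    show "\<exists>v\<in>V. alm (gr v `` X) (Sm X (V - {v}))" if h: "V \<subseteq> G1" "finite V" "card V = Suc d" for V
    proof -
      have "\<exists>v\<in>V. alm (K \<inter> (\<Inter>w\<in>V - {v}. Sm X (V - {w}))) (Sm X (V - {v}))"
        by (rule d[rule_format, OF h(3)]) (use h assms in \<open>intro dfn_Sm; auto\<close>)
      then obtain v where v: "v \<in> V" "alm (K \<inter> (\<Inter>w\<in>V - {v}. Sm X (V - {w}))) (Sm X (V - {v}))" by blast
      have "gr v `` X \<subseteq> K" using gr_K v(1) h(1) G1G by blast
      moreover have "gr v `` X \<subseteq> Sm X (V - {w})" if "w \<in> V - {v}" for w by (rule Sm_mem) (use v that in auto)
      ultimately have "gr v `` X \<subseteq> K \<inter> (\<Inter>w\<in>V - {v}. Sm X (V - {w}))" by blast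
      then show ?thesis using v alm_subset_left[OF v(2)] by blast
    qed
  qed
  then show ?thesis by blast
qed

text \<open>Suppose that many bad \<open>v\<close> lie in different cosets of \<open>R\<close>. Their images are almost contained in the sum
of boundedly many of them, so all of these \<open>v\<close> lie in the group \<open>E\<close> of elements mapping \<open>X\<close> into that
sum. By primeness \<open>E\<close> maps \<open>X\<close> almost into a single summand, and since its index \<open>v\<close> is bad, \<open>E\<close> is
almost contained in \<open>R\<close>. As \<open>E\<close> depends on boundedly many parameters, this bounds the number of cosets.\<close>

lemma good_small:
  assumes d: "dfn Y" "dfn X" "dfn R" and sub: "Y \<subseteq> G1" "X \<subseteq> H1" and na: "\<not> alm Y R"
  shows "small Y {v \<in> Y. alm (Y \<inter> res (gr v `` X <#> K0) X) R}"
proof -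
  obtain c0 where c0: "set c0 \<subseteq> carrier A" "\<And>Z. Z \<in> {Y, X, R, K0} ==> invs c0 Z"
    using dfn_common[of "{Y, X, R, K0}"] d d1 by auto
  from sum_reduce[OF d(2)] obtain dd where dd: "\<forall>V. finite V --> V \<subseteq> G1 --> (\<exists>W\<subseteq>V. card W \<le> dd \<and> (\<forall>v\<in>V. alm (gr v `` X) (Sm X W)))"
    by (rule exE)
  from index_bound[of "length c0 + Suc dd"] obtain N where N: "\<And>c X Y F. set c \<subseteq> carrier A ==> length c \<le> length c0 + Suc dd ==> invs c X ==> invs c Y ==>
     subgroup X A ==> subgroup Y A ==> alm X Y ==> F \<subseteq> X ==> finite F ==> sep F Y ==> card F \<le> N" by blast
  note s = d[THEN dfn_sub]
  have XH: "X \<subseteq> H" using sub d1 by blast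
  show ?thesis
  proof (rule small_sep[OF s(3) na])
    show "{v \<in> Y. alm (Y \<inter> res (gr v `` X <#> K0) X) R} \<subseteq> carrier A" using dfn_car[OF d(1)] by blast
    fix F assume F: "finite F" "F \<subseteq> {v \<in> Y. alm (Y \<inter> res (gr v `` X <#> K0) X) R}" "sep F R"
    show "card F \<le> N"
    proof (cases "F = {}")
      case False
      then obtain v0 where v0: "v0 \<in> F" by blast
      have FG: "F \<subseteq> Y" "F \<subseteq> G1" using F(2) sub by auto
      obtain W0 where W0: "W0 \<subseteq> F" "card W0 \<le> dd" "\<forall>v\<in>F. alm (gr v `` X) (Sm X W0)" using dd[rule_format, OF F(1) FG(2)] by blast
      define W where "W = insert v0 W0"
      have W: "W \<subseteq> F" "finite W" "W \<noteq> {}" "W \<subseteq> G1" unfolding W_def using v0 W0 F(1) FG finite_subset by auto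
      have cW: "card W \<le> Suc dd" unfolding W_def using W0(2) finite_subset[OF W0(1) F(1)] by (simp add: card_insert_if)
      note dS = dfn_Sm[OF W(2,4) d(2)]
      define E where "E = Y \<inter> res (Sm X W) X"
      have dE: "dfn E" unfolding E_def by (intro dfn_Int d dfn_res dS XH)
      have EY: "E \<subseteq> Y" "E \<subseteq> G1" unfolding E_def using sub by auto
      have FE: "F \<subseteq> E"
      proof
        fix v assume v: "v \<in> F"
        have "alm (gr v `` X) (Sm X W)" using W0(3) v Sm_mono[of W0 W X] alm_subset_right[of _ "Sm X W0" "Sm X W"] sub_sub[OF sub_Sm[OF W(4)]]
          unfolding W_def by blast
        then show "v \<in> E" unfolding E_def res_def using v FG G1G by blast
      qed
      have "pr E X (Sm X W)" unfolding pr_def E_def by (intro alm_subset dfn_car dfn_res dS d XH) blast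
      from P2_sum[OF W(2,3,4) dE d(2) EY(2) sub(2) this] obtain v where v: "v \<in> W" "pr E X (gr v `` X <#> K0)" by blast
      have vG: "v \<in> G1" using v W by blast
      have "alm E (Y \<inter> res (gr v `` X <#> K0) X)"
        by (intro alm_inter alm_subset EY dfn_car d v(2)[unfolded pr_def] s sub_res sub_Z vG XH dE)
      moreover have "alm (Y \<inter> res (gr v `` X <#> K0) X) R" using v(1) W(1) F(2) by blast
      ultimately have ER: "alm E R" by (rule alm_trans[OF _ _ dfn_car[OF d(3)]])
      obtain ws where ws: "set ws = W" "distinct ws" using finite_distinct_list[OF W(2)] by blast
      have lw: "length ws \<le> Suc dd" using cW ws distinct_card by fastforce
      define c where "c = c0 @ ws"
      have cc: "set c \<subseteq> carrier A" unfolding c_def using c0(1) ws(1) W(4) dfn_car[OF d1(1)] by auto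
      have ic: "invs c Z" if "Z \<in> {Y, X, R, K0}" for Z using invs_mono[OF c0(2)[OF that]] unfolding c_def by auto
      have "invs c (Sm X W)" using ws ic s by (intro invs_Sm W) (auto simp: c_def)
      then have "invs c E" unfolding E_def using ic by (intro invs_Int invs_res cc XH) auto
      then show ?thesis using lw ic by (intro N[OF cc _ _ _ dfn_sub[OF dE] s(3) ER FE F(1,3)]) (auto simp: c_def)
    qed simp
  qed
qed

end

section \<open>The contradiction in a minimal configuration\<close>

context qmin
begin

lemma kr_transport: assumes "\<sigma> \<in> stab c" "invs c H1" "invs c K0" "y \<in> G"
  shows "\<sigma> ` kr y \<subseteq> kr (\<sigma> y)"
proof
  fix z assume "z \<in> \<sigma> ` kr y"
  then obtain h k where h: "h \<in> H1" "k \<in> K0" "lam y h = Some k" "z = \<sigma> h" using kr_iff by auto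
  have "lam (\<sigma> y) (\<sigma> h) = Some (\<sigma> k)" using lam_inv[OF stab_sub[OF assms(1)] assms(4), of h] h d1(6) by auto
  then show "z \<in> kr (\<sigma> y)" using kr_iff h assms unfolding invs_def by blast
qed

lemma kr_mult: assumes "y \<in> G" "y' \<in> G" shows "kr y \<inter> kr y' \<subseteq> kr (y \<otimes> y')"
proof
  fix h assume "h \<in> kr y \<inter> kr y'"
  then obtain k k' where h: "h \<in> H1" "k \<in> K0" "lam y h = Some k" "k' \<in> K0" "lam y' h = Some k'" using kr_iff by auto
  have "h \<in> H" using h d1 by blast
  from lin2[OF assms this h(3,5)] show "h \<in> kr (y \<otimes> y')" using kr_iff h sub_m[OF s1(4)] by blast
qed

lemma kr_minv: assumes "y \<in> G" shows "kr y \<subseteq> kr (inv y)"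
proof
  fix h assume "h \<in> kr y"
  then obtain k where h: "h \<in> H1" "k \<in> K0" "lam y h = Some k" using kr_iff by auto
  have "h \<in> H" using h d1 by blast
  from minv2[OF assms this h(3)] show "h \<in> kr (inv y)" using kr_iff h sub_inv[OF s1(4)] by blast
qed

text \<open>The elements with large kernel form a group \<open>P\<close> by \<open>bottom\<close>. If \<open>Y\<close> were not almost contained in it,
\<open>good_small\<close> would provide an \<open>a\<close> outside \<open>P\<close> for which the group \<open>E\<close> of all \<open>w\<close> with
\<open>\<lambda>\<^sub>w[H1] \<lesssim> \<lambda>\<^sub>a[H1] + K0\<close> is not almost contained in \<open>P\<close>. For \<open>w \<in> E - P\<close> the relation \<open>TT a w\<close> has a
domain of finite index and kernels small over \<open>X\<close>, so it induces an injective endomorphism of a section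
\<open>S/M\<close>; since its powers repeat, the order of this endomorphism divides a constant \<open>n\<close>. Elements of \<open>E\<close>
all of whose subsums avoid \<open>P\<close> then contradict \<open>additive_family_trivial\<close>.\<close>

lemma generic_kernel:
  assumes dY: "dfn Y" "Y \<subseteq> G1" and np: "\<not> pr Y H1 K0" and X: "X = H1 \<inter> resl K0 Y"
    and P: "P = {y \<in> Y \<inter> res K0 X. \<not> alm (kr y) X}"
  shows "dfn P \<and> alm Y P"
proof -
  have YG: "Y \<subseteq> G" using dY d1 by blast
  have dX: "dfn X" unfolding X by (rule dfn_bot[OF dY])
  have XH: "X \<subseteq> H1" "X \<subseteq> H" unfolding X using d1 by auto
  note sX = dfn_sub[OF dX] and sY = dfn_sub[OF dY(1)]
  have nHX: "\<not> alm H1 X"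
  proof
    assume "alm H1 X"
    then have "alm H1 (resl K0 Y)" using alm_subset_right[of H1 X "resl K0 Y"] dfn_car[OF dfn_resl[OF d1(4) dY(1) YG]] unfolding X by blast
    then show False using pr_flip_iff[OF dY(1) d1(2,4) YG d1(6)] np by blast
  qed
  define Y0 where "Y0 = Y \<inter> res K0 X"
  have dY0: "dfn Y0" unfolding Y0_def by (intro dfn_Int dY dfn_res d1 dX XH)
  have Y0s: "Y0 \<subseteq> Y" "Y0 \<subseteq> G1" "Y0 \<subseteq> G" unfolding Y0_def using dY YG by auto
  have "alm X (resl K0 Y)" by (rule alm_subset[OF _ dfn_car[OF dfn_resl[OF d1(4) dY(1) YG]]]) (auto simp: X)
  then have "pr Y X K0" using pr_flip_iff[OF dY(1) dX d1(4) YG XH(2)] by blast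
  then have YY0: "alm Y Y0" unfolding Y0_def pr_def
    by (intro alm_inter[OF alm_refl[OF sY]] sY sub_res s1 sX XH sub_sub)
  have Xkr: "alm X (kr y)" if "y \<in> Y0" for y using that res_kr[OF _ sX XH(1)] Y0s unfolding Y0_def by blast
  have PY: "P = {y \<in> Y0. \<not> alm (kr y) X}" unfolding P Y0_def ..
  obtain c0 where c0: "set c0 \<subseteq> carrier A" "\<And>Z. Z \<in> {Y, X, H1, K0} ==> invs c0 Z"
    using dfn_common[of "{Y, X, H1, K0}"] dY(1) dX d1 by auto
  have Yc: "y \<in> carrier A" if "y \<in> Y0" for y using that dfn_car[OF dY0] by blast
  have sP: "subgroup P A"
  proof (rule subgroupI')
    show "P \<subseteq> carrier A" unfolding PY using Yc by blast
    have "H1 \<subseteq> kr \<one>"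
    proof
      fix h assume "h \<in> H1"
      then have "h \<in> H1" "lam \<one> h = Some \<one>" using one2 d1(6) by auto
      then show "h \<in> kr \<one>" using kr_iff sub_one[OF s1(4)] by blast
    qed
    then have "\<not> alm (kr \<one>) X" using nHX alm_subset_left by blast
    then show "\<one> \<in> P" unfolding PY using sub_one[OF dfn_sub[OF dY0]] by blast
    fix y assume y: "y \<in> P"
    then have yy: "y \<in> Y0" "\<not> alm (kr y) X" "y \<in> G" unfolding PY using Y0s by auto
    have "\<not> alm (kr (inv y)) X" using yy(2) kr_minv[OF yy(3)] alm_subset_left by blast
    then show "inv y \<in> P" unfolding PY using sub_inv[OF dfn_sub[OF dY0] yy(1)] by blast
    fix y' assume y': "y' \<in> P"
    then have yy': "y' \<in> Y0" "\<not> alm (kr y') X" "y' \<in> G" unfolding PY using Y0s by auto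
    have "\<not> alm (kr y \<inter> kr y') X"
      by (rule bottom[OF dY X dfn_kr[OF yy(3)] dfn_kr[OF yy'(3)] kr_H1 kr_H1 Xkr[OF yy(1)] Xkr[OF yy'(1)] yy(2) yy'(2)])
    then have "\<not> alm (kr (y \<otimes> y')) X" using kr_mult[OF yy(3) yy'(3)] alm_subset_left by blast
    then show "y \<otimes> y' \<in> P" unfolding PY using sub_m[OF dfn_sub[OF dY0] yy(1) yy'(1)] by blast
  qed
  have "invs c0 P" unfolding invs_def
  proof (intro conjI ballI)
    show "P \<subseteq> carrier A" by (rule sub_sub[OF sP])
    fix \<sigma> y assume s: "\<sigma> \<in> stab c0" and y: "y \<in> P"
    have yy: "y \<in> Y0" "\<not> alm (kr y) X" "y \<in> G" using y unfolding PY using Y0s by auto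
    have "invs c0 Y0" unfolding Y0_def using c0 XH by (intro invs_Int invs_res) auto
    then have sy: "\<sigma> y \<in> Y0" using s yy(1) unfolding invs_def by blast
    obtain \<tau> where t: "\<tau> \<in> stab c0" "\<And>x. x \<in> carrier A ==> \<tau> (\<sigma> x) = x" "\<And>x. x \<in> carrier A ==> \<sigma> (\<tau> x) = x"
      using stab_inv[OF s c0(1)] by metis
    have "\<not> alm (kr (\<sigma> y)) X"
    proof
      assume "alm (kr (\<sigma> y)) X"
      then have "alm (\<tau> ` kr (\<sigma> y)) (\<tau> ` X)" by (rule alm_transport[OF stab_sub[OF t(1)] _ sub_sub[OF sX]])
      moreover have "\<tau> ` X = X" by (rule invs_image[OF c0(2) t(1) c0(1)]) simp
      moreover have "kr y \<subseteq> \<tau> ` kr (\<sigma> y)"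
      proof
        fix h assume h: "h \<in> kr y"
        have "\<sigma> h \<in> kr (\<sigma> y)" using kr_transport[OF s _ _ yy(3)] c0(2) h by blast
        moreover have "h \<in> carrier A" using h kr_H1 dfn_car[OF d1(2)] by blast
        then have "\<tau> (\<sigma> h) = h" by (rule t(2))
        ultimately show "h \<in> \<tau> ` kr (\<sigma> y)" by (metis image_eqI)
      qed
      ultimately show False using yy(2) alm_subset_left by metis
    qed
    then show "\<sigma> y \<in> P" unfolding PY using sy by blast
  qed
  then have dP: "dfn P" unfolding dfn_def using sP c0(1) by blast
  have "alm Y P"
  proof (rule ccontr)
    assume na: "\<not> alm Y P"
    have na0: "\<not> alm Y0 P" using na alm_trans[OF YY0 _ dfn_car[OF dP]] by blast
    define bad where "bad = {v \<in> Y0. alm (Y0 \<inter> res (gr v `` H1 <#> K0) H1) P}"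
    have "small Y0 bad" unfolding bad_def by (rule good_small[OF dY0 d1(2) dP Y0s(2) order_refl na0])
    moreover have "small Y0 P" by (rule small_subgroup[OF sP na0])
    ultimately have "small Y0 (bad \<union> P)" by (rule small_Un)
    then have "\<not> Y0 \<subseteq> bad \<union> P" using not_small[OF dfn_sub[OF dY0]] small_subset by blast
    then obtain a where a: "a \<in> Y0" "a \<notin> bad" "a \<notin> P" by blast
    define E where "E = Y0 \<inter> res (gr a `` H1 <#> K0) H1"
    have aG: "a \<in> G1" "a \<in> G" "a \<in> carrier A" using a(1) Y0s Yc by auto
    have krl: "alm (kr w) X" if "w \<in> Y0" "w \<notin> P" for w using that unfolding PY by blast
    have nE: "\<not> alm E P" using a(1,2) unfolding bad_def E_def by blast
    have sE: "subgroup E A" unfolding E_def by (intro sub_int dfn_sub[OF dY0] sub_res sub_Z aG s1 d1)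
    from invr_repeat[of "length c0 + 2"] obtain N where N: "\<forall>c f. set c \<subseteq> carrier A --> length c \<le> length c0 + 2 --> (\<forall>i. invr c (f i)) --> (\<exists>i j. i < j \<and> j \<le> (N::nat) \<and> f i = f j)"
      by (rule exE)
    \<comment> \<open>a common multiple of all orders of the induced endomorphisms, which are at most \<open>N\<close>\<close>
    define n where "n = (fact N :: nat)"
    have n0: "0 < n" unfolding n_def by simp
    obtain v :: "nat => 'a" where v: "\<And>i. i < Suc n ==> v i \<in> E" "\<And>I. I \<subseteq> {..<Suc n} ==> I \<noteq> {} ==> finprod A v I \<notin> P"
      using indep_sums[OF sE sP nE, of "Suc n"] by blast
    define J where "J = {..<Suc n}"
    have J: "finite J" "n < card J" unfolding J_def by auto
    define w where "w I = finprod A v I" for I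
    have wE: "w I \<in> E" if "I \<subseteq> J" for I unfolding w_def
      using that by (intro finprod_sub[OF sE] finite_subset[OF that J(1)] v(1)) (auto simp: J_def)
    have wP: "w I \<notin> P" if "I \<subseteq> J" "I \<noteq> {}" for I unfolding w_def using v(2)[OF that[unfolded J_def]] .
    define \<Omega> where "\<Omega> = w ` (Pow J - {{}})"
    have W: "u \<in> E" "u \<in> Y0" "u \<notin> P" "u \<in> G" "u \<in> carrier A" if "u \<in> \<Omega>" for u
    proof -
      obtain I where I: "I \<subseteq> J" "I \<noteq> {}" "u = w I" using \<open>u \<in> \<Omega>\<close> unfolding \<Omega>_def by blast
      show "u \<in> E" "u \<notin> P" using wE[OF I(1)] wP[OF I(1,2)] I(3) by auto
      then show "u \<in> Y0" unfolding E_def by blast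
      then show "u \<in> G" "u \<in> carrier A" using Y0s(3) Yc by auto
    qed
    have "finite \<Omega>" unfolding \<Omega>_def using J(1) by simp
    then obtain ws where ws: "set ws = \<Omega>" using finite_list by blast
    define c where "c = c0 @ a # ws"
    have cc: "set c \<subseteq> carrier A" unfolding c_def using c0(1) aG W(5) ws by auto
    have ic: "invs c Z" if "Z \<in> {Y, X, H1, K0}" for Z using invs_mono[OF c0(2)[OF that], of c] unfolding c_def by auto
    have icX: "invs c X" and icH: "invs c H1" and icK: "invs c K0" using ic by auto
    have sm: "alm (TT b u `` B) X" if bu: "b \<in> Y0" "u \<in> Y0" "b \<notin> P" and B: "subgroup B A" "B \<subseteq> H1" "alm B X" for b u B
    proof -
      have g: "b \<in> G" "u \<in> G" using bu Y0s by auto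
      have "alm B (kr u)" by (rule alm_trans[OF B(3) Xkr[OF bu(2)] dfn_car[OF dfn_kr[OF g(2)]]])
      from TT_small[OF g B(1,2) this] show ?thesis by (rule alm_trans[OF _ krl[OF bu(1,3)] dfn_car[OF dX]])
    qed
    have lg: "alm H1 (TT u a `` B)" if u: "u \<in> \<Omega>" and B: "subgroup B A" "B \<subseteq> H1" "alm H1 B" for u B
    proof (rule TT_large[OF W(4)[OF u] aG(2) B(1,2) s1(2) order_refl])
      have "alm (gr u `` H1) (gr a `` H1 <#> K0)" using W(1)[OF u] unfolding E_def res_def by blast
      moreover have "alm (gr a `` H1 <#> K0) (gr a `` B <#> K0)"
        by (intro alm_mult_mono alm_image arel_gr aG B s1 alm_refl sub_gr)
      ultimately show "alm (gr u `` H1) (gr a `` B <#> K0)"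
        by (rule alm_trans) (intro sub_sub sub_Z aG B)
    qed
    have cv: "(TT a u)\<inverse> = TT u a" if "u \<in> \<Omega>" for u by (rule TT_conv[OF aG(2) W(4)[OF that]])
    have T1: "arel (TT a u)" "invr c (TT a u)" "TT a u \<subseteq> H1 \<times> H1" if u: "u \<in> \<Omega>" for u
    proof -
      show "arel (TT a u)" by (rule arel_TT[OF aG(2) W(4)[OF u]])
      show "invr c (TT a u)" by (rule invr_TT[OF aG(2) W(4)[OF u] _ _ icK icH]) (use u ws in \<open>auto simp: c_def\<close>)
      show "TT a u \<subseteq> H1 \<times> H1" by (rule TT_H1)
    qed
    have T2: "alm (TT a u `` B) X" "alm ((TT a u)\<inverse> `` B) X" if u: "u \<in> \<Omega>" and B: "subgroup B A" "B \<subseteq> H1" "alm B X" for u B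
      unfolding cv[OF u] using sm[OF a(1) W(2)[OF u] a(3) B] sm[OF W(2)[OF u] a(1) W(3)[OF u] B] by auto
    have T3: "alm H1 ((TT a u)\<inverse> `` B)" if u: "u \<in> \<Omega>" and B: "subgroup B A" "B \<subseteq> H1" "alm H1 B" for u B
      unfolding cv[OF u] by (rule lg[OF u B])
    obtain M S p where MS: "subgroup M A" "subgroup S A" "\<not> S \<subseteq> M"
      and pS: "\<And>u x. u \<in> \<Omega> ==> x \<in> S ==> p u x \<in> S"
      and pc: "\<And>u x y. u \<in> \<Omega> ==> x \<in> S ==> y \<in> S ==> cg M x y ==> cg M (p u x) (p u y)"
      and ph: "\<And>u x y. u \<in> \<Omega> ==> x \<in> S ==> y \<in> S ==> cg M (p u (x \<otimes> inv y)) (p u x \<otimes> inv (p u y))"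
      and pa: "\<And>u u' u'' x. u \<in> \<Omega> ==> u' \<in> \<Omega> ==> u'' \<in> \<Omega> ==> x \<in> S ==>
       (\<And>x y y'. (x, y) \<in> TT a u ==> (x, y') \<in> TT a u' ==> (x, y \<otimes> y') \<in> TT a u'') ==> cg M (p u'' x) (p u x \<otimes> p u' x)"
      and pp: "\<And>u x i j. u \<in> \<Omega> ==> x \<in> S ==> i < j ==> TT a u ^^ Suc i = TT a u ^^ Suc j ==> cg M ((p u ^^ (j - i)) x) x"
      using endo_family[OF cc sX icX s1(2) icH XH(1) nHX, of \<Omega> "TT a", OF T1 T2 T3] by blast
    have pn: "cg M ((p u ^^ n) x) x" if u: "u \<in> \<Omega>" and x: "x \<in> S" for u x
    proof -
      define b where "b = c0 @ [a, u]"
      have b: "set b \<subseteq> carrier A" "length b \<le> length c0 + 2" unfolding b_def using c0(1) aG W(5)[OF u] by auto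
      have "invs b H1" "invs b K0" using invs_mono[OF c0(2), of H1 b] invs_mono[OF c0(2), of K0 b] unfolding b_def by auto
      then have "invr b (TT a u)" by (intro invr_TT aG W u) (auto simp: b_def)
      then have "\<forall>i. invr b (TT a u ^^ Suc i)" using invr_relpow by blast
      from N[rule_format, OF b, of "\<lambda>i. TT a u ^^ Suc i"] this obtain i j where ij: "i < j" "j \<le> N" "TT a u ^^ Suc i = TT a u ^^ Suc j" by blast
      have "j - i dvd n" unfolding n_def by (rule dvd_fact) (use ij in auto)
      then obtain m where m: "n = (j - i) * m" by (rule dvdE)
      have pwS: "(p u ^^ k) x \<in> S" for k by (induction k) (auto simp: x pS u)
      have "cg M ((p u ^^ ((j - i) * m)) x) x" for m
      proof (induction m)
        case 0 show ?case using cg_refl[OF MS(1)] sub_car[OF MS(2) x] by simp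
      next
        case (Suc m)
        have "(p u ^^ ((j - i) * Suc m)) x = (p u ^^ (j - i)) ((p u ^^ ((j - i) * m)) x)"
          by (simp add: funpow_add)
        then show ?case using cg_trans[OF MS(1) pp[OF u pwS ij(1,3)] Suc] by simp
      qed
      then show ?thesis using m by simp
    qed
    define F where "F I = (if I \<subseteq> J \<and> I \<noteq> {} then p (w I) else (\<lambda>_. \<one>))" for I
    have wO: "w I \<in> \<Omega>" if "I \<subseteq> J" "I \<noteq> {}" for I using that unfolding \<Omega>_def by blast
    have oneS: "\<one> \<in> S" by (rule sub_one[OF MS(2)])
    have c11: "cg M \<one> \<one>" by (rule cg_refl[OF MS(1)]) simp
    have "S \<subseteq> M"
    proof (rule additive_family_trivial[OF MS(1,2) J n0, where F = F])
      show "F I x \<in> S" if "x \<in> S" for I x using that pS wO oneS unfolding F_def by auto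
      show "F {} x = \<one>" if "x \<in> S" for x unfolding F_def by simp
      show "cg M (F I x) (F I y)" if "I \<subseteq> J" "x \<in> S" "y \<in> S" "cg M x y" for I x y
        using that pc[OF wO] c11 unfolding F_def by auto
      show "cg M (F I (x \<otimes> inv y)) (F I x \<otimes> inv (F I y))" if "I \<subseteq> J" "x \<in> S" "y \<in> S" for I x y
        using that ph[OF wO] c11 unfolding F_def by auto
      show "cg M ((F I ^^ n) x) x" if "I \<subseteq> J" "I \<noteq> {}" "x \<in> S" for I x
        using pn[OF wO[OF that(1,2)] that(3)] that unfolding F_def by simp
      show "cg M (F (insert y I) x) (F I x \<otimes> F {y} x)" if h: "I \<subseteq> J" "x \<in> S" "y \<in> J - I" for I x y
      proof (cases "I = {}")
        case True
        have "p (w {y}) x \<in> carrier A" using sub_car[OF MS(2) pS[OF wO h(2)]] h by auto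
        then show ?thesis using True h cg_refl[OF MS(1)] unfolding F_def by simp
      next
        case False
        have yJ: "{y} \<subseteq> J" "insert y I \<subseteq> J" using h by auto
        have vc: "v i \<in> carrier A" if "i \<in> J" for i using v(1)[of i] that sub_car[OF sE] unfolding J_def by auto
        have wy: "w (insert y I) = w I \<otimes> w {y}"
        proof -
          have "w (insert y I) = v y \<otimes> w I" unfolding w_def
            by (rule finprod_insert) (use finite_subset[OF h(1) J(1)] h vc in auto)
          moreover have "w {y} = v y \<otimes> w {}" unfolding w_def
            by (rule finprod_insert) (use h vc in auto)
          moreover have "w {} = \<one>" unfolding w_def by simp
          moreover have "w I \<in> carrier A" using sub_car[OF sE wE[OF h(1)]] .
          ultimately show ?thesis using vc[of y] h(3) by (simp add: m_comm)
        qed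
        have "cg M (p (w (insert y I)) x) (p (w I) x \<otimes> p (w {y}) x)"
        proof (rule pa[OF wO[OF h(1) False] wO[OF yJ(1)] wO[OF yJ(2)] h(2)])
          fix z z1 z2 assume z: "(z, z1) \<in> TT a (w I)" "(z, z2) \<in> TT a (w {y})"
          have wG: "w I \<in> G" "w {y} \<in> G" "w (insert y I) \<in> G" using W(4)[OF wO] h(1) False yJ by auto
          obtain k1 l1 where 1: "z \<in> H1" "z1 \<in> H1" "lam (w I) z = Some k1" "lam a z1 = Some l1" "k1 \<otimes> inv l1 \<in> K0"
            using z(1) TT_iff[OF aG(2) wG(1)] by blast
          obtain k2 l2 where 2: "z2 \<in> H1" "lam (w {y}) z = Some k2" "lam a z2 = Some l2" "k2 \<otimes> inv l2 \<in> K0"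
            using z(2) TT_iff[OF aG(2) wG(2)] by blast
          have zH: "z \<in> H" "z1 \<in> H" "z2 \<in> H" using 1 2 d1(6) by auto
          have kc: "k1 \<in> carrier A" "l1 \<in> carrier A" "k2 \<in> carrier A" "l2 \<in> carrier A"
            using lamK[OF wG(1) zH(1) 1(3)] lamK[OF wG(2) zH(1) 2(2)] lamK[OF aG(2) zH(2) 1(4)] lamK[OF aG(2) zH(3) 2(3)] cK by auto
          have "lam (w (insert y I)) z = Some (k1 \<otimes> k2)" unfolding wy by (rule lin2[OF wG(1,2) zH(1) 1(3) 2(2)])
          moreover have "lam a (z1 \<otimes> z2) = Some (l1 \<otimes> l2)" by (rule lin1[OF aG(2) zH(2,3) 1(4) 2(3)])
          moreover have "(k1 \<otimes> k2) \<otimes> inv (l1 \<otimes> l2) = (k1 \<otimes> inv l1) \<otimes> (k2 \<otimes> inv l2)" using kc by (simp add: inv_mult m_ac)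
          then have "(k1 \<otimes> k2) \<otimes> inv (l1 \<otimes> l2) \<in> K0" using sub_m[OF s1(4) 1(5) 2(4)] by simp
          moreover have "z1 \<otimes> z2 \<in> H1" by (rule sub_m[OF s1(2) 1(2) 2(1)])
          ultimately show "(z, z1 \<otimes> z2) \<in> TT a (w (insert y I))" using TT_iff[OF aG(2) wG(3)] 1(1) by blast
        qed simp_all
        then show ?thesis using False h(1) yJ unfolding F_def by simp
      qed
    qed
    then show False using MS(3) by blast
  qed
  with dP show ?thesis by blast
qed

text \<open>Finite burden of \<open>H\<close> for families of kernels.\<close>

lemma ker_reduce:
  "\<exists>d. \<forall>V. finite V --> V \<subseteq> G1 --> (\<exists>W\<subseteq>V. card W \<le> d \<and> (\<forall>v\<in>V. alm (H1 \<inter> (\<Inter>u\<in>W. kr u)) (kr v)))"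
proof -
  from tame_card[OF tameH] obtain d where d: "\<forall>V (D :: 'a => 'a set). card V = Suc d --> (\<forall>v\<in>V. dfn (D v)) -->
     (\<exists>v\<in>V. alm (H \<inter> (\<Inter>w\<in>V - {v}. D w)) (D v))" by (rule exE)
  have kc: "kr v \<subseteq> carrier A" for v using kr_H1 dfn_car[OF d1(2)] by blast
  have "\<exists>W\<subseteq>V. card W \<le> d \<and> (\<forall>v\<in>V. alm (H1 \<inter> (\<Inter>u\<in>W. kr u)) (kr v))" if V: "finite V" "V \<subseteq> G1" for V
  proof (rule dep_reduce[OF _ _ _ V])
    show "alm (H1 \<inter> (\<Inter>u\<in>V. kr u)) (kr v)" if "finite V" "V \<subseteq> G1" "v \<in> V" for v V
      by (rule alm_subset[OF _ kc]) (use that in blast)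
    show "alm (H1 \<inter> (\<Inter>v\<in>W. kr v)) (kr u)" if h: "finite V" "finite W" "V \<subseteq> G1" "W \<subseteq> G1" "\<And>v. v \<in> V ==> alm (H1 \<inter> (\<Inter>v\<in>W. kr v)) (kr v)" "alm (H1 \<inter> (\<Inter>v\<in>V. kr v)) (kr u)" for u V W
    proof -
      have sW: "subgroup (H1 \<inter> (\<Inter>v\<in>W. kr v)) A" using h(4) G1G by (intro sub_Int_INT s1 sub_kr) auto
      have "alm (H1 \<inter> (\<Inter>v\<in>W. kr v)) (H1 \<inter> (\<Inter>v\<in>V. kr v))"
        by (rule conjunct1[OF alm_INT[OF alm_subset s1(2) sW h(1,5)]]) (use dfn_car[OF d1(2)] h(3) G1G sub_kr in auto)
      then show ?thesis using h(6) by (rule alm_trans[OF _ _ kc])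
    qed
    show "\<exists>v\<in>V. alm (H1 \<inter> (\<Inter>u\<in>V - {v}. kr u)) (kr v)" if h: "V \<subseteq> G1" "finite V" "card V = Suc d" for V
    proof -
      obtain v where v: "v \<in> V" "alm (H \<inter> (\<Inter>w\<in>V - {v}. kr w)) (kr v)"
        using d[rule_format, OF h(3), of kr] dfn_kr h(1) G1G by blast
      have "H1 \<inter> (\<Inter>u\<in>V - {v}. kr u) \<subseteq> H \<inter> (\<Inter>w\<in>V - {v}. kr w)" using d1(6) by blast
      from alm_subset_left[OF v(2) this] show ?thesis using v(1) by blast
    qed
  qed
  then show ?thesis by blast
qed

lemma np_OG:
  assumes dW: "dfn W" "W \<subseteq> G1" and n: "\<not> alm W OG" shows "\<not> pr W H1 K0"
proof
  assume "pr W H1 K0"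
  from alm_inter[OF alm_subset[OF dW(2) dfn_car[OF d1(1)]] this[unfolded pr_def] s1(1) sub_res[OF s1(4,2) d1(6)] dfn_car[OF dW(1)]]
  show False using n unfolding OG_def by blast
qed

lemma flip: "dfn Y ==> Y \<subseteq> G1 ==> dfn X ==> X \<subseteq> H1 ==> dfn Z ==> alm X (resl Z Y) \<longleftrightarrow> pr Y X Z"
  using pr_flip_iff[of Y X Z] d1 by blast

text \<open>A large intersection \<open>XV\<close> of generic kernels is infinite over the annihilator of \<open>W\<close> by \<open>bottom\<close>, although
the finitely many elements \<open>V\<close> defining it are chosen in many different cosets of every \<open>R\<close>. As
boundedly many of the kernels suffice, the annihilator \<open>Y0\<close> of \<open>XV\<close> has a bounded number of parameters,
hence contains too many cosets of \<open>R\<close> to be almost contained in it. The pair is the Galois closure of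
\<open>Y0\<close>.\<close>

lemma closed_pair:
  assumes dW: "dfn W" "W \<subseteq> G1" and RR: "finite RR" "\<And>R. R \<in> RR ==> dfn R \<and> \<not> alm W R" and nOG: "\<not> alm W OG"
  shows "\<exists>Y X. dfn Y \<and> dfn X \<and> Y = G1 \<inter> res K0 X \<and> X = H1 \<inter> resl K0 Y \<and> (\<forall>R\<in>RR. \<not> alm (Y \<inter> W) R) \<and> \<not> alm W Y"
proof -
  note np = np_OG[OF dW nOG]
  define Xw where "Xw = H1 \<inter> resl K0 W"
  define P where "P = {y \<in> W \<inter> res K0 Xw. \<not> alm (kr y) Xw}"
  have P: "dfn P" "alm W P" using generic_kernel[OF dW np Xw_def P_def] by auto
  have PW: "P \<subseteq> W" "P \<subseteq> G1" unfolding P_def using dW by auto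
  have dXw: "dfn Xw" unfolding Xw_def by (rule dfn_bot[OF dW])
  have XwH: "Xw \<subseteq> H1" unfolding Xw_def by blast
  define RR' where "RR' = insert OG RR"
  have RR': "finite RR'" "RR' \<noteq> {}" "\<And>R. R \<in> RR' ==> dfn R" unfolding RR'_def using RR dOG by auto
  have nP: "\<not> alm P R" if "R \<in> RR'" for R
  proof
    assume "alm P R"
    then have "alm W R" using alm_trans[OF P(2) _ dfn_car[OF RR'(3)[OF that]]] by blast
    then show False using that RR(2) nOG unfolding RR'_def by blast
  qed
  obtain c0 where c0: "set c0 \<subseteq> carrier A" "\<And>Z. Z \<in> {W, H1, G1, K0} \<union> RR' ==> invs c0 Z"
    using dfn_common[of "{W, H1, G1, K0} \<union> RR'"] RR' dW(1) d1 by auto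
  from ker_reduce obtain d where dd: "\<forall>V. finite V --> V \<subseteq> G1 --> (\<exists>W\<subseteq>V. card W \<le> d \<and> (\<forall>v\<in>V. alm (H1 \<inter> (\<Inter>u\<in>W. kr u)) (kr v)))" by (rule exE)
  from index_bound[of "length c0 + d"] obtain N where N: "\<And>c X Y F. set c \<subseteq> carrier A ==> length c \<le> length c0 + d ==> invs c X ==> invs c Y ==>
     subgroup X A ==> subgroup Y A ==> alm X Y ==> F \<subseteq> X ==> finite F ==> sep F Y ==> card F \<le> N" by blast
  obtain V where V: "finite V" "V \<subseteq> P" "card V = Suc N" "\<forall>R\<in>RR'. sep V R"
    using greedy_sep[OF dfn_sub[OF P(1)] RR'(1,2), of "Suc N"] nP RR'(3) dfn_sub by blast
  have VG: "V \<subseteq> G1" using V PW by blast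
  obtain V' where V': "V' \<subseteq> V" "card V' \<le> d" "\<forall>v\<in>V. alm (H1 \<inter> (\<Inter>u\<in>V'. kr u)) (kr v)" using dd[rule_format, OF V(1) VG] by blast
  have fV': "finite V'" using V' V finite_subset by blast
  define XV where "XV = H1 \<inter> (\<Inter>u\<in>V'. kr u)"
  have nH: "\<not> alm H1 Xw"
  proof
    assume "alm H1 Xw"
    then have "alm H1 (resl K0 W)" by (rule alm_subset_right) (use resl_H cH in \<open>auto simp: Xw_def\<close>)
    then show False using flip[OF dW d1(2) order_refl d1(4)] np by blast
  qed
  have XwP: "alm Xw (kr y)" if "y \<in> P" for y
    using that res_kr[OF _ dfn_sub[OF dXw] XwH, of y] G1G PW unfolding P_def by blast
  have "alm Xw (H1 \<inter> (\<Inter>u\<in>U. kr u)) \<and> \<not> alm (H1 \<inter> (\<Inter>u\<in>U. kr u)) Xw \<and> dfn (H1 \<inter> (\<Inter>u\<in>U. kr u))" if "finite U" "U \<subseteq> P" for U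
    using that
  proof (induction U rule: finite_induct)
    case empty then show ?case using nH d1 alm_subset[OF XwH dfn_car[OF d1(2)]] by simp
  next
    case (insert u U)
    define Q where "Q = H1 \<inter> (\<Inter>u\<in>U. kr u)"
    have Q: "alm Xw Q" "\<not> alm Q Xw" "dfn Q" "Q \<subseteq> H1" using insert unfolding Q_def by auto
    have u: "u \<in> P" "u \<in> G" using insert PW G1G by auto
    have nu: "\<not> alm (kr u) Xw" using u(1) unfolding P_def by blast
    have e: "H1 \<inter> (\<Inter>u\<in>insert u U. kr u) = kr u \<inter> Q" unfolding Q_def by blast
    have "\<not> alm (kr u \<inter> Q) Xw" by (rule bottom[OF dW Xw_def dfn_kr[OF u(2)] Q(3) kr_H1 Q(4) XwP[OF u(1)] Q(1) nu Q(2)])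
    then show ?case unfolding e
      by (intro conjI alm_inter XwP u Q dfn_Int dfn_kr dfn_sub dfn_car dXw)
  qed
  from this[OF fV' order_trans[OF V'(1) V(2)]] have XV: "\<not> alm XV Xw" "dfn XV" "XV \<subseteq> H1" unfolding XV_def by auto
  have HH: "B \<subseteq> H" if "B \<subseteq> H1" for B using that d1 by blast
  define Y0 where "Y0 = G1 \<inter> res K0 XV"
  have dY0: "dfn Y0" unfolding Y0_def by (intro dfn_Int dfn_res d1 XV HH)
  have Y0G: "Y0 \<subseteq> G1" unfolding Y0_def by blast
  have VY0: "V \<subseteq> Y0 \<inter> W"
  proof
    fix v assume v: "v \<in> V"
    have "alm XV (kr v)" using V'(3) v unfolding XV_def by blast
    then have "v \<in> res K0 XV" using res_kr[OF _ dfn_sub[OF XV(2)] XV(3), of v] v VG G1G by blast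
    then show "v \<in> Y0 \<inter> W" unfolding Y0_def using v VG V(2) PW by blast
  qed
  obtain vs where vs: "set vs = V'" "distinct vs" using finite_distinct_list[OF fV'] by blast
  have lv: "length vs \<le> d" using V'(2) vs distinct_card by fastforce
  define c where "c = c0 @ vs"
  have cc: "set c \<subseteq> carrier A" unfolding c_def using c0(1) vs(1) V'(1) VG dfn_car[OF d1(1)] by auto
  have ic: "invs c Z" if "Z \<in> {W, H1, G1, K0} \<union> RR'" for Z using invs_mono[OF c0(2)[OF that], of c] unfolding c_def by auto
  have "invs c (H1 \<inter> (\<Inter>u\<in>U. kr u))" if "finite U" "U \<subseteq> V'" for U
    using that
  proof (induction U rule: finite_induct)
    case empty then show ?case using ic by simp
  next
    case (insert u U)
    have e: "H1 \<inter> (\<Inter>u\<in>insert u U. kr u) = kr u \<inter> (H1 \<inter> (\<Inter>u\<in>U. kr u))" by blast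
    have "u \<in> G" "u \<in> set c" using insert V' VG G1G vs unfolding c_def by auto
    then have "invs c (kr u)" unfolding kr_def using ic by (intro invs_Int invs_rel_image invr_converse invr_gr) auto
    moreover have "invs c (H1 \<inter> (\<Inter>u\<in>U. kr u))" using insert by auto
    ultimately show ?case unfolding e by (rule invs_Int)
  qed
  from this[OF fV' order_refl] have "invs c XV" unfolding XV_def .
  then have iY0: "invs c (Y0 \<inter> W)" unfolding Y0_def using ic by (intro invs_Int invs_res cc HH XV) auto
  have nY0: "\<not> alm (Y0 \<inter> W) R" if R: "R \<in> RR'" for R
  proof
    assume "alm (Y0 \<inter> W) R"
    then have "card V \<le> N" using lv ic R V(4)
      by (intro N[OF cc _ iY0 _ dfn_sub[OF dfn_Int[OF dY0 dW(1)]] dfn_sub[OF RR'(3)[OF R]] _ VY0 V(1)]) (auto simp: c_def)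
    then show False using V(3) by simp
  qed
  define Xa where "Xa = H1 \<inter> resl K0 Y0"
  define Y where "Y = G1 \<inter> res K0 Xa"
  define X where "X = H1 \<inter> resl K0 Y"
  have dXa: "dfn Xa" unfolding Xa_def by (rule dfn_bot[OF dY0 Y0G])
  have XaH: "Xa \<subseteq> H1" unfolding Xa_def by blast
  have dY: "dfn Y" unfolding Y_def by (intro dfn_Int dfn_res d1 dXa HH XaH)
  have YG: "Y \<subseteq> G1" unfolding Y_def by blast
  have dX: "dfn X" unfolding X_def by (rule dfn_bot[OF dY YG])
  have XH: "X \<subseteq> H1" unfolding X_def by blast
  have cres: "res Z B \<subseteq> carrier A" and cresl: "resl Z B \<subseteq> carrier A" for Z B using res_G resl_H cG cH by blast+
  have "pr Y0 XV K0" unfolding pr_def by (rule alm_subset[OF _ cres]) (auto simp: Y0_def)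
  then have "alm XV (resl K0 Y0)" using flip[OF dY0 Y0G XV(2,3) d1(4)] by blast
  from alm_inter[OF alm_subset[OF XV(3) dfn_car[OF d1(2)]] this s1(2) dfn_sub[OF dfn_resl[OF d1(4) dY0]] dfn_car[OF XV(2)]]
  have XVa: "alm XV Xa" unfolding Xa_def using Y0G d1 by blast
  have "alm Xa (resl K0 Y0)" by (rule alm_subset[OF _ cresl]) (auto simp: Xa_def)
  then have "alm Y0 (res K0 Xa)" using flip[OF dY0 Y0G dXa XaH d1(4)] unfolding pr_def by blast
  from alm_inter[OF alm_subset[OF Y0G dfn_car[OF d1(1)]] this s1(1) sub_res[OF s1(4) dfn_sub[OF dXa] HH[OF XaH]] dfn_car[OF dY0]]
  have Y0Y: "alm Y0 Y" unfolding Y_def .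
  have "pr Y Xa K0" unfolding pr_def by (rule alm_subset[OF _ cres]) (auto simp: Y_def)
  then have "alm Xa (resl K0 Y)" using flip[OF dY YG dXa XaH d1(4)] by blast
  from alm_inter[OF alm_subset[OF XaH dfn_car[OF d1(2)]] this s1(2) dfn_sub[OF dfn_resl[OF d1(4) dY]] dfn_car[OF dXa]]
  have XaX: "alm Xa X" unfolding X_def using YG d1 by blast
  have "X \<subseteq> Xa" unfolding X_def Xa_def using resl_mono_Y[OF Y0Y dfn_sub[OF dY] dfn_sub[OF dY0] s1(4)] by blast
  then have XXa: "alm X Xa" by (rule alm_subset[OF _ dfn_car[OF dXa]])
  have "res K0 X = res K0 Xa"
    using res_mono_X[OF XaX dfn_sub[OF dX] dfn_sub[OF dXa] s1(4)] res_mono_X[OF XXa dfn_sub[OF dXa] dfn_sub[OF dX] s1(4)] by blast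
  then have YX: "Y = G1 \<inter> res K0 X" unfolding Y_def by simp
  have nYW: "\<not> alm (Y \<inter> W) R" if "R \<in> RR" for R
  proof
    assume r: "alm (Y \<inter> W) R"
    have RR1: "R \<in> RR'" using that unfolding RR'_def by blast
    have "alm (Y0 \<inter> W) (Y \<inter> W)" by (rule alm_inter_mono[OF Y0Y dfn_sub[OF dY] dfn_sub[OF dW(1)] dfn_sub[OF dY0]])
    then have "alm (Y0 \<inter> W) R" using r by (rule alm_trans[OF _ _ dfn_car[OF RR'(3)[OF RR1]]])
    then show False using nY0[OF RR1] by blast
  qed
  have nWY: "\<not> alm W Y"
  proof
    assume "alm W Y"
    then have "alm W (res K0 X)" by (rule alm_subset_right[OF _ _ cres]) (subst YX, blast)
    then have "alm X (resl K0 W)" using flip[OF dW dX XH d1(4)] unfolding pr_def by blast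
    from alm_inter[OF alm_subset[OF XH dfn_car[OF d1(2)]] this s1(2) dfn_sub[OF dfn_resl[OF d1(4) dW(1)]] dfn_car[OF dX]]
    have "alm X Xw" unfolding Xw_def using dW d1 by blast
    then have "alm XV Xw" using alm_trans[OF XVa alm_trans[OF XaX _ dfn_car[OF dXw]] dfn_car[OF dXw]] by blast
    then show False using XV by blast
  qed
  show ?thesis by (rule exI[of _ Y], rule exI[of _ X]) (intro conjI dY dX YX X_def ballI nYW nWY)
qed

text \<open>The decreasing images of the powers of \<open>T\<close> stabilise at some \<open>B\<close> after \<open>N\<close> steps, uniformly, and the
increasing kernels of the powers stabilise as well. If \<open>B\<close> is not almost contained in \<open>X\<close>, then by
\<open>bottom\<close> neither is its intersection with the kernel of \<open>y\<close>. But \<open>T\<close> maps \<open>B\<close> onto itself, so once the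
kernels are stable, an element of this intersection lies in a power of \<open>T\<close> applied to \<open>\<one>\<close>, and
that is almost contained in \<open>X\<close> because \<open>X\<close> is killed by \<open>y\<close> up to \<open>K0\<close> and the kernel of \<open>a\<close> is small.\<close>

lemma nilpotent:
  "\<exists>N. \<forall>a y Y X. a \<in> G1 --> y \<in> G1 --> dfn Y --> Y \<subseteq> G1 --> X = H1 \<inter> resl K0 Y --> alm (kr a) X --> alm X (kr y) -->
     \<not> alm (kr y) X --> alm ((TT a y ^^ N) `` H1) X"
proof -
  obtain c0 where c0: "set c0 \<subseteq> carrier A" "invs c0 H1" "invs c0 K0" using dfn_pair[OF d1(2,4)] by metis
  from invs_repeat[of "length c0 + 2"] obtain N where N: "\<forall>c f. set c \<subseteq> carrier A --> length c \<le> length c0 + 2 --> (\<forall>i. invs c (f i)) --> (\<exists>i j. i < j \<and> j \<le> (N::nat) \<and> f i = f j)"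
    by (rule exE)
  have "alm ((TT a y ^^ N) `` H1) X" if a: "a \<in> G1" and y: "y \<in> G1" and dY: "dfn Y" "Y \<subseteq> G1" and X: "X = H1 \<inter> resl K0 Y"
    and ka: "alm (kr a) X" and ky: "alm X (kr y)" "\<not> alm (kr y) X" for a y Y X
  proof -
    define T where "T = TT a y"
    have g: "a \<in> G" "y \<in> G" using a y G1G by auto
    define c where "c = c0 @ [a, y]"
    have cc: "set c \<subseteq> carrier A" "length c \<le> length c0 + 2" unfolding c_def using c0 g cG by auto
    have ic: "invs c H1" "invs c K0" using invs_mono[OF c0(2), of c] invs_mono[OF c0(3), of c] unfolding c_def by auto
    have aT: "arel T" unfolding T_def by (rule arel_TT[OF g])
    have iT: "invr c T" unfolding T_def by (intro invr_TT g ic) (auto simp: c_def)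
    have TH: "T `` B \<subseteq> H1" for B unfolding T_def using TT_H1 by blast
    have dX: "dfn X" unfolding X by (rule dfn_bot[OF dY])
    have XH: "X \<subseteq> H1" unfolding X by blast
    note sX = dfn_sub[OF dX]
    define f where "f k = (T ^^ k) `` H1" for k
    have fS: "f (Suc k) = T `` f k" for k unfolding f_def by (simp add: relcomp_Image)
    have f0: "f 0 = H1" unfolding f_def by simp
    have fp: "invs c (f k) \<and> subgroup (f k) A \<and> f k \<subseteq> H1" for k
      by (induction k) (use f0 ic s1 fS invs_rel_image[OF iT] sub_image[OF aT] TH in auto)
    have dec: "f (Suc k) \<subseteq> f k" for k
    proof (induction k)
      case 0 show ?case using fp[of 1] f0 by simp
    next
      case (Suc k) then show ?case unfolding fS[of "Suc k"] fS[of k] by blast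
    qed
    obtain i j where ij: "i < j" "j \<le> N" "f i = f j" using N[rule_format, OF cc, of f] fp by blast
    have "f j \<subseteq> f (Suc i)" using lift_Suc_antimono_le[of f, OF dec, of "Suc i" j] ij(1) by simp
    then have st: "f (Suc i) = f i" using ij(3) dec[of i] by simp
    have const: "f (i + k) = f i" for k
    proof (induction k)
      case (Suc k) then show ?case using fS[of "i + k"] fS[of i] st by simp
    qed simp
    define B where "B = f i"
    have BN: "f N = B" using const[of "N - i"] ij unfolding B_def by simp
    have TB: "T `` B = B" unfolding B_def using fS[of i] st by simp
    have Bp: "invs c B" "subgroup B A" "B \<subseteq> H1" using fp unfolding B_def by auto
    have dB: "dfn B" unfolding dfn_def using Bp cc by blast
    have sky: "subgroup (kr y) A" by (rule sub_kr[OF g(2)])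
    show ?thesis
    proof (rule ccontr)
      assume "\<not> ?thesis"
      then have nB: "\<not> alm B X" using BN unfolding f_def T_def by simp
      define S where "S = B <#> X"
      have S: "B \<subseteq> S" "X \<subseteq> S" "S \<subseteq> H1" unfolding S_def by (intro sub_left sub_right Bp sX mult_least s1 XH)+
      have dS: "dfn S" unfolding S_def by (intro dfn_mult dB dX)
      have nS: "\<not> alm S X" using nB S(1) alm_subset_left by blast
      have nSk: "\<not> alm (S \<inter> kr y) X"
        by (rule bottom[OF dY X dS dfn_kr[OF g(2)] S(3) kr_H1 alm_subset[OF S(2) dfn_car[OF dS]] ky(1) nS ky(2)])
      have nBk: "\<not> alm (B \<inter> kr y) X"
      proof
        assume h: "alm (B \<inter> kr y) X"
        define X' where "X' = X \<inter> kr y"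
        have sX': "subgroup X' A" unfolding X'_def by (intro sub_int sX sky)
        have "alm X X'" unfolding X'_def by (intro alm_inter alm_refl sX sky ky sub_sub)
        then have "alm S (B <#> X')" unfolding S_def by (intro alm_mult_mono alm_refl Bp sX')
        then have "alm (S \<inter> kr y) ((B <#> X') \<inter> kr y)" by (rule alm_inter_mono[OF _ sub_mult[OF Bp(2) sX'] sky dfn_sub[OF dS]])
        moreover have "(B <#> X') \<inter> kr y = X' <#> (kr y \<inter> B)"
        proof -
          have "B <#> X' = X' <#> B" by (intro mult_comm_sets sub_sub Bp sX')
          moreover have "kr y \<inter> (X' <#> B) = X' <#> (kr y \<inter> B)" by (intro modular sX' sky Bp) (simp add: X'_def)
          ultimately show ?thesis by (simp add: Int_commute)
        qed
        moreover have "alm (X' <#> (kr y \<inter> B)) X"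
        proof (intro alm_mult sX)
          show "alm X' X" by (rule alm_subset[OF _ dfn_car[OF dX]]) (simp add: X'_def)
          show "alm (kr y \<inter> B) X" using h by (simp add: Int_commute)
        qed
        ultimately have "alm (S \<inter> kr y) X" using alm_trans[OF _ _ dfn_car[OF dX]] by metis
        then show False using nSk by blast
      qed
      define h where "h k = (T ^^ Suc k)\<inverse> `` {\<one>}" for k
      have "invs c (h k)" for k unfolding h_def
        by (intro invs_rel_image invr_converse invr_relpow iT) (use invs_mono[of "[]" "{\<one>}" c] \<Gamma>_one stab_sub in \<open>auto simp: invs_def\<close>)
      then obtain i j where ij: "i < j" "h i = h j" using N[rule_format, OF cc, of h] by blast
      have one: "(\<one>, \<one>) \<in> T ^^ k" for k by (induction k) (use arelD(3)[OF aT] in auto)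
      have inc: "h k \<subseteq> h (Suc k)" for k
      proof
        fix x assume "x \<in> h k"
        then have "(x, \<one>) \<in> T ^^ Suc k" unfolding h_def by blast
        moreover have "(\<one>, \<one>) \<in> T" by (rule arelD(3)[OF aT])
        ultimately have "(x, \<one>) \<in> T ^^ Suc (Suc k)" by (rule relpow_Suc_I)
        then show "x \<in> h (Suc k)" unfolding h_def by blast
      qed
      have "h (Suc i) \<subseteq> h j" using lift_Suc_mono_le[of h, OF inc, of "Suc i" j] ij(1) by simp
      then have hs: "h (Suc i) \<subseteq> h i" using ij(2) by simp
      have TBk: "(T ^^ k) `` B = B" for k by (induction k) (simp_all add: relcomp_Image TB)
      have sub: "B \<inter> kr y \<subseteq> (T ^^ Suc i) `` {\<one>}"
      proof
        fix b assume b: "b \<in> B \<inter> kr y"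
        then obtain x where x: "x \<in> B" "(x, b) \<in> T ^^ Suc i" using TBk[of "Suc i"] by blast
        obtain k where k: "b \<in> H1" "k \<in> K0" "lam y b = Some k" using b kr_iff by auto
        have "(b, \<one>) \<in> T" unfolding T_def using TT_iff[OF g, of b \<one>] k one1[OF g(1)] sub_one[OF s1(2)] sub_car[OF s1(4) k(2)] by auto
        with x(2) have "(x, \<one>) \<in> T ^^ Suc (Suc i)" by (rule relpow_Suc_I)
        then have "x \<in> h i" using hs unfolding h_def by blast
        then have "(x, \<one>) \<in> T ^^ Suc i" unfolding h_def by blast
        from arelD(6)[OF arel_relpow[OF aT] x(2) this]
        have "(x \<otimes> inv x, b \<otimes> inv \<one>) \<in> T ^^ Suc i" .
        moreover have "x \<in> carrier A" "b \<in> carrier A" using x(1) b sub_car[OF Bp(2)] by auto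
        ultimately have "(\<one>, b) \<in> T ^^ Suc i" by (simp del: relpow.simps)
        then show "b \<in> (T ^^ Suc i) `` {\<one>}" by blast
      qed
      have Tsm: "alm (T `` C) X" if C: "subgroup C A" "C \<subseteq> H1" "alm C X" for C
      proof -
        have "alm C (kr y)" by (rule alm_trans[OF C(3) ky(1) sub_sub[OF sky]])
        from TT_small[OF g C(1,2) this] show ?thesis unfolding T_def by (rule alm_trans[OF _ ka dfn_car[OF dX]])
      qed
      have "alm ((T ^^ Suc k) `` {\<one>}) X \<and> subgroup ((T ^^ Suc k) `` {\<one>}) A \<and> (T ^^ Suc k) `` {\<one>} \<subseteq> H1" for k
      proof (induction k)
        case 0
        have "{\<one>} \<subseteq> X" "{\<one>} \<subseteq> H1" using sub_one[OF sX] sub_one[OF s1(2)] by auto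
        then have "alm (T `` {\<one>}) X" by (intro Tsm triv_subgroup alm_subset dfn_car dX)
        then show ?case using TH[of "{\<one>}"] sub_image[OF aT triv_subgroup] by simp
      next
        case (Suc k)
        have e: "(T ^^ Suc (Suc k)) `` {\<one>} = T `` ((T ^^ Suc k) `` {\<one>})" by (simp add: relcomp_Image)
        show ?case unfolding e using Suc Tsm TH sub_image[OF aT] by blast
      qed
      then have "alm (B \<inter> kr y) X" using alm_subset_left[OF _ sub] by blast
      then show False using nBk by blast
    qed
  qed
  then show ?thesis by blast
qed

lemma closed_not_in:
  assumes "Y = G1 \<inter> res K0 X" "a \<in> G1" "a \<notin> Y" shows "a \<notin> res K0 X"
  using assms by blast

text \<open>Otherwise choose a closed pair for \<open>W\<close>, a generic \<open>y\<close> in \<open>Y \<inter> W\<close> and an \<open>a \<in> W\<close> outside \<open>Y\<close> whose image of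
\<open>H1\<close> is almost contained in that of \<open>y\<close>. Then \<open>TT a y\<close> maps \<open>H1\<close> onto a subgroup of finite index, and so
do its powers, contrary to \<open>nilpotent\<close>.\<close>

lemma good_element:
  assumes dW: "dfn W" "W \<subseteq> G1" and nW: "\<not> alm W OG"
  shows "\<exists>g\<in>G1. \<not> pr W H1 (gr g `` H1 <#> K0) \<and> \<not> alm (G1 \<inter> res (gr g `` H1 <#> K0) H1) OG"
proof (rule ccontr)
  assume neg: "\<not> ?thesis"
  have "\<exists>Y X. dfn Y \<and> dfn X \<and> Y = G1 \<inter> res K0 X \<and> X = H1 \<inter> resl K0 Y \<and> (\<forall>R\<in>{OG}. \<not> alm (Y \<inter> W) R) \<and> \<not> alm W Y"
    by (rule closed_pair[OF dW _ _ nW]) (use nW dOG in simp_all)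
  then obtain Y X where YX0: "dfn Y" "dfn X" "Y = G1 \<inter> res K0 X" "X = H1 \<inter> resl K0 Y" "\<forall>R\<in>{OG}. \<not> alm (Y \<inter> W) R" "\<not> alm W Y"
    by (elim exE conjE)
  have YX5: "\<not> alm (Y \<inter> W) OG" using YX0(5) by simp
  note YX = YX0(1-4) YX5 YX0(6)
  have YG: "Y \<subseteq> G1" using YX(3) by blast
  have XH: "X \<subseteq> H1" using YX(4) by blast
  define U where "U = Y \<inter> W"
  have dU: "dfn U" "U \<subseteq> G1" unfolding U_def using YX(1) dW YG by (auto intro: dfn_Int)
  define Xu where "Xu = H1 \<inter> resl K0 U"
  define P where "P = {y \<in> U \<inter> res K0 Xu. \<not> alm (kr y) Xu}"
  have nU: "\<not> alm U OG" using YX(5) unfolding U_def .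
  have P: "dfn P" "alm U P" using generic_kernel[OF dU np_OG[OF dU nU] Xu_def P_def] by auto
  have PU: "P \<subseteq> U" "P \<subseteq> G1" "P \<subseteq> Y" unfolding P_def using dU by (auto simp: U_def)
  have nP: "\<not> alm P OG" using nU alm_trans[OF P(2) _ dfn_car[OF dOG]] by blast
  have "small P {v \<in> P. alm (P \<inter> res (gr v `` H1 <#> K0) H1) OG}"
    by (rule good_small[OF P(1) d1(2) dOG PU(2) order_refl nP])
  then have "\<not> P \<subseteq> {v \<in> P. alm (P \<inter> res (gr v `` H1 <#> K0) H1) OG}" using not_small[OF dfn_sub[OF P(1)]] small_subset by blast
  then obtain y where y: "y \<in> P" "\<not> alm (P \<inter> res (gr y `` H1 <#> K0) H1) OG" by blast
  define Z where "Z = gr y `` H1 <#> K0"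
  have yG: "y \<in> G1" "y \<in> G" using y(1) PU G1G by auto
  have dZ: "dfn Z" unfolding Z_def by (rule dfn_Z[OF yG(1) d1(2)])
  have "P \<inter> res Z H1 \<subseteq> G1 \<inter> res Z H1" using PU by blast
  then have "\<not> alm (G1 \<inter> res Z H1) OG" using y(2) alm_subset_left unfolding Z_def by blast
  then have "pr W H1 Z" using neg yG(1) unfolding Z_def by blast
  then have WZ: "alm W (W \<inter> res Z H1)" unfolding pr_def
    by (intro alm_inter alm_refl dfn_sub dW dfn_res dZ d1 dfn_car)
  have "\<not> W \<inter> res Z H1 \<subseteq> Y"
  proof
    assume "W \<inter> res Z H1 \<subseteq> Y"
    from alm_subset_right[OF WZ this dfn_car[OF YX(1)]] show False using YX(6) by blast
  qed
  then obtain a where a: "a \<in> W" "a \<in> res Z H1" "a \<notin> Y" by blast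
  have aG: "a \<in> G1" "a \<in> G" using a(1) dW G1G by auto
  have ka: "alm (kr a) X" by (rule ker_comparable[OF YX(1) YG YX(4) aG(1) closed_not_in[OF YX(3) aG(1) a(3)]])
  have "y \<in> res K0 X" using y(1) PU YX(3) by blast
  then have Xy: "alm X (kr y)" using res_kr[OF yG(2) dfn_sub[OF YX(2)] XH] by blast
  have UY: "U \<subseteq> Y" unfolding U_def by blast
  have "resl K0 Y \<subseteq> resl K0 U" by (rule resl_mono_Y[OF alm_subset[OF UY dfn_car[OF YX(1)]] dfn_sub[OF YX(1)] dfn_sub[OF dU(1)] s1(4)])
  then have XXu: "X \<subseteq> Xu" unfolding Xu_def using YX(4) by blast
  have ny: "\<not> alm (kr y) X"
  proof
    assume "alm (kr y) X"
    then have "alm (kr y) Xu" using alm_subset_right[OF _ XXu] dfn_car[OF d1(2)] unfolding Xu_def by blast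
    then show False using y(1) unfolding P_def by blast
  qed
  from nilpotent obtain N where N: "\<forall>a y Y X. a \<in> G1 --> y \<in> G1 --> dfn Y --> Y \<subseteq> G1 --> X = H1 \<inter> resl K0 Y --> alm (kr a) X --> alm X (kr y) -->
     \<not> alm (kr y) X --> alm ((TT a y ^^ N) `` H1) X" by (rule exE)
  have TN: "alm ((TT a y ^^ N) `` H1) X" by (rule N[rule_format, OF aG(1) yG(1) YX(1) YG YX(4) ka Xy ny])
  have aT: "arel (TT a y)" by (rule arel_TT[OF aG(2) yG(2)])
  have big: "alm H1 (TT a y `` H1)"
    by (rule TT_large[OF aG(2) yG(2) s1(2) order_refl s1(2) order_refl]) (use a(2) in \<open>simp add: res_def Z_def\<close>)
  have "alm H1 ((TT a y ^^ k) `` H1) \<and> subgroup ((TT a y ^^ k) `` H1) A" for k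
  proof (induction k)
    case 0 show ?case using alm_refl s1 by simp
  next
    case (Suc k)
    have e: "(TT a y ^^ Suc k) `` H1 = TT a y `` ((TT a y ^^ k) `` H1)" by (simp add: relcomp_Image)
    have "alm (TT a y `` H1) (TT a y `` ((TT a y ^^ k) `` H1))" using Suc by (intro alm_image aT s1) auto
    moreover have s: "subgroup (TT a y `` ((TT a y ^^ k) `` H1)) A" using Suc sub_image[OF aT] by blast
    ultimately show ?case unfolding e using alm_trans[OF big _ sub_sub[OF s]] by blast
  qed
  then have "alm H1 X" using alm_trans[OF _ TN dfn_car[OF YX(2)]] by blast
  then have "alm H1 (resl K0 Y)" by (rule alm_subset_right) (use YX(4) resl_H cH in auto)
  then have "pr Y H1 K0" using flip[OF YX(1) YG d1(2) order_refl d1(4)] by blast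
  then have "alm Y OG" unfolding OG_def pr_def
    by (intro alm_inter[OF alm_subset[OF YG dfn_car[OF d1(1)]]] s1 sub_res d1 dfn_car YX)
  then have "alm (Y \<inter> W) OG" by (rule alm_subset_left) blast
  then show False using YX(5) by blast
qed

text \<open>One link of the chain: \<open>X'\<close> is mapped by almost all of \<open>G1\<close> into \<open>Z\<close>, but \<open>X\<close> is not.\<close>

definition step :: "'a set => 'a set => 'a set => bool" where
  "step X X' Z \<longleftrightarrow> dfn Z \<and> Z \<subseteq> K \<and> K0 \<subseteq> Z \<and> alm Z K1 \<and> \<not> pr G1 X Z \<and> pr G1 X' Z"

text \<open>Here \<open>Z\<close> is the image of \<open>G1\<close> under a single \<open>h \<in> H1\<close>, found by \<open>good_element\<close> with the two sides
exchanged, and \<open>X'\<close> is the group of elements mapping \<open>G1\<close> almost into it.\<close>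

lemma step_exists:
  assumes dX: "dfn X" "X \<subseteq> H1" and nX: "\<not> alm X OH"
  shows "\<exists>X' Z. dfn X' \<and> X' \<subseteq> H1 \<and> \<not> alm X' OH \<and> step X X' Z"
proof -
  interpret sw: qmin A \<Gamma> H G K "\<lambda>h g. lam g h" H1 G1 K1 K0 by (rule qmin_swap)
  have "\<not> alm X sw.OG" using nX by (simp add: sw_OG)
  from sw.good_element[OF dX this] obtain h where h: "h \<in> H1" "\<not> sw.pr X G1 (gl h `` G1 <#> K0)" "\<not> alm (H1 \<inter> resl (gl h `` G1 <#> K0) G1) OH"
    by (auto simp: sw sw_OG)
  define Z where "Z = gl h `` G1 <#> K0"
  have dZ: "dfn Z" "Z \<subseteq> K" "alm Z K1" using sw.dfn_Z[OF h(1) d1(1)] sw.Z_K[OF h(1)] sw.Z_K1[OF h(1) d1(1) order_refl] unfolding Z_def by (simp_all add: sw)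
  have KZ: "K0 \<subseteq> Z" unfolding Z_def using sw.sub_gr[OF sw.G1G[OF h(1)] s1(1)] s1(4) by (intro sub_right) (simp_all add: sw)
  have 1: "\<not> pr G1 X Z" using h(2) flip[OF d1(1) order_refl dX dZ(1)] unfolding sw.pr_def Z_def by (simp add: sw)
  define X' where "X' = H1 \<inter> resl Z G1"
  have dX': "dfn X'" "X' \<subseteq> H1" unfolding X'_def by (auto intro!: dfn_Int dfn_resl d1 dZ)
  have "alm X' (resl Z G1)" by (rule alm_subset) (use resl_H cH in \<open>auto simp: X'_def\<close>)
  then have 2: "pr G1 X' Z" using flip[OF d1(1) order_refl dX' dZ(1)] by blast
  have "\<not> alm X' OH" using h(3) unfolding X'_def Z_def .
  then show ?thesis using dX' dZ KZ 1 2 unfolding step_def by blast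
qed

text \<open>Take the chain \<open>Xs\<close> of length \<open>N\<close>, the bound of \<open>nilpotent\<close>, and a closed pair \<open>(Y, XX)\<close> such that \<open>Y\<close> is
not almost contained in any of the residuals attached to the chain. A generic \<open>y \<in> Y\<close> has large kernel
and, by \<open>good_small\<close> and \<open>pr_trans_K\<close>, almost all of \<open>G1\<close> map \<open>Xs (Suc i)\<close> into \<open>\<lambda>\<^sub>y[Xs i] + K0\<close>. So there is
such an \<open>a\<close> outside \<open>Y\<close>. Then \<open>TT a y\<close> carries \<open>Xs i\<close> over \<open>Xs (Suc i)\<close> and its \<open>N\<close>-th power covers \<open>Xs N\<close>,
whereas by \<open>nilpotent\<close> it is almost contained in \<open>XX\<close>; but \<open>Y\<close> does not annihilate \<open>Xs N\<close>.\<close>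

lemma impossible: False
proof -
  from nilpotent obtain N where N: "\<forall>a y Y X. a \<in> G1 --> y \<in> G1 --> dfn Y --> Y \<subseteq> G1 --> X = H1 \<inter> resl K0 Y --> alm (kr a) X --> alm X (kr y) -->
     \<not> alm (kr y) X --> alm ((TT a y ^^ N) `` H1) X" by (rule exE)
  have nG: "\<not> alm G1 OG"
  proof
    assume "alm G1 OG"
    then have "alm G1 (res K0 H1)" by (rule alm_subset_right) (use res_G cG in \<open>auto simp: OG_def\<close>)
    then show False using d1(9) unfolding pr_def by blast
  qed
  have nH: "\<not> alm H1 OH"
  proof
    assume "alm H1 OH"
    then have "alm H1 (resl K0 G1)" by (rule alm_subset_right) (use resl_H cH in \<open>auto simp: OH_def\<close>)
    then show False using d1(9) flip[OF d1(1) order_refl d1(2) order_refl d1(4)] by blast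
  qed
  have "\<exists>Xs. \<forall>n. ((dfn (Xs n) \<and> Xs n \<subseteq> H1 \<and> \<not> alm (Xs n) OH) \<and> (n = 0 --> Xs n = H1)) \<and> (\<exists>Z. step (Xs n) (Xs (Suc n)) Z)"
  proof -
    have "\<exists>Xs. \<forall>n. ((dfn (Xs n) \<and> Xs n \<subseteq> H1 \<and> \<not> alm (Xs n) OH) \<and> (n = 0 --> Xs n = H1)) \<and> (\<exists>Z. step (Xs n) (Xs (Suc n)) Z)"
    proof (rule dependent_nat_choice)
      show "\<exists>X. (dfn X \<and> X \<subseteq> H1 \<and> \<not> alm X OH) \<and> ((0::nat) = 0 --> X = H1)" using d1 nH by blast
      fix X and n :: nat assume "(dfn X \<and> X \<subseteq> H1 \<and> \<not> alm X OH) \<and> (n = 0 --> X = H1)"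
      then show "\<exists>X'. ((dfn X' \<and> X' \<subseteq> H1 \<and> \<not> alm X' OH) \<and> (Suc n = 0 --> X' = H1)) \<and> (\<exists>Z. step X X' Z)"
        using step_exists[of X] by blast
    qed
    then show ?thesis .
  qed
  then obtain Xs where Xs: "\<forall>n. ((dfn (Xs n) \<and> Xs n \<subseteq> H1 \<and> \<not> alm (Xs n) OH) \<and> (n = 0 --> Xs n = H1)) \<and> (\<exists>Z. step (Xs n) (Xs (Suc n)) Z)" by (rule exE)
  have X: "dfn (Xs n)" "Xs n \<subseteq> H1" "\<not> alm (Xs n) OH" "Xs 0 = H1" for n using Xs by auto
  have "\<forall>n. \<exists>Z. step (Xs n) (Xs (Suc n)) Z" using Xs by blast
  from choice[OF this] obtain Z where Z0: "\<forall>n. step (Xs n) (Xs (Suc n)) (Z n)" by (rule exE)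
  have Z: "dfn (Z n)" "Z n \<subseteq> K" "K0 \<subseteq> Z n" "alm (Z n) K1" "\<not> pr G1 (Xs n) (Z n)" "pr G1 (Xs (Suc n)) (Z n)" for n
    using Z0[rule_format, of n] unfolding step_def by auto
  have XH: "Xs n \<subseteq> H" for n using X(2) d1 by blast
  define R where "R i = res (Z i) (Xs i)" for i
  define RN where "RN = res K0 (Xs N)"
  define RR where "RR = insert RN (R ` {..<N})"
  have dR: "dfn (R i)" "dfn RN" for i unfolding R_def RN_def by (intro dfn_res Z X XH d1)+
  have nRN: "\<not> alm G1 RN"
  proof
    assume "alm G1 RN"
    then have "alm (Xs N) (resl K0 G1)" using flip[OF d1(1) order_refl X(1,2) d1(4)] unfolding RN_def pr_def by blast
    from alm_inter[OF alm_subset[OF X(2) dfn_car[OF d1(2)]] this s1(2) dfn_sub[OF dfn_resl[OF d1(4,1,5)]] dfn_car[OF X(1)]]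
    show False using X(3) unfolding OH_def by blast
  qed
  have nR: "\<not> alm G1 (R i)" for i using Z(5)[of i] unfolding pr_def R_def .
  have "\<exists>Y X. dfn Y \<and> dfn X \<and> Y = G1 \<inter> res K0 X \<and> X = H1 \<inter> resl K0 Y \<and> (\<forall>R\<in>RR. \<not> alm (Y \<inter> G1) R) \<and> \<not> alm G1 Y"
    by (rule closed_pair[OF d1(1) order_refl _ _ nG]) (use dR nRN nR in \<open>auto simp: RR_def\<close>)
  then obtain Y XX where YX: "dfn Y" "dfn XX" "Y = G1 \<inter> res K0 XX" "XX = H1 \<inter> resl K0 Y" "\<forall>R\<in>RR. \<not> alm (Y \<inter> G1) R" "\<not> alm G1 Y"
    by (elim exE conjE)
  have YG: "Y \<subseteq> G1" using YX(3) by blast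
  have XXH: "XX \<subseteq> H1" using YX(4) by blast
  have "Y \<inter> G1 = Y" using YG by blast
  then have nYR: "\<not> alm Y (R i)" if "i < N" for i using YX(5) that unfolding RR_def by auto
  have nYRN: "\<not> alm Y RN" using YX(5) \<open>Y \<inter> G1 = Y\<close> unfolding RR_def by auto
  have npY: "\<not> pr Y H1 K0"
  proof
    assume p: "pr Y H1 K0"
    have "pr Y (Xs N) K0" by (rule pr_mono_X[OF p alm_subset[OF X(2) dfn_car[OF d1(2)]] s1(2) dfn_sub[OF X(1)] s1(4) XH])
    then show False using nYRN unfolding pr_def RN_def by blast
  qed
  define P where "P = {y \<in> Y \<inter> res K0 XX. \<not> alm (kr y) XX}"
  have P: "dfn P" "alm Y P" using generic_kernel[OF YX(1) YG npY YX(4) P_def] by auto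
  have PY: "P \<subseteq> Y" "P \<subseteq> G1" unfolding P_def using YG by auto
  have nPR: "\<not> alm P (R i)" if "i < N" for i using nYR[OF that] alm_trans[OF P(2) _ dfn_car[OF dR(1)]] by blast
  define bad where "bad i = {v \<in> P. alm (P \<inter> res (gr v `` Xs i <#> K0) (Xs i)) (R i)}" for i
  have "small P (\<Union>i\<in>{..<N}. bad i)" unfolding bad_def
    by (intro small_UN finite_lessThan good_small P X dR PY nPR) simp
  then have "\<not> P \<subseteq> (\<Union>i\<in>{..<N}. bad i)" using not_small[OF dfn_sub[OF P(1)]] small_subset by blast
  then obtain y where y: "y \<in> P" "\<And>i. i < N ==> y \<notin> bad i" by blast
  have yG: "y \<in> G1" "y \<in> G" using y(1) PY G1G by auto
  define V where "V i = gr y `` Xs i <#> K0" for i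
  have V: "dfn (V i)" "V i \<subseteq> K" "alm K0 (V i)" "alm (V i) K1" for i unfolding V_def
    by (intro dfn_Z Z_K Z_K0 Z_K1 yG X)+
  have pV: "pr G1 (Xs (Suc i)) (V i)" if i: "i < N" for i
  proof -
    define E where "E = P \<inter> res (V i) (Xs i)"
    have dE: "dfn E" "E \<subseteq> G1" unfolding E_def using PY by (auto intro!: dfn_Int P dfn_res V X XH)
    have nE: "\<not> pr E (Xs i) (Z i)" using y(2)[OF i] y(1) unfolding bad_def E_def pr_def R_def V_def by blast
    have E: "pr E (Xs i) (V i)" unfolding pr_def E_def by (intro alm_subset dfn_car dfn_res V X XH) blast
    have KZ: "alm K0 (Z i)" by (rule alm_subset[OF Z(3) dfn_car[OF Z(1)]])
    show ?thesis
      by (rule pr_trans_K[OF d1(1) X(1) dE(1) X(1) Z(1) V(1) order_refl X(2) dE(2) X(2) Z(2) V(2) KZ V(3) Z(4) V(4) Z(6) nE E])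
  qed
  have sI: "alm G1 (G1 \<inter> (\<Inter>i\<in>{..<N}. res (V i) (Xs (Suc i))))"
    by (rule conjunct1[OF alm_INT[OF alm_refl[OF s1(1)] s1(1) s1(1) finite_lessThan]])
      (use pV in \<open>auto simp: pr_def intro!: sub_res dfn_sub[OF V(1)] dfn_sub[OF X(1)] XH\<close>)
  have "\<not> G1 \<inter> (\<Inter>i\<in>{..<N}. res (V i) (Xs (Suc i))) \<subseteq> Y"
  proof
    assume "G1 \<inter> (\<Inter>i\<in>{..<N}. res (V i) (Xs (Suc i))) \<subseteq> Y"
    from alm_subset_right[OF sI this dfn_car[OF YX(1)]] show False using YX(6) by blast
  qed
  then obtain a where a: "a \<in> G1" "\<And>i. i < N ==> a \<in> res (V i) (Xs (Suc i))" "a \<notin> Y" by blast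
  have aG: "a \<in> G" using a(1) G1G by blast
  have ka: "alm (kr a) XX" by (rule ker_comparable[OF YX(1) YG YX(4) a(1) closed_not_in[OF YX(3) a(1) a(3)]])
  have "y \<in> res K0 XX" using y(1) unfolding P_def by blast
  then have Xy: "alm XX (kr y)" using res_kr[OF yG(2) dfn_sub[OF YX(2)] XXH] by blast
  have ny: "\<not> alm (kr y) XX" using y(1) unfolding P_def by blast
  have TN: "alm ((TT a y ^^ N) `` H1) XX" by (rule N[rule_format, OF a(1) yG(1) YX(1) YG YX(4) ka Xy ny])
  have aT: "arel (TT a y)" by (rule arel_TT[OF aG yG(2)])
  have "alm (Xs k) ((TT a y ^^ k) `` H1) \<and> subgroup ((TT a y ^^ k) `` H1) A" if "k \<le> N" for k
    using that
  proof (induction k)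
    case 0 show ?case using alm_refl s1 X(4) by simp
  next
    case (Suc k)
    have e: "(TT a y ^^ Suc k) `` H1 = TT a y `` ((TT a y ^^ k) `` H1)" by (simp add: relcomp_Image)
    have k: "k < N" using Suc by simp
    have IH: "alm (Xs k) ((TT a y ^^ k) `` H1)" "subgroup ((TT a y ^^ k) `` H1) A" using Suc by auto
    have s: "subgroup (TT a y `` ((TT a y ^^ k) `` H1)) A" using IH(2) sub_image[OF aT] by blast
    have 1: "alm (TT a y `` Xs k) (TT a y `` ((TT a y ^^ k) `` H1))" by (intro alm_image aT IH dfn_sub X)
    have 2: "alm (Xs (Suc k)) (TT a y `` Xs k)"
      by (rule TT_large[OF aG yG(2) dfn_sub[OF X(1)] X(2) dfn_sub[OF X(1)] X(2)]) (use a(2)[OF k] in \<open>simp add: res_def V_def\<close>)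
    show ?case unfolding e using alm_trans[OF 2 1 sub_sub[OF s]] s by blast
  qed
  then have "alm (Xs N) XX" using alm_trans[OF _ TN dfn_car[OF YX(2)]] by blast
  then have "alm (Xs N) (resl K0 Y)" by (rule alm_subset_right) (use YX(4) resl_H cH in auto)
  then have "pr Y (Xs N) K0" using flip[OF YX(1) YG X(1,2) d1(4)] by blast
  then show False using nYRN unfolding pr_def RN_def by blast
qed

end

theorem (in qform) almost_all_trivial: "pr G H {\<one>}"
proof (rule ccontr)
  assume "\<not> pr G H {\<one>}"
  then obtain G1 H1 K1 K0 where "qmin A \<Gamma> G H K lam G1 H1 K1 K0" using qmin_exists by blast
  then interpret qmin A \<Gamma> G H K lam G1 H1 K1 K0 .
  show False by (rule impossible)
qed

section \<open>Types and automorphisms in an omega-categorical theory\<close>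

lemma finite_trm_vars: "finite (trm_vars t)" by (induction t) auto

lemma finite_free_vars: "finite (free_vars \<phi>)"
  by (induction \<phi>) (auto simp: finite_trm_vars)

lemma eval_cong: "(\<And>i. i \<in> trm_vars t ==> e i = e' i) ==> eval_trm M e t = eval_trm M e' t"
proof (induction t)
  case (App f ts)
  have "map (eval_trm M e) ts = map (eval_trm M e') ts"
    by (rule map_cong[OF refl]) (use App in auto)
  then show ?case by (simp only: eval_trm.simps)
qed auto

lemma sat_cong: "(\<And>i. i \<in> free_vars \<phi> ==> e i = e' i) ==> sat M e \<phi> \<longleftrightarrow> sat M e' \<phi>"
proof (induction \<phi> arbitrary: e e')
  case (Equal s t)
  then have "eval_trm M e s = eval_trm M e' s" "eval_trm M e t = eval_trm M e' t" by (auto intro: eval_cong)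
  then show ?case by simp
next
  case (Rel r ts)
  then have "map (eval_trm M e) ts = map (eval_trm M e') ts" by (intro map_cong refl eval_cong) auto
  then show ?case by (simp only: sat.simps)
next
  case (Neg \<phi>)
  show ?case using Neg.IH[of e e'] Neg.prems by simp
next
  case (Conj \<phi> \<psi>)
  show ?case using Conj.IH(1)[of e e'] Conj.IH(2)[of e e'] Conj.prems by simp
next
  case (Exists i \<phi>)
  have "sat M (e(i := c)) \<phi> \<longleftrightarrow> sat M (e'(i := c)) \<phi>" for c
    by (rule Exists.IH) (use Exists.prems in auto)
  then show ?case by simp
qed

fun ren_trm :: "(nat => nat) => 'f trm => 'f trm" where
  "ren_trm r (Var i) = Var (r i)"
| "ren_trm r (App f ts) = App f (map (ren_trm r) ts)"

definition fresh :: "nat set => nat" where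
  "fresh S = Suc (Max (insert 0 S))"

lemma fresh: assumes "finite S" shows "fresh S \<notin> S"
proof
  assume "fresh S \<in> S"
  then have "fresh S \<le> Max (insert 0 S)" using assms by (intro Max_ge) auto
  then show False unfolding fresh_def by simp
qed

text \<open>Simultaneous renaming of free variables, which need not be injective; bound variables are replaced
by fresh ones, so there is no capture and \<open>ren_sat\<close> holds without side conditions.\<close>

fun ren :: "(nat => nat) => ('f, 'r) fm => ('f, 'r) fm" where
  "ren r (Equal s t) = Equal (ren_trm r s) (ren_trm r t)"
| "ren r (Rel R ts) = Rel R (map (ren_trm r) ts)"
| "ren r (Neg \<phi>) = Neg (ren r \<phi>)"
| "ren r (Conj \<phi> \<psi>) = Conj (ren r \<phi>) (ren r \<psi>)"
| "ren r (Exists i \<phi>) = (let k = fresh (r ` free_vars \<phi>) in Exists k (ren (r(i := k)) \<phi>))"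

lemma ren_trm_vars: "trm_vars (ren_trm r t) = r ` trm_vars t" by (induction t) auto

lemma ren_trm_wf: "wf_trm L t ==> wf_trm L (ren_trm r t)" by (induction t) auto

lemma ren_eval: "eval_trm M e (ren_trm r t) = eval_trm M (\<lambda>i. e (r i)) t"
proof (induction t)
  case (App f ts)
  have "map (eval_trm M e) (map (ren_trm r) ts) = map (eval_trm M (\<lambda>i. e (r i))) ts" using App by simp
  then show ?case by (simp only: eval_trm.simps ren_trm.simps)
qed simp

lemma ren_wf: "wf_fm L \<phi> ==> wf_fm L (ren r \<phi>)"
  by (induction \<phi> arbitrary: r) (auto simp: ren_trm_wf Let_def)

lemma ren_vars: "free_vars (ren r \<phi>) = r ` free_vars \<phi>"
proof (induction \<phi> arbitrary: r)
  case (Exists i \<phi>)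
  define k where "k = fresh (r ` free_vars \<phi>)"
  have k: "k \<notin> r ` free_vars \<phi>" unfolding k_def by (intro fresh finite_imageI finite_free_vars)
  have "free_vars (ren r (Exists i \<phi>)) = (r(i := k)) ` free_vars \<phi> - {k}" by (simp only: ren.simps Let_def k_def[symmetric] free_vars.simps Exists)
  also have "\<dots> = r ` (free_vars \<phi> - {i})" using k by (auto simp: image_iff)
  finally show ?case by simp
qed (auto simp: ren_trm_vars)

lemma ren_sat: "sat M e (ren r \<phi>) \<longleftrightarrow> sat M (\<lambda>i. e (r i)) \<phi>"
proof (induction \<phi> arbitrary: r e)
  case (Rel R ts)
  have "map (eval_trm M e) (map (ren_trm r) ts) = map (eval_trm M (\<lambda>i. e (r i))) ts" by (simp add: ren_eval)
  then show ?case by (simp only: sat.simps ren.simps)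
next
  case (Exists i \<phi>)
  define k where "k = fresh (r ` free_vars \<phi>)"
  have k: "k \<notin> r ` free_vars \<phi>" unfolding k_def by (intro fresh finite_imageI finite_free_vars)
  have "sat M (e(k := c)) (ren (r(i := k)) \<phi>) \<longleftrightarrow> sat M ((\<lambda>i. e (r i))(i := c)) \<phi>" for c
    unfolding Exists by (rule sat_cong) (use k in auto)
  then show ?case by (simp only: ren.simps Let_def k_def[symmetric] sat.simps)
qed (auto simp: ren_eval)

lemma holds_cong: "\<phi> \<in> formulas L n ==> (\<And>i. i < n ==> x ! i = y ! i) ==> holds M \<phi> x \<longleftrightarrow> holds M \<phi> y"
  unfolding holds_def by (rule sat_cong) (auto simp: formulas_def)

lemma holds_sat: "\<phi> \<in> formulas L n ==> (\<And>i. i < n ==> x ! i = e i) ==> holds M \<phi> x \<longleftrightarrow> sat M e \<phi>"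
  unfolding holds_def by (rule sat_cong) (auto simp: formulas_def)

lemma holds_Neg [simp]: "holds M (Neg \<phi>) x \<longleftrightarrow> \<not> holds M \<phi> x"
  and holds_Conj [simp]: "holds M (Conj \<phi> \<psi>) x \<longleftrightarrow> holds M \<phi> x \<and> holds M \<psi> x"
  by (simp_all add: holds_def)

lemma formulas_Neg [simp]: "Neg \<phi> \<in> formulas L n \<longleftrightarrow> \<phi> \<in> formulas L n"
  and formulas_Conj [simp]: "Conj \<phi> \<psi> \<in> formulas L n \<longleftrightarrow> \<phi> \<in> formulas L n \<and> \<psi> \<in> formulas L n"
  by (auto simp: formulas_def)

lemma formulas_mono: "\<phi> \<in> formulas L n ==> n \<le> m ==> \<phi> \<in> formulas L m"
  by (auto simp: formulas_def)

text \<open>A contradiction without free variables, so that it is available in \<open>formulas L 0\<close>.\<close>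

definition falsum :: "('f, 'r) fm" where "falsum = Neg (Exists 0 (Equal (Var 0) (Var 0)))"

lemma falsum_formula: "falsum \<in> formulas L n" by (simp add: falsum_def formulas_def)

lemma holds_falsum: "is_struct L M ==> \<not> holds M falsum x"
  by (auto simp: falsum_def holds_def is_struct_def)

lemma disj_exists:
  assumes "is_struct L M" "finite \<Phi>" "\<Phi> \<subseteq> formulas L n"
  shows "\<exists>\<psi>\<in>formulas L n. \<forall>z. holds M \<psi> z \<longleftrightarrow> (\<exists>\<phi>\<in>\<Phi>. holds M \<phi> z)"
  using assms(2,3)
proof (induction \<Phi> rule: finite_induct)
  case empty then show ?case using falsum_formula[of L n] holds_falsum[OF assms(1)] by blast
next
  case (insert \<phi> \<Phi>)
  then obtain \<psi> where \<psi>: "\<psi> \<in> formulas L n" "\<forall>z. holds M \<psi> z \<longleftrightarrow> (\<exists>\<phi>\<in>\<Phi>. holds M \<phi> z)" by auto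
  have "Neg (Conj (Neg \<phi>) (Neg \<psi>)) \<in> formulas L n" using insert \<psi> by simp
  moreover have "\<forall>z. holds M (Neg (Conj (Neg \<phi>) (Neg \<psi>))) z \<longleftrightarrow> (\<exists>\<phi>\<in>insert \<phi> \<Phi>. holds M \<phi> z)" using \<psi>(2) by simp
  ultimately show ?case by blast
qed

lemma iso_eval:
  assumes "is_iso L M N h" "is_struct L M" "\<And>i. e i \<in> universe M"
  shows "wf_trm L t ==> eval_trm M e t \<in> universe M \<and> h (eval_trm M e t) = eval_trm N (\<lambda>i. h (e i)) t"
proof (induction t)
  case (App f ts)
  then have f: "f \<in> funs L" "length ts = farity L f" by auto
  define x where "x = map (eval_trm M e) ts"
  have x: "x \<in> tuples M (farity L f)" unfolding x_def tuples_def using App f by auto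
  have "map h x = map (eval_trm N (\<lambda>i. h (e i))) ts" unfolding x_def map_map o_def by (rule map_cong[OF refl]) (use App in auto)
  moreover have "h (fun_int M f x) = fun_int N f (map h x)" using assms(1) f x unfolding is_iso_def by blast
  moreover have "fun_int M f x \<in> universe M" using assms(2) f x unfolding is_struct_def by blast
  ultimately show ?case unfolding eval_trm.simps x_def[symmetric] by (simp only: simp_thms)
qed (simp add: assms)

lemma iso_sat:
  assumes "is_iso L M N h" "is_struct L M"
  shows "wf_fm L \<phi> ==> (\<And>i. e i \<in> universe M) ==> sat M e \<phi> \<longleftrightarrow> sat N (\<lambda>i. h (e i)) \<phi>"
proof (induction \<phi> arbitrary: e)
  case (Equal s t)
  note ev = iso_eval[OF assms, of e, OF Equal(2)]
  have "inj_on h (universe M)" using assms(1) by (simp add: is_iso_def bij_betw_def)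
  then have "eval_trm M e s = eval_trm M e t \<longleftrightarrow> h (eval_trm M e s) = h (eval_trm M e t)"
    using ev[of s] ev[of t] Equal(1) inj_on_eq_iff[of h "universe M" "eval_trm M e s" "eval_trm M e t"] by simp
  then show ?case using ev[of s] ev[of t] Equal(1) by (simp only: sat.simps wf_fm.simps)
next
  case (Rel r ts)
  note ev = iso_eval[OF assms, of e, OF Rel(2)]
  have t: "wf_trm L t" if "t \<in> set ts" for t using Rel(1) that by simp
  have "map (eval_trm M e) ts \<in> tuples M (rarity L r)" unfolding tuples_def using Rel(1) ev t by auto
  moreover have "map h (map (eval_trm M e) ts) = map (eval_trm N (\<lambda>i. h (e i))) ts"
    unfolding map_map o_def by (rule map_cong[OF refl]) (use ev t in auto)
  moreover have "r \<in> rels L" using Rel(1) by simp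
  ultimately have "rel_int M r (map (eval_trm M e) ts) \<longleftrightarrow> rel_int N r (map (eval_trm N (\<lambda>i. h (e i))) ts)"
    using assms(1) unfolding is_iso_def by metis
  then show ?case by (simp only: sat.simps)
next
  case (Neg \<phi>) then show ?case by simp
next
  case (Conj \<phi> \<psi>) then show ?case by simp
next
  case (Exists i \<phi>)
  have im: "h ` universe M = universe N" using assms(1) by (simp add: is_iso_def bij_betw_def)
  have "sat M (e(i := c)) \<phi> \<longleftrightarrow> sat N ((\<lambda>i. h (e i))(i := h c)) \<phi>" if "c \<in> universe M" for c
  proof -
    have wf: "wf_fm L \<phi>" using Exists(2) by simp
    have eU: "(e(i := c)) j \<in> universe M" for j using Exists(3) that by simp
    have "sat M (e(i := c)) \<phi> \<longleftrightarrow> sat N (\<lambda>j. h ((e(i := c)) j)) \<phi>" by (rule Exists(1)[OF wf eU])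
    moreover have "(\<lambda>j. h ((e(i := c)) j)) = (\<lambda>i. h (e i))(i := h c)" by auto
    ultimately show ?thesis by (simp only:)
  qed
  then show ?case unfolding sat.simps im[symmetric] by blast
qed

lemma iso_holds:
  assumes "is_iso L M N h" "is_struct L M" "\<phi> \<in> formulas L (length x)" "set x \<subseteq> universe M"
  shows "holds M \<phi> x \<longleftrightarrow> holds N \<phi> (map h x)"
proof -
  obtain u where u: "u \<in> universe M" using assms(2) unfolding is_struct_def by blast
  define e where "e i = (if i < length x then x ! i else u)" for i
  have eM: "e i \<in> universe M" for i unfolding e_def using assms(4) u by auto
  have "holds M \<phi> x \<longleftrightarrow> sat M e \<phi>" by (rule holds_sat[OF assms(3)]) (simp add: e_def)
  also have "\<dots> \<longleftrightarrow> sat N (\<lambda>i. h (e i)) \<phi>" using assms(3) eM by (intro iso_sat[OF assms(1,2)]) (simp_all add: formulas_def)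
  also have "\<dots> \<longleftrightarrow> holds N \<phi> (map h x)" by (rule holds_sat[OF assms(3), symmetric]) (simp add: e_def)
  finally show ?thesis .
qed

instance trm :: (countable) countable by countable_datatype
instance fm :: (countable, countable) countable by countable_datatype

lemma wf_trm_funs: "wf_trm L t ==> set_trm t \<subseteq> funs L" by (induction t) auto

lemma wf_fm_symbols: "wf_fm L \<phi> ==> set1_fm \<phi> \<subseteq> funs L \<and> set2_fm \<phi> \<subseteq> rels L"
  by (induction \<phi>) (use wf_trm_funs in fastforce)+

lemma countable_formulas:
  assumes "countable (funs L)" "countable (rels L)" shows "countable {\<phi>. wf_fm L \<phi>}"
proof -
  define f where "f = (map_fm (to_nat_on (funs L)) (to_nat_on (rels L)) :: _ => (nat, nat) fm)"
  have "inj_on f {\<phi>. wf_fm L \<phi>}"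
  proof (rule inj_onI)
    fix \<phi> \<psi> assume h: "\<phi> \<in> {\<phi>. wf_fm L \<phi>}" "\<psi> \<in> {\<phi>. wf_fm L \<phi>}" "f \<phi> = f \<psi>"
    have s: "set1_fm \<phi> \<subseteq> funs L" "set1_fm \<psi> \<subseteq> funs L" "set2_fm \<phi> \<subseteq> rels L" "set2_fm \<psi> \<subseteq> rels L"
      using wf_fm_symbols h by blast+
    show "\<phi> = \<psi>" by (rule fm.inj_map_strong[OF _ _ h(3)[unfolded f_def]])
        (use s inj_on_to_nat_on[OF assms(1)] inj_on_to_nat_on[OF assms(2)] in \<open>auto dest: inj_onD\<close>)
  qed
  then show ?thesis using countable_image_inj_on[of f] by (metis countableI_type)
qed

locale monster =
  fixes L :: "('f, 'r) language" and T and \<kappa> :: "'k rel" and M :: "('f, 'r, 'm) fo_struct"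
  assumes cat: "omega_categorical L T" and mon: "monster_model L T \<kappa> M"
begin

abbreviation "U \<equiv> universe M"

lemma str: "is_struct L M" and mod: "models L M T" and sat_M: "saturated L M \<kappa>" and hom_M: "homogeneous L M \<kappa>"
  using mon unfolding monster_model_def models_def by auto

lemma U_ne: "U \<noteq> {}" using str unfolding is_struct_def by blast

lemma small_card: "finite B ==> card_of B <o \<kappa>"
  using mon ordLess_transitive finite_iff_ordLess_natLeq unfolding monster_model_def by blast

text \<open>Equality of types over the empty set.\<close>

definition ty :: "'m list => 'm list => bool" where
  "ty x y \<longleftrightarrow> length x = length y \<and> (\<forall>\<phi>\<in>formulas L (length x). holds M \<phi> x \<longleftrightarrow> holds M \<phi> y)"

lemma ty_refl: "ty x x" by (simp add: ty_def)
lemma ty_sym: "ty x y ==> ty y x" by (auto simp: ty_def)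

text \<open>An enumeration of all triples of a formula, a variable to be quantified, and a finite list of
indices, in which each triple occurs infinitely often.\<close>

definition req :: "nat => ('f, 'r) fm \<times> nat \<times> nat list" where
  "req k = from_nat_into ({\<phi>. wf_fm L \<phi>} \<times> UNIV) (fst (prod_decode k))"

lemma req_inf: assumes "wf_fm L \<phi>" shows "\<exists>k\<ge>t. req k = (\<phi>, i, s)"
proof -
  have "countable ({\<phi>. wf_fm L \<phi>} \<times> (UNIV :: (nat \<times> nat list) set))"
    using countable_formulas cat unfolding omega_categorical_def by (intro countable_SIGMA) auto
  from from_nat_into_surj[OF this, of "(\<phi>, i, s)"] obtain n where "from_nat_into ({\<phi>. wf_fm L \<phi>} \<times> UNIV) n = (\<phi>, i, s)" using assms by auto
  then have "req (prod_encode (n, t)) = (\<phi>, i, s)" unfolding req_def by simp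
  then show ?thesis using le_prod_encode_2 by blast
qed

definition rfm :: "nat => ('f, 'r) fm" where
  "rfm k = (case req k of (\<phi>, i, s) => ren ((\<lambda>j. s ! j)(i := k)) \<phi>)"

definition elem :: "(nat => 'm) => bool" where
  "elem c \<longleftrightarrow> range c \<subseteq> U \<and> is_struct L (M\<lparr>universe := range c\<rparr>) \<and>
     (\<forall>\<phi> e. wf_fm L \<phi> --> (\<forall>i. e i \<in> range c) --> (sat (M\<lparr>universe := range c\<rparr>) e \<phi> \<longleftrightarrow> sat M e \<phi>))"

text \<open>A Henkin construction inside \<open>M\<close>. Finite lists are extended one element at a time, the \<open>k\<close>-th step
providing a witness for \<open>rfm k\<close> if there is one; as each requirement returns after all indices it
mentions have been used, the Tarski-Vaught test holds in the end. The predicate \<open>Good\<close> is what every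
finite stage preserves: it is trivial for a countable elementary substructure through given elements,
and ``the type is isolated'' for an atomic one.\<close>

lemma elem_exists:
  assumes a0: "Good a0" "set a0 \<subseteq> U"
    and ext: "\<And>cs \<psi> d. Good cs ==> set cs \<subseteq> U ==> \<psi> \<in> formulas L (Suc (length cs)) ==> d \<in> U ==> holds M \<psi> (cs @ [d]) ==>
      \<exists>d\<in>U. Good (cs @ [d]) \<and> holds M \<psi> (cs @ [d])"
  shows "\<exists>c. elem c \<and> map c [0..<length a0] = a0 \<and> (\<forall>k\<ge>length a0. Good (map c [0..<k]))"
proof -
  define la where "la = length a0"
  define P where "P n cs \<longleftrightarrow> length cs = la + n \<and> set cs \<subseteq> U \<and> Good cs \<and> (n = 0 --> cs = a0)" for n cs
  define Q where "Q n cs cs' \<longleftrightarrow> (\<exists>d\<in>U. cs' = cs @ [d] \<and> (rfm (la + n) \<in> formulas L (Suc (la + n)) -->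
     (\<exists>d'\<in>U. holds M (rfm (la + n)) (cs @ [d'])) --> holds M (rfm (la + n)) (cs @ [d])))" for n :: nat and cs cs'
  obtain u where u: "u \<in> U" using U_ne by blast
  have "\<exists>f. \<forall>n. P n (f n) \<and> Q n (f n) (f (Suc n))"
  proof (rule dependent_nat_choice)
    show "\<exists>cs. P 0 cs" using a0 unfolding P_def la_def by auto
    fix cs n assume Pn: "P n cs"
    have true: "\<exists>d\<in>U. Good (cs @ [d])"
      using ext[of cs "Neg falsum" u] Pn u falsum_formula[of L] holds_falsum[OF str] unfolding P_def by auto
    have "\<exists>d\<in>U. Good (cs @ [d]) \<and> (rfm (la + n) \<in> formulas L (Suc (la + n)) -->
     (\<exists>d'\<in>U. holds M (rfm (la + n)) (cs @ [d'])) --> holds M (rfm (la + n)) (cs @ [d]))"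
    proof (cases "rfm (la + n) \<in> formulas L (Suc (la + n)) \<and> (\<exists>d'\<in>U. holds M (rfm (la + n)) (cs @ [d']))")
      case True
      then show ?thesis using ext[of cs "rfm (la + n)"] Pn unfolding P_def by auto
    next
      case False then show ?thesis using true by blast
    qed
    then obtain d where "d \<in> U" "Good (cs @ [d])" "rfm (la + n) \<in> formulas L (Suc (la + n)) -->
     (\<exists>d'\<in>U. holds M (rfm (la + n)) (cs @ [d'])) --> holds M (rfm (la + n)) (cs @ [d])" by blast
    then have "P (Suc n) (cs @ [d]) \<and> Q n cs (cs @ [d])" using Pn unfolding P_def Q_def by auto
    then show "\<exists>cs'. P (Suc n) cs' \<and> Q n cs cs'" by blast
  qed
  then obtain f where f0: "\<forall>n. P n (f n) \<and> Q n (f n) (f (Suc n))" by (rule exE)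
  have len: "length (f n) = la + n" and fU: "set (f n) \<subseteq> U" and fG: "Good (f n)" and f_0: "f 0 = a0" for n
    using f0 unfolding P_def by auto
  have fS: "\<exists>d\<in>U. f (Suc n) = f n @ [d] \<and> (rfm (la + n) \<in> formulas L (Suc (la + n)) -->
     (\<exists>d'\<in>U. holds M (rfm (la + n)) (f n @ [d'])) --> holds M (rfm (la + n)) (f n @ [d]))" for n
    using f0 unfolding Q_def by blast
  have pre: "f (n + m) ! i = f n ! i" if "i < la + n" for n m i
  proof (induction m)
    case (Suc m)
    obtain d where "f (Suc (n + m)) = f (n + m) @ [d]" using fS by blast
    then show ?case using Suc that len[of "n + m"] by (simp add: nth_append)
  qed simp
  define c where "c i = f (Suc i) ! i" for i
  have c: "f n ! i = c i" if "i < la + n" for n i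
  proof (cases "n \<le> Suc i")
    case True then show ?thesis using pre[OF that, of "Suc i - n"] unfolding c_def by simp
  next
    case False then show ?thesis using pre[of i "Suc i" "n - Suc i"] unfolding c_def by simp
  qed
  have cf: "map c [0..<la + n] = f n" for n by (rule nth_equalityI) (use len c in auto)
  have cU: "c i \<in> U" for i using fU[of "Suc i"] len[of "Suc i"] nth_mem[of i "f (Suc i)"] unfolding c_def by auto
  have tv: "\<exists>d\<in>range c. sat M (e(i := d)) \<phi>" if \<phi>: "wf_fm L \<phi>" and e: "\<And>j. e j \<in> range c" and d: "d \<in> U" "sat M (e(i := d)) \<phi>" for \<phi> e i d
  proof -
    have "\<forall>j. \<exists>k. e j = c k" using e by blast
    from choice[OF this] obtain s where s: "\<forall>j. e j = c (s j)" by blast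
    obtain B where B: "\<forall>j\<in>free_vars \<phi>. j < B" using finite_nat_set_iff_bounded finite_free_vars by blast
    define t where "t = la + Suc (\<Sum>j<B. s j)"
    have st: "s j < t" if "j < B" for j using member_le_sum[of j "{..<B}" s] that unfolding t_def by simp
    obtain k where k: "k \<ge> t" "req k = (\<phi>, i, map s [0..<B])" using req_inf[OF \<phi>] by blast
    define n where "n = k - la"
    have kn: "k = la + n" using k(1) unfolding n_def t_def by simp
    define r where "r = (\<lambda>j. map s [0..<B] ! j)(i := k)"
    have rk: "rfm k = ren r \<phi>" unfolding rfm_def k(2) r_def by simp
    have rs: "r j = s j" "s j < k" if "j \<in> free_vars \<phi>" "j \<noteq> i" for j using that B st[of j] k(1) unfolding r_def by auto
    have ri: "r i = k" unfolding r_def by simp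
    have fm: "rfm k \<in> formulas L (Suc k)" unfolding rk formulas_def
    proof (intro CollectI conjI ren_wf \<phi> subsetI)
      fix v assume "v \<in> free_vars (ren r \<phi>)"
      then obtain j where "j \<in> free_vars \<phi>" "v = r j" unfolding ren_vars by blast
      then show "v \<in> {..<Suc k}" using rs[of j] ri by (cases "j = i") auto
    qed
    have hold: "holds M (rfm k) (f n @ [d]) \<longleftrightarrow> sat M (e(i := d)) \<phi>" for d
      unfolding holds_def rk ren_sat
    proof (rule sat_cong)
      fix j assume j: "j \<in> free_vars \<phi>"
      show "(f n @ [d]) ! r j = (e(i := d)) j"
      proof (cases "j = i")
        case True then show ?thesis using ri len[of n] kn by (simp add: nth_append)
      next
        case False
        then show ?thesis using rs[OF j False] len[of n] kn c[of "s j" n] s by (simp add: nth_append)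
      qed
    qed
    obtain d' where d': "d' \<in> U" "f (Suc n) = f n @ [d']" "(\<exists>d'\<in>U. holds M (rfm k) (f n @ [d'])) --> holds M (rfm k) (f n @ [d'])"
      using fS[of n] fm unfolding kn by blast
    then have "sat M (e(i := d')) \<phi>" using hold d by blast
    moreover have "d' = c k" using d'(2) c[of k "Suc n"] kn len[of n] by (simp add: nth_append)
    ultimately show ?thesis by blast
  qed
  let ?N = "M\<lparr>universe := range c\<rparr>"
  have ev: "eval_trm ?N e t = eval_trm M e t" for e t
  proof (induction t)
    case (App g ts)
    then have "map (eval_trm ?N e) ts = map (eval_trm M e) ts" by auto
    moreover have "fun_int ?N = fun_int M" by simp
    ultimately show ?case by (simp only: eval_trm.simps)
  qed simp
  have sat: "sat ?N e \<phi> \<longleftrightarrow> sat M e \<phi>" if "wf_fm L \<phi>" "\<And>i. e i \<in> range c" for e \<phi>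
    using that
  proof (induction \<phi> arbitrary: e)
    case (Equal x1 x2) then show ?case by (simp add: ev)
  next
    case (Rel x1 x2)
    have "eval_trm ?N e = eval_trm M e" by (rule HOL.ext) (rule ev)
    then show ?case by simp
  next
    case (Exists i \<phi>)
    have IH: "sat ?N (e(i := d)) \<phi> \<longleftrightarrow> sat M (e(i := d)) \<phi>" if "d \<in> range c" for d
      using Exists that by simp
    have "sat M (e(i := d)) \<phi> ==> d \<in> U ==> \<exists>d\<in>range c. sat M (e(i := d)) \<phi>" for d
      using tv[where \<phi> = \<phi> and e = e and i = i, OF _ Exists(3)] Exists(2) by simp
    then show ?case using IH cU by auto
  qed auto
  have "is_struct L ?N" unfolding is_struct_def
  proof (intro conjI ballI)
    show "universe ?N \<noteq> {}" by simp
    fix g x assume g: "g \<in> funs L" and x: "x \<in> tuples ?N (farity L g)"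
    have xc: "set x \<subseteq> range c" "length x = farity L g" using x unfolding tuples_def by auto
    then have "x \<in> tuples M (farity L g)" using cU unfolding tuples_def by auto
    then have gU: "fun_int M g x \<in> U" using str g unfolding is_struct_def by blast
    define \<phi> where "\<phi> = (Equal (App g (map (\<lambda>i. Var (Suc i)) [0..<length x])) (Var 0) :: ('f, 'r) fm)"
    have wf: "wf_fm L \<phi>" unfolding \<phi>_def using g xc by auto
    define e where "e j = (if 0 < j \<and> j \<le> length x then x ! (j - 1) else c 0)" for j
    have e: "e j \<in> range c" for j unfolding e_def using xc(1) nth_mem[of "j - 1" x] by auto
    have sv: "sat M (e(0 := d)) \<phi> \<longleftrightarrow> fun_int M g x = d" for d
    proof -
      have "map (eval_trm M (e(0 := d))) (map (\<lambda>i. Var (Suc i)) [0..<length x]) = x"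
        by (rule nth_equalityI) (auto simp: e_def)
      then show ?thesis unfolding \<phi>_def by (simp del: map_map)
    qed
    from tv[where \<phi> = \<phi> and e = e and i = 0, OF wf e gU] have "\<exists>d\<in>range c. sat M (e(0 := d)) \<phi>" unfolding sv by blast
    then have "fun_int M g x \<in> range c" unfolding sv by blast
    then show "fun_int ?N g x \<in> universe ?N" by simp
  qed
  then have "elem c" unfolding elem_def using cU sat by blast
  moreover have "map c [0..<length a0] = a0" using cf[of 0] f_0 unfolding la_def by simp
  moreover have "Good (map c [0..<k])" if "k \<ge> length a0" for k using cf[of "k - la"] fG[of "k - la"] that unfolding la_def by simp
  ultimately show ?thesis by blast
qed

lemma elem_nat:
  assumes "elem c"
  obtains N :: "('f, 'r, nat) fo_struct" and h where "models L N T" "is_iso L (M\<lparr>universe := range c\<rparr>) N h"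
proof -
  let ?N = "M\<lparr>universe := range c\<rparr>"
  define h where "h = to_nat_on (range c)"
  \<comment> \<open>transport the structure to a set of natural numbers\<close>
  define g where "g = inv_into (range c) h"
  have inj: "inj_on h (range c)" unfolding h_def by (rule inj_on_to_nat_on) simp
  have gh: "g (h x) = x" if "x \<in> range c" for x unfolding g_def using inv_into_f_f[OF inj that] .
  define N where "N = \<lparr>universe = h ` range c, fun_int = (\<lambda>f x. h (fun_int M f (map g x))), rel_int = (\<lambda>r x. rel_int M r (map g x))\<rparr>"
  have mg: "map g (map h x) = x" if "set x \<subseteq> range c" for x
    by (rule nth_equalityI) (use that gh nth_mem in \<open>auto simp: subset_iff\<close>)
  have iso: "is_iso L ?N N h" unfolding is_iso_def
  proof (intro conjI ballI)
    show "bij_betw h (universe ?N) (universe N)" unfolding N_def bij_betw_def using inj by simp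
    show "h (fun_int ?N f x) = fun_int N f (map h x)" if "x \<in> tuples ?N (farity L f)" for f x
      using that mg[of x] unfolding N_def tuples_def by (simp del: map_map)
    show "rel_int ?N r x \<longleftrightarrow> rel_int N r (map h x)" if "x \<in> tuples ?N (rarity L r)" for r x
      using that mg[of x] unfolding N_def tuples_def by (simp del: map_map)
  qed
  have sN: "is_struct L ?N" using assms unfolding elem_def by blast
  have "is_struct L N" unfolding is_struct_def
  proof (intro conjI ballI)
    show "universe N \<noteq> {}" unfolding N_def by simp
    fix f x assume f: "f \<in> funs L" and x: "x \<in> tuples N (farity L f)"
    have x: "set x \<subseteq> h ` range c" "length x = farity L f" using x unfolding N_def tuples_def by auto
    have "set (map g x) \<subseteq> range c" using x(1) gh by auto
    then have "fun_int ?N f (map g x) \<in> range c" using sN f x(2) unfolding is_struct_def tuples_def by simp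
    then show "fun_int N f x \<in> universe N" unfolding N_def by simp
  qed
  moreover have "holds N \<phi> []" if \<phi>: "\<phi> \<in> T" for \<phi>
  proof -
    have f: "\<phi> \<in> formulas L 0" using \<phi> cat unfolding omega_categorical_def complete_theory_def by blast
    then have wf: "wf_fm L \<phi>" unfolding formulas_def by simp
    have "holds M \<phi> []" using mod \<phi> unfolding models_def by blast
    then have "sat M (\<lambda>_. c 0) \<phi>" using holds_sat[OF f, of "[]" "\<lambda>_. c 0"] by simp
    then have "sat ?N (\<lambda>_. c 0) \<phi>" using assms wf unfolding elem_def by simp
    then have "sat N (\<lambda>i. h (c 0)) \<phi>" using iso_sat[OF iso sN wf, of "\<lambda>_. c 0"] by simp
    then show ?thesis using holds_sat[OF f, of "[]" "\<lambda>_. h (c 0)"] by simp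
  qed
  ultimately have "models L N T" unfolding models_def by blast
  then show thesis using iso that by blast
qed

lemma elem_holds:
  assumes "elem c" "set x \<subseteq> range c" "\<phi> \<in> formulas L (length x)"
  shows "holds (M\<lparr>universe := range c\<rparr>) \<phi> x \<longleftrightarrow> holds M \<phi> x"
proof -
  define e where "e i = (if i < length x then x ! i else c 0)" for i
  have "e i \<in> range c" for i unfolding e_def using assms(2) nth_mem by auto
  moreover have "wf_fm L \<phi>" using assms(3) by (simp add: formulas_def)
  ultimately have "sat (M\<lparr>universe := range c\<rparr>) e \<phi> \<longleftrightarrow> sat M e \<phi>" using assms(1) unfolding elem_def by blast
  moreover have "holds N \<phi> x \<longleftrightarrow> sat N e \<phi>" for N :: "('f, 'r, 'm) fo_struct" by (rule holds_sat[OF assms(3)]) (simp add: e_def)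
  ultimately show ?thesis by simp
qed

text \<open>Both substructures are countable models of \<open>T\<close>, hence isomorphic.\<close>

lemma same_types:
  assumes "elem c" "elem d" "set x \<subseteq> range c"
  shows "\<exists>y. set y \<subseteq> range d \<and> ty x y"
proof -
  obtain N :: "('f, 'r, nat) fo_struct" and h where N: "models L N T" "is_iso L (M\<lparr>universe := range c\<rparr>) N h" using elem_nat[OF assms(1)] by blast
  obtain N' :: "('f, 'r, nat) fo_struct" and h' where N': "models L N' T" "is_iso L (M\<lparr>universe := range d\<rparr>) N' h'" using elem_nat[OF assms(2)] by blast
  obtain k where k: "is_iso L N N' k" using cat N N' unfolding omega_categorical_def by blast
  define g where "g = inv_into (range d) h'"
  have "bij_betw h' (range d) (universe N')" using N'(2) unfolding is_iso_def by simp
  then have g: "g z \<in> range d" "h' (g z) = z" if "z \<in> universe N'" for z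
    using that unfolding g_def bij_betw_def by (auto simp: inv_into_into f_inv_into_f)
  have hx: "set (map h x) \<subseteq> universe N" using N(2) assms(3) unfolding is_iso_def bij_betw_def by auto
  then have kx: "set (map k (map h x)) \<subseteq> universe N'" using k unfolding is_iso_def bij_betw_def by auto
  define y where "y = map g (map k (map h x))"
  have y: "set y \<subseteq> range d" unfolding y_def using kx g(1) by auto
  have "map h' y = map k (map h x)" unfolding y_def by (rule nth_equalityI) (use kx g(2) nth_mem in \<open>auto simp: subset_iff\<close>)
  have sN: "is_struct L N" using N(1) unfolding models_def by blast
  have "holds M \<phi> x \<longleftrightarrow> holds M \<phi> y" if \<phi>: "\<phi> \<in> formulas L (length x)" for \<phi>
  proof -
    have \<phi>y: "\<phi> \<in> formulas L (length y)" using \<phi> unfolding y_def by simp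
    have s: "is_struct L (M\<lparr>universe := range c\<rparr>)" "is_struct L (M\<lparr>universe := range d\<rparr>)" using assms unfolding elem_def by auto
    have "holds M \<phi> x \<longleftrightarrow> holds N \<phi> (map h x)"
      using elem_holds[OF assms(1,3) \<phi>] iso_holds[OF N(2) s(1) \<phi>] assms(3) by simp
    also have "\<dots> \<longleftrightarrow> holds N' \<phi> (map k (map h x))" by (rule iso_holds[OF k sN _ hx]) (simp add: \<phi>)
    also have "\<dots> \<longleftrightarrow> holds M \<phi> y"
      using elem_holds[OF assms(2) y \<phi>y] iso_holds[OF N'(2) s(2) \<phi>y] y \<open>map h' y = map k (map h x)\<close> by simp
    finally show ?thesis .
  qed
  moreover have "length y = length x" unfolding y_def by simp
  ultimately show ?thesis using y unfolding ty_def by auto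
qed

lemma elem_containing:
  assumes "set a \<subseteq> U" shows "\<exists>c. elem c \<and> set a \<subseteq> range c"
proof -
  have "\<exists>c. elem c \<and> map c [0..<length a] = a \<and> (\<forall>k\<ge>length a. True)"
    by (rule elem_exists[where Good = "\<lambda>_. True"]) (use assms in auto)
  then obtain c where c: "elem c" "map c [0..<length a] = a" by (elim exE conjE)
  have "set (map c [0..<length a]) \<subseteq> range c" by auto
  then show ?thesis using c by auto
qed

definition isolates :: "nat => ('f, 'r) fm => bool" where
  "isolates n \<theta> \<longleftrightarrow> \<theta> \<in> formulas L n \<and> (\<forall>x\<in>tuples M n. \<forall>y\<in>tuples M n. holds M \<theta> x --> holds M \<theta> y --> ty x y)"

definition isolated :: "'m list => bool" where
  "isolated x \<longleftrightarrow> (\<exists>\<theta>. isolates (length x) \<theta> \<and> holds M \<theta> x)"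

lemma isolated_ty: "isolated x ==> ty x y ==> isolated y"
  unfolding isolated_def ty_def isolates_def by auto

lemma realize:
  assumes "\<Psi> \<subseteq> formulas L n" "\<And>q. finite q ==> q \<subseteq> \<Psi> ==> \<exists>x\<in>tuples M n. \<forall>\<psi>\<in>q. holds M \<psi> x"
  shows "\<exists>x\<in>tuples M n. \<forall>\<psi>\<in>\<Psi>. holds M \<psi> x"
proof -
  define p where "p = (\<lambda>\<psi>. (\<psi>, [] :: 'm list)) ` \<Psi>"
  have pt: "p \<in> partial_types L n {}" unfolding p_def partial_types_def using assms(1) by auto
  have "realized_in M n q" if q: "q \<subseteq> p" "finite q" for q
  proof -
    have "finite (fst ` q)" "fst ` q \<subseteq> \<Psi>" using q unfolding p_def by auto
    from assms(2)[OF this] obtain x where x: "x \<in> tuples M n" "\<forall>\<psi>\<in>fst ` q. holds M \<psi> x" by blast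
    have "\<forall>(\<phi>, a)\<in>q. holds M \<phi> (x @ a)"
    proof (clarify)
      fix \<phi> a assume m: "(\<phi>, a) \<in> q"
      then have "a = []" using q(1) unfolding p_def by auto
      then show "holds M \<phi> (x @ a)" using x(2) m by force
    qed
    then show ?thesis unfolding realized_in_def using x(1) by blast
  qed
  then have "realized_in M n p"
    using sat_M pt small_card[of "{} :: 'm set"] unfolding saturated_def by (metis empty_subsetI finite.emptyI)
  then obtain x where "x \<in> tuples M n" "\<forall>(\<phi>, a)\<in>p. holds M \<phi> (x @ a)" unfolding realized_in_def by blast
  then show ?thesis unfolding p_def by (intro bexI[of _ x]) auto
qed

text \<open>By \<open>same_types\<close> every type of an \<open>n\<close>-tuple is realised in a single countable substructure, so there are
countably many. If no isolated type contained \<open>\<phi>\<close>, one could strengthen \<open>\<phi>\<close> step by step, avoiding the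
\<open>k\<close>-th type at step \<open>k\<close>, and a realisation of the resulting sequence would have none of them.\<close>

lemma density:
  assumes "\<phi> \<in> formulas L n" "x \<in> tuples M n" "holds M \<phi> x"
  shows "\<exists>y\<in>tuples M n. holds M \<phi> y \<and> isolated y"
proof (rule ccontr)
  assume no: "\<not> ?thesis"
  obtain c0 where c0: "elem c0" using elem_containing[of "[]"] by auto
  define Bs where "Bs = {y. set y \<subseteq> range c0 \<and> length y = n}"
  have rep: "\<exists>y\<in>Bs. ty a y" if a: "a \<in> tuples M n" for a
  proof -
    obtain c where c: "elem c" "set a \<subseteq> range c" using elem_containing[of a] a unfolding tuples_def by blast
    obtain y where "set y \<subseteq> range c0" "ty a y" using same_types[OF c(1) c0 c(2)] by blast
    then show ?thesis using a unfolding Bs_def tuples_def ty_def by auto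
  qed
  have cB: "countable Bs"
  proof -
    have "Bs \<subseteq> lists (range c0)" unfolding Bs_def by auto
    moreover have "countable (lists (range c0))" by (intro countable_lists) simp
    ultimately show ?thesis by (rule countable_subset)
  qed
  have Bne: "Bs \<noteq> {}" using rep[OF assms(2)] by blast
  define b where "b = from_nat_into Bs"
  have BU: "y \<in> tuples M n" if "y \<in> Bs" for y using that c0 unfolding Bs_def elem_def tuples_def by auto
  define P where "P \<psi> \<longleftrightarrow> \<psi> \<in> formulas L n \<and> (\<exists>z\<in>tuples M n. holds M \<psi> z) \<and> (\<forall>z\<in>tuples M n. holds M \<psi> z --> holds M \<phi> z)" for \<psi>
  have "\<exists>f. \<forall>k::nat. P (f k) \<and> ((\<forall>z. holds M (f (Suc k)) z --> holds M (f k) z) \<and> \<not> holds M (f (Suc k)) (b k))"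
  proof (rule dependent_nat_choice)
    show "\<exists>\<psi>. P \<psi>" using assms unfolding P_def by blast
    fix \<psi> and k :: nat assume P\<psi>: "P \<psi>"
    then obtain z where z: "z \<in> tuples M n" "holds M \<psi> z" unfolding P_def by blast
    then have "\<not> isolated z" using no P\<psi> unfolding P_def by blast
    have lz: "length z = n" using z(1) unfolding tuples_def by simp
    then have "\<not> isolates n \<psi>" using \<open>\<not> isolated z\<close> z(2) unfolding isolated_def by blast
    then obtain u v where uv: "u \<in> tuples M n" "v \<in> tuples M n" "holds M \<psi> u" "holds M \<psi> v" "\<not> ty u v"
      using P\<psi> unfolding isolates_def P_def by blast
    have luv: "length u = n" "length v = n" using uv unfolding tuples_def by auto
    then obtain \<chi> where \<chi>: "\<chi> \<in> formulas L n" "holds M \<chi> u \<noteq> holds M \<chi> v" using uv(5) unfolding ty_def by auto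
    define \<psi>' where "\<psi>' = (if holds M \<chi> (b k) then Conj \<psi> (Neg \<chi>) else Conj \<psi> \<chi>)"
    have "P \<psi>'" using P\<psi> uv \<chi> unfolding P_def \<psi>'_def by auto
    moreover have "\<forall>z. holds M \<psi>' z --> holds M \<psi> z" "\<not> holds M \<psi>' (b k)" unfolding \<psi>'_def by auto
    ultimately show "\<exists>\<psi>'. P \<psi>' \<and> ((\<forall>z. holds M \<psi>' z --> holds M \<psi> z) \<and> \<not> holds M \<psi>' (b k))" by blast
  qed
  then obtain f where f: "\<And>k. P (f k)" "\<And>k z. holds M (f (Suc k)) z ==> holds M (f k) z" "\<And>k. \<not> holds M (f (Suc k)) (b k)" by blast
  have mono: "holds M (f (k + j)) z ==> holds M (f k) z" for k j z by (induction j) (use f(2) in auto)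
  have "\<exists>x\<in>tuples M n. \<forall>\<psi>\<in>range f. holds M \<psi> x"
  proof (rule realize)
    show "range f \<subseteq> formulas L n" using f(1) unfolding P_def by blast
    fix q assume q: "finite q" "q \<subseteq> range f"
    obtain I where I: "finite I" "q = f ` I" using finite_subset_image[OF q] by auto
    obtain m where m: "\<forall>i\<in>I. i \<le> m" using I(1) finite_nat_set_iff_bounded_le by blast
    obtain z where "z \<in> tuples M n" "holds M (f m) z" using f(1)[of m] unfolding P_def by blast
    moreover have "holds M (f i) z" if "i \<in> I" for i using mono[of i "m - i" z] m that calculation(2) by simp
    ultimately show "\<exists>x\<in>tuples M n. \<forall>\<psi>\<in>q. holds M \<psi> x" unfolding I(2) by blast
  qed
  then obtain a where a: "a \<in> tuples M n" "\<And>k. holds M (f k) a" by blast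
  obtain y where y: "y \<in> Bs" "ty a y" using rep[OF a(1)] by blast
  obtain k where k: "b k = y" unfolding b_def using from_nat_into_surj[OF cB y(1)] by blast
  have "f (Suc k) \<in> formulas L (length a)" using f(1) a(1) unfolding P_def tuples_def by simp
  then have "holds M (f (Suc k)) y" using y(2) a(2) unfolding ty_def by blast
  then show False using f(3)[of k] k by simp
qed

definition Aut :: "('m => 'm) set" where "Aut = {\<sigma>. is_iso L M M \<sigma>}"

lemma Aut_bij: "\<sigma> \<in> Aut ==> bij_betw \<sigma> U U" unfolding Aut_def is_iso_def by blast

lemma Aut_U: "\<sigma> \<in> Aut ==> x \<in> U ==> \<sigma> x \<in> U"
  using Aut_bij unfolding bij_betw_def by blast

lemma Aut_holds: "\<sigma> \<in> Aut ==> \<phi> \<in> formulas L (length x) ==> set x \<subseteq> U ==> holds M \<phi> (map \<sigma> x) \<longleftrightarrow> holds M \<phi> x"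
  using iso_holds[OF _ str] unfolding Aut_def by blast

lemma Aut_ty: "\<sigma> \<in> Aut ==> set x \<subseteq> U ==> ty x (map \<sigma> x)"
  unfolding ty_def using Aut_holds by simp

text \<open>The map from \<open>x\<close> to \<open>y\<close> is well defined because equalities between entries belong to the type, and
partial elementary because formulas about entries are renamings of formulas about \<open>x\<close>.\<close>

lemma homog:
  assumes "ty x y" "set x \<subseteq> U" "set y \<subseteq> U"
  shows "\<exists>\<sigma>\<in>Aut. map \<sigma> x = y"
proof -
  define ix where "ix u = (SOME i. i < length x \<and> x ! i = u)" for u
  have ix: "ix u < length x" "x ! ix u = u" if "u \<in> set x" for u
    using someI_ex[of "\<lambda>i. i < length x \<and> x ! i = u"] that unfolding ix_def in_set_conv_nth by auto
  define f where "f u = y ! ix u" for u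
  have len: "length y = length x" using assms(1) unfolding ty_def by simp
  have fx: "f (x ! i) = y ! i" if i: "i < length x" for i
  proof -
    have j: "ix (x ! i) < length x" "x ! ix (x ! i) = x ! i" using ix[of "x ! i"] i by auto
    have "Equal (Var i) (Var (ix (x ! i))) \<in> formulas L (length x)" using i j unfolding formulas_def by simp
    then have "holds M (Equal (Var i) (Var (ix (x ! i)))) x \<longleftrightarrow> holds M (Equal (Var i) (Var (ix (x ! i)))) y"
      using assms(1) unfolding ty_def by blast
    then show ?thesis using j by (simp add: holds_def f_def)
  qed
  have "partial_elementary L M (set x) f" unfolding partial_elementary_def
  proof (intro conjI ballI)
    show "set x \<subseteq> U" by (rule assms)
    show "f ` set x \<subseteq> U"
    proof (clarify)
      fix u assume "u \<in> set x"
      then obtain i where i: "i < length x" "u = x ! i" by (auto simp: in_set_conv_nth)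
      then have "f u = y ! i" "y ! i \<in> set y" using fx len by auto
      then show "f u \<in> U" using assms(3) by auto
    qed
    fix a \<phi> assume a: "a \<in> lists (set x)" and \<phi>: "\<phi> \<in> formulas L (length a)"
    define r where "r j = (if j < length a then ix (a ! j) else 0)" for j
    have aj: "a ! j \<in> set x" if "j < length a" for j using a that by auto
    have rl: "r j < length x" "x ! r j = a ! j" "y ! r j = map f a ! j" if "j < length a" for j
      using ix[OF aj[OF that]] that unfolding r_def f_def by auto
    have "ren r \<phi> \<in> formulas L (length x)" using \<phi> rl(1) ren_wf[of L \<phi> r] by (auto simp: formulas_def ren_vars)
    then have "holds M (ren r \<phi>) x \<longleftrightarrow> holds M (ren r \<phi>) y" using assms(1) unfolding ty_def by blast
    moreover have "holds M (ren r \<phi>) x \<longleftrightarrow> holds M \<phi> a" unfolding holds_def ren_sat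
      by (rule sat_cong) (use rl(2) \<phi> in \<open>auto simp: formulas_def\<close>)
    moreover have "holds M (ren r \<phi>) y \<longleftrightarrow> holds M \<phi> (map f a)" unfolding holds_def ren_sat
      by (rule sat_cong) (use rl(3) \<phi> in \<open>auto simp: formulas_def\<close>)
    ultimately show "holds M \<phi> a \<longleftrightarrow> holds M \<phi> (map f a)" by blast
  qed
  then obtain \<sigma> where s: "is_iso L M M \<sigma>" "\<forall>a\<in>set x. \<sigma> a = f a"
    using hom_M small_card[of "set x"] unfolding homogeneous_def by blast
  have "map \<sigma> x = y" by (rule nth_equalityI) (use s(2) fx len in auto)
  then show ?thesis using s(1) unfolding Aut_def by blast
qed

text \<open>By density there is an isolated type containing \<open>\<psi>\<close> and the formula isolating \<open>cs\<close>; an automorphism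
moves its first part to \<open>cs\<close>.\<close>

lemma isolated_ext:
  assumes "isolated cs" "set cs \<subseteq> U" "\<psi> \<in> formulas L (Suc (length cs))" "d \<in> U" "holds M \<psi> (cs @ [d])"
  shows "\<exists>d\<in>U. isolated (cs @ [d]) \<and> holds M \<psi> (cs @ [d])"
proof -
  define n where "n = length cs"
  obtain \<theta> where \<theta>: "isolates n \<theta>" "holds M \<theta> cs" using assms(1) unfolding isolated_def n_def by blast
  have \<theta>f: "\<theta> \<in> formulas L n" using \<theta>(1) unfolding isolates_def by blast
  have app: "holds M \<theta> (x @ [u]) \<longleftrightarrow> holds M \<theta> x" if "length x = n" for x u
    by (rule holds_cong[OF \<theta>f]) (simp add: nth_append that)
  have "Conj \<theta> \<psi> \<in> formulas L (Suc n)" using formulas_mono[OF \<theta>f, of "Suc n"] assms(3) unfolding n_def by simp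
  moreover have "cs @ [d] \<in> tuples M (Suc n)" using assms unfolding tuples_def n_def by simp
  moreover have "holds M (Conj \<theta> \<psi>) (cs @ [d])" using app[of cs d] \<theta>(2) assms(5) unfolding n_def by simp
  ultimately obtain y where y: "y \<in> tuples M (Suc n)" "holds M (Conj \<theta> \<psi>) y" "isolated y" using density by blast
  obtain ys u where yu: "y = ys @ [u]" using y(1) unfolding tuples_def by (cases y rule: rev_cases) auto
  have ys: "length ys = n" "set ys \<subseteq> U" "u \<in> U" using y(1) unfolding tuples_def yu by auto
  have "holds M \<theta> ys" using y(2) app[OF ys(1)] unfolding yu by simp
  then have "ty ys cs" using \<theta> ys assms(2) unfolding isolates_def tuples_def n_def by auto
  then obtain \<sigma> where s: "\<sigma> \<in> Aut" "map \<sigma> ys = cs" using homog ys assms(2) by blast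
  have my: "map \<sigma> y = cs @ [\<sigma> u]" unfolding yu using s by simp
  have yU: "set y \<subseteq> U" using ys unfolding yu by simp
  have "isolated (cs @ [\<sigma> u])" using isolated_ty[OF y(3) Aut_ty[OF s(1) yU]] unfolding my .
  moreover have "holds M \<psi> (cs @ [\<sigma> u])" using y(2) Aut_holds[OF s(1) _ yU, of \<psi>] assms(3) ys(1) unfolding my unfolding n_def yu by simp
  ultimately show ?thesis using Aut_U[OF s(1) ys(3)] by blast
qed

lemma projection:
  "\<phi> \<in> formulas L (n + k) ==> \<exists>\<psi>\<in>formulas L n. \<forall>z\<in>tuples M n. holds M \<psi> z \<longleftrightarrow> (\<exists>w\<in>tuples M k. holds M \<phi> (z @ w))"
proof (induction k arbitrary: \<phi>)
  case 0 then show ?case by (intro bexI[of _ \<phi>]) (auto simp: tuples_def)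
next
  case (Suc k)
  have f: "Exists (n + k) \<phi> \<in> formulas L (n + k)" using Suc.prems unfolding formulas_def by (auto simp: less_Suc_eq subset_iff)
  have h: "holds M (Exists (n + k) \<phi>) z \<longleftrightarrow> (\<exists>d\<in>U. holds M \<phi> (z @ [d]))" if z: "length z = n + k" for z
  proof -
    have "sat M ((\<lambda>i. z ! i)(n + k := d)) \<phi> \<longleftrightarrow> holds M \<phi> (z @ [d])" for d
      by (rule holds_sat[OF Suc.prems, symmetric]) (auto simp: nth_append z less_Suc_eq)
    then show ?thesis by (simp add: holds_def)
  qed
  from Suc.IH[OF f] obtain \<psi> where \<psi>: "\<psi> \<in> formulas L n" "\<forall>z\<in>tuples M n. holds M \<psi> z \<longleftrightarrow> (\<exists>w\<in>tuples M k. holds M (Exists (n + k) \<phi>) (z @ w))" by blast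
  have "(\<exists>w\<in>tuples M k. holds M (Exists (n + k) \<phi>) (z @ w)) \<longleftrightarrow> (\<exists>w\<in>tuples M (Suc k). holds M \<phi> (z @ w))" if z: "z \<in> tuples M n" for z
  proof
    assume "\<exists>w\<in>tuples M k. holds M (Exists (n + k) \<phi>) (z @ w)"
    then obtain w where w: "w \<in> tuples M k" "holds M (Exists (n + k) \<phi>) (z @ w)" by blast
    then obtain d where "d \<in> U" "holds M \<phi> (z @ w @ [d])" using h[of "z @ w"] z by (auto simp: tuples_def)
    then show "\<exists>w\<in>tuples M (Suc k). holds M \<phi> (z @ w)" using w(1) by (intro bexI[of _ "w @ [d]"]) (auto simp: tuples_def)
  next
    assume "\<exists>w\<in>tuples M (Suc k). holds M \<phi> (z @ w)"
    then obtain w where w: "w \<in> tuples M (Suc k)" "holds M \<phi> (z @ w)" by blast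
    obtain w' d where w': "w = w' @ [d]" using w(1) unfolding tuples_def by (cases w rule: rev_cases) auto
    have "w' \<in> tuples M k" "d \<in> U" using w(1) unfolding w' tuples_def by auto
    then show "\<exists>w\<in>tuples M k. holds M (Exists (n + k) \<phi>) (z @ w)"
      using w(2) h[of "z @ w'"] z unfolding w' by (intro bexI[of _ w']) (auto simp: tuples_def)
  qed
  then show ?case using \<psi> by auto
qed

lemma isolated_subtuple:
  assumes x: "isolated x" "set x \<subseteq> U" and s: "\<forall>i\<in>set s. i < length x"
  shows "isolated (map ((!) x) s)"
proof -
  define k where "k = length x"
  define n where "n = length s"
  obtain \<theta> where \<theta>: "isolates k \<theta>" "holds M \<theta> x" using x(1) unfolding isolated_def k_def by blast
  have \<theta>f: "\<theta> \<in> formulas L k" using \<theta>(1) unfolding isolates_def by blast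
  define \<Phi> where "\<Phi> = (\<lambda>j. Neg (Equal (Var j) (Var (n + s ! j))) :: ('f, 'r) fm) ` {..<n}"
  have sj: "s ! j < k" if "j < n" for j using s that unfolding n_def k_def by auto
  have "\<Phi> \<subseteq> formulas L (n + k)" unfolding \<Phi>_def formulas_def using sj by auto
  moreover have "finite \<Phi>" unfolding \<Phi>_def by simp
  ultimately obtain \<psi> where \<psi>: "\<psi> \<in> formulas L (n + k)" "\<And>z. holds M \<psi> z \<longleftrightarrow> (\<exists>\<phi>\<in>\<Phi>. holds M \<phi> z)"
    using disj_exists[OF str] by blast
  define \<delta> where "\<delta> = Conj (ren (\<lambda>i. n + i) \<theta>) (Neg \<psi>)"
  have "ren (\<lambda>i. n + i) \<theta> \<in> formulas L (n + k)" using \<theta>f ren_wf[of L \<theta>] by (auto simp: formulas_def ren_vars)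
  then have \<delta>f: "\<delta> \<in> formulas L (n + k)" unfolding \<delta>_def using \<psi>(1) by simp
  have \<delta>: "holds M \<delta> (z @ w) \<longleftrightarrow> holds M \<theta> w \<and> z = map ((!) w) s" if l: "length z = n" "length w = k" for z w
  proof -
    have "holds M (ren (\<lambda>i. n + i) \<theta>) (z @ w) \<longleftrightarrow> holds M \<theta> w" unfolding holds_def ren_sat
      by (rule sat_cong) (use l in \<open>auto simp: nth_append\<close>)
    moreover have "holds M (Neg (Equal (Var j) (Var (n + s ! j)))) (z @ w) \<longleftrightarrow> z ! j \<noteq> w ! (s ! j)" if "j < n" for j
      using l that by (simp add: holds_def nth_append)
    then have "\<not> holds M \<psi> (z @ w) \<longleftrightarrow> (\<forall>j<n. z ! j = w ! (s ! j))"
      unfolding \<psi>(2) \<Phi>_def by auto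
    moreover have "(\<forall>j<n. z ! j = w ! (s ! j)) \<longleftrightarrow> z = map ((!) w) s"
      using l(1) by (auto simp: list_eq_iff_nth_eq n_def)
    ultimately show ?thesis unfolding \<delta>_def by simp
  qed
  obtain \<eta> where \<eta>: "\<eta> \<in> formulas L n" "\<forall>z\<in>tuples M n. holds M \<eta> z \<longleftrightarrow> (\<exists>w\<in>tuples M k. holds M \<delta> (z @ w))"
    using projection[OF \<delta>f] by blast
  have "isolates n \<eta>" unfolding isolates_def
  proof (intro conjI \<eta>(1) ballI impI)
    fix z z' assume z: "z \<in> tuples M n" "z' \<in> tuples M n" "holds M \<eta> z" "holds M \<eta> z'"
    obtain w where w: "w \<in> tuples M k" "holds M \<delta> (z @ w)" using \<eta>(2) z by blast
    obtain w' where w': "w' \<in> tuples M k" "holds M \<delta> (z' @ w')" using \<eta>(2) z by blast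
    have e: "holds M \<theta> w" "z = map ((!) w) s" "holds M \<theta> w'" "z' = map ((!) w') s"
      using \<delta>[of z w] \<delta>[of z' w'] z w w' unfolding tuples_def by auto
    have "ty w w'" using \<theta>(1) w(1) w'(1) e unfolding isolates_def by blast
    then obtain \<sigma> where s': "\<sigma> \<in> Aut" "map \<sigma> w = w'" using homog w(1) w'(1) unfolding tuples_def by blast
    have "length w = k" using w(1) unfolding tuples_def by simp
    then have "map \<sigma> z = z'" unfolding e(2,4) s'(2)[symmetric] using s unfolding k_def by auto
    then show "ty z z'" using Aut_ty[OF s'(1), of z] z(1) unfolding tuples_def by auto
  qed
  moreover have "holds M \<eta> (map ((!) x) s)"
  proof -
    have "map ((!) x) s \<in> tuples M n" using x(2) s unfolding tuples_def n_def by auto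
    moreover have "holds M \<delta> (map ((!) x) s @ x)" using \<delta>[of "map ((!) x) s" x] \<theta>(2) unfolding n_def k_def by simp
    moreover have "x \<in> tuples M k" using x(2) unfolding tuples_def k_def by simp
    ultimately show ?thesis using \<eta>(2) by blast
  qed
  ultimately show ?thesis unfolding isolated_def n_def by auto
qed

text \<open>The theorem of Ryll-Nardzewski. There is an atomic countable elementary substructure, and it is
isomorphic to one containing \<open>a\<close>; so \<open>a\<close> has the same type as some tuple with isolated type.\<close>

lemma all_isolated:
  assumes "set a \<subseteq> U" shows "isolated a"
proof -
  have "isolated []"
  proof -
    have "isolates 0 (Neg falsum)" unfolding isolates_def using falsum_formula[of L 0] ty_refl by (auto simp: tuples_def)
    then show ?thesis unfolding isolated_def using holds_falsum[OF str] by auto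
  qed
  then have "\<exists>c. elem c \<and> map c [0..<length ([] :: 'm list)] = [] \<and> (\<forall>k\<ge>length ([] :: 'm list). isolated (map c [0..<k]))"
    by (rule elem_exists[OF _ _ isolated_ext]) simp_all
  then obtain c where c0: "elem c" "\<forall>k\<ge>length ([] :: 'm list). isolated (map c [0..<k])" by (elim exE conjE)
  have c: "elem c" "\<forall>k. isolated (map c [0..<k])" using c0 by simp_all
  obtain d where d: "elem d" "set a \<subseteq> range d" using elem_containing[OF assms] by blast
  obtain y where y: "set y \<subseteq> range c" "ty a y" using same_types[OF d(1) c(1) d(2)] by blast
  have "\<forall>u\<in>set y. \<exists>i. u = c i" using y(1) by blast
  from bchoice[OF this] obtain g where g: "\<forall>u\<in>set y. u = c (g u)" by blast
  define s where "s = map g y"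
  have s: "y = map c s" unfolding s_def by (rule nth_equalityI) (use g nth_mem in auto)
  obtain k where k: "\<forall>i\<in>set s. i < k" using finite_nat_set_iff_bounded[of "set s"] by auto
  define x where "x = map c [0..<k]"
  have "set x \<subseteq> U" using c(1) unfolding x_def elem_def by auto
  moreover have "isolated x" using c(2) unfolding x_def by blast
  moreover have "y = map ((!) x) s" unfolding s x_def using k by auto
  moreover have "\<forall>i\<in>set s. i < length x" using k unfolding x_def by simp
  ultimately have "isolated y" using isolated_subtuple by blast
  then show ?thesis using isolated_ty ty_sym[OF y(2)] by blast
qed

text \<open>Otherwise the negations of all isolating formulas would be finitely satisfiable, hence satisfied by
a tuple whose type is not isolated.\<close>

lemma finitely_many_types:
  "\<exists>\<Theta>. finite \<Theta> \<and> (\<forall>\<theta>\<in>\<Theta>. isolates n \<theta>) \<and> (\<forall>x\<in>tuples M n. \<exists>\<theta>\<in>\<Theta>. holds M \<theta> x)"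
proof (rule ccontr)
  assume no: "\<not> ?thesis"
  define \<Psi> where "\<Psi> = Neg ` {\<theta>. isolates n \<theta>}"
  have "\<exists>x\<in>tuples M n. \<forall>\<psi>\<in>\<Psi>. holds M \<psi> x"
  proof (rule realize)
    show "\<Psi> \<subseteq> formulas L n" unfolding \<Psi>_def isolates_def by auto
    fix q assume q: "finite q" "q \<subseteq> \<Psi>"
    obtain \<Theta> where \<Theta>: "finite \<Theta>" "\<Theta> \<subseteq> {\<theta>. isolates n \<theta>}" "q = Neg ` \<Theta>" using finite_subset_image[OF q[unfolded \<Psi>_def]] by blast
    then have "\<not> (\<forall>x\<in>tuples M n. \<exists>\<theta>\<in>\<Theta>. holds M \<theta> x)" using no by blast
    then show "\<exists>x\<in>tuples M n. \<forall>\<psi>\<in>q. holds M \<psi> x" unfolding \<Theta>(3) by auto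
  qed
  then obtain x where x: "x \<in> tuples M n" "\<forall>\<psi>\<in>\<Psi>. holds M \<psi> x" by blast
  then have "isolated x" using all_isolated unfolding tuples_def by blast
  then show False using x unfolding isolated_def \<Psi>_def tuples_def by auto
qed

theorem finitely_many_orbits:
  "\<exists>R. finite R \<and> R \<subseteq> tuples M n \<and> (\<forall>x\<in>tuples M n. \<exists>r\<in>R. \<exists>\<sigma>\<in>Aut. map \<sigma> r = x)"
proof -
  obtain \<Theta> where \<Theta>: "finite \<Theta>" "\<forall>\<theta>\<in>\<Theta>. isolates n \<theta>" "\<forall>x\<in>tuples M n. \<exists>\<theta>\<in>\<Theta>. holds M \<theta> x"
    using finitely_many_types by blast
  define r where "r \<theta> = (SOME x. x \<in> tuples M n \<and> holds M \<theta> x)" for \<theta>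
  define \<Theta>' where "\<Theta>' = {\<theta>\<in>\<Theta>. \<exists>x. x \<in> tuples M n \<and> holds M \<theta> x}"
  have r: "r \<theta> \<in> tuples M n \<and> holds M \<theta> (r \<theta>)" if "\<theta> \<in> \<Theta>'" for \<theta>
    unfolding r_def by (rule someI_ex) (use that in \<open>simp add: \<Theta>'_def\<close>)
  have "\<exists>y\<in>r ` \<Theta>'. \<exists>\<sigma>\<in>Aut. map \<sigma> y = x" if x: "x \<in> tuples M n" for x
  proof -
    obtain \<theta> where th: "\<theta> \<in> \<Theta>'" "holds M \<theta> x" "isolates n \<theta>" using \<Theta> x unfolding \<Theta>'_def by blast
    then have "ty (r \<theta>) x" using r[OF th(1)] x unfolding isolates_def by blast
    then have "\<exists>\<sigma>\<in>Aut. map \<sigma> (r \<theta>) = x" using homog r[OF th(1)] x unfolding tuples_def by blast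
    then show ?thesis using th(1) by blast
  qed
  moreover have "finite (r ` \<Theta>')" "r ` \<Theta>' \<subseteq> tuples M n" using \<Theta>(1) r unfolding \<Theta>'_def by auto
  ultimately show ?thesis by blast
qed

theorem invariant_definable:
  assumes X: "X \<subseteq> tuples M n" and c: "set c \<subseteq> U"
    and inv: "\<And>\<sigma> x. \<sigma> \<in> Aut ==> (\<forall>u\<in>set c. \<sigma> u = u) ==> x \<in> X ==> map \<sigma> x \<in> X"
  shows "definable L M n X"
proof -
  define m where "m = n + length c"
  obtain \<Theta> where \<Theta>: "finite \<Theta>" "\<forall>\<theta>\<in>\<Theta>. isolates m \<theta>" "\<forall>x\<in>tuples M m. \<exists>\<theta>\<in>\<Theta>. holds M \<theta> x"
    using finitely_many_types by blast
  define \<Theta>' where "\<Theta>' = {\<theta>\<in>\<Theta>. \<exists>x\<in>X. holds M \<theta> (x @ c)}"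
  have "finite \<Theta>'" "\<Theta>' \<subseteq> formulas L m" unfolding \<Theta>'_def using \<Theta> unfolding isolates_def by auto
  then obtain \<psi> where \<psi>: "\<psi> \<in> formulas L m" "\<And>z. holds M \<psi> z \<longleftrightarrow> (\<exists>\<phi>\<in>\<Theta>'. holds M \<phi> z)" using disj_exists[OF str] by blast
  have app: "x @ c \<in> tuples M m" if "x \<in> tuples M n" for x using that c unfolding tuples_def m_def by auto
  have "X = {x \<in> tuples M n. holds M \<psi> (x @ c)}"
  proof (intro equalityI subsetI)
    fix x assume x: "x \<in> X"
    then have "x \<in> tuples M n" using X by blast
    moreover obtain \<theta> where "\<theta> \<in> \<Theta>" "holds M \<theta> (x @ c)" using \<Theta>(3) app[OF calculation] by blast
    ultimately show "x \<in> {x \<in> tuples M n. holds M \<psi> (x @ c)}" using \<psi>(2) x unfolding \<Theta>'_def by blast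
  next
    fix x' assume "x' \<in> {x \<in> tuples M n. holds M \<psi> (x @ c)}"
    then obtain \<theta> x where h: "x' \<in> tuples M n" "\<theta> \<in> \<Theta>" "x \<in> X" "holds M \<theta> (x @ c)" "holds M \<theta> (x' @ c)"
      using \<psi>(2) unfolding \<Theta>'_def by auto
    have xt: "x \<in> tuples M n" using h(3) X by blast
    have "ty (x @ c) (x' @ c)" using \<Theta>(2) h app[OF xt] app[OF h(1)] unfolding isolates_def by blast
    then obtain \<sigma> where s: "\<sigma> \<in> Aut" "map \<sigma> (x @ c) = x' @ c" using homog app[OF xt] app[OF h(1)] unfolding tuples_def by blast
    have "length x = length x'" using xt h(1) unfolding tuples_def by simp
    then have m: "map \<sigma> x = x'" "map \<sigma> c = c" using s(2) by auto
    have "\<forall>u\<in>set c. \<sigma> u = u" using m(2) map_eq_conv[of \<sigma> c id] by simp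
    then show "x' \<in> X" using inv[OF s(1) _ h(3)] m(1) by simp
  qed
  then show ?thesis unfolding definable_def using c \<psi>(1) unfolding m_def by auto
qed

theorem definable_invariant:
  assumes "definable L M n X"
  shows "\<exists>c. set c \<subseteq> U \<and> (\<forall>\<sigma>\<in>Aut. (\<forall>u\<in>set c. \<sigma> u = u) --> (\<forall>x\<in>X. map \<sigma> x \<in> X))"
proof -
  obtain a \<phi> where a: "a \<in> lists U" "\<phi> \<in> formulas L (n + length a)" "X = {x \<in> tuples M n. holds M \<phi> (x @ a)}"
    using assms unfolding definable_def by blast
  have "map \<sigma> x \<in> X" if s: "\<sigma> \<in> Aut" "\<forall>u\<in>set a. \<sigma> u = u" and x: "x \<in> X" for \<sigma> x
  proof -
    have x': "x \<in> tuples M n" "holds M \<phi> (x @ a)" using x a(3) by auto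
    have "map \<sigma> a = a" using s(2) by (simp add: map_idI)
    moreover have "holds M \<phi> (map \<sigma> (x @ a))" using Aut_holds[OF s(1), of \<phi> "x @ a"] x' a unfolding tuples_def by auto
    moreover have "map \<sigma> x \<in> tuples M n" using x'(1) Aut_U[OF s(1)] unfolding tuples_def by auto
    ultimately show ?thesis unfolding a(3) by simp
  qed
  then show ?thesis using a(1) by (intro exI[of _ a]) auto
qed

lemma Aut_comp: assumes "\<sigma> \<in> Aut" "\<tau> \<in> Aut" shows "\<sigma> \<circ> \<tau> \<in> Aut"
proof -
  have b: "bij_betw \<sigma> U U" "bij_betw \<tau> U U" using assms Aut_bij by auto
  have t: "map \<tau> x \<in> tuples M n" if "x \<in> tuples M n" for x n using that Aut_U[OF assms(2)] unfolding tuples_def by auto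
  show ?thesis using assms t bij_betw_trans[OF b(2,1)] unfolding Aut_def is_iso_def by (auto simp: o_def)
qed

lemma Aut_inv: assumes "\<sigma> \<in> Aut" shows "inv_into U \<sigma> \<in> Aut"
proof -
  define \<tau> where "\<tau> = inv_into U \<sigma>"
  have b: "bij_betw \<sigma> U U" by (rule Aut_bij[OF assms])
  have bt: "bij_betw \<tau> U U" unfolding \<tau>_def by (rule bij_betw_inv_into[OF b])
  have st: "\<sigma> (\<tau> x) = x" "\<tau> x \<in> U" if "x \<in> U" for x unfolding \<tau>_def using b that
    by (auto simp: bij_betw_def f_inv_into_f inv_into_into)
  have ts: "\<tau> (\<sigma> x) = x" if "x \<in> U" for x unfolding \<tau>_def using bij_betw_inv_into_left[OF b that] .
  have mst: "map \<sigma> (map \<tau> x) = x" "map \<tau> x \<in> tuples M n" if "x \<in> tuples M n" for x n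
    using that st unfolding tuples_def by (auto intro!: map_idI)
  have i: "is_iso L M M \<sigma>" using assms unfolding Aut_def by simp
  have "is_iso L M M \<tau>" unfolding is_iso_def
  proof (intro conjI bt ballI)
    fix f x assume f: "f \<in> funs L" and x: "x \<in> tuples M (farity L f)"
    note y = mst[OF x]
    have "\<sigma> (fun_int M f (map \<tau> x)) = fun_int M f x" using i f y unfolding is_iso_def by metis
    moreover have "fun_int M f (map \<tau> x) \<in> U" using str f y(2) unfolding is_struct_def by blast
    ultimately show "\<tau> (fun_int M f x) = fun_int M f (map \<tau> x)" using ts by metis
  next
    fix r x assume r: "r \<in> rels L" and x: "x \<in> tuples M (rarity L r)"
    note y = mst[OF x]
    show "rel_int M r x = rel_int M r (map \<tau> x)" using i r y unfolding is_iso_def by metis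
  qed
  then show ?thesis unfolding Aut_def \<tau>_def by simp
qed

lemma Aut_inv_map: assumes "\<sigma> \<in> Aut" "set x \<subseteq> U"
  shows "map (inv_into U \<sigma>) (map \<sigma> x) = x" "map \<sigma> (map (inv_into U \<sigma>) x) = x"
proof -
  have b: "bij_betw \<sigma> U U" by (rule Aut_bij[OF assms(1)])
  show "map (inv_into U \<sigma>) (map \<sigma> x) = x"
    unfolding map_map by (rule map_idI) (use assms(2) bij_betw_inv_into_left[OF b] in auto)
  show "map \<sigma> (map (inv_into U \<sigma>) x) = x"
    unfolding map_map by (rule map_idI) (use assms(2) bij_betw_inv_into_right[OF b] in auto)
qed

end

section \<open>Values of the form, and the action on imaginaries\<close>

text \<open>An inp-pattern needs infinitely many cosets at once; a maximal separated subset of \<open>B\<close> is infinite.\<close>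

lemma (in comm_group) not_alm_seq:
  assumes "\<not> alm B C" "subgroup C G" "B \<subseteq> carrier G"
  shows "\<exists>b::nat => 'a. (\<forall>j. b j \<in> B) \<and> (\<forall>i j. i \<noteq> j --> b i \<otimes> inv (b j) \<notin> C)"
proof -
  define SS where "SS = {F. F \<subseteq> B \<and> sep F C}"
  have "\<exists>F\<in>SS. \<forall>X\<in>SS. F \<subseteq> X --> X = F"
  proof (rule subset_Zorn')
    fix CC assume ch: "subset.chain SS CC"
    have "sep (\<Union>CC) C" unfolding sep_def
    proof (intro ballI impI)
      fix x y assume "x \<in> \<Union>CC" "y \<in> \<Union>CC" and ne: "x \<noteq> y"
      then obtain X Y where XY: "X \<in> CC" "x \<in> X" "Y \<in> CC" "y \<in> Y" by blast
      have "X \<subseteq> Y \<or> Y \<subseteq> X" using ch XY unfolding subset.chain_def by blast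
      then obtain Z where "Z \<in> CC" "x \<in> Z" "y \<in> Z" using XY by blast
      moreover have "Z \<in> SS" using ch calculation(1) unfolding subset.chain_def by blast
      ultimately show "x \<otimes> inv y \<notin> C" using ne unfolding SS_def sep_def by blast
    qed
    moreover have "\<Union>CC \<subseteq> B" using ch unfolding subset.chain_def SS_def by blast
    ultimately show "\<Union>CC \<in> SS" unfolding SS_def by blast
  qed
  then obtain F where F0: "F \<in> SS" "\<forall>X\<in>SS. F \<subseteq> X --> X = F" by (rule bexE)
  have F: "F \<subseteq> B" "sep F C" using F0(1) unfolding SS_def by simp_all
  have mx: "X = F" if "X \<in> SS" "F \<subseteq> X" for X using F0(2) that by simp
  have Fc: "F \<subseteq> carrier G" using F assms by blast
  have "infinite F"
  proof
    assume fin: "finite F"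
    have "B \<subseteq> F <#> C"
    proof
      fix x assume x: "x \<in> B"
      then have xc: "x \<in> carrier G" using assms by blast
      have "\<exists>y\<in>F. x \<otimes> inv y \<in> C"
      proof (cases "x \<in> F")
        case True then show ?thesis using xc sub_one[OF assms(2)] by (intro bexI[of _ x]) auto
      next
        case False
        then have "insert x F \<notin> SS" using mx[of "insert x F"] by blast
        then have "\<not> sep (insert x F) C" using x F unfolding SS_def by blast
        then obtain u v where uv: "u \<in> insert x F" "v \<in> insert x F" "u \<noteq> v" "u \<otimes> inv v \<in> C" unfolding sep_def by blast
        have "u = x \<and> v \<in> F \<or> v = x \<and> u \<in> F" using uv F(2) unfolding sep_def by blast
        then show ?thesis
        proof
          assume "u = x \<and> v \<in> F" then show ?thesis using uv by blast
        next
          assume h: "v = x \<and> u \<in> F"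
          then have "inv (u \<otimes> inv x) \<in> C" using uv sub_inv[OF assms(2)] by blast
          moreover have "inv (u \<otimes> inv x) = x \<otimes> inv u" using h xc Fc by (simp add: inv_mult m_comm subset_iff)
          ultimately show ?thesis using h by auto
        qed
      qed
      then obtain y where y: "y \<in> F" "x \<otimes> inv y \<in> C" by blast
      have "x = y \<otimes> (x \<otimes> inv y)" using xc y Fc by (simp add: m_comm[of y] m_assoc subset_iff)
      then show "x \<in> F <#> C" by (rule set_multI[OF y])
    qed
    then show False using assms(1) fin Fc unfolding alm_def by blast
  qed
  then obtain b :: "nat => 'a" where b: "inj b" "range b \<subseteq> F" using infinite_countable_subset by blast
  have "b i \<otimes> inv (b j) \<notin> C" if "i \<noteq> j" for i j
    using F(2) b that unfolding sep_def inj_def by blast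
  then show ?thesis using b(2) F(1) by blast
qed

lemma (in comm_group) alm_one_finite:
  assumes "alm B {\<one>}" shows "finite B"
proof -
  obtain F where F: "finite F" "F \<subseteq> carrier G" "B \<subseteq> F <#> {\<one>}" using assms unfolding alm_def by blast
  have "F <#> {\<one>} = F" using F(2) unfolding set_mult_def by force
  then show ?thesis using F finite_subset by metis
qed

context qform
begin

lemma res_one_large: "alm G (res {\<one>} H)" using almost_all_trivial unfolding pr_def .

lemma resl_one_large: "alm H (resl {\<one>} G)"
proof -
  interpret sw: qform A \<Gamma> H G K "\<lambda>h g. lam g h" by (rule qform_swap)
  show ?thesis using sw.res_one_large by (simp add: sw)
qed

text \<open>Choose \<open>g\<close> with an image \<open>F\<close> of the largest possible size, which exists because the sizes are
uniformly bounded, and preimages \<open>h k\<close> of the elements \<open>k\<close> of \<open>F\<close>. If \<open>g'\<close> annihilates all \<open>h k\<close>, then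
\<open>g' \<otimes> g\<close> still takes all values in \<open>F\<close> and by maximality no others; hence \<open>g'\<close> takes its values in \<open>F\<close>.\<close>

lemma finite_values:
  "\<exists>C D F. subgroup C A \<and> subgroup D A \<and> subgroup F A \<and> C \<subseteq> G \<and> D \<subseteq> H \<and> F \<subseteq> K \<and> alm G C \<and> alm H D \<and> finite F \<and>
     (\<forall>g\<in>C. \<forall>h\<in>D. \<forall>k. lam g h = Some k --> k \<in> F)"
proof -
  interpret sw: qform A \<Gamma> H G K "\<lambda>h g. lam g h" by (rule qform_swap)
  define R where "R = res {\<one>} H"
  define E where "E = resl {\<one>} G"
  have dE: "dfn E" "E \<subseteq> H" unfolding E_def using sw.dfn_res[OF dfn_one dG] resl_def by (auto simp: sw resl_def)
  have sR: "subgroup R A" "R \<subseteq> G" unfolding R_def using sub_res[OF dfn_sub[OF dfn_one] sH] res_G by auto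
  note sE = dfn_sub[OF dE(1)] and s1 = dfn_sub[OF dfn_one]
  have iE: "invs [] E" unfolding E_def using sw.invs_res[of "[]" "{\<one>}" G] invG \<Gamma>_one stab_sub by (simp add: sw invs_def)
  have alR: "alm (gr g `` E) {\<one>}" if "g \<in> R" for g
    using that dE(2) alm_subset_left[of "gr g `` H" "{\<one>}" "gr g `` E"] unfolding R_def res_def by blast
  from index_bound[of 1] obtain N where N: "\<And>c X Y F. set c \<subseteq> carrier A ==> length c \<le> 1 ==> invs c X ==> invs c Y ==>
     subgroup X A ==> subgroup Y A ==> alm X Y ==> F \<subseteq> X ==> finite F ==> sep F Y ==> card F \<le> N" by blast
  have sI: "subgroup (gr g `` E) A" if "g \<in> R" for g using sub_gr[OF _ sE] that sR by blast
  have fI: "finite (gr g `` E)" if "g \<in> R" for g by (rule alm_one_finite[OF alR[OF that]])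
  have bound: "card (gr g `` E) \<le> N" if g: "g \<in> R" for g
  proof (rule N[of "[g]" _ "{\<one>}"])
    have gG: "g \<in> G" using g sR by blast
    show "set [g] \<subseteq> carrier A" using gG cG by auto
    show "invs [g] (gr g `` E)" using iE by (intro invs_rel_image invr_gr gG invs_mono[OF iE]) auto
    show "invs [g] {\<one>}" unfolding invs_def using \<Gamma>_one stab_sub by auto
    show "sep (gr g `` E) {\<one>}" unfolding sep_def
    proof (intro ballI impI notI)
      fix x y assume h: "x \<in> gr g `` E" "y \<in> gr g `` E" "x \<noteq> y" "x \<otimes> inv y \<in> {\<one>}"
      have c: "x \<in> carrier A" "y \<in> carrier A" using h sub_car[OF sI[OF g]] by auto
      have "x = y" using h(4) c by (metis inv_equality inv_inv inv_closed singletonD)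
      then show False using h(3) by blast
    qed
  qed (use g sI fI alR s1 in auto)
  have "\<exists>g\<in>R. \<forall>g'\<in>R. card (gr g' `` E) \<le> card (gr g `` E)"
  proof -
    have "(\<lambda>g. card (gr g `` E)) ` R \<subseteq> {..N}" by (rule image_subsetI) (simp only: atMost_iff bound)
    then have fin: "finite ((\<lambda>g. card (gr g `` E)) ` R)" by (rule finite_subset) simp
    have "(\<lambda>g. card (gr g `` E)) ` R \<noteq> {}" unfolding image_is_empty using sub_one[OF sR(1)] by blast
    with fin have "Max ((\<lambda>g. card (gr g `` E)) ` R) \<in> (\<lambda>g. card (gr g `` E)) ` R" by (rule Max_in)
    then obtain g where g: "Max ((\<lambda>g. card (gr g `` E)) ` R) = card (gr g `` E)" "g \<in> R" by (rule imageE)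
    have "card (gr g' `` E) \<le> card (gr g `` E)" if "g' \<in> R" for g'
      unfolding g(1)[symmetric] by (rule Max_ge[OF fin imageI[OF that]])
    then show ?thesis using g(2) by blast
  qed
  then obtain g where g: "g \<in> R" "\<And>g'. g' \<in> R ==> card (gr g' `` E) \<le> card (gr g `` E)" by blast
  have gG: "g \<in> G" using g(1) sR by blast
  define F where "F = gr g `` E"
  have "\<forall>k\<in>F. \<exists>h. h \<in> E \<and> h \<in> H \<and> lam g h = Some k" unfolding F_def gr_def by blast
  from bchoice[OF this] obtain h where h: "\<And>k. k \<in> F ==> h k \<in> E \<and> h k \<in> H \<and> lam g (h k) = Some k" by blast
  define kl where "kl k = (gl (h k))\<inverse> `` {\<one>}" for k
  have kl: "alm G (kl k) \<and> subgroup (kl k) A" if k: "k \<in> F" for k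
  proof -
    have hk: "h k \<in> H" "alm (gl (h k) `` G) {\<one>}" using h[OF k] unfolding E_def resl_def by auto
    have a: "arel (gl (h k))" using sw.arel_gr[OF hk(1)] by (simp add: sw)
    have "alm G (Domain (gl (h k)))" using sw.gr_dom[OF hk(1)] by (simp add: sw)
    from alm_preimage[OF a hk(2) this sG s1] show ?thesis unfolding kl_def using sub_image[OF arel_converse[OF a] s1] by blast
  qed
  define C where "C = R \<inter> (\<Inter>k\<in>F. kl k)"
  have C: "alm G C" "subgroup C A"
    using alm_INT[OF _ sR(1) sG fI[OF g(1), folded F_def], of kl] kl res_one_large unfolding C_def R_def by blast+
  define D where "D = E \<inter> Domain (gr g)"
  have sD: "subgroup D A" unfolding D_def by (intro sub_int sE sub_Domain arel_gr gG)
  have "alm H D" unfolding D_def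
    by (intro alm_inter gr_dom gG sE sub_Domain arel_gr cH) (use resl_one_large in \<open>simp add: E_def\<close>)
  moreover have "k \<in> F" if x: "g' \<in> C" "y \<in> D" "lam g' y = Some k" for g' y k
  proof -
    have g': "g' \<in> R" "g' \<in> G" using x(1) sR unfolding C_def by auto
    have gg: "g' \<otimes> g \<in> R" "g' \<otimes> g \<in> G" using sub_m[OF sR(1) g'(1) g(1)] sR by auto
    have yH: "y \<in> H" "y \<in> E" using x(2) dE unfolding D_def by auto
    have "F \<subseteq> gr (g' \<otimes> g) `` E"
    proof
      fix l assume l: "l \<in> F"
      have "g' \<in> kl l" using x(1) l unfolding C_def by blast
      then have "lam g' (h l) = Some \<one>" unfolding kl_def gl_def by blast
      then have "lam (g' \<otimes> g) (h l) = Some (\<one> \<otimes> l)" using lin2[OF g'(2) gG, of "h l" \<one> l] h[OF l] by blast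
      moreover have "l \<in> carrier A" using l sub_car[OF sI[OF g(1)]] unfolding F_def by blast
      ultimately show "l \<in> gr (g' \<otimes> g) `` E" using h[OF l] unfolding gr_def by auto
    qed
    then have eq: "F = gr (g' \<otimes> g) `` E"
      by (rule card_seteq[OF fI[OF gg(1)]]) (use g(2)[OF gg(1)] in \<open>simp add: F_def\<close>)
    obtain l where l: "lam g y = Some l" using x(2) unfolding D_def gr_def by blast
    have lF: "l \<in> F" unfolding F_def gr_def using l yH by blast
    have "lam (g' \<otimes> g) y = Some (k \<otimes> l)" by (rule lin2[OF g'(2) gG yH(1) x(3) l])
    then have "k \<otimes> l \<in> F" unfolding eq gr_def using yH by blast
    then have "(k \<otimes> l) \<otimes> inv l \<in> F" using sub_div[OF sI[OF g(1)]] lF unfolding F_def by blast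
    moreover have "k \<in> carrier A" "l \<in> carrier A" using lamK[OF g'(2) yH(1) x(3)] lamK[OF gG yH(1) l] cK by auto
    ultimately show ?thesis by (simp add: m_assoc)
  qed
  moreover have "F \<subseteq> K" unfolding F_def by (rule gr_K[OF gG])
  moreover have "C \<subseteq> G" "D \<subseteq> H" unfolding C_def D_def using sR dE by auto
  ultimately show ?thesis using C sD sI[OF g(1)] fI[OF g(1)] unfolding F_def by blast
qed

text \<open>By connectedness \<open>res {\<one>} H\<close> is all of \<open>G\<close>, so each \<open>lam g\<close> has finite image and its kernel has finite
index.\<close>

lemma connected_trivial:
  assumes cn: "\<And>B. dfn B ==> B \<subseteq> G ==> alm G B ==> B = G" "\<And>B. dfn B ==> B \<subseteq> H ==> alm H B ==> B = H"
    and g: "g \<in> G" "h \<in> H"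
  shows "lam g h = Some \<one>"
proof -
  have "res {\<one>} H = G" by (rule cn(1)[OF dfn_res[OF dfn_one dH order_refl] res_G res_one_large])
  then have al: "alm (gr g `` H) {\<one>}" using g(1) unfolding res_def by blast
  have s: "subgroup {\<one>} A" by (rule dfn_sub[OF dfn_one])
  have "invs [g] {\<one>}" unfolding invs_def using \<Gamma>_one stab_sub by auto
  then have "invs [g] ((gr g)\<inverse> `` {\<one>})" by (intro invs_rel_image invr_converse invr_gr g) auto
  then have d: "dfn ((gr g)\<inverse> `` {\<one>})" unfolding dfn_def using sub_image[OF arel_converse[OF arel_gr[OF g(1)]] s] g(1) cG
    by (intro conjI exI[of _ "[g]"]) auto
  have "(gr g)\<inverse> `` {\<one>} = H"
    by (rule cn(2)[OF d _ alm_preimage[OF arel_gr[OF g(1)] al gr_dom[OF g(1)] sH s]]) (auto simp: gr_def)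
  then show ?thesis using g(2) unfolding gr_def by blast
qed

end

lemma finite_representatives:
  assumes "finite (f ` S)" shows "\<exists>R. finite R \<and> R \<subseteq> S \<and> (\<forall>x\<in>S. \<exists>r\<in>R. f r = f x)"
proof (intro exI conjI ballI)
  show "finite (inv_into S f ` (f ` S))" using assms by simp
  show "inv_into S f ` (f ` S) \<subseteq> S" by (auto intro: inv_into_into)
  show "\<exists>r\<in>inv_into S f ` (f ` S). f r = f x" if "x \<in> S" for x using that by (auto intro!: f_inv_into_f)
qed

context monster
begin

definition act :: "('m => 'm) => 'm list set => 'm list set" where "act \<sigma> C = map \<sigma> ` C"

definition Fx :: "'m list => ('m => 'm) set" where "Fx c = {\<sigma> \<in> Aut. \<forall>u\<in>set c. \<sigma> u = u}"

text \<open>The family \<open>S\<close> of pairwise disjoint nonempty sets of \<open>n\<close>-tuples is mapped to itself by the automorphisms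
fixing \<open>c\<close>. This holds for every definable set of imaginaries and is all that is used of it.\<close>

definition sortc :: "'m list => nat => 'm list set set => bool" where
  "sortc c n S \<longleftrightarrow> (\<forall>C\<in>S. C \<noteq> {} \<and> C \<subseteq> tuples M n) \<and> (\<forall>C\<in>S. \<forall>D\<in>S. \<forall>x. x \<in> C --> x \<in> D --> C = D) \<and>
     (\<forall>\<sigma>\<in>Fx c. \<forall>C\<in>S. act \<sigma> C \<in> S)"

lemma Fx_Aut: "\<sigma> \<in> Fx c ==> \<sigma> \<in> Aut" by (simp add: Fx_def)

lemma Fx_mono: "set c \<subseteq> set d ==> Fx d \<subseteq> Fx c" by (auto simp: Fx_def)

lemma Fx_inv: assumes "\<sigma> \<in> Fx c" "set c \<subseteq> U" shows "inv_into U \<sigma> \<in> Fx c"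
proof -
  have "inv_into U \<sigma> u = u" if "u \<in> set c" for u
    using bij_betw_inv_into_left[OF Aut_bij[OF Fx_Aut[OF assms(1)]], of u] that assms unfolding Fx_def by auto
  then show ?thesis using Aut_inv[OF Fx_Aut[OF assms(1)]] unfolding Fx_def by blast
qed

lemma Fx_comp: "\<sigma> \<in> Fx c ==> \<tau> \<in> Fx c ==> \<sigma> \<circ> \<tau> \<in> Fx c"
  using Aut_comp unfolding Fx_def by auto

lemma act_comp: "act (\<sigma> \<circ> \<tau>) C = act \<sigma> (act \<tau> C)"
  unfolding act_def by (simp add: image_image)

lemma act_inv: assumes "\<sigma> \<in> Aut" "C \<subseteq> tuples M n"
  shows "act (inv_into U \<sigma>) (act \<sigma> C) = C" "act \<sigma> (act (inv_into U \<sigma>) C) = C"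
proof -
  have c: "set x \<subseteq> U" if "x \<in> C" for x using assms(2) that unfolding tuples_def by blast
  have "map (inv_into U \<sigma>) (map \<sigma> x) = x" "map \<sigma> (map (inv_into U \<sigma>) x) = x" if "x \<in> C" for x
    using Aut_inv_map[OF assms(1) c[OF that]] by auto
  then show "act (inv_into U \<sigma>) (act \<sigma> C) = C" "act \<sigma> (act (inv_into U \<sigma>) C) = C"
    unfolding act_def image_image by (auto simp del: map_map)
qed

lemma sortD:
  assumes "sortc c n S"
  shows "C \<in> S ==> C \<noteq> {}" "C \<in> S ==> C \<subseteq> tuples M n" "C \<in> S ==> D \<in> S ==> x \<in> C ==> x \<in> D ==> C = D"
    "\<sigma> \<in> Fx c ==> C \<in> S ==> act \<sigma> C \<in> S" "C \<in> S ==> x \<in> C ==> length x = n" "C \<in> S ==> x \<in> C ==> set x \<subseteq> U"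
proof -
  have 1: "\<forall>C\<in>S. C \<noteq> {} \<and> C \<subseteq> tuples M n" and 2: "\<forall>C\<in>S. \<forall>D\<in>S. \<forall>x. x \<in> C --> x \<in> D --> C = D"
    and 3: "\<forall>\<sigma>\<in>Fx c. \<forall>C\<in>S. act \<sigma> C \<in> S" using assms unfolding sortc_def by simp_all
  show "C \<in> S ==> C \<noteq> {}" "C \<in> S ==> C \<subseteq> tuples M n" using 1 by simp_all
  show "C \<in> S ==> D \<in> S ==> x \<in> C ==> x \<in> D ==> C = D" by (rule 2[rule_format])
  show "\<sigma> \<in> Fx c ==> C \<in> S ==> act \<sigma> C \<in> S" using 3 by simp
  show "length x = n" "set x \<subseteq> U" if "C \<in> S" "x \<in> C"
  proof -
    have "x \<in> tuples M n" using 1 that by blast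
    then show "length x = n" "set x \<subseteq> U" unfolding tuples_def by simp_all
  qed
qed

lemma sort_mono: "sortc c n S ==> set c \<subseteq> set d ==> sortc d n S"
  unfolding sortc_def using Fx_mono[of c d] by blast

lemma act_eqI:
  assumes s: "sortc c n S" and h: "\<sigma> \<in> Fx c" "C \<in> S" "D \<in> S" "x \<in> C" "map \<sigma> x \<in> D"
  shows "act \<sigma> C = D"
proof (rule sortD(3)[OF s sortD(4)[OF s h(1,2)] h(3) _ h(5)])
  show "map \<sigma> x \<in> act \<sigma> C" unfolding act_def by (rule imageI[OF h(4)])
qed

lemma imag_sort:
  assumes "imag_set L M n S" shows "\<exists>c. set c \<subseteq> U \<and> sortc c n S"
proof -
  obtain X E where XE: "definable L M n X" "equiv X E" "definable L M (n + n) {x @ y | x y. (x, y) \<in> E}" "S = X // E"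
    using assms unfolding imag_set_def by blast
  obtain c1 where c1: "set c1 \<subseteq> U" "\<forall>\<sigma>\<in>Aut. (\<forall>u\<in>set c1. \<sigma> u = u) --> (\<forall>x\<in>X. map \<sigma> x \<in> X)"
    using definable_invariant[OF XE(1)] by blast
  obtain c2 where c2: "set c2 \<subseteq> U" "\<forall>\<sigma>\<in>Aut. (\<forall>u\<in>set c2. \<sigma> u = u) --> (\<forall>z\<in>{x @ y | x y. (x, y) \<in> E}. map \<sigma> z \<in> {x @ y | x y. (x, y) \<in> E})"
    using definable_invariant[OF XE(3)] by blast
  define c where "c = c1 @ c2"
  have cU: "set c \<subseteq> U" unfolding c_def using c1 c2 by auto
  have Xt: "X \<subseteq> tuples M n" using XE(1) unfolding definable_def by blast
  have Es: "E \<subseteq> X \<times> X" using XE(2) by (rule equiv_type)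
  have iX: "map \<sigma> x \<in> X" if "\<sigma> \<in> Fx c" "x \<in> X" for \<sigma> x using c1(2) that unfolding Fx_def c_def by auto
  have iE: "(map \<sigma> x, map \<sigma> y) \<in> E" if s: "\<sigma> \<in> Fx c" and xy: "(x, y) \<in> E" for \<sigma> x y
  proof -
    have "x @ y \<in> {x @ y | x y. (x, y) \<in> E}" using xy by blast
    moreover have "\<sigma> \<in> Aut" "\<forall>u\<in>set c2. \<sigma> u = u" using s unfolding Fx_def c_def by auto
    ultimately have "map \<sigma> (x @ y) \<in> {x @ y | x y. (x, y) \<in> E}" using c2(2) by blast
    then obtain x' y' where x': "map \<sigma> x @ map \<sigma> y = x' @ y'" "(x', y') \<in> E" by auto
    have "length x = n" "length x' = n" using xy x'(2) Es Xt unfolding tuples_def by auto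
    then show ?thesis using x' by auto
  qed
  have im: "act \<sigma> (E `` {x}) = E `` {map \<sigma> x}" if s: "\<sigma> \<in> Fx c" and x: "x \<in> X" for \<sigma> x
  proof (intro equalityI subsetI)
    show "z \<in> E `` {map \<sigma> x}" if "z \<in> act \<sigma> (E `` {x})" for z using that iE[OF s] unfolding act_def by auto
    fix z assume z: "z \<in> E `` {map \<sigma> x}"
    define \<tau> where "\<tau> = inv_into U \<sigma>"
    have t: "\<tau> \<in> Fx c" unfolding \<tau>_def by (rule Fx_inv[OF s cU])
    have zU: "set z \<subseteq> U" "set x \<subseteq> U" using z x Es Xt unfolding tuples_def by auto
    have "(map \<tau> (map \<sigma> x), map \<tau> z) \<in> E" using iE[OF t] z by blast
    then have "(x, map \<tau> z) \<in> E" using Aut_inv_map(1)[OF Fx_Aut[OF s] zU(2)] unfolding \<tau>_def by (simp only:)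
    moreover have "map \<sigma> (map \<tau> z) = z" unfolding \<tau>_def by (rule Aut_inv_map(2)[OF Fx_Aut[OF s] zU(1)])
    ultimately show "z \<in> act \<sigma> (E `` {x})" unfolding act_def by (metis Image_singleton_iff image_eqI)
  qed
  have "sortc c n S" unfolding sortc_def XE(4)
  proof (intro conjI ballI allI impI)
    fix C assume C: "C \<in> X // E"
    show "C \<noteq> {}" using in_quotient_imp_non_empty[OF XE(2) C] .
    show "C \<subseteq> tuples M n" using in_quotient_imp_subset[OF XE(2) C] Xt by blast
    show "C = D" if "D \<in> X // E" "x \<in> C" "x \<in> D" for D x using quotient_disj[OF XE(2) C that(1)] that by blast
    show "act \<sigma> C \<in> X // E" if s: "\<sigma> \<in> Fx c" for \<sigma>
    proof -
      obtain x where x: "x \<in> X" "C = E `` {x}" using C by (rule quotientE)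
      show ?thesis unfolding x(2) im[OF s x(1)] by (rule quotientI[OF iX[OF s x(1)]])
    qed
  qed
  then show ?thesis using cU by blast
qed

text \<open>The set of concatenated representatives is invariant. Since the lengths of the three parts are fixed,
a concatenation determines its parts, and a class is determined by any of its elements.\<close>

lemma relation_invariant:
  assumes R: "imag_rel_definable L M R" and s: "sortc c n1 S1" "sortc c n2 S2" "sortc c n3 S3"
    and sub: "\<And>cs. cs \<in> R ==> \<exists>a\<in>S1. \<exists>b\<in>S2. \<exists>d\<in>S3. cs = [a, b, d]"
  shows "\<exists>c'. set c' \<subseteq> U \<and> (\<forall>\<sigma>\<in>Fx (c @ c'). \<forall>a b d. [a, b, d] \<in> R --> [act \<sigma> a, act \<sigma> b, act \<sigma> d] \<in> R)"
proof -
  define D where "D = {concat xs | xs cs. cs \<in> R \<and> list_all2 (\<in>) xs cs}"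
  obtain N where "definable L M N D" using R unfolding imag_rel_definable_def D_def by blast
  from definable_invariant[OF this] obtain c' where c': "set c' \<subseteq> U" "\<forall>\<sigma>\<in>Aut. (\<forall>u\<in>set c'. \<sigma> u = u) --> (\<forall>x\<in>D. map \<sigma> x \<in> D)" by blast
  have "[act \<sigma> a, act \<sigma> b, act \<sigma> d] \<in> R" if sg: "\<sigma> \<in> Fx (c @ c')" and r: "[a, b, d] \<in> R" for \<sigma> a b d
  proof -
    have S: "a \<in> S1" "b \<in> S2" "d \<in> S3" using sub[OF r] by auto
    obtain x y z where xyz: "x \<in> a" "y \<in> b" "z \<in> d" using sortD(1)[OF s(1) S(1)] sortD(1)[OF s(2) S(2)] sortD(1)[OF s(3) S(3)] by blast
    have "concat [x, y, z] \<in> D" unfolding D_def using r xyz by (intro CollectI exI[of _ "[x, y, z]"] exI[of _ "[a, b, d]"]) simp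
    moreover have "\<sigma> \<in> Aut" "\<forall>u\<in>set c'. \<sigma> u = u" using sg unfolding Fx_def by auto
    ultimately have "map \<sigma> (concat [x, y, z]) \<in> D" using c'(2) by blast
    then obtain xs cs where xs: "map \<sigma> (concat [x, y, z]) = concat xs" "cs \<in> R" "list_all2 (\<in>) xs cs" unfolding D_def by blast
    obtain a' b' d' where cs: "a' \<in> S1" "b' \<in> S2" "d' \<in> S3" "cs = [a', b', d']" using sub[OF xs(2)] by blast
    obtain x' y' z' where xs': "xs = [x', y', z']" "x' \<in> a'" "y' \<in> b'" "z' \<in> d'" using xs(3) unfolding cs(4) by (auto simp: list_all2_Cons2)
    have l: "length x = length x'" "length y = length y'"
      using sortD(5)[OF s(1)] sortD(5)[OF s(2)] S cs xyz xs' by auto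
    have e: "map \<sigma> x = x'" "map \<sigma> y = y'" "map \<sigma> z = z'" using xs(1) l unfolding xs'(1) by auto
    have sg': "\<sigma> \<in> Fx c" using sg Fx_mono[of c "c @ c'"] by auto
    have "act \<sigma> a = a'" "act \<sigma> b = b'" "act \<sigma> d = d'"
      using act_eqI[OF s(1) sg' S(1) cs(1) xyz(1)] act_eqI[OF s(2) sg' S(2) cs(2) xyz(2)] act_eqI[OF s(3) sg' S(3) cs(3) xyz(3)] e xs' by auto
    then show ?thesis using xs(2) cs(4) by simp
  qed
  then show ?thesis using c'(1) by blast
qed

text \<open>Parameters are absorbed by appending them to the tuple.\<close>

lemma orbits_Fx:
  assumes c: "set c \<subseteq> U"
  shows "\<exists>R. finite R \<and> R \<subseteq> tuples M n \<and> (\<forall>x\<in>tuples M n. \<exists>r\<in>R. \<exists>\<sigma>\<in>Fx c. map \<sigma> r = x)"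
proof -
  from finitely_many_orbits[of "n + length c"]
  obtain R1 where R1: "finite R1" "R1 \<subseteq> tuples M (n + length c)" "\<forall>x\<in>tuples M (n + length c). \<exists>r\<in>R1. \<exists>\<sigma>\<in>Aut. map \<sigma> r = x"
    by (elim exE conjE)
  have "\<forall>x\<in>tuples M n. \<exists>r. r \<in> R1 \<and> (\<exists>\<sigma>\<in>Aut. map \<sigma> r = x @ c)"
  proof
    fix x assume "x \<in> tuples M n"
    then have "x @ c \<in> tuples M (n + length c)" using c unfolding tuples_def by auto
    from R1(3)[rule_format, OF this] show "\<exists>r. r \<in> R1 \<and> (\<exists>\<sigma>\<in>Aut. map \<sigma> r = x @ c)" unfolding Bex_def .
  qed
  from bchoice[OF this] obtain f where f0: "\<forall>x\<in>tuples M n. f x \<in> R1 \<and> (\<exists>\<sigma>\<in>Aut. map \<sigma> (f x) = x @ c)" by (rule exE)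
  have f: "f x \<in> R1" "\<exists>\<sigma>\<in>Aut. map \<sigma> (f x) = x @ c" if "x \<in> tuples M n" for x using f0 that by simp_all
  have "f ` tuples M n \<subseteq> R1" using f(1) by (rule image_subsetI)
  then have "finite (f ` tuples M n)" using R1(1) by (rule finite_subset)
  from finite_representatives[OF this] obtain R where R: "finite R" "R \<subseteq> tuples M n" "\<forall>x\<in>tuples M n. \<exists>r\<in>R. f r = f x" by (elim exE conjE)
  have "\<exists>r\<in>R. \<exists>\<sigma>\<in>Fx c. map \<sigma> r = x" if x: "x \<in> tuples M n" for x
  proof -
    obtain r where r: "f r = f x" "r \<in> R" using R(3)[rule_format, OF x] by (rule bexE)
    have rt: "r \<in> tuples M n" using R(2) r(2) by blast
    obtain \<sigma> where s: "map \<sigma> (f x) = x @ c" "\<sigma> \<in> Aut" using f(2)[OF x] by (rule bexE)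
    obtain \<tau> where t: "map \<tau> (f x) = r @ c" "\<tau> \<in> Aut" using f(2)[OF rt] unfolding r(1) by (rule bexE)
    have "f x \<in> tuples M (n + length c)" using f(1)[OF x] R1(2) by blast
    then have fU: "set (f x) \<subseteq> U" unfolding tuples_def by simp
    define \<rho> where "\<rho> = \<sigma> \<circ> inv_into U \<tau>"
    have "\<rho> \<in> Aut" unfolding \<rho>_def by (rule Aut_comp[OF s(2) Aut_inv[OF t(2)]])
    have "map \<rho> (r @ c) = map \<sigma> (map (inv_into U \<tau>) (map \<tau> (f x)))" unfolding t(1) \<rho>_def by simp
    also have "\<dots> = x @ c" using Aut_inv_map(1)[OF t(2) fU] s(1) by (simp only:)
    finally have e: "map \<rho> r @ map \<rho> c = x @ c" by simp
    have "length r = length x" using rt x unfolding tuples_def by simp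
    then have m: "map \<rho> r = x" "map \<rho> c = c" using e by auto
    from m(2) have "\<forall>u\<in>set c. \<rho> u = u" using map_eq_conv[of \<rho> c id] by simp
    then have "\<rho> \<in> Fx c" using \<open>\<rho> \<in> Aut\<close> unfolding Fx_def by blast
    then show ?thesis using m(1) r(2) by blast
  qed
  then show ?thesis using R(1,2) by blast
qed

end

section \<open>From definable to invariant quasi-forms\<close>

text \<open>The three groups are handled uniformly as images of embeddings into the ambient group.\<close>

locale embedding = comm_group A + X: comm_group X for A (structure) and X :: "'c monoid" +
  fixes \<iota>
  assumes hom: "\<iota> \<in> hom X A" and inj: "inj_on \<iota> (carrier X)"
begin

abbreviation "T \<equiv> \<iota> ` carrier X"

lemma gh: "group_hom X A \<iota>"
  using hom by (simp add: group_hom_def group_hom_axioms_def X.is_group is_group)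

lemma \<iota>_car: "x \<in> carrier X ==> \<iota> x \<in> carrier A" using hom by (auto simp: hom_def)

lemma \<iota>_mult: "x \<in> carrier X ==> y \<in> carrier X ==> \<iota> (x \<otimes>\<^bsub>X\<^esub> y) = \<iota> x \<otimes> \<iota> y" using hom by (auto simp: hom_def)

lemma \<iota>_inv: "x \<in> carrier X ==> \<iota> (inv\<^bsub>X\<^esub> x) = inv (\<iota> x)" by (rule group_hom.hom_inv[OF gh])

lemma \<iota>_one: "\<iota> \<one>\<^bsub>X\<^esub> = \<one>" by (rule group_hom.hom_one[OF gh])

lemma sub_img: "subgroup D X ==> subgroup (\<iota> ` D) A" by (rule group_hom.subgroup_img_is_subgroup[OF gh])

lemma sub_T: "subgroup T A" by (rule sub_img[OF X.subgroup_self])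

lemma sub_vimage: assumes "subgroup D A" shows "subgroup {x \<in> carrier X. \<iota> x \<in> D} X"
  by (rule X.subgroupI') (use sub_one[OF assms] sub_m[OF assms] sub_inv[OF assms] \<iota>_one \<iota>_mult \<iota>_inv in auto)

lemma alm_of_finite_index:
  assumes "subgroup D X" "finite (rcosets\<^bsub>X\<^esub> D)" shows "alm T (\<iota> ` D)"
proof -
  define F where "F = (\<lambda>R. \<iota> (SOME x. x \<in> R)) ` (rcosets\<^bsub>X\<^esub> D)"
  have mem: "(SOME y. y \<in> D #>\<^bsub>X\<^esub> x) \<in> D #>\<^bsub>X\<^esub> x" if "x \<in> carrier X" for x
    by (rule someI[where P = "\<lambda>y. y \<in> D #>\<^bsub>X\<^esub> x"]) (rule X.rcos_self[OF that assms(1)])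
  have Dc: "D \<subseteq> carrier X" by (rule X.sub_sub[OF assms(1)])
  have "T \<subseteq> F <#> \<iota> ` D"
  proof
    fix t assume "t \<in> T"
    then obtain x where x: "x \<in> carrier X" "t = \<iota> x" by blast
    define r where "r = (SOME y. y \<in> D #>\<^bsub>X\<^esub> x)"
    obtain d where d: "d \<in> D" "r = d \<otimes>\<^bsub>X\<^esub> x" using mem[OF x(1)] unfolding r_def r_coset_def by blast
    have dc: "d \<in> carrier X" using d(1) Dc by blast
    have rc: "r \<in> carrier X" using d(2) dc x(1) by simp
    have "x = r \<otimes>\<^bsub>X\<^esub> inv\<^bsub>X\<^esub> d" using d(2) dc x(1) by (simp add: X.m_comm[of d x] X.m_assoc)
    then have "t = \<iota> r \<otimes> \<iota> (inv\<^bsub>X\<^esub> d)" using \<iota>_mult[OF rc, of "inv\<^bsub>X\<^esub> d"] dc x(2) by simp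
    moreover have "\<iota> r \<in> F" unfolding F_def r_def using X.rcosetsI[OF Dc x(1)] by blast
    moreover have "\<iota> (inv\<^bsub>X\<^esub> d) \<in> \<iota> ` D" using X.sub_inv[OF assms(1) d(1)] by blast
    ultimately show "t \<in> F <#> \<iota> ` D" using set_multI[of "\<iota> r" F "\<iota> (inv\<^bsub>X\<^esub> d)" "\<iota> ` D" t] by blast
  qed
  moreover have "F \<subseteq> carrier A"
  proof
    fix f assume "f \<in> F"
    then obtain x where "x \<in> carrier X" "f = \<iota> (SOME y. y \<in> D #>\<^bsub>X\<^esub> x)" unfolding F_def RCOSETS_def by blast
    then show "f \<in> carrier A" using mem X.r_coset_subset_G[OF Dc] \<iota>_car by blast
  qed
  moreover have "finite F" unfolding F_def using assms(2) by simp
  ultimately show ?thesis unfolding alm_def by blast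
qed

lemma finite_index_of_alm:
  assumes "subgroup D A" "alm T D" shows "finite_index_subgroup {x \<in> carrier X. \<iota> x \<in> D} X"
proof -
  define D' where "D' = {x \<in> carrier X. \<iota> x \<in> D}"
  have sD': "subgroup D' X" unfolding D'_def by (rule sub_vimage[OF assms(1)])
  obtain F where F: "finite F" "F \<subseteq> T" "T \<subseteq> F <#> D" by (rule alm_in[OF assms(2,1) sub_sub[OF sub_T]])
  have "rcosets\<^bsub>X\<^esub> D' \<subseteq> (\<lambda>f. D' #>\<^bsub>X\<^esub> inv_into (carrier X) \<iota> f) ` F"
  proof
    fix R assume "R \<in> rcosets\<^bsub>X\<^esub> D'"
    then obtain x where x: "x \<in> carrier X" "R = D' #>\<^bsub>X\<^esub> x" unfolding RCOSETS_def by blast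
    then have "\<iota> x \<in> F <#> D" using F(3) by blast
    then obtain f d where fd: "f \<in> F" "d \<in> D" "\<iota> x = f \<otimes> d" by (blast elim: set_multE)
    obtain y where y: "y \<in> carrier X" "f = \<iota> y" using F(2) fd(1) by blast
    have iy: "inv_into (carrier X) \<iota> f = y" unfolding y(2) by (rule inv_into_f_f[OF inj y(1)])
    have dc: "d \<in> carrier A" using sub_car[OF assms(1) fd(2)] .
    have "\<iota> (x \<otimes>\<^bsub>X\<^esub> inv\<^bsub>X\<^esub> y) = (f \<otimes> d) \<otimes> inv f" using \<iota>_mult[OF x(1), of "inv\<^bsub>X\<^esub> y"] \<iota>_inv[OF y(1)] y fd(3) by simp
    also have "\<dots> = d"
    proof -
      have "f \<in> carrier A" using y \<iota>_car by simp
      then show ?thesis using dc by (simp add: m_comm[of f d] m_assoc)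
    qed
    finally have "x \<otimes>\<^bsub>X\<^esub> inv\<^bsub>X\<^esub> y \<in> D'" unfolding D'_def using fd(2) x(1) y(1) by simp
    moreover have "x = (x \<otimes>\<^bsub>X\<^esub> inv\<^bsub>X\<^esub> y) \<otimes>\<^bsub>X\<^esub> y" using x(1) y(1) by (simp add: X.m_assoc)
    ultimately have "x \<in> D' #>\<^bsub>X\<^esub> y" unfolding r_coset_def by blast
    then have "D' #>\<^bsub>X\<^esub> y = D' #>\<^bsub>X\<^esub> x" by (rule X.repr_independence[OF _ y(1) sD'])
    then show "R \<in> (\<lambda>f. D' #>\<^bsub>X\<^esub> inv_into (carrier X) \<iota> f) ` F" using fd(1) x(2) iy by (metis image_eqI)
  qed
  then show ?thesis unfolding finite_index_subgroup_def D'_def[symmetric] using sD' F(1) finite_subset by blast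
qed

end

lemma partial_homD:
  assumes X: "comm_group X" and K: "comm_group K" and f: "partial_hom X K f"
  shows "subgroup {x \<in> carrier X. f x \<noteq> None} X" "finite (rcosets\<^bsub>X\<^esub> {x \<in> carrier X. f x \<noteq> None})"
    "x \<in> carrier X ==> f x = Some k ==> k \<in> carrier K"
    "x \<in> carrier X ==> y \<in> carrier X ==> f x = Some k ==> f y = Some l ==> f (x \<otimes>\<^bsub>X\<^esub> y) = Some (k \<otimes>\<^bsub>K\<^esub> l)"
    "f \<one>\<^bsub>X\<^esub> = Some \<one>\<^bsub>K\<^esub>"
    "x \<in> carrier X ==> f x = Some k ==> f (inv\<^bsub>X\<^esub> x) = Some (inv\<^bsub>K\<^esub> k)"
proof -
  interpret X: comm_group X by (rule X)
  interpret K: comm_group K by (rule K)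
  define D where "D = {x \<in> carrier X. f x \<noteq> None}"
  have D: "subgroup D X" "finite (rcosets\<^bsub>X\<^esub> D)" and h: "(\<lambda>x. the (f x)) \<in> hom (X\<lparr>carrier := D\<rparr>) K"
    using f unfolding partial_hom_def Let_def finite_index_subgroup_def D_def by auto
  show "subgroup {x \<in> carrier X. f x \<noteq> None} X" "finite (rcosets\<^bsub>X\<^esub> {x \<in> carrier X. f x \<noteq> None})" using D unfolding D_def by auto
  have hk: "the (f x) \<in> carrier K" "the (f (x \<otimes>\<^bsub>X\<^esub> y)) = the (f x) \<otimes>\<^bsub>K\<^esub> the (f y)" if "x \<in> D" "y \<in> D" for x y
    using h that unfolding hom_def by auto
  show car: "k \<in> carrier K" if "x \<in> carrier X" "f x = Some k" for x k using hk(1)[of x x] that unfolding D_def by auto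
  show mul: "f (x \<otimes>\<^bsub>X\<^esub> y) = Some (k \<otimes>\<^bsub>K\<^esub> l)" if "x \<in> carrier X" "y \<in> carrier X" "f x = Some k" "f y = Some l" for x y k l
  proof -
    have "x \<in> D" "y \<in> D" using that unfolding D_def by auto
    then have "x \<otimes>\<^bsub>X\<^esub> y \<in> D" "the (f (x \<otimes>\<^bsub>X\<^esub> y)) = k \<otimes>\<^bsub>K\<^esub> l" using X.sub_m[OF D(1)] hk(2) that by auto
    then show ?thesis unfolding D_def by auto
  qed
  have "\<one>\<^bsub>X\<^esub> \<in> D" by (rule X.sub_one[OF D(1)])
  then obtain e where e: "f \<one>\<^bsub>X\<^esub> = Some e" unfolding D_def by auto
  have ec: "e \<in> carrier K" by (rule car[OF _ e]) simp
  have "f (\<one>\<^bsub>X\<^esub> \<otimes>\<^bsub>X\<^esub> \<one>\<^bsub>X\<^esub>) = Some (e \<otimes>\<^bsub>K\<^esub> e)" by (rule mul[OF _ _ e e]) simp_all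
  then have "e \<otimes>\<^bsub>K\<^esub> e = e" using e by simp
  then have "e = \<one>\<^bsub>K\<^esub>" using ec K.r_cancel_one' by metis
  then show one: "f \<one>\<^bsub>X\<^esub> = Some \<one>\<^bsub>K\<^esub>" using e by simp
  show "f (inv\<^bsub>X\<^esub> x) = Some (inv\<^bsub>K\<^esub> k)" if x: "x \<in> carrier X" "f x = Some k" for x k
  proof -
    have "x \<in> D" using x unfolding D_def by auto
    then have "inv\<^bsub>X\<^esub> x \<in> D" by (rule X.sub_inv[OF D(1)])
    then obtain l where l: "f (inv\<^bsub>X\<^esub> x) = Some l" unfolding D_def by auto
    have lc: "l \<in> carrier K" "k \<in> carrier K" using car[OF _ l] car[OF x] x(1) by auto
    have "f (inv\<^bsub>X\<^esub> x \<otimes>\<^bsub>X\<^esub> x) = Some (l \<otimes>\<^bsub>K\<^esub> k)" by (rule mul[OF _ x(1) l x(2)]) (use x in simp)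
    then have "l \<otimes>\<^bsub>K\<^esub> k = \<one>\<^bsub>K\<^esub>" using one x(1) by simp
    then have "inv\<^bsub>K\<^esub> k = l" by (rule K.inv_equality[OF _ lc(2,1)])
    then show ?thesis using l by simp
  qed
qed

lemma (in monster) group_base:
  assumes "definable_group L M n X"
  shows "\<exists>c. set c \<subseteq> U \<and> sortc c n (carrier X) \<and> (\<forall>\<sigma>\<in>Fx c. \<forall>a\<in>carrier X. \<forall>b\<in>carrier X. act \<sigma> (a \<otimes>\<^bsub>X\<^esub> b) = act \<sigma> a \<otimes>\<^bsub>X\<^esub> act \<sigma> b)"
proof -
  have g: "group X" "imag_set L M n (carrier X)" "imag_rel_definable L M {[a, b, a \<otimes>\<^bsub>X\<^esub> b] | a b. a \<in> carrier X \<and> b \<in> carrier X}"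
    using assms unfolding definable_group_def by auto
  interpret X: group X by (rule g(1))
  obtain c where c: "set c \<subseteq> U" "sortc c n (carrier X)" using imag_sort[OF g(2)] by blast
  have "\<exists>c'. set c' \<subseteq> U \<and> (\<forall>\<sigma>\<in>Fx (c @ c'). \<forall>a b d. [a, b, d] \<in> {[a, b, a \<otimes>\<^bsub>X\<^esub> b] | a b. a \<in> carrier X \<and> b \<in> carrier X} -->
     [act \<sigma> a, act \<sigma> b, act \<sigma> d] \<in> {[a, b, a \<otimes>\<^bsub>X\<^esub> b] | a b. a \<in> carrier X \<and> b \<in> carrier X})"
    by (rule relation_invariant[OF g(3) c(2) c(2) c(2)]) auto
  then obtain c' where c': "set c' \<subseteq> U" "\<forall>\<sigma>\<in>Fx (c @ c'). \<forall>a b d. [a, b, d] \<in> {[a, b, a \<otimes>\<^bsub>X\<^esub> b] | a b. a \<in> carrier X \<and> b \<in> carrier X} -->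
     [act \<sigma> a, act \<sigma> b, act \<sigma> d] \<in> {[a, b, a \<otimes>\<^bsub>X\<^esub> b] | a b. a \<in> carrier X \<and> b \<in> carrier X}" by (elim exE conjE)
  have "act \<sigma> (a \<otimes>\<^bsub>X\<^esub> b) = act \<sigma> a \<otimes>\<^bsub>X\<^esub> act \<sigma> b" if "\<sigma> \<in> Fx (c @ c')" "a \<in> carrier X" "b \<in> carrier X" for \<sigma> a b
    using c'(2)[rule_format, OF that(1), of a b "a \<otimes>\<^bsub>X\<^esub> b"] that by auto
  moreover have "sortc (c @ c') n (carrier X)" by (rule sort_mono[OF c(2)]) simp
  ultimately show ?thesis using c(1) c'(1) by (intro exI[of _ "c @ c'"]) auto
qed

locale quasi = monster L T \<kappa> M
  for L :: "('f, 'r) language" and T and \<kappa> :: "'k rel" and M :: "('f, 'r, 'm) fo_struct" +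
  fixes G H K :: "'m list set monoid" and lam :: "'m list set => 'm list set => 'm list set option" and nG nH nK :: nat
  assumes dgG: "definable_group L M nG G" and cgG: "comm_group G" and fbG: "finite_burden L M nG (carrier G)"
    and dgH: "definable_group L M nH H" and cgH: "comm_group H" and fbH: "finite_burden L M nH (carrier H)"
    and dgK: "definable_group L M nK K" and cgK: "comm_group K" and fbK: "finite_burden L M nK (carrier K)"
    and bil: "bilinear_quasi_form G H K lam" and dlam: "definable_partial_map L M G H lam"
begin

sublocale G: comm_group G by (rule cgG)
sublocale H: comm_group H by (rule cgH)
sublocale K: comm_group K by (rule cgK)

lemma ph1: "g \<in> carrier G ==> partial_hom H K (\<lambda>h. lam g h)" and ph2: "h \<in> carrier H ==> partial_hom G K (\<lambda>g. lam g h)"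
  using bil unfolding bilinear_quasi_form_def by auto

lemmas phD1 = partial_homD[OF cgH cgK ph1]
lemmas phD2 = partial_homD[OF cgG cgK ph2]

lemma base_exists:
  "\<exists>c. set c \<subseteq> U \<and> sortc c nG (carrier G) \<and> sortc c nH (carrier H) \<and> sortc c nK (carrier K) \<and>
    (\<forall>\<sigma>\<in>Fx c. (\<forall>a\<in>carrier G. \<forall>b\<in>carrier G. act \<sigma> (a \<otimes>\<^bsub>G\<^esub> b) = act \<sigma> a \<otimes>\<^bsub>G\<^esub> act \<sigma> b) \<and>
      (\<forall>a\<in>carrier H. \<forall>b\<in>carrier H. act \<sigma> (a \<otimes>\<^bsub>H\<^esub> b) = act \<sigma> a \<otimes>\<^bsub>H\<^esub> act \<sigma> b) \<and>
      (\<forall>a\<in>carrier K. \<forall>b\<in>carrier K. act \<sigma> (a \<otimes>\<^bsub>K\<^esub> b) = act \<sigma> a \<otimes>\<^bsub>K\<^esub> act \<sigma> b) \<and>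
      (\<forall>g\<in>carrier G. \<forall>h\<in>carrier H. \<forall>k. lam g h = Some k --> lam (act \<sigma> g) (act \<sigma> h) = Some (act \<sigma> k)))"
proof -
  obtain c1 where c1: "set c1 \<subseteq> U" "sortc c1 nG (carrier G)" "\<forall>\<sigma>\<in>Fx c1. \<forall>a\<in>carrier G. \<forall>b\<in>carrier G. act \<sigma> (a \<otimes>\<^bsub>G\<^esub> b) = act \<sigma> a \<otimes>\<^bsub>G\<^esub> act \<sigma> b"
    using group_base[OF dgG] by blast
  obtain c2 where c2: "set c2 \<subseteq> U" "sortc c2 nH (carrier H)" "\<forall>\<sigma>\<in>Fx c2. \<forall>a\<in>carrier H. \<forall>b\<in>carrier H. act \<sigma> (a \<otimes>\<^bsub>H\<^esub> b) = act \<sigma> a \<otimes>\<^bsub>H\<^esub> act \<sigma> b"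
    using group_base[OF dgH] by blast
  obtain c3 where c3: "set c3 \<subseteq> U" "sortc c3 nK (carrier K)" "\<forall>\<sigma>\<in>Fx c3. \<forall>a\<in>carrier K. \<forall>b\<in>carrier K. act \<sigma> (a \<otimes>\<^bsub>K\<^esub> b) = act \<sigma> a \<otimes>\<^bsub>K\<^esub> act \<sigma> b"
    using group_base[OF dgK] by blast
  define c where "c = c1 @ c2 @ c3"
  have so: "sortc c nG (carrier G)" "sortc c nH (carrier H)" "sortc c nK (carrier K)"
    using sort_mono[OF c1(2), of c] sort_mono[OF c2(2), of c] sort_mono[OF c3(2), of c] unfolding c_def by auto
  define R where "R = {[g, h, k] | g h k. g \<in> carrier G \<and> h \<in> carrier H \<and> lam g h = Some k}"
  have dR: "imag_rel_definable L M R" using dlam unfolding definable_partial_map_def R_def .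
  have "\<exists>c'. set c' \<subseteq> U \<and> (\<forall>\<sigma>\<in>Fx (c @ c'). \<forall>a b d. [a, b, d] \<in> R --> [act \<sigma> a, act \<sigma> b, act \<sigma> d] \<in> R)"
    by (rule relation_invariant[OF dR so]) (use phD1(3) in \<open>auto simp: R_def\<close>)
  then obtain c' where c': "set c' \<subseteq> U" "\<forall>\<sigma>\<in>Fx (c @ c'). \<forall>a b d. [a, b, d] \<in> R --> [act \<sigma> a, act \<sigma> b, act \<sigma> d] \<in> R" by (elim exE conjE)
  define b where "b = c @ c'"
  have m: "Fx b \<subseteq> Fx c1" "Fx b \<subseteq> Fx c2" "Fx b \<subseteq> Fx c3" unfolding b_def c_def by (intro Fx_mono; auto)+
  have l: "lam (act \<sigma> g) (act \<sigma> h) = Some (act \<sigma> k)" if "\<sigma> \<in> Fx b" "g \<in> carrier G" "h \<in> carrier H" "lam g h = Some k" for \<sigma> g h k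
    using c'(2)[rule_format, of \<sigma> g h k] that unfolding b_def R_def by auto
  have sb: "sortc b nG (carrier G)" "sortc b nH (carrier H)" "sortc b nK (carrier K)"
    using sort_mono[OF so(1), of b] sort_mono[OF so(2), of b] sort_mono[OF so(3), of b] unfolding b_def by auto
  have bU: "set b \<subseteq> U" unfolding b_def c_def using c1 c2 c3 c' by auto
  show ?thesis
    by (rule exI[of _ b]) (intro conjI ballI allI impI bU sb l c1(3)[rule_format] c2(3)[rule_format] c3(3)[rule_format]; (use m in blast)?)
qed

text \<open>Parameters over which the three groups, their operations and the form are all invariant.\<close>

definition c0 :: "'m list" where
  "c0 = (SOME c. set c \<subseteq> U \<and> sortc c nG (carrier G) \<and> sortc c nH (carrier H) \<and> sortc c nK (carrier K) \<and>
    (\<forall>\<sigma>\<in>Fx c. (\<forall>a\<in>carrier G. \<forall>b\<in>carrier G. act \<sigma> (a \<otimes>\<^bsub>G\<^esub> b) = act \<sigma> a \<otimes>\<^bsub>G\<^esub> act \<sigma> b) \<and>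
      (\<forall>a\<in>carrier H. \<forall>b\<in>carrier H. act \<sigma> (a \<otimes>\<^bsub>H\<^esub> b) = act \<sigma> a \<otimes>\<^bsub>H\<^esub> act \<sigma> b) \<and>
      (\<forall>a\<in>carrier K. \<forall>b\<in>carrier K. act \<sigma> (a \<otimes>\<^bsub>K\<^esub> b) = act \<sigma> a \<otimes>\<^bsub>K\<^esub> act \<sigma> b) \<and>
      (\<forall>g\<in>carrier G. \<forall>h\<in>carrier H. \<forall>k. lam g h = Some k --> lam (act \<sigma> g) (act \<sigma> h) = Some (act \<sigma> k))))"

lemma c0: "set c0 \<subseteq> U" "sortc c0 nG (carrier G)" "sortc c0 nH (carrier H)" "sortc c0 nK (carrier K)"
  and actG: "\<sigma> \<in> Fx c0 ==> a \<in> carrier G ==> b \<in> carrier G ==> act \<sigma> (a \<otimes>\<^bsub>G\<^esub> b) = act \<sigma> a \<otimes>\<^bsub>G\<^esub> act \<sigma> b"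
  and actH: "\<sigma> \<in> Fx c0 ==> a' \<in> carrier H ==> b' \<in> carrier H ==> act \<sigma> (a' \<otimes>\<^bsub>H\<^esub> b') = act \<sigma> a' \<otimes>\<^bsub>H\<^esub> act \<sigma> b'"
  and actK: "\<sigma> \<in> Fx c0 ==> a'' \<in> carrier K ==> b'' \<in> carrier K ==> act \<sigma> (a'' \<otimes>\<^bsub>K\<^esub> b'') = act \<sigma> a'' \<otimes>\<^bsub>K\<^esub> act \<sigma> b''"
  and actlam: "\<sigma> \<in> Fx c0 ==> g \<in> carrier G ==> h \<in> carrier H ==> lam g h = Some k ==> lam (act \<sigma> g) (act \<sigma> h) = Some (act \<sigma> k)"
  using someI_ex[OF base_exists, folded c0_def] by simp_all

definition A where "A = G \<times>\<times> (H \<times>\<times> K)"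

definition gact where "gact \<sigma> = (\<lambda>(g, h, k). (act \<sigma> g, act \<sigma> h, act \<sigma> k))"

definition \<Gamma> where "\<Gamma> = gact ` Fx c0"

lemma A_simps: "carrier A = carrier G \<times> carrier H \<times> carrier K" "\<one>\<^bsub>A\<^esub> = (\<one>\<^bsub>G\<^esub>, \<one>\<^bsub>H\<^esub>, \<one>\<^bsub>K\<^esub>)"
  "(g, h, k) \<otimes>\<^bsub>A\<^esub> (g', h', k') = (g \<otimes>\<^bsub>G\<^esub> g', h \<otimes>\<^bsub>H\<^esub> h', k \<otimes>\<^bsub>K\<^esub> k')"
  by (simp_all add: A_def)

lemma gact_simp: "gact \<sigma> (g, h, k) = (act \<sigma> g, act \<sigma> h, act \<sigma> k)" by (simp add: gact_def)

lemma comm_A: "comm_group A"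
proof -
  have "group A" unfolding A_def by (intro DirProd_group G.is_group H.is_group K.is_group)
  then show ?thesis
    by (rule group.group_comm_groupI) (auto simp: A_simps G.m_comm H.m_comm K.m_comm)
qed

lemma act_car: "\<sigma> \<in> Fx c0 ==> a \<in> carrier G ==> act \<sigma> a \<in> carrier G" "\<sigma> \<in> Fx c0 ==> a \<in> carrier H ==> act \<sigma> a \<in> carrier H"
   "\<sigma> \<in> Fx c0 ==> a \<in> carrier K ==> act \<sigma> a \<in> carrier K"
  by (rule sortD(4)[OF c0(2)] sortD(4)[OF c0(3)] sortD(4)[OF c0(4)]; assumption)+

lemma act_back: "\<sigma> \<in> Fx c0 ==> a \<in> carrier G ==> act (inv_into U \<sigma>) (act \<sigma> a) = a \<and> act \<sigma> (act (inv_into U \<sigma>) a) = a"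
   "\<sigma> \<in> Fx c0 ==> a \<in> carrier H ==> act (inv_into U \<sigma>) (act \<sigma> a) = a \<and> act \<sigma> (act (inv_into U \<sigma>) a) = a"
   "\<sigma> \<in> Fx c0 ==> a \<in> carrier K ==> act (inv_into U \<sigma>) (act \<sigma> a) = a \<and> act \<sigma> (act (inv_into U \<sigma>) a) = a"
  using act_inv[OF Fx_Aut sortD(2)[OF c0(2)]] act_inv[OF Fx_Aut sortD(2)[OF c0(3)]] act_inv[OF Fx_Aut sortD(2)[OF c0(4)]] by auto

text \<open>A real tuple representing a triple of imaginaries. An automorphism is determined on the triple by
its action on the representative.\<close>

definition rp where "rp = (\<lambda>(g, h, k). (SOME x. x \<in> g) @ (SOME x. x \<in> h) @ (SOME x. x \<in> k))"

lemma rp: assumes "u \<in> carrier A"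
  shows "\<exists>x\<in>fst u. \<exists>y\<in>fst (snd u). \<exists>z\<in>snd (snd u). rp u = x @ y @ z" "rp u \<in> tuples M (nG + nH + nK)"
proof -
  obtain g h k where u: "u = (g, h, k)" "g \<in> carrier G" "h \<in> carrier H" "k \<in> carrier K" using assms by (auto simp: A_simps)
  have m: "(SOME x. x \<in> g) \<in> g" "(SOME x. x \<in> h) \<in> h" "(SOME x. x \<in> k) \<in> k"
    using sortD(1)[OF c0(2) u(2)] sortD(1)[OF c0(3) u(3)] sortD(1)[OF c0(4) u(4)] by (auto intro: some_in_eq[THEN iffD2])
  then show "\<exists>x\<in>fst u. \<exists>y\<in>fst (snd u). \<exists>z\<in>snd (snd u). rp u = x @ y @ z" unfolding rp_def u(1) by auto
  show "rp u \<in> tuples M (nG + nH + nK)" unfolding rp_def u(1) tuples_def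
    using sortD(5,6)[OF c0(2) u(2) m(1)] sortD(5,6)[OF c0(3) u(3) m(2)] sortD(5,6)[OF c0(4) u(4) m(3)] by auto
qed

lemma rp_gact: assumes "u \<in> carrier A" "v \<in> carrier A" "\<sigma> \<in> Fx c0" "map \<sigma> (rp u) = rp v" shows "gact \<sigma> u = v"
proof -
  obtain g h k where u: "u = (g, h, k)" "g \<in> carrier G" "h \<in> carrier H" "k \<in> carrier K" using assms by (auto simp: A_simps)
  obtain g' h' k' where v: "v = (g', h', k')" "g' \<in> carrier G" "h' \<in> carrier H" "k' \<in> carrier K" using assms by (auto simp: A_simps)
  obtain x y z where x: "x \<in> g" "y \<in> h" "z \<in> k" "rp u = x @ y @ z" using rp(1)[OF assms(1)] unfolding u(1) by auto
  obtain x' y' z' where x': "x' \<in> g'" "y' \<in> h'" "z' \<in> k'" "rp v = x' @ y' @ z'" using rp(1)[OF assms(2)] unfolding v(1) by auto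
  have l: "length x = length x'" "length y = length y'"
    using sortD(5)[OF c0(2) u(2) x(1)] sortD(5)[OF c0(2) v(2) x'(1)] sortD(5)[OF c0(3) u(3) x(2)] sortD(5)[OF c0(3) v(3) x'(2)] by auto
  then have "map \<sigma> x = x'" "map \<sigma> y = y'" "map \<sigma> z = z'" using assms(4) x(4) x'(4) by auto
  then show ?thesis unfolding u(1) v(1) gact_simp
    using act_eqI[OF c0(2) assms(3) u(2) v(2) x(1)] act_eqI[OF c0(3) assms(3) u(3) v(3) x(2)] act_eqI[OF c0(4) assms(3) u(4) v(4) x(3)] x' by auto
qed

lemma rp_list: "set us \<subseteq> carrier A ==> concat (map rp us) \<in> tuples M (length us * (nG + nH + nK))"
  by (induction us) (use rp(2) in \<open>auto simp: tuples_def\<close>)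

lemma rp_list_gact: "set us \<subseteq> carrier A ==> set vs \<subseteq> carrier A ==> length us = length vs ==> \<sigma> \<in> Fx c0 ==>
    map \<sigma> (concat (map rp us)) = concat (map rp vs) ==> map (gact \<sigma>) us = vs"
proof (induction us arbitrary: vs)
  case (Cons u us)
  then obtain v vs' where v: "vs = v # vs'" by (cases vs) auto
  have uv: "u \<in> carrier A" "v \<in> carrier A" using Cons.prems v by auto
  have "length (rp u) = length (rp v)" using rp(2)[OF uv(1)] rp(2)[OF uv(2)] unfolding tuples_def by simp
  then have "map \<sigma> (rp u) = rp v" "map \<sigma> (concat (map rp us)) = concat (map rp vs')" using Cons.prems(5) unfolding v by auto
  then show ?case using rp_gact[OF uv Cons.prems(4)] Cons.IH[of vs'] Cons.prems unfolding v by auto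
qed simp

lemma oligo_A: "oligo A \<Gamma>"
proof (intro oligo.intro oligo_axioms.intro comm_A)
  fix \<sigma> assume "\<sigma> \<in> \<Gamma>"
  then obtain s where s: "s \<in> Fx c0" "\<sigma> = gact s" unfolding \<Gamma>_def by blast
  show "\<sigma> \<in> hom A A" unfolding s(2) hom_def
    using act_car[OF s(1)] actG[OF s(1)] actH[OF s(1)] actK[OF s(1)] by (auto simp: A_simps gact_simp)
  have "inv_into U s \<in> Fx c0" by (rule Fx_inv[OF s(1) c0(1)])
  then show "\<exists>\<tau>\<in>\<Gamma>. \<forall>x\<in>carrier A. \<tau> (\<sigma> x) = x \<and> \<sigma> (\<tau> x) = x" unfolding s(2) \<Gamma>_def
    using act_back[OF s(1)] by (intro bexI[of _ "gact (inv_into U s)"]) (auto simp: A_simps gact_simp)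
  fix \<tau> assume "\<tau> \<in> \<Gamma>"
  then obtain t where t: "t \<in> Fx c0" "\<tau> = gact t" unfolding \<Gamma>_def by blast
  show "\<exists>\<rho>\<in>\<Gamma>. \<forall>x\<in>carrier A. \<rho> x = \<sigma> (\<tau> x)" unfolding s(2) t(2) \<Gamma>_def
    using Fx_comp[OF s(1) t(1)] by (intro bexI[of _ "gact (s \<circ> t)"]) (auto simp: gact_simp act_comp)
next
  fix l :: nat
  define SS where "SS = {us. set us \<subseteq> carrier A \<and> length us = l}"
  from orbits_Fx[OF c0(1), of "l * (nG + nH + nK)"] obtain R where R: "finite R" "R \<subseteq> tuples M (l * (nG + nH + nK))" "\<forall>x\<in>tuples M (l * (nG + nH + nK)). \<exists>r\<in>R. \<exists>\<sigma>\<in>Fx c0. map \<sigma> r = x"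
    by (elim exE conjE)
  have "\<forall>us\<in>SS. \<exists>r. r \<in> R \<and> (\<exists>\<sigma>\<in>Fx c0. map \<sigma> r = concat (map rp us))"
  proof
    fix us assume "us \<in> SS"
    then have "concat (map rp us) \<in> tuples M (l * (nG + nH + nK))" using rp_list[of us] unfolding SS_def by blast
    from R(3)[rule_format, OF this] show "\<exists>r. r \<in> R \<and> (\<exists>\<sigma>\<in>Fx c0. map \<sigma> r = concat (map rp us))" unfolding Bex_def .
  qed
  from bchoice[OF this] obtain f where f: "\<forall>us\<in>SS. f us \<in> R \<and> (\<exists>\<sigma>\<in>Fx c0. map \<sigma> (f us) = concat (map rp us))" by (rule exE)
  have f1: "f us \<in> R" "\<exists>\<sigma>\<in>Fx c0. map \<sigma> (f us) = concat (map rp us)" if "us \<in> SS" for us using f that by simp_all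
  have "f ` SS \<subseteq> R" using f1(1) by (rule image_subsetI)
  then have "finite (f ` SS)" using R(1) by (rule finite_subset)
  from finite_representatives[OF this] obtain R' where R': "finite R'" "R' \<subseteq> SS" "\<forall>us\<in>SS. \<exists>r\<in>R'. f r = f us" by (elim exE conjE)
  have "\<exists>r\<in>R'. \<exists>\<sigma>\<in>\<Gamma>. map \<sigma> r = us" if us: "us \<in> SS" for us
  proof -
    obtain vs where vs: "f vs = f us" "vs \<in> R'" using R'(3)[rule_format, OF us] by (rule bexE)
    have vsS: "vs \<in> SS" using R'(2) vs(2) by blast
    obtain s where s: "map s (f us) = concat (map rp us)" "s \<in> Fx c0" using f1(2)[OF us] by (rule bexE)
    obtain t where t: "map t (f us) = concat (map rp vs)" "t \<in> Fx c0" using f1(2)[OF vsS] unfolding vs(1) by (rule bexE)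
    have "f us \<in> tuples M (l * (nG + nH + nK))" using f1(1)[OF us] R(2) by blast
    then have fU: "set (f us) \<subseteq> U" unfolding tuples_def by simp
    define \<rho> where "\<rho> = s \<circ> inv_into U t"
    have r: "\<rho> \<in> Fx c0" unfolding \<rho>_def by (rule Fx_comp[OF s(2) Fx_inv[OF t(2) c0(1)]])
    have "map \<rho> (concat (map rp vs)) = map s (map (inv_into U t) (map t (f us)))" unfolding t(1) \<rho>_def by simp
    also have "\<dots> = concat (map rp us)" unfolding Aut_inv_map(1)[OF Fx_Aut[OF t(2)] fU] by (rule s(1))
    finally have "map (gact \<rho>) vs = us" using us vsS unfolding SS_def by (intro rp_list_gact r) simp_all
    then show ?thesis using r vs(2) unfolding \<Gamma>_def by blast
  qed
  then show "\<exists>R. finite R \<and> (\<forall>r\<in>R. set r \<subseteq> carrier A) \<and>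
      (\<forall>us. set us \<subseteq> carrier A --> length us = l --> (\<exists>r\<in>R. \<exists>\<sigma>\<in>\<Gamma>. map \<sigma> r = us))"
    using R'(1,2) unfolding SS_def by (intro exI[of _ R']) blast
qed

sublocale O: oligo A \<Gamma> by (rule oligo_A)

lemma real_parameters:
  "set c \<subseteq> carrier A ==> \<exists>e. set e \<subseteq> U \<and> (\<forall>\<sigma>\<in>Fx (c0 @ e). gact \<sigma> \<in> O.stab c)"
proof (induction c)
  case Nil
  have "gact \<sigma> \<in> O.stab []" if "\<sigma> \<in> Fx (c0 @ [])" for \<sigma>
  proof -
    have "gact \<sigma> \<in> \<Gamma>" using that unfolding \<Gamma>_def by simp
    then show ?thesis unfolding O.stab_def by simp
  qed
  then show ?case by (intro exI[of _ "[]"]) simp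
next
  case (Cons u c)
  then obtain e where e: "set e \<subseteq> U" "\<forall>\<sigma>\<in>Fx (c0 @ e). gact \<sigma> \<in> O.stab c" by auto
  have u: "u \<in> carrier A" using Cons by simp
  have "gact \<sigma> \<in> O.stab (u # c)" if s: "\<sigma> \<in> Fx (c0 @ rp u @ e)" for \<sigma>
  proof -
    have s1: "\<sigma> \<in> Fx (c0 @ e)" "\<sigma> \<in> Fx c0" "\<forall>x\<in>set (rp u). \<sigma> x = x" using s unfolding Fx_def by auto
    have "gact \<sigma> u = u" by (rule rp_gact[OF u u s1(2)]) (use s1(3) in \<open>simp add: map_idI\<close>)
    then show ?thesis using e(2) s1(1) unfolding O.stab_def by simp
  qed
  moreover have "set (rp u) \<subseteq> U" using rp(2)[OF u] unfolding tuples_def by blast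
  ultimately show ?case using e(1) by (intro exI[of _ "rp u @ e"]) auto
qed

text \<open>Independent subgroups \<open>D 0, \<dots>, D d\<close> yield an inp-pattern of depth \<open>d + 1\<close>: row \<open>i\<close> consists of infinitely
many different cosets of \<open>D i\<close>, represented by elements \<open>b i j\<close> of all the other \<open>D k\<close>. Rows are
\<open>2\<close>-inconsistent because different cosets are disjoint, and every path is consistent because the
product of the chosen \<open>b i (\<eta> i)\<close> lies in all the chosen cosets. The formula of row \<open>i\<close> expresses that two
elements of \<open>X\<close> differ by an element of \<open>D i\<close>; it is definable as an invariant relation, with the same
parameters for the whole row.\<close>

lemma tame_image:
  assumes e: "embedding A X \<iota>" and s: "sortc c0 n (carrier X)" and fb: "finite_burden L M n (carrier X)"
    and eq: "\<And>\<sigma> x. \<sigma> \<in> Fx c0 ==> x \<in> carrier X ==> gact \<sigma> (\<iota> x) = \<iota> (act \<sigma> x)"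
  shows "O.tame (\<iota> ` carrier X)"
proof -
  interpret E: embedding A X \<iota> by (rule e)
  have inv: "O.invs [] E.T" unfolding O.invs_def
  proof (intro conjI ballI)
    show "E.T \<subseteq> carrier A" using E.\<iota>_car by blast
    fix \<gamma> t assume g: "\<gamma> \<in> O.stab []" and "t \<in> E.T"
    moreover have "\<gamma> \<in> \<Gamma>" by (rule O.stab_sub[OF g])
    ultimately obtain \<sigma> x where "\<sigma> \<in> Fx c0" "\<gamma> = gact \<sigma>" "x \<in> carrier X" "t = \<iota> x" unfolding \<Gamma>_def by blast
    then show "\<gamma> t \<in> E.T" using eq sortD(4)[OF s] by auto
  qed
  have dT: "O.dfn E.T" unfolding O.dfn_def using E.sub_T inv by (intro conjI exI[of _ "[]"]) auto
  obtain d where d: "\<not> (\<exists>\<phi> a. inp_pattern L M n (carrier X) (Suc d) \<phi> a)" using fb unfolding finite_burden_def by (rule exE)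
  have "\<exists>i\<le>d. O.alm (E.T \<inter> (\<Inter>j\<in>{..d}-{i}. D j)) (D i)" if D: "\<forall>i\<le>d. O.dfn (D i)" for D
  proof (rule ccontr)
    assume no: "\<not> ?thesis"
    define B where "B i = E.T \<inter> (\<Inter>j\<in>{..d}-{i}. D j)" for i
    have Bc: "B i \<subseteq> carrier A" for i unfolding B_def using E.\<iota>_car by blast
    have sD: "subgroup (D i) A" if "i \<le> d" for i using D that O.dfn_sub by simp
    have "\<forall>i\<in>{..d}. \<exists>b::nat => _. (\<forall>j. b j \<in> B i) \<and> (\<forall>j k. j \<noteq> k --> b j \<otimes>\<^bsub>A\<^esub> inv\<^bsub>A\<^esub> b k \<notin> D i)"
    proof
      fix i assume "i \<in> {..d}"
      then have i: "i \<le> d" by simp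
      have "\<not> O.alm (B i) (D i)" using no i unfolding B_def by blast
      from O.not_alm_seq[OF this sD[OF i] Bc] show "\<exists>b::nat => _. (\<forall>j. b j \<in> B i) \<and> (\<forall>j k. j \<noteq> k --> b j \<otimes>\<^bsub>A\<^esub> inv\<^bsub>A\<^esub> b k \<notin> D i)" .
    qed
    from bchoice[OF this] obtain b where b0: "\<forall>i\<in>{..d}. (\<forall>j::nat. b i j \<in> B i) \<and> (\<forall>j k. j \<noteq> k --> b i j \<otimes>\<^bsub>A\<^esub> inv\<^bsub>A\<^esub> b i k \<notin> D i)" by (rule exE)
    have b: "b i j \<in> B i" "j \<noteq> k ==> b i j \<otimes>\<^bsub>A\<^esub> inv\<^bsub>A\<^esub> b i k \<notin> D i" if "i \<le> d" for i j k using b0 that by simp_all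
    define x where "x i j = inv_into (carrier X) \<iota> (b i j)" for i j
    have x: "x i j \<in> carrier X" "\<iota> (x i j) = b i j" if "i \<le> d" for i j
      using b(1)[OF that, of j] unfolding B_def x_def by (auto simp: f_inv_into_f inv_into_into)
    define r where "r i j = (SOME u. u \<in> x i j)" for i j
    have r: "r i j \<in> x i j" if "i \<le> d" for i j unfolding r_def some_in_eq using sortD(1)[OF s x(1)[OF that]] .
    have "\<forall>i\<in>{..d}. \<exists>q. set (fst q) \<subseteq> U \<and> snd q \<in> formulas L (n + n + length (fst q)) \<and>
       (\<forall>g\<in>carrier X. \<forall>h\<in>carrier X. \<forall>u\<in>g. \<forall>v\<in>h. holds M (snd q) (u @ v @ fst q) \<longleftrightarrow> \<iota> g \<otimes>\<^bsub>A\<^esub> inv\<^bsub>A\<^esub> \<iota> h \<in> D i)"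
    proof
      fix i assume "i \<in> {..d}"
      then have i: "i \<le> d" by simp
      obtain c where c: "set c \<subseteq> carrier A" "O.invs c (D i)" using O.dfnE D i by metis
      obtain e where e: "set e \<subseteq> U" "\<forall>\<sigma>\<in>Fx (c0 @ e). gact \<sigma> \<in> O.stab c" using real_parameters[OF c(1)] by blast
      define W where "W = {u @ v | u v g h. g \<in> carrier X \<and> h \<in> carrier X \<and> u \<in> g \<and> v \<in> h \<and> \<iota> g \<otimes>\<^bsub>A\<^esub> inv\<^bsub>A\<^esub> \<iota> h \<in> D i}"
      have "definable L M (n + n) W"
      proof (rule invariant_definable)
        show "set (c0 @ e) \<subseteq> U" using c0(1) e(1) by simp
        show "W \<subseteq> tuples M (n + n)"
        proof
          fix w assume "w \<in> W"
          then obtain u v g h where w: "w = u @ v" "g \<in> carrier X" "h \<in> carrier X" "u \<in> g" "v \<in> h" unfolding W_def by blast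
          then show "w \<in> tuples M (n + n)" using sortD(5,6)[OF s w(2,4)] sortD(5,6)[OF s w(3,5)] unfolding tuples_def by simp
        qed
        fix \<sigma> w assume sg: "\<sigma> \<in> Aut" "\<forall>u\<in>set (c0 @ e). \<sigma> u = u" and "w \<in> W"
        then obtain u v g h where w: "w = u @ v" "g \<in> carrier X" "h \<in> carrier X" "u \<in> g" "v \<in> h" "\<iota> g \<otimes>\<^bsub>A\<^esub> inv\<^bsub>A\<^esub> \<iota> h \<in> D i" unfolding W_def by blast
        have sF: "\<sigma> \<in> Fx (c0 @ e)" "\<sigma> \<in> Fx c0" using sg unfolding Fx_def by auto
        have st: "gact \<sigma> \<in> O.stab c" using e(2) sF(1) by blast
        note sG = O.stab_sub[OF st]
        have "gact \<sigma> (\<iota> g \<otimes>\<^bsub>A\<^esub> inv\<^bsub>A\<^esub> \<iota> h) \<in> D i" using c(2) st w(6) unfolding O.invs_def by blast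
        moreover have "gact \<sigma> (\<iota> g \<otimes>\<^bsub>A\<^esub> inv\<^bsub>A\<^esub> \<iota> h) = \<iota> (act \<sigma> g) \<otimes>\<^bsub>A\<^esub> inv\<^bsub>A\<^esub> \<iota> (act \<sigma> h)"
          using O.\<Gamma>_mult[OF sG, of "\<iota> g" "inv\<^bsub>A\<^esub> \<iota> h"] O.\<Gamma>_m_inv[OF sG, of "\<iota> h"] E.\<iota>_car[OF w(2)] E.\<iota>_car[OF w(3)] eq[OF sF(2) w(2)] eq[OF sF(2) w(3)] by simp
        ultimately have "\<iota> (act \<sigma> g) \<otimes>\<^bsub>A\<^esub> inv\<^bsub>A\<^esub> \<iota> (act \<sigma> h) \<in> D i" by simp
        moreover have "act \<sigma> g \<in> carrier X" "act \<sigma> h \<in> carrier X" using sortD(4)[OF s sF(2)] w by auto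
        moreover have "map \<sigma> u \<in> act \<sigma> g" "map \<sigma> v \<in> act \<sigma> h" unfolding act_def using w by auto
        ultimately show "map \<sigma> w \<in> W" unfolding W_def w(1) map_append by blast
      qed
      then obtain p \<phi> where p: "p \<in> lists U" "\<phi> \<in> formulas L (n + n + length p)" "W = {z \<in> tuples M (n + n). holds M \<phi> (z @ p)}"
        unfolding definable_def by blast
      have "holds M \<phi> (u @ v @ p) \<longleftrightarrow> \<iota> g \<otimes>\<^bsub>A\<^esub> inv\<^bsub>A\<^esub> \<iota> h \<in> D i" if h: "g \<in> carrier X" "h \<in> carrier X" "u \<in> g" "v \<in> h" for g h u v
      proof -
        note lu = sortD(5,6)[OF s h(1,3)] and lv = sortD(5,6)[OF s h(2,4)]
        have "u @ v \<in> tuples M (n + n)" using lu lv unfolding tuples_def by simp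
        then have "holds M \<phi> (u @ v @ p) \<longleftrightarrow> u @ v \<in> W" unfolding p(3) by simp
        also have "\<dots> \<longleftrightarrow> \<iota> g \<otimes>\<^bsub>A\<^esub> inv\<^bsub>A\<^esub> \<iota> h \<in> D i"
        proof
          assume "u @ v \<in> W"
          then obtain u' v' g' h' where w: "u @ v = u' @ v'" "g' \<in> carrier X" "h' \<in> carrier X" "u' \<in> g'" "v' \<in> h'" "\<iota> g' \<otimes>\<^bsub>A\<^esub> inv\<^bsub>A\<^esub> \<iota> h' \<in> D i" unfolding W_def by blast
          have "u = u'" "v = v'" using w(1) lu(1) sortD(5)[OF s w(2,4)] by auto
          then have "g' = g" "h' = h" using sortD(3)[OF s w(2) h(1) w(4)] sortD(3)[OF s w(3) h(2) w(5)] h by auto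
          then show "\<iota> g \<otimes>\<^bsub>A\<^esub> inv\<^bsub>A\<^esub> \<iota> h \<in> D i" using w(6) by simp
        next
          assume "\<iota> g \<otimes>\<^bsub>A\<^esub> inv\<^bsub>A\<^esub> \<iota> h \<in> D i"
          then show "u @ v \<in> W" unfolding W_def using h by blast
        qed
        finally show ?thesis .
      qed
      then show "\<exists>q. set (fst q) \<subseteq> U \<and> snd q \<in> formulas L (n + n + length (fst q)) \<and>
         (\<forall>g\<in>carrier X. \<forall>h\<in>carrier X. \<forall>u\<in>g. \<forall>v\<in>h. holds M (snd q) (u @ v @ fst q) \<longleftrightarrow> \<iota> g \<otimes>\<^bsub>A\<^esub> inv\<^bsub>A\<^esub> \<iota> h \<in> D i)"
        using p(1,2) by (intro exI[of _ "(p, \<phi>)"]) auto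
    qed
    from bchoice[OF this] obtain q where q0: "\<forall>i\<in>{..d}. set (fst (q i)) \<subseteq> U \<and> snd (q i) \<in> formulas L (n + n + length (fst (q i))) \<and>
       (\<forall>g\<in>carrier X. \<forall>h\<in>carrier X. \<forall>u\<in>g. \<forall>v\<in>h. holds M (snd (q i)) (u @ v @ fst (q i)) \<longleftrightarrow> \<iota> g \<otimes>\<^bsub>A\<^esub> inv\<^bsub>A\<^esub> \<iota> h \<in> D i)" by (rule exE)
    define a where "a i j = r i j @ fst (q i)" for i j
    have q: "set (fst (q i)) \<subseteq> U" "snd (q i) \<in> formulas L (n + n + length (fst (q i)))" if "i \<le> d" for i using q0 that by simp_all
    have h: "imag_holds M (snd (q i)) g (a i j) \<longleftrightarrow> \<iota> g \<otimes>\<^bsub>A\<^esub> inv\<^bsub>A\<^esub> b i j \<in> D i" if i: "i \<le> d" and g: "g \<in> carrier X" for i j g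
    proof -
      have "holds M (snd (q i)) (u @ r i j @ fst (q i)) \<longleftrightarrow> \<iota> g \<otimes>\<^bsub>A\<^esub> inv\<^bsub>A\<^esub> b i j \<in> D i" if "u \<in> g" for u
        using q0 i g x[OF i, of j] r[OF i, of j] that by auto
      moreover have "g \<noteq> {}" using sortD(1)[OF s g] .
      ultimately show ?thesis unfolding imag_holds_def a_def by auto
    qed
    have "inp_pattern L M n (carrier X) (Suc d) (\<lambda>i. snd (q i)) a" unfolding inp_pattern_def
    proof (intro conjI allI impI)
      fix i assume "i < Suc d"
      then have i: "i \<le> d" by simp
      have "a i j \<in> tuples M (n + length (fst (q i)))" for j
        using sortD(5,6)[OF s x(1)[OF i] r[OF i], of j] q(1)[OF i] unfolding a_def tuples_def by simp
      then show "\<exists>m. snd (q i) \<in> formulas L (n + m) \<and> (\<forall>j. a i j \<in> tuples M m)"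
        using q(2)[OF i] by (intro exI[of _ "n + length (fst (q i))"]) (simp add: add.assoc)
    next
      fix i assume "i < Suc d"
      then have i: "i \<le> d" by simp
      have "\<not> (\<exists>c\<in>carrier X. \<forall>j\<in>J. imag_holds M (snd (q i)) c (a i j))" if J: "finite J \<and> card J = 2" for J
      proof
        assume "\<exists>c\<in>carrier X. \<forall>j\<in>J. imag_holds M (snd (q i)) c (a i j)"
        then obtain g where g: "g \<in> carrier X" "\<forall>j\<in>J. imag_holds M (snd (q i)) g (a i j)" by blast
        obtain j k where jk: "J = {j, k}" "j \<noteq> k" using J card_2_iff[of J] by auto
        have m: "\<iota> g \<otimes>\<^bsub>A\<^esub> inv\<^bsub>A\<^esub> b i j \<in> D i" "\<iota> g \<otimes>\<^bsub>A\<^esub> inv\<^bsub>A\<^esub> b i k \<in> D i" using g h[OF i g(1)] jk by auto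
        have cc: "\<iota> g \<in> carrier A" "b i j \<in> carrier A" "b i k \<in> carrier A" using E.\<iota>_car[OF g(1)] b(1)[OF i] Bc by auto
        have "inv\<^bsub>A\<^esub> (\<iota> g \<otimes>\<^bsub>A\<^esub> inv\<^bsub>A\<^esub> b i j) \<otimes>\<^bsub>A\<^esub> (\<iota> g \<otimes>\<^bsub>A\<^esub> inv\<^bsub>A\<^esub> b i k) \<in> D i"
          by (rule O.sub_m[OF sD[OF i] O.sub_inv[OF sD[OF i] m(1)] m(2)])
        moreover have "inv\<^bsub>A\<^esub> (\<iota> g \<otimes>\<^bsub>A\<^esub> inv\<^bsub>A\<^esub> b i j) = b i j \<otimes>\<^bsub>A\<^esub> inv\<^bsub>A\<^esub> \<iota> g" using cc by (simp add: O.inv_mult O.m_comm)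
        moreover have "(b i j \<otimes>\<^bsub>A\<^esub> inv\<^bsub>A\<^esub> \<iota> g) \<otimes>\<^bsub>A\<^esub> (\<iota> g \<otimes>\<^bsub>A\<^esub> inv\<^bsub>A\<^esub> b i k) = b i j \<otimes>\<^bsub>A\<^esub> inv\<^bsub>A\<^esub> b i k"
        proof -
          have "inv\<^bsub>A\<^esub> \<iota> g \<otimes>\<^bsub>A\<^esub> (\<iota> g \<otimes>\<^bsub>A\<^esub> inv\<^bsub>A\<^esub> b i k) = inv\<^bsub>A\<^esub> b i k" using cc by (simp add: O.m_assoc[symmetric])
          then show ?thesis using cc by (simp add: O.m_assoc)
        qed
        ultimately have "b i j \<otimes>\<^bsub>A\<^esub> inv\<^bsub>A\<^esub> b i k \<in> D i" by simp
        then show False using b(2)[OF i jk(2)] by blast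
      qed
      then show "\<exists>k. \<forall>J. finite J \<and> card J = k --> \<not> (\<exists>c\<in>carrier X. \<forall>j\<in>J. imag_holds M (snd (q i)) c (a i j))" by blast
    next
      fix \<eta> :: "nat => nat"
      have bT: "b i j \<in> E.T" "b i j \<in> carrier A" if "i \<le> d" for i j using b(1)[OF that, of j] Bc unfolding B_def by auto
      define w where "w = finprod A (\<lambda>i. b i (\<eta> i)) {..d}"
      have "w \<in> E.T" unfolding w_def by (rule O.finprod_sub[OF E.sub_T]) (use bT in auto)
      then obtain g where g: "g \<in> carrier X" "w = \<iota> g" by blast
      have "\<iota> g \<otimes>\<^bsub>A\<^esub> inv\<^bsub>A\<^esub> b i (\<eta> i) \<in> D i" if i: "i \<le> d" for i
      proof -
        define v where "v = finprod A (\<lambda>i. b i (\<eta> i)) ({..d} - {i})"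
        have v: "v \<in> D i" unfolding v_def
        proof (rule O.finprod_sub[OF sD[OF i]])
          fix k assume k: "k \<in> {..d} - {i}"
          then have "b k (\<eta> k) \<in> B k" by (intro b(1)) simp
          then show "b k (\<eta> k) \<in> D i" unfolding B_def using i k by auto
        qed simp
        have "finprod A (\<lambda>i. b i (\<eta> i)) (insert i ({..d} - {i})) = b i (\<eta> i) \<otimes>\<^bsub>A\<^esub> v" unfolding v_def
          by (rule O.finprod_insert) (use bT i in auto)
        moreover have "insert i ({..d} - {i}) = {..d}" using i by auto
        ultimately have "w = b i (\<eta> i) \<otimes>\<^bsub>A\<^esub> v" unfolding w_def by simp
        moreover have "v \<in> carrier A" using O.sub_car[OF sD[OF i] v] .
        ultimately have "w \<otimes>\<^bsub>A\<^esub> inv\<^bsub>A\<^esub> b i (\<eta> i) = v" using bT(2)[OF i, of "\<eta> i"] by (simp add: O.m_comm[of "b i (\<eta> i)" v] O.m_assoc)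
        then show ?thesis using v g(2) by simp
      qed
      then show "\<exists>c\<in>carrier X. \<forall>i<Suc d. imag_holds M (snd (q i)) c (a i (\<eta> i))"
        using g(1) h by (intro bexI[of _ g]) auto
    qed
    then show False using d by blast
  qed
  then show ?thesis unfolding O.tame_def using dT by blast
qed

text \<open>The union of the classes in the preimage of \<open>B\<close> is an invariant set of tuples, hence definable.\<close>

lemma connected_image:
  assumes e: "embedding A X \<iota>" and s: "sortc c0 n (carrier X)" and cn: "connected_group L M X"
    and eq: "\<And>\<sigma> x. \<sigma> \<in> Fx c0 ==> x \<in> carrier X ==> gact \<sigma> (\<iota> x) = \<iota> (act \<sigma> x)"
    and B: "O.dfn B" "B \<subseteq> \<iota> ` carrier X" "O.alm (\<iota> ` carrier X) B"
  shows "B = \<iota> ` carrier X"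
proof -
  interpret E: embedding A X \<iota> by (rule e)
  define D where "D = {x \<in> carrier X. \<iota> x \<in> B}"
  have fi: "finite_index_subgroup D X" unfolding D_def by (rule E.finite_index_of_alm[OF O.dfn_sub[OF B(1)] B(3)])
  obtain c where c: "set c \<subseteq> carrier A" "O.invs c B" using O.dfnE[OF B(1)] by metis
  obtain e where e: "set e \<subseteq> U" "\<forall>\<sigma>\<in>Fx (c0 @ e). gact \<sigma> \<in> O.stab c" using real_parameters[OF c(1)] by blast
  have "definable L M n (\<Union>D)"
  proof (rule invariant_definable)
    show "set (c0 @ e) \<subseteq> U" using c0(1) e(1) by simp
    show "\<Union>D \<subseteq> tuples M n" using sortD(2)[OF s] unfolding D_def by blast
    fix \<sigma> w assume sg: "\<sigma> \<in> Aut" "\<forall>u\<in>set (c0 @ e). \<sigma> u = u" and "w \<in> \<Union>D"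
    then obtain x where x: "x \<in> carrier X" "\<iota> x \<in> B" "w \<in> x" unfolding D_def by blast
    have sF: "\<sigma> \<in> Fx (c0 @ e)" "\<sigma> \<in> Fx c0" using sg unfolding Fx_def by auto
    have "gact \<sigma> (\<iota> x) \<in> B" using c(2) e(2) sF(1) x(2) unfolding O.invs_def by blast
    then have "act \<sigma> x \<in> D" unfolding D_def using eq[OF sF(2) x(1)] sortD(4)[OF s sF(2) x(1)] by simp
    moreover have "map \<sigma> w \<in> act \<sigma> x" unfolding act_def using x(3) by blast
    ultimately show "map \<sigma> w \<in> \<Union>D" by blast
  qed
  moreover have "{concat xs | xs cs. cs \<in> {[c] | c. c \<in> D} \<and> list_all2 (\<in>) xs cs} = \<Union>D"
  proof (intro equalityI subsetI)
    fix w assume "w \<in> {concat xs | xs cs. cs \<in> {[c] | c. c \<in> D} \<and> list_all2 (\<in>) xs cs}"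
    then obtain xs x where "x \<in> D" "list_all2 (\<in>) xs [x]" "w = concat xs" by blast
    moreover from this obtain y where "xs = [y]" "y \<in> x" by (auto simp: list_all2_Cons2)
    ultimately have "x \<in> D" "w \<in> x" by simp_all
    then show "w \<in> \<Union>D" by (rule UnionI)
  next
    fix w assume "w \<in> \<Union>D"
    then obtain x where x: "x \<in> D" "w \<in> x" by blast
    then show "w \<in> {concat xs | xs cs. cs \<in> {[c] | c. c \<in> D} \<and> list_all2 (\<in>) xs cs}"
      by (intro CollectI exI[of _ "[w]"] exI[of _ "[x]"]) simp
  qed
  ultimately have "imag_rel_definable L M {[c] | c. c \<in> D}" unfolding imag_rel_definable_def by (intro exI[of _ n]) simp
  then have "D = carrier X" using cn fi unfolding connected_group_def by blast
  then show ?thesis using B(2) unfolding D_def by blast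
qed

definition "\<iota>G = (\<lambda>g. (g, \<one>\<^bsub>H\<^esub>, \<one>\<^bsub>K\<^esub>))"
definition "\<iota>H = (\<lambda>h. (\<one>\<^bsub>G\<^esub>, h, \<one>\<^bsub>K\<^esub>))"
definition "\<iota>K = (\<lambda>k. (\<one>\<^bsub>G\<^esub>, \<one>\<^bsub>H\<^esub>, k))"

lemma act_one:
  assumes s: "\<sigma> \<in> Fx c0"
  shows "act \<sigma> \<one>\<^bsub>G\<^esub> = \<one>\<^bsub>G\<^esub>" "act \<sigma> \<one>\<^bsub>H\<^esub> = \<one>\<^bsub>H\<^esub>" "act \<sigma> \<one>\<^bsub>K\<^esub> = \<one>\<^bsub>K\<^esub>"
proof -
  have "gact \<sigma> \<one>\<^bsub>A\<^esub> = \<one>\<^bsub>A\<^esub>" by (rule O.\<Gamma>_one) (use s in \<open>simp add: \<Gamma>_def\<close>)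
  then show "act \<sigma> \<one>\<^bsub>G\<^esub> = \<one>\<^bsub>G\<^esub>" "act \<sigma> \<one>\<^bsub>H\<^esub> = \<one>\<^bsub>H\<^esub>" "act \<sigma> \<one>\<^bsub>K\<^esub> = \<one>\<^bsub>K\<^esub>" by (simp_all add: A_simps gact_simp)
qed

lemma eqG: "\<sigma> \<in> Fx c0 ==> gact \<sigma> (\<iota>G x) = \<iota>G (act \<sigma> x)" and eqH: "\<sigma> \<in> Fx c0 ==> gact \<sigma> (\<iota>H x) = \<iota>H (act \<sigma> x)"
  and eqK: "\<sigma> \<in> Fx c0 ==> gact \<sigma> (\<iota>K x) = \<iota>K (act \<sigma> x)"
  by (simp_all add: \<iota>G_def \<iota>H_def \<iota>K_def gact_simp act_one)

lemma embG: "embedding A G \<iota>G" and embH: "embedding A H \<iota>H" and embK: "embedding A K \<iota>K"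
  by (auto intro!: embedding.intro embedding_axioms.intro comm_A cgG cgH cgK inj_onI simp: hom_def A_simps \<iota>G_def \<iota>H_def \<iota>K_def)

lemmas tG = tame_image[OF embG c0(2) fbG eqG] and tH = tame_image[OF embH c0(3) fbH eqH] and tK = tame_image[OF embK c0(4) fbK eqK]

definition lam' where "lam' u v = map_option \<iota>K (lam (fst u) (fst (snd v)))"

lemma lam'_simp: "lam' (\<iota>G g) (\<iota>H h) = map_option \<iota>K (lam g h)" by (simp add: lam'_def \<iota>G_def \<iota>H_def)

lemma lam'_None: "lam' (\<iota>G g) (\<iota>H h) \<noteq> None \<longleftrightarrow> lam g h \<noteq> None"
  unfolding lam'_simp by (cases "lam g h") simp_all

lemma inv_image:
  assumes e: "embedding A X \<iota>" and s: "sortc c0 n (carrier X)"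
    and eq: "\<And>\<sigma> x. \<sigma> \<in> Fx c0 ==> gact \<sigma> (\<iota> x) = \<iota> (act \<sigma> x)"
  shows "O.invs [] (\<iota> ` carrier X)" unfolding O.invs_def
proof (intro conjI ballI)
  show "\<iota> ` carrier X \<subseteq> carrier A" using embedding.\<iota>_car[OF e] by blast
  fix \<gamma> t assume g: "\<gamma> \<in> O.stab []" and "t \<in> \<iota> ` carrier X"
  moreover have "\<gamma> \<in> \<Gamma>" by (rule O.stab_sub[OF g])
  ultimately obtain \<sigma> x where h: "\<sigma> \<in> Fx c0" "\<gamma> = gact \<sigma>" "x \<in> carrier X" "t = \<iota> x" unfolding \<Gamma>_def by blast
  show "\<gamma> t \<in> \<iota> ` carrier X" unfolding h(2,4) eq[OF h(1)] by (rule imageI[OF sortD(4)[OF s h(1,3)]])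
qed

sublocale EG: embedding A G \<iota>G by (rule embG)
sublocale EH: embedding A H \<iota>H by (rule embH)
sublocale EK: embedding A K \<iota>K by (rule embK)

lemma actlam':
  assumes s: "\<sigma> \<in> Fx c0" and gh: "g \<in> carrier G" "h \<in> carrier H"
  shows "lam (act \<sigma> g) (act \<sigma> h) = map_option (act \<sigma>) (lam g h)"
proof (cases "lam g h")
  case (Some k) then show ?thesis using actlam[OF s gh] by simp
next
  case None
  have "lam (act \<sigma> g) (act \<sigma> h) = None"
  proof (rule ccontr)
    assume "lam (act \<sigma> g) (act \<sigma> h) \<noteq> None"
    then obtain k where k: "lam (act \<sigma> g) (act \<sigma> h) = Some k" by blast
    have "lam (act (inv_into U \<sigma>) (act \<sigma> g)) (act (inv_into U \<sigma>) (act \<sigma> h)) = Some (act (inv_into U \<sigma>) k)"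
      by (rule actlam[OF Fx_inv[OF s c0(1)] act_car(1)[OF s gh(1)] act_car(2)[OF s gh(2)] k])
    then show False using None act_back(1)[OF s gh(1)] act_back(2)[OF s gh(2)] by simp
  qed
  then show ?thesis using None by simp
qed

lemma qform_A: "qform A \<Gamma> (\<iota>G ` carrier G) (\<iota>H ` carrier H) (\<iota>K ` carrier K) lam'"
proof (intro qform.intro qform_axioms.intro oligo_A)
  show "O.invs [] (\<iota>G ` carrier G)" by (rule inv_image[OF embG c0(2) eqG])
  show "O.invs [] (\<iota>H ` carrier H)" by (rule inv_image[OF embH c0(3) eqH])
  show "O.invs [] (\<iota>K ` carrier K)" by (rule inv_image[OF embK c0(4) eqK])
  show "O.tame (\<iota>G ` carrier G)" by (rule tG)
  show "O.tame (\<iota>H ` carrier H)" by (rule tH)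
  show "O.tame (\<iota>K ` carrier K)" by (rule tK)
  fix u assume "u \<in> \<iota>G ` carrier G"
  then obtain g where g: "g \<in> carrier G" "u = \<iota>G g" by blast
  note p1 = phD1[OF g(1)]
  show "lam' u \<one>\<^bsub>A\<^esub> = Some \<one>\<^bsub>A\<^esub>" using lam'_simp[of g "\<one>\<^bsub>H\<^esub>"] p1(5) g(2) by (simp add: EK.\<iota>_one EH.\<iota>_one)
  have dm: "{v \<in> \<iota>H ` carrier H. lam' u v \<noteq> None} = \<iota>H ` {h \<in> carrier H. lam g h \<noteq> None}"
    unfolding g(2) using lam'_None by blast
  show "O.alm (\<iota>H ` carrier H) {v \<in> \<iota>H ` carrier H. lam' u v \<noteq> None}" unfolding dm
    by (rule EH.alm_of_finite_index[OF p1(1,2)])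
  fix v assume "v \<in> \<iota>H ` carrier H"
  then obtain h where h: "h \<in> carrier H" "v = \<iota>H h" by blast
  show "\<sigma> \<in> \<Gamma> ==> lam' (\<sigma> u) (\<sigma> v) = map_option \<sigma> (lam' u v)" for \<sigma>
    unfolding \<Gamma>_def g(2) h(2) using actlam'[OF _ g(1) h(1)] by (auto simp: eqG eqH lam'_simp option.map_comp o_def eqK cong: option.map_cong)
  { fix k assume "lam' u v = Some k"
    then obtain l where l: "lam g h = Some l" "k = \<iota>K l" unfolding g(2) h(2) lam'_simp by auto
    have lc: "l \<in> carrier K" by (rule p1(3)[OF h(1) l(1)])
    show "k \<in> \<iota>K ` carrier K" unfolding l(2) using lc by blast
    have "lam g (inv\<^bsub>H\<^esub> h) = Some (inv\<^bsub>K\<^esub> l)" by (rule p1(6)[OF h(1) l(1)])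
    then show "lam' u (inv\<^bsub>A\<^esub> v) = Some (inv\<^bsub>A\<^esub> k)"
      unfolding g(2) h(2) l(2) EH.\<iota>_inv[OF h(1), symmetric] EK.\<iota>_inv[OF lc, symmetric] lam'_simp by simp
    have "lam (inv\<^bsub>G\<^esub> g) h = Some (inv\<^bsub>K\<^esub> l)" by (rule phD2(6)[OF h(1) g(1) l(1)])
    then show "lam' (inv\<^bsub>A\<^esub> u) v = Some (inv\<^bsub>A\<^esub> k)"
      unfolding g(2) h(2) l(2) EG.\<iota>_inv[OF g(1), symmetric] EK.\<iota>_inv[OF lc, symmetric] lam'_simp by simp
    fix v' k' assume "v' \<in> \<iota>H ` carrier H" and k': "lam' u v' = Some k'"
    then obtain h' where h': "h' \<in> carrier H" "v' = \<iota>H h'" by blast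
    obtain l' where l': "lam g h' = Some l'" "k' = \<iota>K l'" using k' unfolding g(2) h'(2) lam'_simp by auto
    have lc': "l' \<in> carrier K" by (rule p1(3)[OF h'(1) l'(1)])
    have "lam g (h \<otimes>\<^bsub>H\<^esub> h') = Some (l \<otimes>\<^bsub>K\<^esub> l')" by (rule p1(4)[OF h(1) h'(1) l(1) l'(1)])
    then show "lam' u (v \<otimes>\<^bsub>A\<^esub> v') = Some (k \<otimes>\<^bsub>A\<^esub> k')"
      unfolding g(2) h(2) h'(2) l(2) l'(2) EH.\<iota>_mult[OF h(1) h'(1), symmetric] EK.\<iota>_mult[OF lc lc', symmetric] lam'_simp by simp
  }
  { fix u' k k' assume "u' \<in> \<iota>G ` carrier G" and k: "lam' u v = Some k" "lam' u' v = Some k'"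
    then obtain g' where g': "g' \<in> carrier G" "u' = \<iota>G g'" by blast
    obtain l where l: "lam g h = Some l" "k = \<iota>K l" using k(1) unfolding g(2) h(2) lam'_simp by auto
    obtain l' where l': "lam g' h = Some l'" "k' = \<iota>K l'" using k(2) unfolding g'(2) h(2) lam'_simp by auto
    have lc: "l \<in> carrier K" by (rule p1(3)[OF h(1) l(1)])
    have lc': "l' \<in> carrier K" by (rule phD1(3)[OF g'(1) h(1) l'(1)])
    have "lam (g \<otimes>\<^bsub>G\<^esub> g') h = Some (l \<otimes>\<^bsub>K\<^esub> l')" by (rule phD2(4)[OF h(1) g(1) g'(1) l(1) l'(1)])
    then show "lam' (u \<otimes>\<^bsub>A\<^esub> u') v = Some (k \<otimes>\<^bsub>A\<^esub> k')"
      unfolding g(2) h(2) g'(2) l(2) l'(2) EG.\<iota>_mult[OF g(1) g'(1), symmetric] EK.\<iota>_mult[OF lc lc', symmetric] lam'_simp by simp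
  }
next
  fix v assume "v \<in> \<iota>H ` carrier H"
  then obtain h where h: "h \<in> carrier H" "v = \<iota>H h" by blast
  note p2 = phD2[OF h(1)]
  show "lam' \<one>\<^bsub>A\<^esub> v = Some \<one>\<^bsub>A\<^esub>" using lam'_simp[of "\<one>\<^bsub>G\<^esub>" h] p2(5) h(2) by (simp add: EK.\<iota>_one EG.\<iota>_one)
  have dm: "{u \<in> \<iota>G ` carrier G. lam' u v \<noteq> None} = \<iota>G ` {g \<in> carrier G. lam g h \<noteq> None}"
    unfolding h(2) using lam'_None by blast
  show "O.alm (\<iota>G ` carrier G) {u \<in> \<iota>G ` carrier G. lam' u v \<noteq> None}" unfolding dm
    by (rule EG.alm_of_finite_index[OF p2(1,2)])
qed

sublocale Q: qform A \<Gamma> "\<iota>G ` carrier G" "\<iota>H ` carrier H" "\<iota>K ` carrier K" lam' by (rule qform_A)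

lemma main:
  "virtually_almost_trivial G H K lam \<and>
    (connected_group L M G \<and> connected_group L M H --> (\<forall>g\<in>carrier G. \<forall>h\<in>carrier H. lam g h = Some \<one>\<^bsub>K\<^esub>))"
proof
  obtain C D F where h: "subgroup C A" "subgroup D A" "subgroup F A" "O.alm (\<iota>G ` carrier G) C" "O.alm (\<iota>H ` carrier H) D" "finite F"
     "\<forall>g\<in>C. \<forall>h\<in>D. \<forall>k. lam' g h = Some k --> k \<in> F"
    using Q.finite_values by (elim exE conjE)
  define F0 where "F0 = {k \<in> carrier K. \<iota>K k \<in> F}"
  have "finite F0" unfolding F0_def
    by (rule finite_imageD[of \<iota>K]) (use h(6) EK.inj in \<open>auto intro: finite_subset inj_on_subset\<close>)
  moreover have "subgroup F0 K" unfolding F0_def by (rule EK.sub_vimage[OF h(3)])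
  moreover have "k \<in> F0" if "g \<in> carrier G" "\<iota>G g \<in> C" "h' \<in> carrier H" "\<iota>H h' \<in> D" "lam g h' = Some k" for g h' k
    using h(7)[rule_format, OF that(2,4), of "\<iota>K k"] that(5) phD1(3)[OF that(1,3,5)] unfolding F0_def lam'_simp by simp
  ultimately have "almost_trivial_on K lam {g \<in> carrier G. \<iota>G g \<in> C} {h \<in> carrier H. \<iota>H h \<in> D}"
    unfolding almost_trivial_on_def by (intro exI[of _ F0]) blast
  then show "virtually_almost_trivial G H K lam" unfolding virtually_almost_trivial_def
    using EG.finite_index_of_alm[OF h(1,4)] EH.finite_index_of_alm[OF h(2,5)] by blast
  show "connected_group L M G \<and> connected_group L M H --> (\<forall>g\<in>carrier G. \<forall>h\<in>carrier H. lam g h = Some \<one>\<^bsub>K\<^esub>)"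
  proof (intro impI ballI)
    assume cn: "connected_group L M G \<and> connected_group L M H"
    fix g h assume g: "g \<in> carrier G" and h: "h \<in> carrier H"
    have "lam' (\<iota>G g) (\<iota>H h) = Some \<one>\<^bsub>A\<^esub>"
    proof (rule Q.connected_trivial)
      show "B = \<iota>G ` carrier G" if "O.dfn B" "B \<subseteq> \<iota>G ` carrier G" "O.alm (\<iota>G ` carrier G) B" for B
        by (rule connected_image[OF embG c0(2) _ eqG that]) (use cn in auto)
      show "B = \<iota>H ` carrier H" if "O.dfn B" "B \<subseteq> \<iota>H ` carrier H" "O.alm (\<iota>H ` carrier H) B" for B
        by (rule connected_image[OF embH c0(3) _ eqH that]) (use cn in auto)
    qed (use g h in auto)
    then obtain k where k: "lam g h = Some k" "\<iota>K k = \<one>\<^bsub>A\<^esub>" unfolding lam'_simp by auto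
    then have "k = \<one>\<^bsub>K\<^esub>" by (simp add: \<iota>K_def A_simps)
    then show "lam g h = Some \<one>\<^bsub>K\<^esub>" using k(1) by simp
  qed
qed

end

theorem theorem6p4:
  fixes L :: "('f, 'r) language"
    and T :: "('f, 'r) fm set"
    and \<kappa> :: "'k rel"
    and M :: "('f, 'r, 'm) fo_struct"
    and G H K :: "'m list set monoid"
    and lam :: "'m list set \<Rightarrow> 'm list set \<Rightarrow> 'm list set option"
    and nG nH nK :: nat
  assumes "omega_categorical L T"
    and "monster_model L T \<kappa> M"
    and "definable_group L M nG G" and "comm_group G" and "finite_burden L M nG (carrier G)"
    and "definable_group L M nH H" and "comm_group H" and "finite_burden L M nH (carrier H)"
    and "definable_group L M nK K" and "comm_group K" and "finite_burden L M nK (carrier K)"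
    and "bilinear_quasi_form G H K lam"
    and "definable_partial_map L M G H lam"
  shows "virtually_almost_trivial G H K lam \<and>
    (connected_group L M G \<and> connected_group L M H \<longrightarrow>
       (\<forall>g\<in>carrier G. \<forall>h\<in>carrier H. lam g h = Some \<one>\<^bsub>K\<^esub>))"
proof -
  interpret quasi L T \<kappa> M G H K lam nG nH nK
    by (rule quasi.intro[OF monster.intro[OF assms(1,2)] quasi_axioms.intro[OF assms(3-13)]])
  show ?thesis by (rule main)
qed

end
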